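(* The nucleolus can be found in polynomial time for the multi market uncapacitated production-distribution game with a fixed number of markets: for every fixed $m\ge 1$ there is an algorithm that, given the profits $(\alpha_{ij})$ and demands $(d_{ij})$ of such a game $(N,v)$ with $m$ markets, computes its nucleolus in polynomial time.
   Context: Multi market uncapacitated production-distribution game: players $N=\{1,\dots,n\}$, markets $M=\{1,\dots,m\}$, per-unit profits $\alpha_{ij}\ge 0$ and demands $d_{ij}\ge 0$ for $i\in N$, $j\in M$; the value of a nonempty $S\subseteq N$ is $$v(S)=\sum_{j\in M}\Big(\sum_{i\in S}d_{ij}\Big)\cdot\max_{k\in S}\alpha_{kj},$$ and $v(\emptyset)=0$. Nucleolus: for $x\in\mathbb{R}^n$ with $x(N)=v(N)$, where $x(S)=\sum_{i\in S}x_i$, let $e_S(x)=x(S)-v(S)$ be the excess of $S\subseteq N$ and let $\overrightarrow{e(x)}\in\mathbb{R}^{2^n}$ be the vector of all excesses arranged in non-decreasing order. The nucleolus of $(N,v)$ (a game with nonempty core) is the set of $x$ with $x(N)=v(N)$ for which $\overrightarrow{e(x)}$ is lexicographically maximal; it is known to consist of a single point, with which it is identified. Polynomial time is with respect to the encoding length of the rational input data, with $m$ a constant (the polynomial may depend on $m$). *)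

theory Defs
  imports
    Complex_Main
    "HOL-Library.Multiset"
    "HOL-Library.FuncSet"
    "HOL-Library.Log_Nat"
    "HOL-Computational_Algebra.Polynomial"
begin

section \<open>The production-distribution game and the nucleolus\<close>

definition pd_game :: "nat \<Rightarrow> (nat \<Rightarrow> nat \<Rightarrow> real) \<Rightarrow> (nat \<Rightarrow> nat \<Rightarrow> real) \<Rightarrow> nat set \<Rightarrow> real" where
  "pd_game m \<alpha> d S =
     (if S = {} then 0 else (\<Sum>j\<in>{1..m}. (\<Sum>i\<in>S. d i j) * Max ((\<lambda>k. \<alpha> k j) ` S)))"

text \<open>
  A point of the real n-space is a function on the naturals that is \<^const>\<open>undefined\<close> outside
  the player set \<open>{1..n}\<close>, so that equality of such functions is equality of vectors.
\<close>

definition preimputations :: "nat \<Rightarrow> (nat set \<Rightarrow> real) \<Rightarrow> (nat \<Rightarrow> real) set" where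
  "preimputations n v = {x \<in> extensional {1..n}. (\<Sum>i\<in>{1..n}. x i) = v {1..n}}"

definition excess :: "(nat set \<Rightarrow> real) \<Rightarrow> (nat \<Rightarrow> real) \<Rightarrow> nat set \<Rightarrow> real" where
  "excess v x S = (\<Sum>i\<in>S. x i) - v S"

definition excess_vector :: "nat \<Rightarrow> (nat set \<Rightarrow> real) \<Rightarrow> (nat \<Rightarrow> real) \<Rightarrow> real list" where
  "excess_vector n v x =
     sorted_list_of_multiset (image_mset (excess v x) (mset_set (Pow {1..n})))"

definition nucleolus :: "nat \<Rightarrow> (nat set \<Rightarrow> real) \<Rightarrow> (nat \<Rightarrow> real) set" where
  "nucleolus n v =
     {x \<in> preimputations n v. \<forall>y \<in> preimputations n v.
        (excess_vector n v x, excess_vector n v y) \<notin> lexord {(a, b). a < b}}"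

section \<open>Polynomial-time computation\<close>

text \<open>
  The machine model is a random access machine under the logarithmic cost criterion, presented as
  a structured language. The memory consists of named arrays of integers indexed by integers (a
  scalar variable is cell 0 of its array); a program mentions only finitely many arrays. Every
  operation is charged the binary lengths of its operands and every memory access the binary
  lengths of the address and of the value transferred, so that the cost is polynomially related
  to the running time of a Turing machine.
\<close>

type_synonym state = "string \<Rightarrow> int \<Rightarrow> int"

datatype aexp =
    Num int
  | Cell string aexp
  | Plus aexp aexp
  | Minus aexp aexp
  | Times aexp aexp
  | Div aexp aexp

datatype bexp =
    Less aexp aexp
  | Not bexp
  | And bexp bexp

datatype com =
    Skip
  | Store string aexp aexp
  | Seq com com
  | If bexp com com
  | While bexp com

text \<open>The summand 1 accounts for the sign; in particular every integer has positive size.\<close>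

definition int_size :: "int \<Rightarrow> nat" where
  "int_size z = 1 + nat (bitlen \<bar>z\<bar>)"

fun aval :: "aexp \<Rightarrow> state \<Rightarrow> int" where
  "aval (Num k) s = k"
| "aval (Cell x a) s = s x (aval a s)"
| "aval (Plus a b) s = aval a s + aval b s"
| "aval (Minus a b) s = aval a s - aval b s"
| "aval (Times a b) s = aval a s * aval b s"
| "aval (Div a b) s = aval a s div aval b s"

fun acost :: "aexp \<Rightarrow> state \<Rightarrow> nat" where
  "acost (Num k) s = int_size k"
| "acost (Cell x a) s = acost a s + int_size (aval a s) + int_size (s x (aval a s))"
| "acost (Plus a b) s = acost a s + acost b s + int_size (aval a s) + int_size (aval b s)"
| "acost (Minus a b) s = acost a s + acost b s + int_size (aval a s) + int_size (aval b s)"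
| "acost (Times a b) s = acost a s + acost b s + int_size (aval a s) + int_size (aval b s)"
| "acost (Div a b) s = acost a s + acost b s + int_size (aval a s) + int_size (aval b s)"

fun bval :: "bexp \<Rightarrow> state \<Rightarrow> bool" where
  "bval (Less a b) s \<longleftrightarrow> aval a s < aval b s"
| "bval (Not b) s \<longleftrightarrow> \<not> bval b s"
| "bval (And b c) s \<longleftrightarrow> bval b s \<and> bval c s"

fun bcost :: "bexp \<Rightarrow> state \<Rightarrow> nat" where
  "bcost (Less a b) s = acost a s + acost b s + int_size (aval a s) + int_size (aval b s)"
| "bcost (Not b) s = bcost b s + 1"
| "bcost (And b c) s = bcost b s + bcost c s + 1"

text \<open>\<open>exec c s t s'\<close>: started in \<open>s\<close>, the program \<open>c\<close> halts in \<open>s'\<close> at total cost \<open>t\<close>.\<close>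

inductive exec :: "com \<Rightarrow> state \<Rightarrow> nat \<Rightarrow> state \<Rightarrow> bool" where
  Skip: "exec Skip s 1 s"
| Store: "exec (Store x a b) s
    (acost a s + acost b s + int_size (aval a s) + int_size (aval b s))
    (s(x := (s x)(aval a s := aval b s)))"
| Seq: "exec c1 s1 t1 s2 \<Longrightarrow> exec c2 s2 t2 s3 \<Longrightarrow> exec (Seq c1 c2) s1 (t1 + t2) s3"
| IfTrue: "bval b s \<Longrightarrow> exec c1 s t s' \<Longrightarrow> exec (If b c1 c2) s (bcost b s + t) s'"
| IfFalse: "\<not> bval b s \<Longrightarrow> exec c2 s t s' \<Longrightarrow> exec (If b c1 c2) s (bcost b s + t) s'"
| WhileFalse: "\<not> bval b s \<Longrightarrow> exec (While b c) s (bcost b s) s"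
| WhileTrue: "bval b s1 \<Longrightarrow> exec c s1 t1 s2 \<Longrightarrow> exec (While b c) s2 t2 s3 \<Longrightarrow>
    exec (While b c) s1 (bcost b s1 + t1 + t2) s3"

inductive_cases SkipE: "exec Skip s t s'"
inductive_cases StoreE: "exec (Store x a b) s t s'"
inductive_cases SeqE: "exec (Seq c1 c2) s t s'"
inductive_cases IfE: "exec (If b c1 c2) s t s'"
inductive_cases WhileE: "exec (While b c) s t s'"

lemma exec_deterministic:
  assumes "exec c s t s'" and "exec c s u s''"
  shows "t = u \<and> s' = s''"
  using assms
proof (induction arbitrary: u s'' rule: exec.induct)
  case (Skip s)
  then show ?case by (auto elim: SkipE)
next
  case (Store x a b s)
  then show ?case by (auto elim: StoreE)
next
  case (Seq c1 s1 t1 s2 c2 t2 s3)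
  from Seq.prems obtain u1 r u2
    where "exec c1 s1 u1 r" "exec c2 r u2 s''" "u = u1 + u2" by (rule SeqE)
  with Seq.IH show ?case by metis
next
  case (IfTrue b s c1 t s' c2)
  from IfTrue.prems IfTrue.hyps(1) obtain u1
    where "exec c1 s u1 s''" "u = bcost b s + u1" by (auto elim: IfE)
  with IfTrue.IH show ?case by metis
next
  case (IfFalse b s c2 t s' c1)
  from IfFalse.prems IfFalse.hyps(1) obtain u1
    where "exec c2 s u1 s''" "u = bcost b s + u1" by (auto elim: IfE)
  with IfFalse.IH show ?case by metis
next
  case (WhileFalse b s c)
  from WhileFalse.prems WhileFalse.hyps show ?case by (rule_tac WhileE) auto
next
  case (WhileTrue b s1 c t1 s2 t2 s3)
  from WhileTrue.prems WhileTrue.hyps(1) obtain u1 r u2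
    where "exec c s1 u1 r" "exec (While b c) r u2 s''" "u = bcost b s1 + u1 + u2"
    by (rule_tac WhileE) auto
  with WhileTrue.IH show ?case by metis
qed

text \<open>
  A list is passed as an array that holds its length in cell 0 and its entries in the cells
  from 1 on; all other memory is initially 0.
\<close>

definition input_state :: "int list \<Rightarrow> state" where
  "input_state xs x k =
     (if x = ''input'' then
        if k = 0 then int (length xs)
        else if 1 \<le> k \<and> k \<le> int (length xs) then xs ! nat (k - 1)
        else 0
      else 0)"

definition output_list :: "state \<Rightarrow> int list" where
  "output_list s = map (s ''output'') [1..s ''output'' 0]"

definition encoding_length :: "int list \<Rightarrow> nat" where
  "encoding_length xs = (\<Sum>x\<leftarrow>xs. int_size x)"

text \<open>
  On every instance \<open>a \<in> A\<close>, presented as \<open>enc_in a\<close>, one program has to output the encoding of some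
  solution \<open>b\<close> with \<open>R a b\<close>, within a time bound polynomial in the encoding length of the instance.
\<close>

definition poly_time_computable ::
  "('a \<Rightarrow> int list) \<Rightarrow> ('b \<Rightarrow> int list) \<Rightarrow> 'a set \<Rightarrow> ('a \<Rightarrow> 'b \<Rightarrow> bool) \<Rightarrow> bool" where
  "poly_time_computable enc_in enc_out A R \<longleftrightarrow>
     (\<exists>(c :: com) (p :: nat poly). \<forall>a\<in>A. \<exists>b t s.
        exec c (input_state (enc_in a)) t s \<and>
        output_list s = enc_out b \<and>
        R a b \<and>
        t \<le> poly p (encoding_length (enc_in a)))"

section \<open>Instances and solutions\<close>

text \<open>An instance is the number of players with the profit and demand matrices.\<close>

type_synonym pd_instance = "nat \<times> (nat \<Rightarrow> nat \<Rightarrow> rat) \<times> (nat \<Rightarrow> nat \<Rightarrow> rat)"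

definition pd_instances :: "nat \<Rightarrow> pd_instance set" where
  "pd_instances m = {(n, \<alpha>, d). 1 \<le> n \<and> (\<forall>i\<in>{1..n}. \<forall>j\<in>{1..m}. 0 \<le> \<alpha> i j \<and> 0 \<le> d i j)}"

text \<open>\<^const>\<open>quotient_of\<close> yields lowest terms with a positive denominator.\<close>

definition encode_rat :: "rat \<Rightarrow> int list" where
  "encode_rat q = [fst (quotient_of q), snd (quotient_of q)]"

definition encode_instance :: "nat \<Rightarrow> pd_instance \<Rightarrow> int list" where
  "encode_instance m = (\<lambda>(n, \<alpha>, d).
     int n # concat [encode_rat (\<alpha> i j) @ encode_rat (d i j). i \<leftarrow> [1..<n+1], j \<leftarrow> [1..<m+1]])"

definition encode_vector :: "rat list \<Rightarrow> int list" where
  "encode_vector xs = concat (map encode_rat xs)"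

definition real_vector :: "rat list \<Rightarrow> nat \<Rightarrow> real" where
  "real_vector xs = (\<lambda>i\<in>{1..length xs}. real_of_rat (xs ! (i - 1)))"

definition real_matrix :: "(nat \<Rightarrow> nat \<Rightarrow> rat) \<Rightarrow> nat \<Rightarrow> nat \<Rightarrow> real" where
  "real_matrix a = (\<lambda>i j. real_of_rat (a i j))"

end

theory Submission
  imports
    Defs
    "HOL-Analysis.Analysis"
    "Jordan_Normal_Form.Determinant"
begin

text \<open>
  Clear denominators, so that the game is integral. A choice of one player per market (there are
  only \<open>n ^ m\<close>) fixes the market maxima, and among the coalitions with these maxima the game is additive.
  Splitting each such family by the membership of one more player gives \<open>K = 2 n ^ (m+1)\<close> blocks of
  coalitions over which the least excess \<open>H B x\<close> is easy to compute. Every excess is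
  \<open>H g x\<close> plus a sum of differences \<open>H B x - H g x \<ge> 0\<close> for blocks \<open>g, B\<close>; therefore the nucleolus is also the
  lexicographic maximizer of the sorted vector of block minima. Reading this vector in base \<open>M\<close> gives
  a concave function \<open>F\<close>, and since by Cramer's rule the relevant points have denominators of at most
  \<open>n ^ n\<close> times a known factor, for large \<open>M\<close> the value of \<open>F\<close> drops by a definite amount at a given small distance from the
  nucleolus. \<open>F\<close> is maximized by a cutting-simplex method in exact integer arithmetic: each supergradient
  cut through the centre is enclosed in a new simplex on a common denominator, and the barycentric
  determinant of a fixed small simplex near the nucleolus grows by the factor \<open>exp (1 / (16 n ^ 3))\<close>. Since it is
  at most 1, after polynomially many rounds some centre is close to the nucleolus, whose
  coordinates are then recovered by continued fractions.
\<close>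

section \<open>Lexicographic order and base-M values\<close>

text \<open>Blocks and excesses come with different multiplicities, so lexicographic optimality does
  not transfer formally. It transfers because an excess lies above every block minimum in its
  representation: after a small step the excesses below the lowest changed block minimum are
  unchanged, and the first change occurs at the same level in both vectors. The powers of
  \<open>M\<close> have exponentially large values but polynomially many bits; a cutting method in
  exact arithmetic tolerates this, as its number of rounds grows only with the logarithm of the
  required precision. Closeness in value must be turned into closeness in space; this is done by
  comparing the nucleolus with a maximizer on a small sphere around it, chosen so that ties and
  active bounds determine it. A simplex is preferred to an ellipsoid because its update is rational,
  and determinants of barycentric coordinates replace volumes: the bound 1 for column-stochastic
  matrices needs no measure theory, and the hyperplane of efficient vectors needs no coordinates of
  its own.\<close>

abbreviation lex_less :: "real list \<Rightarrow> real list \<Rightarrow> bool" (infix "\<lless>" 50) where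
  "xs \<lless> ys \<equiv> (xs, ys) \<in> lexord {(a, b). a < b}"

fun horner :: "'a::linordered_idom \<Rightarrow> 'a list \<Rightarrow> 'a" where
  "horner M [] = 0"
| "horner M (x # xs) = x * M ^ length xs + horner M xs"

lemma horner_append: "horner M (xs @ [x]) = horner M xs * M + x"
  by (induction xs) (auto simp: algebra_simps)

section \<open>Sorting as minimization over all arrangements\<close>

lemma sum_list_take_insort:
  fixes x :: "'a::linordered_idom"
  shows "sum_list (take k (insort x xs)) \<le> sum_list (take k (x # xs))"
proof (induction xs arbitrary: k)
  case Nil
  then show ?case by simp
next
  case (Cons y ys)
  show ?case
  proof (cases k)
    case (Suc k')
    show ?thesis
    proof (cases "x \<le> y")
      case False
      have *: "y + sum_list (take k' (insort x ys)) \<le> y + sum_list (take k' (x # ys))"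
        using Cons.IH by simp
      show ?thesis using * False Suc by (cases k') auto
    qed (simp add: Suc)
  qed simp
qed

lemma sum_list_take_sort:
  fixes xs :: "'a::linordered_idom list"
  shows "sum_list (take k (sort xs)) \<le> sum_list (take k xs)"
proof (induction xs arbitrary: k)
  case (Cons x xs)
  have "sum_list (take k (insort x (sort xs))) \<le> sum_list (take k (x # sort xs))"
    by (rule sum_list_take_insort)
  also have "\<dots> \<le> sum_list (take k (x # xs))"
    using Cons.IH by (cases k) auto
  finally show ?case by simp
qed simp

text \<open>For base at least 1 the weights do not increase along the list, so moving a smaller
  entry in front of \<open>x\<close> cannot raise the value;
  \<open>(x - y) * (M - 1) * M ^ length ys\<close> is the gain of one exchange.\<close>

lemma horner_insort:
  fixes x :: "'a::linordered_idom"
  assumes "M \<ge> 1"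
  shows "horner M (insort x xs) \<le> horner M (x # xs)"
proof (induction xs)
  case (Cons y ys)
  show ?case
  proof (cases "x \<le> y")
    case False
    have "y * M ^ Suc (length ys) + horner M (insort x ys)
        \<le> y * M ^ Suc (length ys) + (x * M ^ length ys + horner M ys)"
      using Cons.IH by simp
    moreover have "0 \<le> (x - y) * (M - 1) * M ^ length ys"
      using False assms by simp
    ultimately show ?thesis using False by (simp add: algebra_simps)
  qed simp
qed simp

lemma horner_sort:
  fixes xs :: "'a::linordered_idom list"
  assumes "M \<ge> 1"
  shows "horner M (sort xs) \<le> horner M xs"
proof (induction xs)
  case (Cons x xs)
  have "horner M (insort x (sort xs)) \<le> horner M (x # sort xs)"
    by (rule horner_insort[OF assms])
  also have "\<dots> \<le> horner M (x # xs)" using Cons.IH by simp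
  finally show ?case by simp
qed simp

lemma sort_map_eq: "sort (map h xs) = map h (sort_key h xs)"
  by (rule properties_for_sort) auto

lemma sort_mset_eq: "mset xs = mset ys \<Longrightarrow> sort xs = sort (ys :: 'a::linorder list)"
  by (metis properties_for_sort mset_sort sorted_sort)

text \<open>The least sum of \<open>k\<close> entries, so a minimum of linear functions and concave.
  Comparing these sums for all \<open>k\<close> makes the lexicographic order of sorted vectors
  accessible to convexity arguments.\<close>

definition psum :: "nat \<Rightarrow> 'a::linordered_idom list \<Rightarrow> 'a" where
  "psum k xs = sum_list (take k (sort xs))"

lemma psum_le:
  assumes "mset ys = mset xs"
  shows "psum k xs \<le> sum_list (take k ys)"
  using sum_list_take_sort[of k ys] sort_mset_eq[OF assms] by (simp add: psum_def)

lemma horner_sort_le: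
  assumes "mset ys = mset xs" "M \<ge> 1"
  shows "horner M (sort xs) \<le> horner M ys"
  using horner_sort[of M ys] sort_mset_eq[OF assms(1)] assms by simp

lemma sum_list_take_mono:
  fixes f h :: "'b \<Rightarrow> 'a::linordered_idom"
  assumes "\<And>i. i \<in> set xs \<Longrightarrow> f i \<le> h i"
  shows "sum_list (take k (map f xs)) \<le> sum_list (take k (map h xs))"
  unfolding take_map by (intro sum_list_mono) (auto dest: in_set_takeD assms)

lemma sum_list_take_lincomb:
  fixes f g :: "'b \<Rightarrow> 'a::linordered_idom"
  shows "sum_list (take k (map (\<lambda>i. s * f i + t * g i) xs)) =
    s * sum_list (take k (map f xs)) + t * sum_list (take k (map g xs))"
  unfolding take_map by (simp add: sum_list_addf sum_list_const_mult)

text \<open>The arrangement that sorts \<open>h\<close> is exact for \<open>h\<close>, whereas for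
  \<open>f\<close> and \<open>g\<close> it only bounds the least sums from above.\<close>

lemma psum_concave:
  fixes f g h :: "'b \<Rightarrow> 'a::linordered_idom"
  assumes "s \<ge> 0" "t \<ge> 0" "\<And>i. i \<in> set xs \<Longrightarrow> s * f i + t * g i \<le> h i"
  shows "s * psum k (map f xs) + t * psum k (map g xs) \<le> psum k (map h xs)"
proof -
  define js where "js = sort_key h xs"
  have "s * psum k (map f xs) + t * psum k (map g xs)
     \<le> s * sum_list (take k (map f js)) + t * sum_list (take k (map g js))"
    by (intro add_mono mult_left_mono psum_le) (auto simp: js_def assms)
  also have "\<dots> = sum_list (take k (map (\<lambda>i. s * f i + t * g i) js))"
    by (rule sum_list_take_lincomb[symmetric])
  also have "\<dots> \<le> sum_list (take k (map h js))"
    by (rule sum_list_take_mono) (use assms in \<open>auto simp: js_def\<close>)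
  finally show ?thesis by (simp add: psum_def sort_map_eq js_def)
qed

lemma horner_mono:
  fixes f h :: "'b \<Rightarrow> 'a::linordered_idom"
  assumes "M \<ge> 0" "\<And>i. i \<in> set xs \<Longrightarrow> f i \<le> h i"
  shows "horner M (map f xs) \<le> horner M (map h xs)"
  using assms(2) by (induction xs) (auto intro!: add_mono mult_right_mono simp: assms(1))

lemma horner_lincomb:
  "horner M (map (\<lambda>i. s * f i + t * g i) xs) = s * horner M (map f xs) + t * horner M (map g xs)"
  by (induction xs) (auto simp: algebra_simps)

text \<open>As for \<open>psum\<close>: the arrangement that sorts \<open>h\<close> is optimal for
  \<open>h\<close> and merely admissible for \<open>f\<close> and \<open>g\<close>.\<close>

lemma horner_sort_concave:
  fixes f g h :: "'b \<Rightarrow> 'a::linordered_idom"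
  assumes "M \<ge> 1" "s \<ge> 0" "t \<ge> 0" "\<And>i. i \<in> set xs \<Longrightarrow> s * f i + t * g i \<le> h i"
  shows "s * horner M (sort (map f xs)) + t * horner M (sort (map g xs))
    \<le> horner M (sort (map h xs))"
proof -
  define js where "js = sort_key h xs"
  have "s * horner M (sort (map f xs)) + t * horner M (sort (map g xs))
     \<le> s * horner M (map f js) + t * horner M (map g js)"
    by (intro add_mono mult_left_mono horner_sort_le) (auto simp: js_def assms)
  also have "\<dots> = horner M (map (\<lambda>i. s * f i + t * g i) js)"
    by (rule horner_lincomb[symmetric])
  also have "\<dots> \<le> horner M (map h js)"
    by (rule horner_mono) (use assms in \<open>auto simp: js_def\<close>)
  finally show ?thesis by (simp add: sort_map_eq js_def)
qed

section \<open>Comparing sorted vectors under local changes\<close>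

lemma lex_less_linear: "xs \<lless> ys \<or> xs = ys \<or> ys \<lless> xs"
  by (rule lexord_linear) auto

lemma lex_less_irrefl: "\<not> xs \<lless> xs"
  by (rule lexord_irreflexive) auto

lemma lex_less_trans: "xs \<lless> ys \<Longrightarrow> ys \<lless> zs \<Longrightarrow> xs \<lless> zs"
  by (rule lexord_trans) (auto simp: trans_def)

lemma lex_lessE:
  assumes "xs \<lless> ys" "length xs = length ys"
  obtains k where "k < length xs" "take k xs = take k ys" "xs ! k < ys ! k"
proof -
  from assms obtain u a b v w where uv: "a < b" "xs = u @ a # v" "ys = u @ b # w"
    unfolding lexord_def by auto
  show ?thesis by (rule that[of "length u"]) (use uv in auto)
qed

text \<open>Up to the first difference of the sorted vectors all sums of least entries agree, and
  the next one is strictly larger; in this form lexicographic order meets concavity.\<close>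

lemma lex_less_psumE:
  assumes "sort xs \<lless> sort ys" "length xs = length ys"
  obtains k where "k < length xs" "\<And>j. j \<le> k \<Longrightarrow> psum j xs = psum j ys"
    "psum (Suc k) xs < psum (Suc k) ys"
proof -
  from assms obtain k where k: "k < length xs" "take k (sort xs) = take k (sort ys)"
    "sort xs ! k < sort ys ! k"
    by (auto elim: lex_lessE)
  show ?thesis
  proof (rule that)
    show "psum j xs = psum j ys" if "j \<le> k" for j
      using k(2) that unfolding psum_def by (metis min.absorb1 take_take)
    show "psum (Suc k) xs < psum (Suc k) ys"
      using k assms(2) by (simp add: psum_def take_Suc_conv_app_nth)
  qed (fact k(1))
qed

lemma sort_append_eq:
  assumes "mset zs = mset xs + mset ys" "\<And>x y. x \<in> set xs \<Longrightarrow> y \<in> set ys \<Longrightarrow> x \<le> y"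
  shows "sort zs = sort xs @ sort (ys :: 'a::linorder list)"
  by (rule properties_for_sort) (use assms in \<open>auto simp: sorted_append\<close>)

lemma map_filter_split:
  "mset (map f xs) = mset (map f (filter P xs)) + mset (map f (filter (\<lambda>x. \<not> P x) xs))"
  by (metis mset_map image_mset_union mset_filter multiset_partition)

text \<open>Splitting the indices by whether \<open>b\<close> exceeds \<open>r\<close> cuts both
  sorted vectors at the same place. The lower parts coincide; the upper part of \<open>a\<close>
  starts with \<open>r\<close>, because of \<open>i0\<close>, and that of \<open>b\<close> starts
  above \<open>r\<close>.\<close>

lemma sort_lex_less_localI:
  fixes a b :: "'b \<Rightarrow> real"
  assumes below: "\<And>i. i \<in> set xs \<Longrightarrow> a i < r \<Longrightarrow> b i = a i"
    and at: "\<And>i. i \<in> set xs \<Longrightarrow> a i = r \<Longrightarrow> b i \<ge> r"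
    and above: "\<And>i. i \<in> set xs \<Longrightarrow> a i > r \<Longrightarrow> b i > r"
    and wit: "i0 \<in> set xs" "a i0 = r" "b i0 > r"
  shows "sort (map a xs) \<lless> sort (map b xs)"
proof -
  define J1 where "J1 = filter (\<lambda>i. b i \<le> r) xs"
  define J2 where "J2 = filter (\<lambda>i. \<not> b i \<le> r) xs"
  have J1: "b i = a i" "a i \<le> r" if "i \<in> set J1" for i
    using that below[of i] at[of i] above[of i] by (cases "a i" r rule: linorder_cases; force simp: J1_def)+
  have J2: "r \<le> a i" "r < b i" if "i \<in> set J2" for i
    using that below[of i] by (cases "a i" r rule: linorder_cases; force simp: J2_def)+
  have sa: "sort (map a xs) = sort (map a J1) @ sort (map a J2)"
    by (rule sort_append_eq)
      (use J1 J2 map_filter_split[of a xs "\<lambda>i. b i \<le> r"] in \<open>fastforce simp: J1_def[symmetric] J2_def[symmetric]\<close>)+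
  have sb: "sort (map b xs) = sort (map b J1) @ sort (map b J2)"
    by (rule sort_append_eq)
      (use J1 J2 map_filter_split[of b xs "\<lambda>i. b i \<le> r"] in \<open>fastforce simp: J1_def[symmetric] J2_def[symmetric]\<close>)+
  have e: "map a J1 = map b J1" using J1 by simp
  have i0: "i0 \<in> set J2" using wit by (simp add: J2_def)
  have "sort (map a J2) \<lless> sort (map b J2)"
  proof -
    obtain x us where us: "sort (map a J2) = x # us"
      using i0 set_sort[of "\<lambda>x. x" "map a J2"] by (cases "sort (map a J2)") auto
    obtain y vs where vs: "sort (map b J2) = y # vs"
      using i0 set_sort[of "\<lambda>x. x" "map b J2"] by (cases "sort (map b J2)") auto
    have "set (x # us) = a ` set J2" using us by (metis list.set_map set_sort)
    moreover have "sorted (x # us)" using us by (metis sorted_sort)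
    ultimately have "x \<le> r" using i0 wit(2) by (metis image_eqI set_ConsD sorted_simps(2) order_refl)
    moreover have "y \<in> b ` set J2" using vs by (metis list.set_map set_sort list.set_intros(1))
    then have "r < y" using J2 by auto
    ultimately show ?thesis by (simp add: us vs)
  qed
  then show ?thesis unfolding sa sb e by (rule lexord_append_leftI)
qed

text \<open>Let \<open>k0\<close> entries of \<open>a\<close> lie below \<open>r\<close>. If
  \<open>b i0\<close> fell below \<open>r\<close>, the sum of the \<open>k0 + 1\<close> least
  entries would drop and no shorter sum would rise. But \<open>c\<close> is not worse than
  \<open>a\<close>, so one of these sums is not smaller for \<open>c\<close>, strictly larger if it
  is a shorter one, and by concavity \<open>b\<close> inherits this.\<close>

lemma lowest_change_increases:
  fixes a b c :: "'b \<Rightarrow> real"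
  assumes conc: "\<And>i. i \<in> set xs \<Longrightarrow> (1 - t) * a i + t * c i \<le> b i" and t: "0 < t" "t \<le> 1"
    and nl: "\<not> sort (map c xs) \<lless> sort (map a xs)"
    and below: "\<And>i. i \<in> set xs \<Longrightarrow> a i < r \<Longrightarrow> b i = a i"
    and i0: "i0 \<in> set xs" "a i0 = r"
  shows "b i0 \<ge> r"
proof (rule ccontr)
  assume "\<not> b i0 \<ge> r"
  then have lt: "b i0 < r" by simp
  define J where "J = filter (\<lambda>i. a i < r) xs"
  define R where "R = filter (\<lambda>i. \<not> a i < r) xs"
  define js where "js = sort_key a J"
  define rs where "rs = i0 # remove1 i0 R"
  have i0R: "i0 \<in> set R" using i0 by (simp add: R_def)
  have ms: "mset (js @ rs) = mset xs"
    using i0R by (simp add: js_def rs_def J_def R_def)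
  have sa: "sort (map a xs) = map a js @ sort (map a rs)"
  proof -
    have "sort (map a xs) = sort (map a js) @ sort (map a rs)"
    proof (rule sort_append_eq)
      show "mset (map a xs) = mset (map a js) + mset (map a rs)"
        using ms by (metis mset_map mset_append map_append)
      show "x \<le> y" if "x \<in> set (map a js)" "y \<in> set (map a rs)" for x y
        using that i0 by (auto simp: js_def rs_def J_def R_def dest!: notin_set_remove1[rotated] in_set_remove1[THEN iffD1, rotated] set_remove1_subset[THEN subsetD])
    qed
    then show ?thesis by (simp add: js_def sort_map_eq[symmetric] sorted_sort_id)
  qed
  have hd: "\<exists>us. sort (map a rs) = r # us"
  proof -
    have "mset (map a rs) = mset [r] + mset (map a (remove1 i0 R))" by (simp add: rs_def i0)
    moreover have "x \<le> y" if "x \<in> set [r]" "y \<in> set (map a (remove1 i0 R))" for x y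
      using that set_remove1_subset[of i0 R] by (auto simp: R_def)
    ultimately have "sort (map a rs) = sort [r] @ sort (map a (remove1 i0 R))"
      by (rule sort_append_eq)
    then show ?thesis by simp
  qed
  define k0 where "k0 = length js"
  have pa: "psum (Suc k0) (map a xs) = sum_list (map a js) + r"
    using hd by (auto simp: psum_def sa k0_def)
  have eqJ: "map b js = map a js"
    using below by (auto simp: js_def J_def)
  have pb: "psum (Suc k0) (map b xs) \<le> sum_list (map a js) + b i0"
  proof -
    have "psum (Suc k0) (map b xs) \<le> sum_list (take (Suc k0) (map b (js @ rs)))"
      by (rule psum_le) (use ms in \<open>metis mset_map\<close>)
    also have "\<dots> = sum_list (map a js) + b i0" using eqJ by (simp add: k0_def rs_def del: map_eq_conv)
    finally show ?thesis .
  qed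
  have pj: "psum j (map b xs) \<le> psum j (map a xs)" if "j \<le> k0" for j
  proof -
    have "psum j (map b xs) \<le> sum_list (take j (map b (js @ rs)))"
      by (rule psum_le) (use ms in \<open>metis mset_map\<close>)
    also have "\<dots> = psum j (map a xs)" using eqJ that by (simp add: k0_def psum_def sa del: map_eq_conv)
    finally show ?thesis .
  qed
  have pc: "(1 - t) * psum j (map a xs) + t * psum j (map c xs) \<le> psum j (map b xs)" for j
    by (rule psum_concave) (use t conc in auto)
  \<comment> \<open>Decided by the position of the first difference of \<open>a\<close> and
    \<open>c\<close>: beyond \<open>k0\<close> the sums up to \<open>Suc k0\<close> agree, and at or
    before \<open>k0\<close> the sum ending there is strictly larger for \<open>c\<close>.\<close>
  have key: "\<exists>j. psum j (map c xs) \<ge> psum j (map a xs) \<and> j = Suc k0 \<or>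
      psum j (map c xs) > psum j (map a xs) \<and> j \<le> k0"
  proof (cases "sort (map c xs) = sort (map a xs)")
    case True
    then show ?thesis by (auto simp: psum_def)
  next
    case False
    then have "sort (map a xs) \<lless> sort (map c xs)" using nl lex_less_linear by blast
    then obtain k where k: "\<And>j. j \<le> k \<Longrightarrow> psum j (map a xs) = psum j (map c xs)"
      "psum (Suc k) (map a xs) < psum (Suc k) (map c xs)"
      by (rule lex_less_psumE) auto
    consider "Suc k0 \<le> k" | "k0 = k" | "Suc k \<le> k0" by linarith
    then show ?thesis
    proof cases
      case 1
      then show ?thesis using k(1)[of "Suc k0"] by (metis order_refl)
    next
      case 2
      then show ?thesis using k(2) by (metis less_imp_le)
    next
      case 3
      then show ?thesis using k(2) by blast
    qed
  qed
  then show False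
  proof (elim exE disjE conjE)
    fix j assume j: "psum j (map c xs) \<ge> psum j (map a xs)" "j = Suc k0"
    have "psum j (map a xs) = (1 - t) * psum j (map a xs) + t * psum j (map a xs)"
      by (simp add: algebra_simps)
    also have "\<dots> \<le> psum j (map b xs)" using pc[of j] mult_left_mono[OF j(1), of t] t by linarith
    finally show False using pa pb j lt by simp
  next
    fix j assume j: "psum j (map c xs) > psum j (map a xs)" "j \<le> k0"
    have "psum j (map a xs) = (1 - t) * psum j (map a xs) + t * psum j (map a xs)"
      by (simp add: algebra_simps)
    also have "\<dots> < psum j (map b xs)"
      using pc[of j] mult_strict_left_mono[OF j(1), of t] t by linarith
    finally show False using pj[OF j(2)] by simp
  qed
qed

section \<open>The nucleolus through blocks of coalitions\<close>

lemma sum_list_sort_key: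
  fixes f :: "'b \<Rightarrow> real"
  shows "(\<Sum>i\<leftarrow>sort_key g xs. f i) = (\<Sum>i\<leftarrow>xs. f i)"
  by (simp flip: sum_mset_sum_list)

section \<open>Continuity and lexicographic maximization on compact sets\<close>

lemma abs_psum_diff_le:
  fixes f g :: "'b \<Rightarrow> real"
  shows "\<bar>psum k (map f xs) - psum k (map g xs)\<bar> \<le> (\<Sum>i\<leftarrow>xs. \<bar>f i - g i\<bar>)"
proof -
  have *: "psum k (map f xs) - psum k (map g xs) \<le> (\<Sum>i\<leftarrow>xs. \<bar>f i - g i\<bar>)" for f g :: "'b \<Rightarrow> real"
  proof -
    define js where "js = sort_key g xs"
    have "psum k (map f xs) \<le> sum_list (take k (map f js))"
      by (rule psum_le) (simp add: js_def)
    also have "\<dots> \<le> sum_list (take k (map (\<lambda>i. 1 * g i + 1 * \<bar>f i - g i\<bar>) js))"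
      by (rule sum_list_take_mono) auto
    also have "\<dots> = sum_list (take k (map g js)) + sum_list (take k (map (\<lambda>i. \<bar>f i - g i\<bar>) js))"
      by (subst sum_list_take_lincomb) simp
    also have "sum_list (take k (map g js)) = psum k (map g xs)"
      by (simp add: psum_def sort_map_eq js_def)
    also have "sum_list (take k (map (\<lambda>i. \<bar>f i - g i\<bar>) js)) \<le> (\<Sum>i\<leftarrow>js. \<bar>f i - g i\<bar>)"
    proof -
      have "sum_list zs \<ge> sum_list (take k zs)" if "\<forall>z\<in>set zs. z \<ge> (0::real)" for zs
      proof -
        have "sum_list zs = sum_list (take k zs @ drop k zs)" by simp
        also have "\<dots> = sum_list (take k zs) + sum_list (drop k zs)" by (rule sum_list_append)
        finally show ?thesis using that sum_list_nonneg[of "drop k zs"] in_set_dropD by fastforce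
      qed
      then show ?thesis by simp
    qed
    also have "(\<Sum>i\<leftarrow>js. \<bar>f i - g i\<bar>) = (\<Sum>i\<leftarrow>xs. \<bar>f i - g i\<bar>)"
      by (simp add: js_def sum_list_sort_key)
    finally show ?thesis by simp
  qed
  have "(\<Sum>i\<leftarrow>xs. \<bar>g i - f i\<bar>) = (\<Sum>i\<leftarrow>xs. \<bar>f i - g i\<bar>)" by (simp add: abs_minus_commute)
  with *[of f g] *[of g f] show ?thesis by linarith
qed

lemma continuous_on_sum_list:
  fixes f :: "'b \<Rightarrow> 'a::topological_space \<Rightarrow> real"
  assumes "\<And>i. i \<in> set xs \<Longrightarrow> continuous_on C (f i)"
  shows "continuous_on C (\<lambda>x. \<Sum>i\<leftarrow>xs. f i x)"
  using assms by (induction xs) (auto intro!: continuous_intros)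

text \<open>A substitute for Lipschitz continuity on a space with a mere topology: as a function of
  one argument the dominating sum is continuous, and it vanishes at the other argument.\<close>

lemma continuous_on_dominated_diff:
  fixes F :: "'a::topological_space \<Rightarrow> real"
  assumes f: "\<And>i. i \<in> set xs \<Longrightarrow> continuous_on C (f i)"
    and F: "\<And>x y. x \<in> C \<Longrightarrow> y \<in> C \<Longrightarrow> \<bar>F x - F y\<bar> \<le> c * (\<Sum>i\<leftarrow>xs. \<bar>f i x - f i y :: real\<bar>)"
  shows "continuous_on C F"
  unfolding continuous_on_def
proof
  fix x assume x: "x \<in> C"
  have "continuous_on C (\<lambda>y. c * (\<Sum>i\<leftarrow>xs. \<bar>f i y - f i x\<bar>))"
    by (intro continuous_intros continuous_on_sum_list f)
  then have "((\<lambda>y. c * (\<Sum>i\<leftarrow>xs. \<bar>f i y - f i x\<bar>)) \<longlongrightarrow> c * (\<Sum>i\<leftarrow>xs. \<bar>f i x - f i x\<bar>)) (at x within C)"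
    using x unfolding continuous_on_def by blast
  then have "((\<lambda>y. c * (\<Sum>i\<leftarrow>xs. \<bar>f i y - f i x\<bar>)) \<longlongrightarrow> 0) (at x within C)"
    by simp
  moreover have "\<forall>\<^sub>F y in at x within C. norm (F y - F x) \<le> c * (\<Sum>i\<leftarrow>xs. \<bar>f i y - f i x\<bar>)"
    using F x by (auto simp: eventually_at_filter)
  ultimately have "((\<lambda>y. F y - F x) \<longlongrightarrow> 0) (at x within C)"
    by (rule Lim_null_comparison[rotated])
  then show "(F \<longlongrightarrow> F x) (at x within C)" by (simp add: LIM_zero_iff)
qed

lemma continuous_on_psum:
  fixes f :: "'b \<Rightarrow> 'a::topological_space \<Rightarrow> real"
  assumes "\<And>i. i \<in> set xs \<Longrightarrow> continuous_on C (f i)"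
  shows "continuous_on C (\<lambda>x. psum k (map (\<lambda>i. f i x) xs))"
  by (rule continuous_on_dominated_diff[of xs _ f _ 1]) (use assms abs_psum_diff_le in auto)

text \<open>The maximizers of the first function form a compact set, on which the induction
  continues with the remaining functions.\<close>

lemma lexicographic_maximum:
  fixes f :: "nat \<Rightarrow> 'a::topological_space \<Rightarrow> real"
  assumes "compact C" "C \<noteq> {}" "\<And>k. k < n \<Longrightarrow> continuous_on C (f k)"
  shows "\<exists>x\<in>C. \<forall>y\<in>C. \<forall>k<n. (\<forall>j<k. f j y = f j x) \<longrightarrow> f k y \<le> f k x"
  using assms
proof (induction n arbitrary: C f)
  case 0
  then show ?case by auto
next
  case (Suc n)
  from continuous_attains_sup[OF Suc.prems(1,2) Suc.prems(3)[of 0]]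
  obtain m where m: "m \<in> C" "\<And>y. y \<in> C \<Longrightarrow> f 0 y \<le> f 0 m" by auto
  define D where "D = C \<inter> {x \<in> C. f 0 x \<ge> f 0 m}"
  have "closedin (top_of_set C) {x \<in> C. f 0 x \<ge> f 0 m}"
    using continuous_closedin_preimage[OF Suc.prems(3)[of 0], of "{f 0 m..}"]
    by (simp add: vimage_def Int_def conj_commute)
  then have D: "compact D" unfolding D_def
    by (metis Int_absorb1 Suc.prems(1) closedin_compact closedin_imp_subset)
  have "\<exists>x\<in>D. \<forall>y\<in>D. \<forall>k<n. (\<forall>j<k. f (Suc j) y = f (Suc j) x) \<longrightarrow> f (Suc k) y \<le> f (Suc k) x"
  proof (rule Suc.IH[OF D])
    show "D \<noteq> {}" using m by (auto simp: D_def)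
    show "continuous_on D (f (Suc k))" if "k < n" for k
      using Suc.prems(3)[of "Suc k"] that by (auto simp: D_def intro: continuous_on_subset)
  qed
  then obtain x where x: "x \<in> D"
    "\<And>y k. y \<in> D \<Longrightarrow> k < n \<Longrightarrow> (\<forall>j<k. f (Suc j) y = f (Suc j) x) \<Longrightarrow> f (Suc k) y \<le> f (Suc k) x"
    by blast
  have x0: "f 0 x = f 0 m" using x(1) m by (auto simp: D_def intro: antisym)
  show ?case
  proof (intro bexI[of _ x] ballI allI impI)
    fix y k assume y: "y \<in> C" "k < Suc n" "\<forall>j<k. f j y = f j x"
    show "f k y \<le> f k x"
    proof (cases k)
      case 0
      then show ?thesis using m y x0 by simp
    next
      case (Suc k')
      then have "y \<in> D" using y x0 by (auto simp: D_def)
      then show ?thesis using x(2)[of y k'] y Suc by auto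
    qed
  qed (use x in \<open>auto simp: D_def\<close>)
qed

text \<open>Outside \<open>N\<close> the points are pinned to \<open>undefined\<close>, so this is a
  product over all indices with singletons as the remaining factors, and Tychonoff's theorem
  applies.\<close>

lemma compact_PiE_singletons:
  fixes N :: "'a set" and a b :: real
  shows "compact (N \<rightarrow>\<^sub>E {a..b})"
proof -
  have "N \<rightarrow>\<^sub>E {a..b} = (\<Pi>\<^sub>E i\<in>UNIV. if i \<in> N then {a..b} else {undefined})"
    by (auto simp: PiE_def Pi_def extensional_def split: if_splits)
  moreover have "compactin (product_topology (\<lambda>i::'a. euclidean :: real topology) UNIV)
      (\<Pi>\<^sub>E i\<in>UNIV. if i \<in> N then {a..b} else {undefined})"
    by (subst compactin_PiE) auto
  ultimately show ?thesis
    by (metis compactin_euclidean_iff euclidean_product_topology)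
qed

lemma continuous_on_coord: "continuous_on C (\<lambda>x::'a \<Rightarrow> real. x i)"
  by (rule continuous_on_product_then_coordinatewise) simp

lemma compact_box_hyperplane:
  assumes "finite N"
  shows "compact {x \<in> N \<rightarrow>\<^sub>E {a..b::real}. sum x N = c}"
proof -
  have "closed ((\<lambda>x::'a \<Rightarrow> real. sum x N) -` {c})"
    by (intro closed_vimage continuous_on_sum continuous_on_coord) auto
  then have "compact ((N \<rightarrow>\<^sub>E {a..b}) \<inter> (\<lambda>x. sum x N) -` {c})"
    by (intro compact_Int_closed compact_PiE_singletons)
  moreover have "(N \<rightarrow>\<^sub>E {a..b}) \<inter> (\<lambda>x. sum x N) -` {c} = {x \<in> N \<rightarrow>\<^sub>E {a..b}. sum x N = c}"
    by auto
  ultimately show ?thesis by simp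
qed

lemma continuous_on_excess: "continuous_on C (\<lambda>x. excess v x S)"
  unfolding excess_def by (intro continuous_intros continuous_on_coord)

definition affine_comb :: "nat set \<Rightarrow> real \<Rightarrow> (nat \<Rightarrow> real) \<Rightarrow> (nat \<Rightarrow> real) \<Rightarrow> nat \<Rightarrow> real" where
  "affine_comb N t x y = (\<lambda>i\<in>N. (1 - t) * x i + t * y i)"

lemma excess_affine_comb:
  "S \<subseteq> N \<Longrightarrow> excess v (affine_comb N t x y) S = (1 - t) * excess v x S + t * excess v y S"
  (is "_ \<Longrightarrow> ?l = ?r")
proof -
  assume S: "S \<subseteq> N"
  have "sum (affine_comb N t x y) S = (\<Sum>i\<in>S. (1 - t) * x i + t * y i)"
    by (rule sum.cong) (use S in \<open>auto simp: affine_comb_def\<close>)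
  then have "sum (affine_comb N t x y) S = (1 - t) * sum x S + t * sum y S"
    by (simp add: sum.distrib sum_distrib_left)
  then show ?thesis by (simp add: excess_def algebra_simps)
qed

section \<open>Existence and uniqueness of the lexicographic maximizer of the excesses\<close>

locale core_game =
  fixes N :: "nat set" and v :: "nat set \<Rightarrow> real" and core_pt :: "nat \<Rightarrow> real"
  assumes fin: "finite N" and ne: "N \<noteq> {}" and v_empty: "v {} = 0"
    and v_singleton: "\<And>i. i \<in> N \<Longrightarrow> v {i} \<ge> 0"
    and core_ext: "core_pt \<in> extensional N" and core_sum: "sum core_pt N = v N"
    and core_excess: "\<And>S. S \<subseteq> N \<Longrightarrow> excess v core_pt S \<ge> 0"
begin

definition pre :: "(nat \<Rightarrow> real) set" where
  "pre = {x \<in> extensional N. sum x N = v N}"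

text \<open>Turns the family of coalitions into a list, to which sorting and \<open>psum\<close>
  apply; the order chosen is immaterial.\<close>

definition coalitions :: "nat set list" where
  "coalitions = (SOME cs. distinct cs \<and> set cs = Pow N)"

definition \<theta> :: "(nat \<Rightarrow> real) \<Rightarrow> real list" where
  "\<theta> x = sort (map (excess v x) coalitions)"

lemma coalitions: "distinct coalitions" "set coalitions = Pow N"
proof -
  have "\<exists>cs. distinct cs \<and> set cs = Pow N"
    using finite_distinct_list[of "Pow N"] fin by blast
  then have "distinct coalitions \<and> set coalitions = Pow N"
    unfolding coalitions_def by (rule someI_ex)
  then show "distinct coalitions" "set coalitions = Pow N" by auto
qed

lemma \<theta>_eq: "\<theta> x = sorted_list_of_multiset (image_mset (excess v x) (mset_set (Pow N)))"
proof -
  have "mset coalitions = mset_set (Pow N)" using coalitions by (metis mset_set_set)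
  then show ?thesis by (metis \<theta>_def mset_map sorted_list_of_multiset_mset)
qed

lemma set_\<theta>: "set (\<theta> x) = excess v x ` Pow N"
  by (simp add: \<theta>_def coalitions)

lemma affine_comb_pre: "x \<in> pre \<Longrightarrow> y \<in> pre \<Longrightarrow> affine_comb N t x y \<in> pre"
  using excess_affine_comb[of N N v t x y] by (simp add: pre_def excess_def affine_comb_def algebra_simps)

lemma pre_eqI: "x \<in> pre \<Longrightarrow> y \<in> pre \<Longrightarrow> (\<And>i. i \<in> N \<Longrightarrow> x i = y i) \<Longrightarrow> x = y"
  by (auto simp: pre_def intro: extensionalityI)

definition box :: "(nat \<Rightarrow> real) set" where
  "box = {x \<in> N \<rightarrow>\<^sub>E {0..v N}. sum x N = v N}"

lemma pre_nonneg_box: "x \<in> pre \<Longrightarrow> (\<And>i. i \<in> N \<Longrightarrow> x i \<ge> 0) \<Longrightarrow> x \<in> box"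
  using fin member_le_sum[of _ N x] by (fastforce simp: pre_def box_def PiE_def)

lemma box_pre: "x \<in> box \<Longrightarrow> x \<in> pre"
  by (auto simp: box_def pre_def PiE_def)

lemma core_pre: "core_pt \<in> pre"
  using core_ext core_sum by (simp add: pre_def)

lemma core_box: "core_pt \<in> box"
proof (rule pre_nonneg_box)
  show "core_pt i \<ge> 0" if "i \<in> N" for i
    using core_excess[of "{i}"] v_singleton[of i] that by (simp add: excess_def)
qed (rule core_pre)

lemma outside_box:
  assumes "y \<in> pre" "y \<notin> box"
  shows "hd (\<theta> y) < 0"
proof -
  have "\<not> (\<forall>i\<in>N. y i \<ge> 0)" using pre_nonneg_box[OF assms(1)] assms(2) by auto
  then obtain i where i: "i \<in> N" "y i < 0" by auto
  have "y i < v {i}" using i v_singleton[OF i(1)] by linarith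
  then have "excess v y {i} < 0" by (simp add: excess_def)
  moreover have "excess v y {i} \<in> set (\<theta> y)"
    unfolding set_\<theta> using i(1) by (intro imageI) simp
  moreover have "hd (\<theta> y) \<le> e" if "e \<in> set (\<theta> y)" for e
  proof -
    have "sorted (\<theta> y)" by (simp add: \<theta>_def)
    then show ?thesis using that by (cases "\<theta> y") auto
  qed
  ultimately show ?thesis by (meson le_less_trans)
qed

lemma \<theta>_ne: "\<theta> x \<noteq> []"
  by (metis Pow_not_empty image_is_empty list.set(1) set_\<theta>)

lemma hd_less: "hd (\<theta> x) < hd (\<theta> y) \<Longrightarrow> \<theta> x \<lless> \<theta> y"
  using \<theta>_ne[of x] \<theta>_ne[of y] by (cases "\<theta> x"; cases "\<theta> y") auto

text \<open>On the compact \<open>box\<close> the sums of least excesses have a lexicographic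
  maximum. Outside, a negative coordinate makes a singleton excess negative, while the core point
  forces a nonnegative least excess at the maximum.\<close>

lemma ex_lexmax: "\<exists>x\<in>box. \<forall>y\<in>pre. \<not> \<theta> x \<lless> \<theta> y"
proof -
  let ?p = "\<lambda>k x. psum (Suc k) (map (excess v x) coalitions)"
  have "\<exists>x\<in>box. \<forall>y\<in>box. \<forall>k<length coalitions. (\<forall>j<k. ?p j y = ?p j x) \<longrightarrow> ?p k y \<le> ?p k x"
  proof (rule lexicographic_maximum)
    show "compact box" unfolding box_def by (rule compact_box_hyperplane[OF fin])
    show "box \<noteq> {}" using core_box by blast
    show "continuous_on box (?p k)" for k
      using continuous_on_psum[of coalitions box "\<lambda>S x. excess v x S" "Suc k"] continuous_on_excess by simp
  qed
  then obtain x where x: "x \<in> box"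
    "\<And>y k. y \<in> box \<Longrightarrow> k < length coalitions \<Longrightarrow> (\<forall>j<k. ?p j y = ?p j x) \<Longrightarrow> ?p k y \<le> ?p k x"
    by blast
  have box: "\<not> \<theta> x \<lless> \<theta> y" if "y \<in> box" for y
  proof
    assume "\<theta> x \<lless> \<theta> y"
    then obtain k where k: "k < length coalitions"
      "\<And>j. j \<le> k \<Longrightarrow> psum j (map (excess v x) coalitions) = psum j (map (excess v y) coalitions)"
      "?p k x < ?p k y"
      unfolding \<theta>_def by (rule lex_less_psumE) auto
    have "?p k y \<le> ?p k x" by (rule x(2)[OF that k(1)]) (use k(2) in auto)
    with k show False by simp
  qed
  have "hd (\<theta> core_pt) \<ge> 0"
    using core_excess \<theta>_ne[of core_pt] list.set_sel(1)[of "\<theta> core_pt"] by (auto simp: set_\<theta>)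
  moreover have "hd (\<theta> x) \<ge> hd (\<theta> core_pt)"
    using box[OF core_box] hd_less not_less by blast
  ultimately have "\<theta> y \<lless> \<theta> x" if "y \<in> pre" "y \<notin> box" for y
    using outside_box[OF that] hd_less by auto
  then have "\<not> \<theta> x \<lless> \<theta> y" if "y \<in> pre" for y
    using that box lex_less_trans lex_less_irrefl by blast
  then show ?thesis using x(1) by blast
qed

lemma sum_list_sq_\<theta>: "(\<Sum>e\<leftarrow>\<theta> x. e\<^sup>2) = (\<Sum>S\<in>Pow N. (excess v x S)\<^sup>2)"
proof -
  have "(\<Sum>e\<leftarrow>\<theta> x. e\<^sup>2) = (\<Sum>S\<leftarrow>coalitions. (excess v x S)\<^sup>2)"
    unfolding \<theta>_def sort_map_eq map_map comp_def
    by (rule sum_list_sort_key)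
  then show ?thesis by (simp add: sum_list_distinct_conv_sum_set coalitions)
qed

text \<open>The midpoint is at least as good in every sum of least excesses, so its vector is
  \<open>\<theta> x\<close> too. Equal sorted vectors have equal sums of squares, and strict
  convexity of the square rules out any difference.\<close>

lemma lexmax_unique:
  assumes x: "x \<in> pre" "\<And>y. y \<in> pre \<Longrightarrow> \<not> \<theta> x \<lless> \<theta> y" and y: "y \<in> pre" "\<theta> y = \<theta> x"
  shows "y = x"
proof -
  define z where "z = affine_comb N (1/2) x y"
  have z: "z \<in> pre" using x y affine_comb_pre z_def by blast
  have ez: "excess v z S = (excess v x S + excess v y S) / 2" if "S \<subseteq> N" for S
    using excess_affine_comb[OF that] by (simp add: z_def)
  have pz: "psum k (map (excess v x) coalitions) \<le> psum k (map (excess v z) coalitions)" for k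
  proof -
    have "psum k (map (excess v y) coalitions) = psum k (map (excess v x) coalitions)"
      using y(2) by (simp add: psum_def \<theta>_def)
    moreover have "1/2 * psum k (map (excess v x) coalitions) + 1/2 * psum k (map (excess v y) coalitions)
        \<le> psum k (map (excess v z) coalitions)"
      by (rule psum_concave) (simp_all add: coalitions ez)
    ultimately show ?thesis by simp
  qed
  have "\<not> \<theta> z \<lless> \<theta> x"
  proof
    assume "\<theta> z \<lless> \<theta> x"
    then obtain k where "psum (Suc k) (map (excess v z) coalitions) < psum (Suc k) (map (excess v x) coalitions)"
      unfolding \<theta>_def by (rule lex_less_psumE) auto
    then show False using pz[of "Suc k"] by simp
  qed
  then have zx: "\<theta> z = \<theta> x" using x(2)[OF z] lex_less_linear by blast
  have sq: "((a + b) / 2)\<^sup>2 = (a\<^sup>2 + b\<^sup>2) / 2 - (a - b)\<^sup>2 / 4" for a b :: real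
    by (simp add: power2_eq_square field_simps)
  have "(\<Sum>S\<in>Pow N. (excess v z S)\<^sup>2) = (\<Sum>S\<in>Pow N. (excess v x S)\<^sup>2)"
    using zx sum_list_sq_\<theta> by metis
  moreover have "(\<Sum>S\<in>Pow N. (excess v y S)\<^sup>2) = (\<Sum>S\<in>Pow N. (excess v x S)\<^sup>2)"
    using y(2) sum_list_sq_\<theta> by metis
  moreover have "(\<Sum>S\<in>Pow N. (excess v z S)\<^sup>2) =
      ((\<Sum>S\<in>Pow N. (excess v x S)\<^sup>2) + (\<Sum>S\<in>Pow N. (excess v y S)\<^sup>2)) / 2
      - (\<Sum>S\<in>Pow N. (excess v x S - excess v y S)\<^sup>2) / 4"
  proof -
    have "(\<Sum>S\<in>Pow N. (excess v z S)\<^sup>2) =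
      (\<Sum>S\<in>Pow N. ((excess v x S)\<^sup>2 + (excess v y S)\<^sup>2) / 2 - (excess v x S - excess v y S)\<^sup>2 / 4)"
      by (rule sum.cong) (auto simp: ez sq)
    then show ?thesis by (simp add: sum_subtractf sum.distrib sum_divide_distrib[symmetric])
  qed
  ultimately have "(\<Sum>S\<in>Pow N. (excess v x S - excess v y S)\<^sup>2) = 0" by simp
  then have "\<forall>S\<in>Pow N. (excess v x S - excess v y S)\<^sup>2 = 0"
    by (subst (asm) sum_nonneg_eq_0_iff) (use fin in auto)
  then have eq: "excess v x {i} = excess v y {i}" if "i \<in> N" for i using that by auto
  show ?thesis by (rule pre_eqI[OF y(1) x(1)]) (use eq in \<open>auto simp: excess_def\<close>)
qed

definition nuc :: "nat \<Rightarrow> real" where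
  "nuc = (SOME x. x \<in> box \<and> (\<forall>y\<in>pre. \<not> \<theta> x \<lless> \<theta> y))"

lemma nuc: "nuc \<in> box" "\<And>y. y \<in> pre \<Longrightarrow> \<not> \<theta> nuc \<lless> \<theta> y"
proof -
  have "\<exists>x. x \<in> box \<and> (\<forall>y\<in>pre. \<not> \<theta> x \<lless> \<theta> y)"
    using ex_lexmax by (simp add: Bex_def)
  then have "nuc \<in> box \<and> (\<forall>y\<in>pre. \<not> \<theta> nuc \<lless> \<theta> y)"
    unfolding nuc_def by (rule someI_ex)
  then show "nuc \<in> box" "\<And>y. y \<in> pre \<Longrightarrow> \<not> \<theta> nuc \<lless> \<theta> y" by auto
qed

lemma nuc_pre: "nuc \<in> pre"
  using nuc box_pre by blast

lemma less_nuc: "y \<in> pre \<Longrightarrow> y \<noteq> nuc \<Longrightarrow> \<theta> y \<lless> \<theta> nuc"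
  using lexmax_unique[OF nuc_pre nuc(2)] nuc(2) lex_less_linear by blast

lemma lexmax_set_eq_nuc: "{x \<in> pre. \<forall>y\<in>pre. \<not> \<theta> x \<lless> \<theta> y} = {nuc}"
  using nuc_pre nuc(2) less_nuc by blast

end

text \<open>The last assumption lets block minima stand for single excesses: an excess is one block
  minimum plus nonnegative differences, with the same blocks at every payoff vector. So it lies
  above all block minima that occur in it and is determined by them.\<close>

locale block_game = core_game +
  fixes K :: nat and blk :: "nat \<Rightarrow> nat set set"
  assumes blk_sub: "\<And>B. B < K \<Longrightarrow> blk B \<subseteq> Pow N" and blk_ne: "\<And>B. B < K \<Longrightarrow> blk B \<noteq> {}"
    and blk_repr: "\<And>S. S \<subseteq> N \<Longrightarrow> S \<noteq> {} \<Longrightarrow>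
      \<exists>g J. g < K \<and> J \<subseteq> {..<K} \<and> (\<forall>x.
        excess v x S = Min (excess v x ` blk g) + (\<Sum>B\<in>J. Min (excess v x ` blk B) - Min (excess v x ` blk g))
        \<and> (\<forall>B\<in>J. Min (excess v x ` blk g) \<le> Min (excess v x ` blk B)))"
begin

definition H :: "(nat \<Rightarrow> real) \<Rightarrow> nat \<Rightarrow> real" where
  "H x B = Min (excess v x ` blk B)"

lemma fin_blk: "B < K \<Longrightarrow> finite (blk B)"
  using blk_sub fin by (meson finite_Pow_iff finite_subset)

lemma H_le: "B < K \<Longrightarrow> S \<in> blk B \<Longrightarrow> H x B \<le> excess v x S"
  by (simp add: H_def fin_blk)

lemma H_attained: "B < K \<Longrightarrow> \<exists>S\<in>blk B. H x B = excess v x S"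
  unfolding H_def using Min_in[of "excess v x ` blk B"] fin_blk[of B] blk_ne[of B] by fastforce

lemma H_concave:
  assumes "B < K" "0 \<le> t" "t \<le> 1"
  shows "(1 - t) * H x B + t * H y B \<le> H (affine_comb N t x y) B"
proof -
  obtain S where S: "S \<in> blk B" "H (affine_comb N t x y) B = excess v (affine_comb N t x y) S"
    using H_attained assms by blast
  then have "excess v (affine_comb N t x y) S = (1 - t) * excess v x S + t * excess v y S"
    using blk_sub[OF assms(1)] by (intro excess_affine_comb) auto
  then show ?thesis using S assms H_le[OF assms(1) S(1)] by (auto intro!: add_mono mult_left_mono)
qed

lemma excess_H:
  assumes "S \<subseteq> N" "S \<noteq> {}"
  obtains g J where "g < K" "J \<subseteq> {..<K}"
    "\<And>x. excess v x S = H x g + (\<Sum>B\<in>J. H x B - H x g)"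
    "\<And>x B. B \<in> J \<Longrightarrow> H x g \<le> H x B"
proof -
  from blk_repr[OF assms] obtain g J where *: "g < K" "J \<subseteq> {..<K}" "\<forall>x.
        excess v x S = Min (excess v x ` blk g) + (\<Sum>B\<in>J. Min (excess v x ` blk B) - Min (excess v x ` blk g))
        \<and> (\<forall>B\<in>J. Min (excess v x ` blk g) \<le> Min (excess v x ` blk B))" by blast
  show ?thesis by (rule that[of g J]) (use * in \<open>auto simp: H_def\<close>)
qed

text \<open>If the block vector at \<open>y\<close> were not worse, a small step towards
  \<open>y\<close> would improve the excess vector itself. Take the least level \<open>r\<close> at
  which a block minimum changes in this step: by concavity the minima at \<open>r\<close> cannot
  fall, and the excesses inherit this through their representation.\<close>

lemma H_less_nuc:
  assumes y: "y \<in> pre" "y \<noteq> nuc"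
  shows "sort (map (H y) [0..<K]) \<lless> sort (map (H nuc) [0..<K])"
proof (rule ccontr)
  assume nl: "\<not> sort (map (H y) [0..<K]) \<lless> sort (map (H nuc) [0..<K])"
  have "\<forall>\<^sub>F t in at_right 0. \<forall>S\<in>Pow N. \<forall>S'\<in>Pow N. excess v nuc S' < excess v nuc S \<longrightarrow>
      excess v nuc S' < (1 - t) * excess v nuc S + t * excess v y S"
  proof (intro eventually_ball_finite ballI)
    fix S S' assume "S \<in> Pow N" "S' \<in> Pow N"
    have "((\<lambda>t. (1 - t) * excess v nuc S + t * excess v y S) \<longlongrightarrow>
        (1 - 0) * excess v nuc S + 0 * excess v y S) (at_right 0)"
      by (intro tendsto_intros)
    then have lim: "((\<lambda>t. (1 - t) * excess v nuc S + t * excess v y S) \<longlongrightarrow> excess v nuc S) (at_right 0)"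
      by simp
    show "\<forall>\<^sub>F t in at_right 0. excess v nuc S' < excess v nuc S \<longrightarrow>
      excess v nuc S' < (1 - t) * excess v nuc S + t * excess v y S"
    proof (cases "excess v nuc S' < excess v nuc S")
      case True
      then show ?thesis using order_tendstoD(1)[OF lim True] by (auto elim: eventually_mono)
    qed simp
  qed (use fin in auto)
  moreover have "\<forall>\<^sub>F t in at_right (0::real). t > 0 \<and> t < 1"
    by (auto simp: eventually_at_right_field intro: exI[of _ 1])
  ultimately have "\<forall>\<^sub>F t in at_right 0. (t > 0 \<and> t < 1) \<and> (\<forall>S\<in>Pow N. \<forall>S'\<in>Pow N.
      excess v nuc S' < excess v nuc S \<longrightarrow> excess v nuc S' < (1 - t) * excess v nuc S + t * excess v y S)"
    by eventually_elim auto
  then obtain t :: real where t: "0 < t" "t < 1"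
    and sep: "\<And>S S'. S \<subseteq> N \<Longrightarrow> S' \<subseteq> N \<Longrightarrow> excess v nuc S' < excess v nuc S \<Longrightarrow>
       excess v nuc S' < (1 - t) * excess v nuc S + t * excess v y S"
    using eventually_happens'[OF trivial_limit_at_right_real] by (metis (no_types, lifting) Pow_iff)
  \<comment> \<open>\<open>t\<close> is so small that an excess strictly above another one stays
    above the old value of that one; \<open>sep'\<close> states this for \<open>z\<close>.\<close>
  define z where "z = affine_comb N t nuc y"
  have z: "z \<in> pre" using nuc_pre y affine_comb_pre z_def by blast
  have sep': "excess v nuc S' < excess v z S"
    if "S \<subseteq> N" "S' \<subseteq> N" "excess v nuc S' < excess v nuc S" for S S'
    using sep[OF that] excess_affine_comb[OF that(1)] by (simp add: z_def)
  have "z \<noteq> nuc"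
  proof
    assume "z = nuc"
    have "y i = nuc i" if "i \<in> N" for i
    proof -
      have "z i = (1 - t) * nuc i + t * y i" using that by (simp add: z_def affine_comb_def)
      then have "t * (y i - nuc i) = 0" using \<open>z = nuc\<close> by (auto simp: algebra_simps)
      then show ?thesis using t by simp
    qed
    then show False using y pre_eqI nuc_pre by blast
  qed
  define Ch where "Ch = {B. B < K \<and> H z B \<noteq> H nuc B}"
  \<comment> \<open>Block minima determine all excesses, in particular those of the singletons, and
    these determine the vector.\<close>
  have "Ch \<noteq> {}"
  proof
    assume "Ch = {}"
    then have eq: "H z B = H nuc B" if "B < K" for B using that by (auto simp: Ch_def)
    have "excess v z S = excess v nuc S" if S: "S \<subseteq> N" "S \<noteq> {}" for S
    proof -
      obtain g J where gJ: "g < K" "J \<subseteq> {..<K}"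
        "\<And>x. excess v x S = H x g + (\<Sum>B\<in>J. H x B - H x g)" by (rule excess_H[OF S]) blast
      have "(\<Sum>B\<in>J. H z B - H z g) = (\<Sum>B\<in>J. H nuc B - H nuc g)"
        using gJ(1,2) eq by (intro sum.cong) (auto simp: subset_iff)
      then show ?thesis using gJ eq by simp
    qed
    then have "excess v z {i} = excess v nuc {i}" if "i \<in> N" for i using that by simp
    then have "z = nuc" by (intro pre_eqI[OF z nuc_pre]) (auto simp: excess_def)
    with \<open>z \<noteq> nuc\<close> show False ..
  qed
  have finCh: "finite Ch" by (simp add: Ch_def)
  define r where "r = Min (H nuc ` Ch)"
  have "r \<in> H nuc ` Ch" unfolding r_def using finCh \<open>Ch \<noteq> {}\<close> by (intro Min_in) auto
  then obtain B0 where B0: "B0 \<in> Ch" "H nuc B0 = r" by auto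
  have below: "H z B = H nuc B" if "B < K" "H nuc B < r" for B
  proof (rule ccontr)
    assume "H z B \<noteq> H nuc B"
    then have "B \<in> Ch" using that by (simp add: Ch_def)
    then have "r \<le> H nuc B" using finCh by (simp add: r_def)
    then show False using that by simp
  qed
  have atr: "H z B \<ge> r" if "B < K" "H nuc B = r" for B
  proof (rule lowest_change_increases[where xs = "[0..<K]" and a = "H nuc" and c = "H y" and t = t])
    show "(1 - t) * H nuc i + t * H y i \<le> H z i" if "i \<in> set [0..<K]" for i
      using H_concave[of i t nuc y] that t by (simp add: z_def)
  qed (use t nl below that in auto)
  \<comment> \<open>A coalition attaining the lowest changed minimum. That minimum rises above
    \<open>r\<close>, and the excess of \<open>S0\<close> with it; this is the strict
    improvement.\<close>
  obtain S0 where S0: "S0 \<in> blk B0" "H nuc B0 = excess v nuc S0" using H_attained B0 by (auto simp: Ch_def)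
  have B0K: "B0 < K" using B0 by (simp add: Ch_def)
  have "\<theta> nuc \<lless> \<theta> z"
    unfolding \<theta>_def
  proof (rule sort_lex_less_localI)
    fix S assume "S \<in> set coalitions"
    then have S: "S \<subseteq> N" by (simp add: coalitions)
    show "excess v z S = excess v nuc S" if lt: "excess v nuc S < r"
    proof (cases "S = {}")
      case False
      obtain g J where gJ: "g < K" "J \<subseteq> {..<K}"
        "\<And>x. excess v x S = H x g + (\<Sum>B\<in>J. H x B - H x g)"
        "\<And>x B. B \<in> J \<Longrightarrow> H x g \<le> H x B" by (rule excess_H[OF S False]) blast
      have finJ: "finite J" using gJ(2) finite_subset by blast
      have g: "H nuc g \<le> excess v nuc S"
        unfolding gJ(3) using gJ(4)[of _ nuc] by (simp add: sum_nonneg)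
      have B: "H nuc B \<le> excess v nuc S" if "B \<in> J" for B
        unfolding gJ(3) using member_le_sum[OF that, of "\<lambda>B. H nuc B - H nuc g"] finJ gJ(4)[of _ nuc] by auto
      have "H z B = H nuc B" if "B \<in> J" for B using below B[OF that] lt gJ(2) that by force
      moreover have "H z g = H nuc g" using below g lt gJ(1) by force
      ultimately show ?thesis unfolding gJ(3) by simp
    qed (simp add: excess_def)
    show "excess v z S \<ge> r" if at: "excess v nuc S = r"
    proof (cases "S = {}")
      case True
      then show ?thesis using at by (simp add: excess_def)
    next
      case False
      obtain g J where gJ: "g < K" "J \<subseteq> {..<K}"
        "\<And>x. excess v x S = H x g + (\<Sum>B\<in>J. H x B - H x g)"
        "\<And>x B. B \<in> J \<Longrightarrow> H x g \<le> H x B" by (rule excess_H[OF S False]) blast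
      have finJ: "finite J" using gJ(2) finite_subset by blast
      have g: "H nuc g \<le> excess v nuc S"
        unfolding gJ(3) using gJ(4)[of _ nuc] by (simp add: sum_nonneg)
      have B: "H nuc B \<le> excess v nuc S" if "B \<in> J" for B
        unfolding gJ(3) using member_le_sum[OF that, of "\<lambda>B. H nuc B - H nuc g"] finJ gJ(4)[of _ nuc] by auto
      have le: "H nuc B \<le> H z B" if "B \<in> J" for B
        using B[OF that] at below[of B] atr[of B] gJ(2) that by (cases "H nuc B = r") force+
      show ?thesis
      proof (cases "H nuc g = r")
        case True
        have "excess v z S \<ge> H z g" unfolding gJ(3) using gJ(4)[of _ z] by (simp add: sum_nonneg)
        then show ?thesis using atr[OF gJ(1) True] by simp
      next
        case False
        then have "H z g = H nuc g" using below g at gJ(1) by force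
        then have "excess v z S \<ge> excess v nuc S" unfolding gJ(3) using le by (auto intro!: sum_mono)
        then show ?thesis using at by simp
      qed
    qed
    show "excess v z S > r" if gt: "excess v nuc S > r"
    proof -
      have "S0 \<subseteq> N" using S0 blk_sub[OF B0K] by auto
      then show ?thesis using sep'[OF S, of S0] S0 B0 gt by simp
    qed
  next
    show "S0 \<in> set coalitions" using S0 blk_sub[OF B0K] coalitions by auto
    show "excess v nuc S0 = r" using S0 B0 by simp
    have "H z B0 > r" using atr[OF B0K B0(2)] B0 by (auto simp: Ch_def)
    then show "excess v z S0 > r" using H_le[OF B0K S0(1), of z] by simp
  qed
  moreover have "\<not> \<theta> nuc \<lless> \<theta> z" using nuc(2)[OF z] .
  ultimately show False by simp
qed

end

section \<open>Determinants with small entries\<close>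

text \<open>Expanding the product of column sums gives a term for every map of the indices into
  themselves; Leibniz's formula uses only the permutations among them.\<close>

lemma abs_det_le_prod_column_sums:
  fixes A :: "'a::linordered_idom mat"
  assumes A: "A \<in> carrier_mat n n"
  shows "\<bar>det A\<bar> \<le> (\<Prod>j<n. \<Sum>i<n. \<bar>A $$ (i, j)\<bar>)"
proof -
  let ?P = "{p. p permutes {0..<n}}"
  let ?f = "\<lambda>p::nat \<Rightarrow> nat. \<Prod>j\<in>{0..<n}. \<bar>A $$ (p j, j)\<bar>"
  have T: "A\<^sup>T \<in> carrier_mat n n" using A by simp
  have "det A = det (A\<^sup>T)" using det_transpose[OF A] by simp
  also have "\<dots> = (\<Sum>p\<in>?P. signof p * (\<Prod>i = 0..<n. A\<^sup>T $$ (i, p i)))"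
    by (rule det_def'[OF T])
  also have "\<bar>\<dots>\<bar> \<le> (\<Sum>p\<in>?P. \<bar>signof p * (\<Prod>i = 0..<n. A\<^sup>T $$ (i, p i))\<bar>)"
    by (rule sum_abs)
  also have "\<dots> = (\<Sum>p\<in>?P. ?f p)"
  proof (rule sum.cong[OF refl])
    fix p assume p: "p \<in> ?P"
    have s: "\<bar>signof p :: 'a\<bar> = 1" by (simp add: sign_def)
    have "(\<Prod>i = 0..<n. A\<^sup>T $$ (i, p i)) = (\<Prod>i = 0..<n. A $$ (p i, i))"
    proof (rule prod.cong[OF refl])
      fix i assume "i \<in> {0..<n}"
      moreover then have "p i \<in> {0..<n}" using p permutes_in_image by fastforce
      ultimately show "A\<^sup>T $$ (i, p i) = A $$ (p i, i)" using A by auto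
    qed
    then show "\<bar>signof p * (\<Prod>i = 0..<n. A\<^sup>T $$ (i, p i))\<bar> = ?f p"
      by (simp add: abs_mult s abs_prod)
  qed
  also have "\<dots> = (\<Sum>q\<in>(\<lambda>p. restrict p {0..<n}) ` ?P. ?f q)"
  proof (subst sum.reindex)
    show "inj_on (\<lambda>p. restrict p {0..<n}) ?P"
    proof (rule inj_onI)
      fix p q assume pq: "p \<in> ?P" "q \<in> ?P" "restrict p {0..<n} = restrict q {0..<n}"
      show "p = q"
      proof
        fix i show "p i = q i"
        proof (cases "i \<in> {0..<n}")
          case True then show ?thesis using fun_cong[OF pq(3), of i] by simp
        next
          case False then show ?thesis using pq by (simp add: permutes_def)
        qed
      qed
    qed
  qed simp
  also have "\<dots> \<le> (\<Sum>q\<in>{0..<n} \<rightarrow>\<^sub>E {0..<n}. ?f q)"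
  proof (rule sum_mono2)
    show "finite ({0..<n} \<rightarrow>\<^sub>E {0..<n})" by (intro finite_PiE) auto
    show "(\<lambda>p. restrict p {0..<n}) ` ?P \<subseteq> {0..<n} \<rightarrow>\<^sub>E {0..<n}"
      using permutes_in_image by fastforce
  qed (auto intro: prod_nonneg)
  also have "\<dots> = (\<Prod>j\<in>{0..<n}. \<Sum>i\<in>{0..<n}. \<bar>A $$ (i, j)\<bar>)"
    by (subst prod_sum_PiE) auto
  finally show ?thesis by (simp add: atLeast0LessThan)
qed

text \<open>The minor is bordered by a new column and a new row. Its determinant is linear in the
  new row with the cofactors as coefficients; if it vanished for all rows in \<open>R\<close>, the
  cofactors would form a kernel vector, nonzero at the new column, where the cofactor is the old
  minor.\<close>

lemma nonsingular_minor:
  fixes R :: "(nat \<Rightarrow> int) set"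
  assumes ker: "\<And>u :: nat \<Rightarrow> int. (\<And>a. a \<in> R \<Longrightarrow> (\<Sum>i<n. a i * u i) = 0) \<Longrightarrow> \<forall>i<n. u i = 0"
    and "k \<le> n"
  shows "\<exists>r c. (\<forall>i<k. r i \<in> R) \<and> inj_on c {..<k} \<and> c ` {..<k} \<subseteq> {..<n} \<and>
    det (mat k k (\<lambda>(i, j). r i (c j))) \<noteq> 0"
  using \<open>k \<le> n\<close>
proof (induction k)
  case 0
  show ?case by (intro exI[of _ "\<lambda>_ _. 0"] exI[of _ "\<lambda>i. i"]) auto
next
  case (Suc k)
  then obtain r c where rc: "\<And>i. i < k \<Longrightarrow> r i \<in> R" "inj_on c {..<k}" "c ` {..<k} \<subseteq> {..<n}"
    "det (mat k k (\<lambda>(i, j). r i (c j))) \<noteq> 0" by auto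
  have "card (c ` {..<k}) < card {..<n}" using Suc.prems rc(2) by (simp add: card_image)
  then have "\<not> {..<n} \<subseteq> c ` {..<k}"
    using card_mono[of "c ` {..<k}" "{..<n}"] by auto
  then obtain c' where c': "c' < n" "c' \<notin> c ` {..<k}" by auto
  define d where "d = c(k := c')"
  have dk: "d ` {..<k} = c ` {..<k}" by (auto simp: d_def intro!: image_cong)
  have "inj_on d {..<k}" using rc(2) by (simp add: d_def inj_on_def)
  then have "inj_on d (insert k {..<k})" using c'(2) dk by (simp add: d_def)
  then have d1: "inj_on d {..<Suc k}" by (simp only: lessThan_Suc)
  have "d k < n" using c'(1) by (simp add: d_def)
  then have "d ` {..<Suc k} \<subseteq> {..<n}" unfolding lessThan_Suc image_insert dk using rc(3) by simp
  note d = d1 this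
  define M where "M a = mat (Suc k) (Suc k) (\<lambda>(i, j). (r(k := a)) i (d j))" for a
  have M: "M a \<in> carrier_mat (Suc k) (Suc k)" for a by (simp add: M_def)
  define cf where "cf j = cofactor (M (\<lambda>_. 0)) k j" for j
  have del: "mat_delete (M a) k j = mat_delete (M (\<lambda>_. 0)) k j" for a j
    by (rule eq_matI) (auto simp: mat_delete_def M_def)
  have expand: "det (M a) = (\<Sum>j<Suc k. a (d j) * cf j)" for a
  proof -
    have "det (M a) = (\<Sum>j<Suc k. M a $$ (k, j) * cofactor (M a) k j)"
      by (rule laplace_expansion_row[OF M]) simp
    also have "\<dots> = (\<Sum>j<Suc k. a (d j) * cf j)"
    proof (rule sum.cong[OF refl])
      fix j assume "j \<in> {..<Suc k}"
      then have "M a $$ (k, j) = a (d j)" by (simp add: M_def)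
      then show "M a $$ (k, j) * cofactor (M a) k j = a (d j) * cf j"
        by (simp add: cf_def cofactor_def del[of a])
    qed
    finally show ?thesis .
  qed
  have "mat_delete (M (\<lambda>_. 0)) k k = mat k k (\<lambda>(i, j). r i (c j))"
    by (rule eq_matI) (auto simp: mat_delete_def M_def d_def)
  then have cfk: "cf k \<noteq> 0" using rc(4) by (simp add: cf_def cofactor_def)
  \<comment> \<open>The cofactors, placed at the columns to which they belong, and 0
    elsewhere.\<close>
  define u where "u i = (\<Sum>j<Suc k. if d j = i then cf j else 0)" for i
  have "\<exists>a\<in>R. det (M a) \<noteq> 0"
  proof (rule ccontr)
    assume "\<not> ?thesis"
    then have z: "det (M a) = 0" if "a \<in> R" for a using that by blast
    have "(\<Sum>i<n. a i * u i) = 0" if "a \<in> R" for a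
    proof -
      have "(\<Sum>i<n. a i * u i) = (\<Sum>j<Suc k. \<Sum>i<n. if d j = i then a i * cf j else 0)"
        unfolding u_def sum_distrib_left by (subst sum.swap) (intro sum.cong refl, simp)
      also have "\<dots> = (\<Sum>j<Suc k. a (d j) * cf j)"
      proof (rule sum.cong[OF refl])
        fix j assume "j \<in> {..<Suc k}"
        then have "d j < n" using d(2) by blast
        then show "(\<Sum>i<n. if d j = i then a i * cf j else 0) = a (d j) * cf j" by simp
      qed
      finally show ?thesis using z[OF that] expand by simp
    qed
    then have "\<forall>i<n. u i = 0" by (rule ker)
    moreover have "u (d k) = cf k"
    proof -
      have "u (d k) = (\<Sum>j<Suc k. if j = k then cf j else 0)"
        unfolding u_def by (rule sum.cong) (use d(1) in \<open>auto simp: inj_on_def\<close>)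
      then show ?thesis by simp
    qed
    moreover have "d k < n" using d(2) by auto
    ultimately show False using cfk by auto
  qed
  then obtain a where a: "a \<in> R" "det (M a) \<noteq> 0" by blast
  show ?case
  proof (intro exI conjI)
    show "\<forall>i<Suc k. (r(k := a)) i \<in> R" using a rc(1) by (simp add: less_Suc_eq)
    show "det (mat (Suc k) (Suc k) (\<lambda>(i, j). (r(k := a)) i (d j))) \<noteq> 0"
      using a(2) unfolding M_def .
  qed (fact d)+
qed

text \<open>Cramer's rule through the adjugate: a nonsingular square system of rows in
  \<open>R\<close> makes \<open>det A * x i\<close> an integral combination of right-hand sides,
  which \<open>G\<close> clears of fractions. Entries of absolute value at most 1 give column sums
  at most \<open>n\<close>, hence \<open>n ^ n\<close>.\<close>

lemma unique_solution_denominator: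
  fixes x :: "nat \<Rightarrow> real" and R :: "(nat \<Rightarrow> int) set"
  assumes coef: "\<And>a i. a \<in> R \<Longrightarrow> i < n \<Longrightarrow> \<bar>a i\<bar> \<le> 1"
    and rhs: "\<And>a. a \<in> R \<Longrightarrow> (\<Sum>i<n. real_of_int (a i) * x i) * G \<in> \<int>"
    and ker: "\<And>u :: nat \<Rightarrow> real. (\<And>a. a \<in> R \<Longrightarrow> (\<Sum>i<n. real_of_int (a i) * u i) = 0) \<Longrightarrow> \<forall>i<n. u i = 0"
  shows "\<exists>D::int. 1 \<le> D \<and> D \<le> int n ^ n \<and> (\<forall>i<n. real_of_int D * x i * G \<in> \<int>)"
proof -
  have "\<exists>r c. (\<forall>i<n. r i \<in> R) \<and> inj_on c {..<n} \<and> c ` {..<n} \<subseteq> {..<n} \<and>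
    det (mat n n (\<lambda>(i, j). r i (c j))) \<noteq> 0"
  proof (rule nonsingular_minor)
    fix u :: "nat \<Rightarrow> int" assume u: "\<And>a. a \<in> R \<Longrightarrow> (\<Sum>i<n. a i * u i) = 0"
    have "\<forall>i<n. real_of_int (u i) = 0"
    proof (rule ker)
      show "(\<Sum>i<n. real_of_int (a i) * real_of_int (u i)) = 0" if "a \<in> R" for a
        using u[OF that] by (metis (no_types, lifting) of_int_0 of_int_mult of_int_sum sum.cong)
    qed
    then show "\<forall>i<n. u i = 0" by simp
  qed simp
  then obtain r c where rc: "\<And>i. i < n \<Longrightarrow> r i \<in> R" "inj_on c {..<n}" "c ` {..<n} \<subseteq> {..<n}"
    "det (mat n n (\<lambda>(i, j). r i (c j))) \<noteq> 0" by blast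
  define A where "A = mat n n (\<lambda>(i, j). r i (c j))"
  have A: "A \<in> carrier_mat n n" by (simp add: A_def)
  have img: "c ` {..<n} = {..<n}"
    using rc(2,3) by (metis card_image card_subset_eq finite_lessThan)
  have bound: "\<bar>det A\<bar> \<le> int n ^ n"
  proof -
    have "\<bar>det A\<bar> \<le> (\<Prod>j<n. \<Sum>i<n. \<bar>A $$ (i, j)\<bar>)" by (rule abs_det_le_prod_column_sums[OF A])
    also have "\<dots> \<le> (\<Prod>j<n. int n)"
    proof (intro prod_mono conjI)
      fix j assume "j \<in> {..<n}"
      then have "(\<Sum>i<n. \<bar>A $$ (i, j)\<bar>) \<le> (\<Sum>i<n. 1)"
        using rc(3) by (intro sum_mono) (auto simp: A_def intro!: coef rc(1))
      then show "(\<Sum>i<n. \<bar>A $$ (i, j)\<bar>) \<le> int n" by simp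
    qed (auto intro: sum_nonneg)
    finally show ?thesis by simp
  qed
  have sol: "real_of_int (det A) * x i * G \<in> \<int>" if "i < n" for i
  proof -
    obtain j where j: "j < n" "c j = i" using img \<open>i < n\<close> by (metis imageE lessThan_iff)
    define B where "B = adj_mat A"
    have B: "B \<in> carrier_mat n n" using adj_mat(1)[OF A] by (simp add: B_def)
    have BA: "(\<Sum>k<n. B $$ (j, k) * A $$ (k, l)) = (if l = j then det A else 0)" if "l < n" for l
    proof -
      have "(B * A) $$ (j, l) = (\<Sum>k<n. B $$ (j, k) * A $$ (k, l))"
        using A B j that by (auto simp: scalar_prod_def atLeast0LessThan)
      moreover have "(B * A) $$ (j, l) = (if l = j then det A else 0)"
        using adj_mat(3)[OF A] that j by (simp add: B_def)
      ultimately show ?thesis by simp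
    qed
    have row: "(\<Sum>l<n. real_of_int (A $$ (k, l)) * x (c l)) = (\<Sum>i<n. real_of_int (r k i) * x i)" if "k < n" for k
    proof -
      have "(\<Sum>i<n. real_of_int (r k i) * x i) = (\<Sum>i\<in>c ` {..<n}. real_of_int (r k i) * x i)"
        by (simp add: img)
      also have "\<dots> = (\<Sum>l<n. real_of_int (r k (c l)) * x (c l))"
        by (subst sum.reindex[OF rc(2)]) simp
      finally show ?thesis using that by (simp add: A_def)
    qed
    have "(\<Sum>k<n. real_of_int (B $$ (j, k)) * ((\<Sum>i<n. real_of_int (r k i) * x i) * G)) =
      (\<Sum>k<n. \<Sum>l<n. real_of_int (B $$ (j, k) * A $$ (k, l)) * x (c l) * G)"
    proof (rule sum.cong[OF refl])
      fix k assume "k \<in> {..<n}"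
      then have "(\<Sum>i<n. real_of_int (r k i) * x i) * G = (\<Sum>l<n. real_of_int (A $$ (k, l)) * x (c l)) * G"
        using row[of k] by simp
      then show "real_of_int (B $$ (j, k)) * ((\<Sum>i<n. real_of_int (r k i) * x i) * G) =
          (\<Sum>l<n. real_of_int (B $$ (j, k) * A $$ (k, l)) * x (c l) * G)"
        by (simp add: sum_distrib_left sum_distrib_right mult.assoc)
    qed
    also have "\<dots> = (\<Sum>l<n. real_of_int (\<Sum>k<n. B $$ (j, k) * A $$ (k, l)) * x (c l) * G)"
      by (subst sum.swap) (simp add: sum_distrib_right)
    also have "\<dots> = (\<Sum>l<n. if l = j then real_of_int (det A) * x (c j) * G else 0)"
      by (intro sum.cong) (auto simp: BA)
    also have "\<dots> = real_of_int (det A) * x i * G" using j by simp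
    finally have "real_of_int (det A) * x i * G =
      (\<Sum>k<n. real_of_int (B $$ (j, k)) * ((\<Sum>i<n. real_of_int (r k i) * x i) * G))" ..
    also have "\<dots> \<in> \<int>" by (intro Ints_sum Ints_mult[OF Ints_of_int] rhs rc(1)) simp
    finally show ?thesis .
  qed
  show ?thesis
  proof (intro exI[of _ "\<bar>det A\<bar>"] conjI allI impI)
    show "real_of_int \<bar>det A\<bar> * x i * G \<in> \<int>" if "i < n" for i
      using sol[OF that] by (cases "det A \<ge> 0") (auto simp: abs_if)
    have "det A \<noteq> 0" using rc(4) by (simp add: A_def)
    then show "1 \<le> \<bar>det A\<bar>" by linarith
  qed (rule bound)
qed

section \<open>A concave function with a sharp maximum at the nucleolus\<close>

text \<open>The geometric series, multiplied by \<open>M - 1\<close> instead of divided.\<close>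

lemma abs_horner_le:
  fixes xs :: "real list"
  assumes "\<And>e. e \<in> set xs \<Longrightarrow> \<bar>e\<bar> \<le> A" "M \<ge> 1"
  shows "\<bar>horner M xs\<bar> * (M - 1) \<le> A * (M ^ length xs - 1)"
  using assms(1)
proof (induction xs)
  case (Cons x xs)
  have IH: "\<bar>horner M xs\<bar> * (M - 1) \<le> A * (M ^ length xs - 1)" using Cons by simp
  have "\<bar>horner M (x # xs)\<bar> \<le> \<bar>x\<bar> * M ^ length xs + \<bar>horner M xs\<bar>"
    using assms(2) abs_triangle_ineq[of "x * M ^ length xs" "horner M xs"] by (simp add: abs_mult)
  also have "\<dots> \<le> A * M ^ length xs + \<bar>horner M xs\<bar>"
    using assms(2) Cons.prems by (intro add_right_mono mult_right_mono) auto
  finally have "\<bar>horner M (x # xs)\<bar> * (M - 1) \<le> (A * M ^ length xs + \<bar>horner M xs\<bar>) * (M - 1)"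
    using assms(2) by (intro mult_right_mono) auto
  also have "\<dots> \<le> A * M ^ length xs * (M - 1) + A * (M ^ length xs - 1)"
    using IH by (simp add: algebra_simps)
  finally show ?case by (simp add: algebra_simps)
qed simp

lemma horner_diff_append:
  "length v = length w \<Longrightarrow>
   horner M (u @ b # w) - horner M (u @ a # v) = (b - a) * M ^ length w + horner M w - horner M v"
  by (induction u) (auto simp: algebra_simps)

text \<open>With \<open>l\<close> entries behind the first difference, that difference gains at
  least \<open>M ^ l / G\<close>, and the tails lose at most
  \<open>2 * A * (M ^ l - 1) / (M - 1)\<close>, which this \<open>M\<close> keeps below
  \<open>(M ^ l - 1) / G\<close>. So \<open>1 / G\<close> remains.\<close>

lemma horner_lex_less_gap:
  fixes xs ys :: "real list"
  assumes "xs \<lless> ys" "length xs = length ys"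
    and ints: "\<And>e. e \<in> set xs \<union> set ys \<Longrightarrow> G * e \<in> \<int>" and G: "G > 0"
    and A: "\<And>e. e \<in> set xs \<union> set ys \<Longrightarrow> \<bar>e\<bar> \<le> A"
    and M: "M \<ge> 1 + 2 * A * G" "M > 1"
  shows "horner M xs + 1 / G \<le> horner M ys"
proof -
  from assms(1,2) obtain u a b v w where uv: "a < b" "xs = u @ a # v" "ys = u @ b # w"
    unfolding lexord_def by auto
  have len: "length v = length w" using assms(2) uv by simp
  have "1 \<le> G * b - G * a"
  proof -
    have "G * b - G * a \<in> \<int>" using ints[of a] ints[of b] uv by (intro Ints_diff) auto
    moreover have "G * b - G * a > 0" using uv(1) G by simp
    ultimately obtain z where "G * b - G * a = of_int z" "of_int z > (0::real)"
      by (metis Ints_cases)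
    then show ?thesis by simp
  qed
  then have ab: "b - a \<ge> 1 / G" using G by (simp add: field_simps)
  define l where "l = length w"
  have v: "\<bar>horner M v\<bar> * (M - 1) \<le> A * (M ^ l - 1)" "\<bar>horner M w\<bar> * (M - 1) \<le> A * (M ^ l - 1)"
    using abs_horner_le[of v A M] abs_horner_le[of w A M] A uv M len by (auto simp: l_def)
  have Ml: "M ^ l \<ge> 1" using M by simp
  have "(horner M v - horner M w) * (M - 1) \<le> (\<bar>horner M v\<bar> + \<bar>horner M w\<bar>) * (M - 1)"
    using M by (intro mult_right_mono) auto
  also have "\<dots> \<le> 2 * A * (M ^ l - 1)" using v by (simp add: algebra_simps)
  also have "\<dots> \<le> (M - 1) / G * (M ^ l - 1)"
    using M(1) G Ml by (intro mult_right_mono) (auto simp: field_simps)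
  also have "\<dots> = (M ^ l - 1) / G * (M - 1)" by simp
  finally have "horner M v - horner M w \<le> (M ^ l - 1) / G"
    by (rule mult_right_le_imp_le) (use M(2) in simp)
  moreover have "(b - a) * M ^ l \<ge> 1 / G * M ^ l" using ab Ml by (intro mult_right_mono) auto
  ultimately have "horner M ys - horner M xs \<ge> 1 / G"
    unfolding uv horner_diff_append[OF len] l_def[symmetric] by (simp add: diff_divide_distrib)
  then show ?thesis by simp
qed

text \<open>The first nonzero value of \<open>g\<close>, if there is one, makes one of the two
  perturbed lists larger than the unperturbed one.\<close>

lemma no_two_sided_descent:
  fixes f g :: "'b \<Rightarrow> real"
  shows "\<not> (map (\<lambda>i. f i + g i) xs \<lless> map f xs \<and> map (\<lambda>i. f i - g i) xs \<lless> map f xs)"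
  by (induction xs) auto

context block_game
begin

section \<open>The function \<open>F\<close>: concavity, continuity and affine majorants\<close>

definition F :: "real \<Rightarrow> (nat \<Rightarrow> real) \<Rightarrow> real" where
  "F M x = horner M (sort (map (H x) [0..<K]))"

definition shift :: "(nat \<Rightarrow> real) \<Rightarrow> real \<Rightarrow> (nat \<Rightarrow> real) \<Rightarrow> nat \<Rightarrow> real" where
  "shift x t u = (\<lambda>i\<in>N. x i + t * u i)"

lemma excess_shift: "S \<subseteq> N \<Longrightarrow> excess v (shift x t u) S = excess v x S + t * sum u S"
proof -
  assume S: "S \<subseteq> N"
  have "sum (shift x t u) S = (\<Sum>i\<in>S. x i + t * u i)"
    by (rule sum.cong) (use S in \<open>auto simp: shift_def\<close>)
  then show ?thesis by (simp add: excess_def sum.distrib sum_distrib_left)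
qed

lemma F_concave:
  assumes "M \<ge> 1" "0 \<le> t" "t \<le> 1"
  shows "(1 - t) * F M x + t * F M y \<le> F M (affine_comb N t x y)"
  unfolding F_def by (rule horner_sort_concave) (use assms H_concave in auto)

text \<open>\<open>F\<close> is a minimum of affine functions, one for every arrangement
  \<open>p\<close> of the blocks and every choice \<open>\<sigma>\<close> of a coalition per block;
  \<open>F_eq_selection\<close> names a choice that attains it. Supergradients are read off from
  this.\<close>

lemma F_le_selection:
  assumes "M \<ge> 1" "mset p = mset [0..<K]" "\<And>B. B < K \<Longrightarrow> \<sigma> B \<in> blk B"
  shows "F M y \<le> horner M (map (\<lambda>B. excess v y (\<sigma> B)) p)"
proof -
  have "F M y \<le> horner M (map (H y) p)"
    unfolding F_def by (rule horner_sort_le) (use assms in \<open>auto simp: mset_map\<close>)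
  also have "\<dots> \<le> horner M (map (\<lambda>B. excess v y (\<sigma> B)) p)"
  proof (rule horner_mono)
    fix B assume "B \<in> set p"
    then have "B < K" using assms(2) by (metis atLeastLessThan_iff set_mset_mset set_upt)
    then show "H y B \<le> excess v y (\<sigma> B)" using assms(3) H_le by blast
  qed (use assms(1) in simp)
  finally show ?thesis .
qed

lemma F_eq_selection:
  assumes "mset p = mset [0..<K]" "sorted (map (H x) p)" "\<And>B. B < K \<Longrightarrow> excess v x (\<sigma> B) = H x B"
  shows "F M x = horner M (map (\<lambda>B. excess v x (\<sigma> B)) p)"
proof -
  have "sort (map (H x) [0..<K]) = map (H x) p"
    by (rule properties_for_sort) (use assms in \<open>auto simp: mset_map\<close>)
  moreover have "map (H x) p = map (\<lambda>B. excess v x (\<sigma> B)) p"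
  proof (rule map_cong[OF refl])
    fix B assume "B \<in> set p"
    then have "B < K" using assms(1) by (metis atLeastLessThan_iff set_mset_mset set_upt)
    then show "H x B = excess v x (\<sigma> B)" using assms(3) by simp
  qed
  ultimately show ?thesis by (simp add: F_def)
qed

lemma abs_H_diff_le:
  assumes "B < K"
  shows "\<bar>H x B - H y B\<bar> \<le> (\<Sum>i\<in>N. \<bar>x i - y i\<bar>)"
proof -
  have *: "H x B - H y B \<le> (\<Sum>i\<in>N. \<bar>x i - y i\<bar>)" for x y
  proof -
    obtain S where S: "S \<in> blk B" "H y B = excess v y S" using H_attained[OF assms] by blast
    have SN: "S \<subseteq> N" using S(1) blk_sub[OF assms] by auto
    have "H x B - H y B \<le> excess v x S - excess v y S" using S H_le[OF assms S(1), of x] by simp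
    also have "\<dots> = (\<Sum>i\<in>S. x i - y i)" by (simp add: excess_def sum_subtractf)
    also have "\<dots> \<le> (\<Sum>i\<in>S. \<bar>x i - y i\<bar>)" by (intro sum_mono) auto
    also have "\<dots> \<le> (\<Sum>i\<in>N. \<bar>x i - y i\<bar>)" using SN fin by (intro sum_mono2) auto
    finally show ?thesis .
  qed
  have "(\<Sum>i\<in>N. \<bar>y i - x i\<bar>) = (\<Sum>i\<in>N. \<bar>x i - y i\<bar>)" by (simp add: abs_minus_commute)
  with *[of x y] *[of y x] show ?thesis by linarith
qed

lemma continuous_on_H: "B < K \<Longrightarrow> continuous_on C (\<lambda>x. H x B)"
proof -
  assume B: "B < K"
  obtain ns where ns: "set ns = N" "distinct ns" using finite_distinct_list[OF fin] by blast
  show ?thesis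
  proof (rule continuous_on_dominated_diff[of ns C "\<lambda>i x. x i" _ 1])
    show "continuous_on C (\<lambda>x. x i)" for i :: nat by (rule continuous_on_coord)
    show "\<bar>H x B - H y B\<bar> \<le> 1 * (\<Sum>i\<leftarrow>ns. \<bar>x i - y i\<bar>)" for x y
      using abs_H_diff_le[OF B, of x y] ns by (simp add: sum_list_distinct_conv_sum_set)
  qed
qed

lemma horner_diff_le:
  fixes f g :: "'b \<Rightarrow> real"
  assumes "M \<ge> 1"
  shows "horner M (map f xs) - horner M (map g xs) \<le> M ^ length xs * (\<Sum>i\<leftarrow>xs. \<bar>f i - g i\<bar>)"
proof (induction xs)
  case (Cons x xs)
  have s: "0 \<le> (\<Sum>i\<leftarrow>xs. \<bar>f i - g i\<bar>)" by (rule sum_list_nonneg) auto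
  have "(f x - g x) * M ^ length xs \<le> \<bar>f x - g x\<bar> * M ^ Suc (length xs)"
    using assms by (intro mult_mono power_increasing) auto
  moreover have "M ^ length xs * (\<Sum>i\<leftarrow>xs. \<bar>f i - g i\<bar>) \<le> M ^ Suc (length xs) * (\<Sum>i\<leftarrow>xs. \<bar>f i - g i\<bar>)"
    using assms s by (intro mult_right_mono power_increasing) auto
  ultimately show ?case using Cons.IH by (simp add: algebra_simps)
qed simp

lemma abs_F_diff_le:
  assumes "M \<ge> 1"
  shows "\<bar>F M x - F M y\<bar> \<le> M ^ K * (\<Sum>B\<leftarrow>[0..<K]. \<bar>H x B - H y B\<bar>)"
proof -
  have *: "F M x - F M y \<le> M ^ K * (\<Sum>B\<leftarrow>[0..<K]. \<bar>H x B - H y B\<bar>)" for x y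
  proof -
    define js where "js = sort_key (H y) [0..<K]"
    have "F M x \<le> horner M (map (H x) js)"
      unfolding F_def by (rule horner_sort_le) (use assms in \<open>auto simp: js_def\<close>)
    moreover have "F M y = horner M (map (H y) js)" by (simp add: F_def sort_map_eq js_def)
    ultimately have "F M x - F M y \<le> M ^ length js * (\<Sum>B\<leftarrow>js. \<bar>H x B - H y B\<bar>)"
      using horner_diff_le[OF assms, of "H x" js "H y"] by simp
    then show ?thesis by (simp add: js_def sum_list_sort_key)
  qed
  have "(\<Sum>B\<leftarrow>[0..<K]. \<bar>H y B - H x B\<bar>) = (\<Sum>B\<leftarrow>[0..<K]. \<bar>H x B - H y B\<bar>)"
    by (simp add: abs_minus_commute)
  with *[of x y] *[of y x] show ?thesis by simp
qed

lemma continuous_on_F: "M \<ge> 1 \<Longrightarrow> continuous_on C (F M)"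
  by (rule continuous_on_dominated_diff[of "[0..<K]" C "\<lambda>B x. H x B" _ "M ^ K"])
    (use continuous_on_H abs_F_diff_le in auto)

text \<open>Along a direction that respects all ties of excesses at \<open>x\<close>, the order of the excesses does
  not change near \<open>x\<close>, so that everything is locally affine.\<close>

lemma small_step:
  assumes "finite I" "\<And>i. i \<in> I \<Longrightarrow> p i < (q i :: real)"
  shows "\<exists>t0>0. \<forall>t. \<bar>t\<bar> \<le> t0 \<longrightarrow> (\<forall>i\<in>I. p i + t * c i < q i + t * d i)"
  using assms
proof (induction I rule: finite_induct)
  case empty
  show ?case by (intro exI[of _ 1]) simp
next
  case (insert i I)
  then obtain t0 where t0: "t0 > 0" "\<And>t j. \<bar>t\<bar> \<le> t0 \<Longrightarrow> j \<in> I \<Longrightarrow> p j + t * c j < q j + t * d j"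
    by (metis insertCI)
  define t1 where "t1 = (q i - p i) / (\<bar>c i - d i\<bar> + 1)"
  have gap: "q i - p i > 0" using insert.prems by simp
  have t1: "t1 > 0" using gap by (simp add: t1_def)
  have "p i + t * c i < q i + t * d i" if "\<bar>t\<bar> \<le> t1" for t
  proof -
    have "t * (c i - d i) \<le> \<bar>t\<bar> * \<bar>c i - d i\<bar>" by (metis abs_ge_self abs_mult)
    also have "\<dots> \<le> t1 * \<bar>c i - d i\<bar>" using that by (intro mult_right_mono) auto
    also have "\<dots> < t1 * (\<bar>c i - d i\<bar> + 1)" using t1 by simp
    also have "\<dots> = q i - p i" using abs_ge_zero[of "c i - d i"] by (simp add: t1_def)
    finally show ?thesis by (simp add: algebra_simps)
  qed
  then show ?case
    by (intro exI[of _ "min t0 t1"]) (use t0 t1 in auto)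
qed

lemma order_stable:
  assumes ties: "\<And>S S'. S \<subseteq> N \<Longrightarrow> S' \<subseteq> N \<Longrightarrow> excess v x S = excess v x S' \<Longrightarrow> sum u S = sum u S'"
  shows "\<exists>t0>0. \<forall>t S S'. \<bar>t\<bar> \<le> t0 \<longrightarrow> S \<subseteq> N \<longrightarrow> S' \<subseteq> N \<longrightarrow> excess v x S \<le> excess v x S' \<longrightarrow>
    excess v x S + t * sum u S \<le> excess v x S' + t * sum u S'"
proof -
  define I where "I = {(S, S'). S \<subseteq> N \<and> S' \<subseteq> N \<and> excess v x S < excess v x S'}"
  have "finite I" using fin by (rule_tac finite_subset[of _ "Pow N \<times> Pow N"]) (auto simp: I_def)
  then have "\<exists>t0>0. \<forall>t. \<bar>t\<bar> \<le> t0 \<longrightarrow> (\<forall>z\<in>I. excess v x (fst z) + t * sum u (fst z) < excess v x (snd z) + t * sum u (snd z))"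
    by (rule small_step) (auto simp: I_def)
  then obtain t0 where t0: "t0 > 0"
    "\<And>t z. \<bar>t\<bar> \<le> t0 \<Longrightarrow> z \<in> I \<Longrightarrow> excess v x (fst z) + t * sum u (fst z) < excess v x (snd z) + t * sum u (snd z)"
    by blast
  show ?thesis
  proof (intro exI[of _ t0] conjI allI impI)
    fix t S S' assume h: "\<bar>t\<bar> \<le> t0" "S \<subseteq> N" "S' \<subseteq> N" "excess v x S \<le> excess v x S'"
    show "excess v x S + t * sum u S \<le> excess v x S' + t * sum u S'"
    proof (cases "excess v x S = excess v x S'")
      case True
      then show ?thesis using ties[OF h(2,3)] by simp
    next
      case False
      then have "(S, S') \<in> I" using h by (simp add: I_def)
      then show ?thesis using t0(2)[OF h(1)] by fastforce
    qed
  qed (fact t0)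
qed

section \<open>Denominators of points that are determined by ties\<close>

definition tie_row :: "nat set \<Rightarrow> nat set \<Rightarrow> nat \<Rightarrow> int" where
  "tie_row S S' i = of_bool (i \<in> S) - of_bool (i \<in> S')"

lemma sum_tie_row:
  assumes "S \<subseteq> N" "S' \<subseteq> N"
  shows "(\<Sum>i\<in>N. real_of_int (tie_row S S' i) * u i) = sum u S - sum u S'"
proof -
  have "(\<Sum>i\<in>N. real_of_int (tie_row S S' i) * u i) =
    (\<Sum>i\<in>N. (if i \<in> S then u i else 0) - (if i \<in> S' then u i else 0))"
    by (rule sum.cong) (auto simp: tie_row_def)
  also have "\<dots> = sum u (N \<inter> S) - sum u (N \<inter> S')"
    by (simp add: sum_subtractf sum.inter_restrict[OF fin])
  finally show ?thesis using assms by (simp add: Int_absorb1)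
qed

lemma Ints_excess_diff:
  assumes "\<And>S. S \<subseteq> N \<Longrightarrow> v S \<in> \<int>" "S \<subseteq> N" "S' \<subseteq> N" "excess v x S = excess v x S'"
  shows "sum x S - sum x S' \<in> \<int>"
proof -
  have "sum x S - sum x S' = v S - v S'" using assms(4) by (simp add: excess_def)
  then show ?thesis using assms by simp
qed

end

locale int_block_game = block_game +
  fixes n :: nat
  assumes N_eq: "N = {1..n}" and v_Ints: "\<And>S. S \<subseteq> N \<Longrightarrow> v S \<in> \<int>"
    and v_nonneg: "\<And>S. S \<subseteq> N \<Longrightarrow> 0 \<le> v S" and v_le: "\<And>S. S \<subseteq> N \<Longrightarrow> v S \<le> v N"
begin

lemma n_pos: "n \<ge> 1"
  using ne N_eq by (cases n) auto

lemma sum_N: "sum f N = (\<Sum>i<n. f (Suc i))"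
  by (simp add: N_eq sum.atLeast1_atMost_eq)

text \<open>Ties and the coordinates in \<open>I\<close> form a linear system with coefficients 0, 1
  and -1. A tie has an integral right-hand side because \<open>v\<close> is integral, a fixed
  coordinate has one after multiplication by \<open>G\<close>.\<close>

lemma tie_solution_denominator:
  assumes G: "G \<in> \<int>" and I: "\<And>i. i \<in> I \<Longrightarrow> x i * G \<in> \<int>" "I \<subseteq> N"
    and ker: "\<And>u :: nat \<Rightarrow> real. (\<And>S S'. S \<subseteq> N \<Longrightarrow> S' \<subseteq> N \<Longrightarrow> excess v x S = excess v x S' \<Longrightarrow> sum u S = sum u S') \<Longrightarrow>
      (\<And>i. i \<in> I \<Longrightarrow> u i = 0) \<Longrightarrow> \<forall>i\<in>N. u i = 0"
  shows "\<exists>D::int. 1 \<le> D \<and> D \<le> int n ^ n \<and> (\<forall>i\<in>N. real_of_int D * x i * G \<in> \<int>)"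
proof -
  define T where "T = {(S, S'). S \<subseteq> N \<and> S' \<subseteq> N \<and> excess v x S = excess v x S'}"
  define R where "R = (\<lambda>(S, S') i. tie_row S S' (Suc i)) ` T \<union> (\<lambda>j i. if Suc i = j then 1 else 0) ` I"
  have unit: "(\<Sum>i<n. real_of_int (if Suc i = j then 1 else 0) * u (Suc i)) = u j" if "j \<in> I" for u j
  proof -
    have "(\<Sum>i<n. real_of_int (if Suc i = j then 1 else 0) * u (Suc i)) = (\<Sum>i\<in>N. if i = j then u i else 0)"
      unfolding sum_N by (rule sum.cong) auto
    also have "\<dots> = u j" using that I(2) fin by auto
    finally show ?thesis .
  qed
  have tie: "(\<Sum>i<n. real_of_int (tie_row S S' (Suc i)) * u (Suc i)) = sum u S - sum u S'"
    if "(S, S') \<in> T" for u S S'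
    using sum_tie_row[of S S' u] that by (simp add: T_def sum_N)
  have "\<exists>D::int. 1 \<le> D \<and> D \<le> int n ^ n \<and> (\<forall>i<n. real_of_int D * x (Suc i) * G \<in> \<int>)"
  proof (rule unique_solution_denominator)
    fix a i assume "a \<in> R"
    then show "\<bar>a i\<bar> \<le> 1" by (auto simp: R_def tie_row_def)
  next
    fix a assume "a \<in> R"
    then consider S S' where "(S, S') \<in> T" "a = (\<lambda>i. tie_row S S' (Suc i))"
      | j where "j \<in> I" "a = (\<lambda>i. if Suc i = j then 1 else 0)" by (auto simp: R_def)
    then show "(\<Sum>i<n. real_of_int (a i) * x (Suc i)) * G \<in> \<int>"
    proof cases
      case 1
      then have "sum x S - sum x S' \<in> \<int>"
        by (intro Ints_excess_diff[OF v_Ints]) (auto simp: T_def)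
      then show ?thesis using tie[OF 1(1), of x] G 1(2) by (auto intro: Ints_mult)
    next
      case 2
      show ?thesis unfolding 2(2) unit[OF 2(1)] by (rule I(1)[OF 2(1)])
    qed
  next
    fix u :: "nat \<Rightarrow> real"
    assume u: "\<And>a. a \<in> R \<Longrightarrow> (\<Sum>i<n. real_of_int (a i) * u i) = 0"
    define w where "w j = u (j - 1)" for j
    have "\<forall>i\<in>N. w i = 0"
    proof (rule ker)
      fix S S' assume "S \<subseteq> N" "S' \<subseteq> N" "excess v x S = excess v x S'"
      then have T: "(S, S') \<in> T" by (simp add: T_def)
      then have "(\<lambda>i. tie_row S S' (Suc i)) \<in> R" by (force simp: R_def)
      from u[OF this] tie[OF T, of w] show "sum w S = sum w S'" by (simp add: w_def)
    next
      fix j assume "j \<in> I"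
      then have "(\<lambda>i. if Suc i = j then 1 else 0) \<in> R" by (simp add: R_def)
      from u[OF this] unit[OF \<open>j \<in> I\<close>, of w] show "w j = 0" by (simp add: w_def)
    qed
    then have "w (Suc i) = 0" if "i < n" for i using that by (simp add: N_eq)
    then show "\<forall>i<n. u i = 0" by (simp add: w_def)
  qed
  then obtain D :: int where D: "1 \<le> D" "D \<le> int n ^ n" "\<And>i. i < n \<Longrightarrow> real_of_int D * x (Suc i) * G \<in> \<int>" by blast
  have "real_of_int D * x i * G \<in> \<int>" if "i \<in> N" for i
  proof -
    have "1 \<le> i" "i \<le> n" using that by (simp_all add: N_eq)
    then show ?thesis using D(3)[of "i - 1"] by simp
  qed
  then show ?thesis using D by blast
qed

text \<open>Along a nonzero direction respecting all ties, the sorted excess vector would move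
  linearly both forwards and backwards, and the nucleolus would have to beat both sides. So the ties
  determine it. Efficiency is among them: the grand and the empty coalition both have excess
  0.\<close>

lemma nuc_denominator:
  "\<exists>D::int. 1 \<le> D \<and> D \<le> int n ^ n \<and> (\<forall>i\<in>N. real_of_int D * nuc i \<in> \<int>)"
proof -
  have "\<exists>D::int. 1 \<le> D \<and> D \<le> int n ^ n \<and> (\<forall>i\<in>N. real_of_int D * nuc i * 1 \<in> \<int>)"
  proof (rule tie_solution_denominator[where I = "{}"])
    fix u :: "nat \<Rightarrow> real"
    assume ties: "\<And>S S'. S \<subseteq> N \<Longrightarrow> S' \<subseteq> N \<Longrightarrow> excess v nuc S = excess v nuc S' \<Longrightarrow> sum u S = sum u S'"
    obtain t0 where t0: "t0 > 0" "\<And>t S S'. \<bar>t\<bar> \<le> t0 \<Longrightarrow> S \<subseteq> N \<Longrightarrow> S' \<subseteq> N \<Longrightarrow> excess v nuc S \<le> excess v nuc S' \<Longrightarrow>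
      excess v nuc S + t * sum u S \<le> excess v nuc S' + t * sum u S'"
      using order_stable[OF ties] by blast
    define js where "js = sort_key (excess v nuc) coalitions"
    have js: "set js = Pow N" by (simp add: js_def coalitions)
    have \<theta>n: "\<theta> nuc = map (excess v nuc) js" by (simp add: \<theta>_def sort_map_eq js_def)
    have srt: "sorted (map (excess v nuc) js)" by (simp add: js_def)
    have \<theta>s: "\<theta> (shift nuc t u) = map (\<lambda>S. excess v nuc S + t * sum u S) js" if "\<bar>t\<bar> \<le> t0" for t
    proof -
      have eq: "map (\<lambda>S. excess v nuc S + t * sum u S) js = map (excess v (shift nuc t u)) js"
        using js by (intro map_cong refl) (auto simp: excess_shift)
      have "sorted (map (\<lambda>S. excess v nuc S + t * sum u S) js)"
        unfolding sorted_map
        by (rule sorted_wrt_mono_rel[OF _ srt[unfolded sorted_map]]) (use t0(2)[OF that] js in auto)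
      then have "sorted (map (excess v (shift nuc t u)) js)" by (simp only: eq)
      then have "sort (map (excess v (shift nuc t u)) coalitions) = map (excess v (shift nuc t u)) js"
        by (rule properties_for_sort[rotated]) (simp add: js_def)
      then show ?thesis by (simp only: \<theta>_def eq)
    qed
    have pre: "shift nuc t u \<in> pre" for t
    proof -
      have "sum u N = 0" using ties[of N "{}"] nuc_pre v_empty by (simp add: excess_def pre_def)
      then show ?thesis using nuc_pre excess_shift[of N nuc t u]
        by (simp add: pre_def shift_def excess_def)
    qed
    show "\<forall>i\<in>N. u i = 0"
    proof (rule ccontr)
      assume "\<not> ?thesis"
      then obtain i where i: "i \<in> N" "u i \<noteq> 0" by blast
      have ne: "shift nuc t u \<noteq> nuc" if "t \<noteq> 0" for t
      proof
        assume "shift nuc t u = nuc"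
        then have "shift nuc t u i = nuc i" by simp
        then show False using i that by (simp add: shift_def)
      qed
      have "map (\<lambda>S. excess v nuc S + t0 * sum u S) js \<lless> map (excess v nuc) js"
        using less_nuc[OF pre ne, of t0] \<theta>s[of t0] t0(1) \<theta>n by simp
      moreover have "map (\<lambda>S. excess v nuc S - t0 * sum u S) js \<lless> map (excess v nuc) js"
        using less_nuc[OF pre ne, of "- t0"] \<theta>s[of "- t0"] t0(1) \<theta>n by simp
      ultimately show False
        using no_two_sided_descent[of "excess v nuc" "\<lambda>S. t0 * sum u S" js] by simp
    qed
  qed auto
  then show ?thesis by simp
qed

text \<open>Bounds the excesses of vectors whose coordinates are at most \<open>v N + 1\<close> in
  absolute value, which covers all vectors within distance 1 of the nucleolus in every
  coordinate.\<close>

definition HB :: real where "HB = real n * (v N + 1) + v N"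

lemma abs_excess_le:
  assumes "\<And>i. i \<in> N \<Longrightarrow> \<bar>x i\<bar> \<le> v N + 1" "S \<subseteq> N"
  shows "\<bar>excess v x S\<bar> \<le> HB"
proof -
  have "\<bar>sum x S\<bar> \<le> (\<Sum>i\<in>S. \<bar>x i\<bar>)" by (rule sum_abs)
  also have "\<dots> \<le> (\<Sum>i\<in>N. \<bar>x i\<bar>)" using assms fin by (intro sum_mono2) auto
  also have "\<dots> \<le> (\<Sum>i\<in>N. v N + 1)" by (intro sum_mono assms)
  also have "\<dots> = real n * (v N + 1)" by (simp add: N_eq)
  finally show ?thesis using v_nonneg[OF assms(2)] v_le[OF assms(2)] by (simp add: excess_def HB_def)
qed

lemma abs_H_le:
  assumes "\<And>i. i \<in> N \<Longrightarrow> \<bar>x i\<bar> \<le> v N + 1" "B < K"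
  shows "\<bar>H x B\<bar> \<le> HB"
proof -
  obtain S where "S \<in> blk B" "H x B = excess v x S" using H_attained[OF assms(2)] by blast
  then show ?thesis using abs_excess_le[of x S] assms blk_sub by auto
qed

lemma HB_nonneg: "HB \<ge> 0"
  using v_nonneg[of N] by (simp add: HB_def)

lemma nuc_bounds: "i \<in> N \<Longrightarrow> 0 \<le> nuc i" "i \<in> N \<Longrightarrow> nuc i \<le> v N"
  using nuc(1) by (auto simp: box_def PiE_def)

lemma H_scaled_Ints:
  assumes "G \<in> \<int>" "\<And>i. i \<in> N \<Longrightarrow> G * x i \<in> \<int>" "B < K"
  shows "G * H x B \<in> \<int>"
proof -
  obtain S where S: "S \<in> blk B" "H x B = excess v x S" using H_attained[OF assms(3)] by blast
  then have "S \<subseteq> N" using blk_sub[OF assms(3)] by auto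
  then have "(\<Sum>i\<in>S. G * x i) - G * v S \<in> \<int>"
    using assms(2) by (intro Ints_diff Ints_sum Ints_mult[OF assms(1) v_Ints]) auto
  moreover have "G * H x B = (\<Sum>i\<in>S. G * x i) - G * v S"
    unfolding S(2) by (simp add: excess_def sum_distrib_left right_diff_distrib)
  ultimately show ?thesis by simp
qed

lemma F_affine_along_ties:
  assumes ties: "\<And>S S'. S \<subseteq> N \<Longrightarrow> S' \<subseteq> N \<Longrightarrow> excess v x S = excess v x S' \<Longrightarrow> sum u S = sum u S'"
  shows "\<exists>t0>0. \<exists>c. \<forall>t. \<bar>t\<bar> \<le> t0 \<longrightarrow> F M (shift x t u) = F M x + t * c"
proof -
  obtain t0 where t0: "t0 > 0" "\<And>t S S'. \<bar>t\<bar> \<le> t0 \<Longrightarrow> S \<subseteq> N \<Longrightarrow> S' \<subseteq> N \<Longrightarrow> excess v x S \<le> excess v x S' \<Longrightarrow>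
      excess v x S + t * sum u S \<le> excess v x S' + t * sum u S'"
    using order_stable[OF ties] by blast
  have "\<forall>B. \<exists>S. B < K \<longrightarrow> S \<in> blk B \<and> H x B = excess v x S"
    using H_attained by blast
  then obtain \<sigma> where \<sigma>: "\<And>B. B < K \<Longrightarrow> \<sigma> B \<in> blk B" "\<And>B. B < K \<Longrightarrow> H x B = excess v x (\<sigma> B)"
    by metis
  have \<sigma>N: "\<sigma> B \<subseteq> N" if "B < K" for B using \<sigma>(1)[OF that] blk_sub[OF that] by auto
  define js where "js = sort_key (H x) [0..<K]"
  have js: "set js = {0..<K}" by (simp add: js_def)
  have Hs: "H (shift x t u) B = H x B + t * sum u (\<sigma> B)" if tB: "\<bar>t\<bar> \<le> t0" "B < K" for t B
  proof (rule antisym)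
    show "H (shift x t u) B \<le> H x B + t * sum u (\<sigma> B)"
      using H_le[OF tB(2) \<sigma>(1)[OF tB(2)], of "shift x t u"] \<sigma>(2)[OF tB(2)] excess_shift[OF \<sigma>N[OF tB(2)]]
      by simp
    obtain S where S: "S \<in> blk B" "H (shift x t u) B = excess v (shift x t u) S"
      using H_attained[OF tB(2)] by blast
    have SN: "S \<subseteq> N" using S(1) blk_sub[OF tB(2)] by auto
    have "excess v x (\<sigma> B) \<le> excess v x S" using H_le[OF tB(2) S(1), of x] \<sigma>(2)[OF tB(2)] by simp
    from t0(2)[OF tB(1) \<sigma>N[OF tB(2)] SN this]
    show "H x B + t * sum u (\<sigma> B) \<le> H (shift x t u) B"
      using S(2) \<sigma>(2)[OF tB(2)] excess_shift[OF SN] by simp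
  qed
  have "F M (shift x t u) = F M x + t * horner M (map (\<lambda>B. sum u (\<sigma> B)) js)" if t: "\<bar>t\<bar> \<le> t0" for t
  proof -
    have eq: "map (H (shift x t u)) js = map (\<lambda>B. 1 * H x B + t * sum u (\<sigma> B)) js"
      using Hs[OF t] js by (intro map_cong refl) auto
    have "sorted_wrt (\<lambda>B B'. H x B \<le> H x B') js" using sorted_sort_key[of "H x" "[0..<K]"] by (simp add: js_def sorted_map)
    then have "sorted_wrt (\<lambda>B B'. H (shift x t u) B \<le> H (shift x t u) B') js"
    proof (rule sorted_wrt_mono_rel[rotated])
      fix B B' assume "B \<in> set js" "B' \<in> set js" "H x B \<le> H x B'"
      then show "H (shift x t u) B \<le> H (shift x t u) B'"
        using t0(2)[OF t \<sigma>N \<sigma>N, of B B'] js Hs[OF t] \<sigma>(2) by simp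
    qed
    then have "sort (map (H (shift x t u)) [0..<K]) = map (H (shift x t u)) js"
      by (intro properties_for_sort) (simp_all add: js_def sorted_map)
    then have "F M (shift x t u) = horner M (map (\<lambda>B. 1 * H x B + t * sum u (\<sigma> B)) js)"
      by (simp only: F_def eq)
    also have "\<dots> = horner M (map (H x) js) + t * horner M (map (\<lambda>B. sum u (\<sigma> B)) js)"
      by (subst horner_lincomb) simp
    also have "horner M (map (H x) js) = F M x" by (simp add: F_def sort_map_eq js_def)
    finally show ?thesis .
  qed
  then show ?thesis using t0(1) by blast
qed

text \<open>
  On the sphere of radius \<open>1/R\<close> around the nucleolus the maximum of \<open>F\<close> is attained at a rational
  point with small denominators (a maximizer of largest Euclidean norm), and there two different
  sorted vectors of rationals are compared.
\<close>

lemma F_gap_on_face: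
  assumes M: "M \<ge> 1 + 2 * HB * (real n ^ n * real n ^ n * real R)" "M > 1" and R: "R \<ge> 1"
    and y: "y \<in> pre" "\<And>i. i \<in> N \<Longrightarrow> \<bar>y i - nuc i\<bar> \<le> 1 / real R"
    and i0: "i0 \<in> N" "\<bar>y i0 - nuc i0\<bar> = 1 / real R"
  shows "F M y + 1 / (real n ^ n * real n ^ n * real R) \<le> F M nuc"
proof -
  define \<rho> where "\<rho> = 1 / real R"
  have \<rho>: "0 < \<rho>" "\<rho> \<le> 1" using R by (auto simp: \<rho>_def)
  \<comment> \<open>Fixing coordinate \<open>i0\<close> at distance \<open>\<rho>\<close> keeps the
    nucleolus out. The outer box contains all points this close to the nucleolus and makes the
    compactness lemma applicable.\<close>
  define face where "face = {x \<in> N \<rightarrow>\<^sub>E {-1..v N + 1}. sum x N = v N} \<inter>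
    ((\<Inter>i\<in>N. {x. \<bar>x i - nuc i\<bar> \<le> \<rho>}) \<inter> {x. x i0 = y i0})"
  have face_iff: "x \<in> face \<longleftrightarrow> x \<in> pre \<and> (\<forall>i\<in>N. \<bar>x i - nuc i\<bar> \<le> \<rho>) \<and> x i0 = y i0" for x
  proof -
    have "x i \<in> {-1..v N + 1}" if "\<bar>x i - nuc i\<bar> \<le> \<rho>" "i \<in> N" for i
      using that nuc_bounds[of i] \<rho> by auto
    then show ?thesis by (auto simp: face_def pre_def PiE_def Pi_def)
  qed
  have cl: "closed ((\<Inter>i\<in>N. {x. \<bar>x i - nuc i\<bar> \<le> \<rho>}) \<inter> {x. x i0 = y i0})"
    by (intro closed_Int closed_INT ballI closed_Collect_le closed_Collect_eq continuous_intros continuous_on_coord)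
  have "compact face" unfolding face_def
    by (intro compact_Int_closed compact_box_hyperplane fin cl)
  moreover have yf: "y \<in> face" using y by (simp add: face_iff \<rho>_def)
  then have "face \<noteq> {}" by blast
  \<comment> \<open>The second criterion picks a maximizer of \<open>F\<close> of largest norm; no
    segment of maximizers can have it in its interior, as the square of the norm is strictly
    convex.\<close>
  moreover define f where "f k x = (if k = 0 then F M x else (\<Sum>i\<in>N. (x i)\<^sup>2))" for k :: nat and x
  have "continuous_on face (f k)" for k
  proof (cases "k = 0")
    case True
    then show ?thesis using continuous_on_F[of M face] M(2) by (simp add: f_def[abs_def])
  next
    case False
    then show ?thesis by (auto simp: f_def[abs_def] intro!: continuous_intros continuous_on_coord)
  qed
  ultimately obtain x where x: "x \<in> face"
    "\<And>z k. z \<in> face \<Longrightarrow> k < 2 \<Longrightarrow> (\<forall>j<k. f j z = f j x) \<Longrightarrow> f k z \<le> f k x"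
    using lexicographic_maximum[of face 2 f] by blast
  have max: "F M z \<le> F M x" if "z \<in> face" for z using x(2)[OF that, of 0] by (simp add: f_def)
  have max2: "(\<Sum>i\<in>N. (z i)\<^sup>2) \<le> (\<Sum>i\<in>N. (x i)\<^sup>2)" if "z \<in> face" "F M z = F M x" for z
    using x(2)[OF that(1), of 1] that(2) by (simp add: f_def)
  have xp: "x \<in> pre" and xn: "\<And>i. i \<in> N \<Longrightarrow> \<bar>x i - nuc i\<bar> \<le> \<rho>" and xi0: "x i0 = y i0"
    using x(1) by (auto simp: face_iff)
  obtain D :: int where D: "1 \<le> D" "D \<le> int n ^ n" "\<And>i. i \<in> N \<Longrightarrow> real_of_int D * nuc i \<in> \<int>"
    using nuc_denominator by blast
  define I where "I = {i \<in> N. \<bar>x i - nuc i\<bar> = \<rho>}"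
  have "\<exists>D'::int. 1 \<le> D' \<and> D' \<le> int n ^ n \<and> (\<forall>i\<in>N. real_of_int D' * x i * (real_of_int D * real R) \<in> \<int>)"
  proof (rule tie_solution_denominator[where I = I])
    show "x i * (real_of_int D * real R) \<in> \<int>" if "i \<in> I" for i
    proof -
      have \<rho>R: "\<rho> * real R = 1" using R by (simp add: \<rho>_def)
      have "real_of_int D * nuc i * real R \<in> \<int>"
        by (rule Ints_mult[OF D(3)]) (use that in \<open>simp_all add: I_def\<close>)
      moreover have "\<bar>x i - nuc i\<bar> = \<rho>" using that by (simp add: I_def)
      then consider (1) "x i = nuc i + \<rho>" | (2) "x i = nuc i - \<rho>" by linarith
      then have "x i * (real_of_int D * real R) = real_of_int D * nuc i * real R + real_of_int D * (\<rho> * real R) \<or>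
          x i * (real_of_int D * real R) = real_of_int D * nuc i * real R - real_of_int D * (\<rho> * real R)"
      proof cases
        case 1
        show ?thesis unfolding 1 by (simp add: algebra_simps)
      next
        case 2
        show ?thesis unfolding 2 by (simp add: algebra_simps)
      qed
      ultimately show ?thesis unfolding \<rho>R by (elim disjE) simp_all
    qed
  next
    fix u :: "nat \<Rightarrow> real"
    assume ties: "\<And>S S'. S \<subseteq> N \<Longrightarrow> S' \<subseteq> N \<Longrightarrow> excess v x S = excess v x S' \<Longrightarrow> sum u S = sum u S'"
      and uI: "\<And>i. i \<in> I \<Longrightarrow> u i = 0"
    obtain t0 c where t0: "t0 > 0" and c: "\<And>t. \<bar>t\<bar> \<le> t0 \<Longrightarrow> F M (shift x t u) = F M x + t * c"
      using F_affine_along_ties[OF ties] by blast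
    have "\<exists>t1>0. \<forall>t. \<bar>t\<bar> \<le> t1 \<longrightarrow> (\<forall>i\<in>N - I. \<bar>x i - nuc i\<bar> + t * 0 < \<rho> + t * u i)"
      by (rule small_step) (use fin xn in \<open>force simp: I_def\<close>)+
    then obtain t1 where t1: "t1 > 0" "\<And>t i. \<bar>t\<bar> \<le> t1 \<Longrightarrow> i \<in> N - I \<Longrightarrow> \<bar>x i - nuc i\<bar> < \<rho> + t * u i"
      by auto
    define t where "t = min t0 t1"
    have t: "t > 0" "\<bar>t\<bar> \<le> t0" "\<bar>- t\<bar> \<le> t0" "\<bar>t\<bar> \<le> t1" "\<bar>- t\<bar> \<le> t1" using t0 t1(1) by (auto simp: t_def)
    have sf: "shift x s u \<in> face" if s: "s = t \<or> s = - t" for s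
      unfolding face_iff
    proof (intro conjI ballI)
      have "sum u N = 0" using ties[of N "{}"] xp v_empty by (simp add: excess_def pre_def)
      then show "shift x s u \<in> pre" using xp excess_shift[of N x s u]
        by (simp add: pre_def shift_def excess_def)
      show "\<bar>shift x s u i - nuc i\<bar> \<le> \<rho>" if "i \<in> N" for i
      proof (cases "i \<in> I")
        case True
        then show ?thesis using uI xn that by (simp add: shift_def)
      next
        case False
        have "\<bar>x i - nuc i\<bar> < \<rho> + t * u i" "\<bar>x i - nuc i\<bar> < \<rho> - t * u i"
          using t1(2)[OF t(4), of i] t1(2)[OF t(5), of i] False that by auto
        then show ?thesis using s that by (auto simp: shift_def)
      qed
      have "i0 \<in> I" using i0 xi0 by (simp add: I_def \<rho>_def)
      then show "shift x s u i0 = y i0" using uI xi0 i0 by (simp add: shift_def)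
    qed
    \<comment> \<open>Both opposite points stay in the face, so the slope is 0 and both are again
      maximizers of \<open>F\<close>; comparing norms then forces \<open>u\<close> to
      vanish.\<close>
    have "t * c \<le> 0" "- t * c \<le> 0"
      using max[OF sf[of t]] max[OF sf[of "- t"]] c[OF t(2)] c[OF t(3)] by auto
    then have c0: "c = 0" using t(1) by (simp add: mult_le_0_iff zero_le_mult_iff)
    have sq: "(\<Sum>i\<in>N. (shift x s u i)\<^sup>2) = (\<Sum>i\<in>N. (x i)\<^sup>2) + 2 * s * (\<Sum>i\<in>N. x i * u i) + s\<^sup>2 * (\<Sum>i\<in>N. (u i)\<^sup>2)" for s
    proof -
      have "(\<Sum>i\<in>N. (shift x s u i)\<^sup>2) = (\<Sum>i\<in>N. (x i)\<^sup>2 + 2 * s * (x i * u i) + s\<^sup>2 * (u i)\<^sup>2)"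
        by (rule sum.cong) (auto simp: shift_def power2_eq_square algebra_simps)
      then show ?thesis by (simp add: sum.distrib sum_distrib_left)
    qed
    have "(\<Sum>i\<in>N. (shift x t u i)\<^sup>2) \<le> (\<Sum>i\<in>N. (x i)\<^sup>2)" "(\<Sum>i\<in>N. (shift x (- t) u i)\<^sup>2) \<le> (\<Sum>i\<in>N. (x i)\<^sup>2)"
      using max2[OF sf[of t]] max2[OF sf[of "- t"]] c[OF t(2)] c[OF t(3)] c0 by auto
    then have "t\<^sup>2 * (\<Sum>i\<in>N. (u i)\<^sup>2) \<le> 0" unfolding sq by simp
    then have "(\<Sum>i\<in>N. (u i)\<^sup>2) \<le> 0" using t(1) by (simp add: mult_le_0_iff)
    then have "(\<Sum>i\<in>N. (u i)\<^sup>2) = 0" by (intro antisym sum_nonneg) auto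
    then show "\<forall>i\<in>N. u i = 0" using fin by (subst (asm) sum_nonneg_eq_0_iff) auto
  qed (auto simp: I_def)
  then obtain D' :: int where D': "1 \<le> D'" "D' \<le> int n ^ n"
    "\<And>i. i \<in> N \<Longrightarrow> real_of_int D' * x i * (real_of_int D * real R) \<in> \<int>" by blast
  \<comment> \<open>A common denominator: \<open>D\<close> serves the nucleolus, and the active
    coordinates of \<open>x\<close> differ from it by \<open>1 / R\<close>, so the system for
    \<open>x\<close> has right-hand sides over \<open>D * R\<close> and determinant
    \<open>D'\<close> at most.\<close>
  define G where "G = real_of_int D' * real_of_int D * real R"
  have G: "G > 0" "G \<in> \<int>" using D(1) D'(1) R by (auto simp: G_def)
  have DD: "real_of_int D \<le> real n ^ n" "real_of_int D' \<le> real n ^ n"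
    using D(2) D'(2) by (metis of_int_le_iff of_int_of_nat_eq of_int_power)+
  have Gle: "G \<le> real n ^ n * real n ^ n * real R"
    unfolding G_def using DD D(1) D'(1) by (intro mult_right_mono mult_mono) auto
  have "F M x + 1 / G \<le> F M nuc"
    unfolding F_def
  proof (rule horner_lex_less_gap)
    have "x \<noteq> nuc" using xi0 i0 R by auto
    then show "sort (map (H x) [0..<K]) \<lless> sort (map (H nuc) [0..<K])" by (rule H_less_nuc[OF xp])
    have ints: "G * x i \<in> \<int>" "G * nuc i \<in> \<int>" if "i \<in> N" for i
    proof -
      show "G * x i \<in> \<int>" using D'(3)[OF that] by (simp add: G_def mult_ac)
      have "real_of_int D' * real R * (real_of_int D * nuc i) \<in> \<int>"
        by (rule Ints_mult[OF _ D(3)[OF that]]) simp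
      then show "G * nuc i \<in> \<int>" by (simp add: G_def mult_ac)
    qed
    show "G * e \<in> \<int>" if "e \<in> set (sort (map (H x) [0..<K])) \<union> set (sort (map (H nuc) [0..<K]))" for e
      using that H_scaled_Ints[OF G(2) ints(1)] H_scaled_Ints[OF G(2) ints(2)] by auto
    have "\<bar>x i\<bar> \<le> v N + 1" "\<bar>nuc i\<bar> \<le> v N + 1" if "i \<in> N" for i
      using xn[OF that] nuc_bounds[OF that] \<rho> by auto
    then show "\<bar>e\<bar> \<le> HB" if "e \<in> set (sort (map (H x) [0..<K])) \<union> set (sort (map (H nuc) [0..<K]))" for e
      using that abs_H_le[of x] abs_H_le[of nuc] by auto
    have "2 * HB * G \<le> 2 * HB * (real n ^ n * real n ^ n * real R)"
      using HB_nonneg Gle by (intro mult_left_mono) auto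
    then show "1 + 2 * HB * G \<le> M" using M(1) by linarith
  qed (use G M in simp_all)
  moreover have "1 / (real n ^ n * real n ^ n * real R) \<le> 1 / G" using G Gle by (intro divide_left_mono) auto
  ultimately show ?thesis using max[OF yf] by linarith
qed

text \<open>A far point is pulled towards the nucleolus until its largest deviation is exactly
  \<open>1 / R\<close>. There the gap is known, and concavity carries it outwards.\<close>

lemma F_sharp:
  assumes M: "M \<ge> 1 + 2 * HB * (real n ^ n * real n ^ n * real R)" "M > 1" and R: "R \<ge> 1"
    and y: "y \<in> pre" "F M nuc - 1 / (real n ^ n * real n ^ n * real R) < F M y" and i: "i \<in> N"
  shows "\<bar>y i - nuc i\<bar> < 1 / real R"
proof (rule ccontr)
  assume neg: "\<not> ?thesis"
  define \<delta> where "\<delta> = Max ((\<lambda>i. \<bar>y i - nuc i\<bar>) ` N)"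
  define \<eta> where "\<eta> = 1 / (real n ^ n * real n ^ n * real R)"
  have \<eta>: "\<eta> > 0" using R n_pos by (simp add: \<eta>_def)
  have \<delta>: "\<bar>y j - nuc j\<bar> \<le> \<delta>" if "j \<in> N" for j using fin that by (simp add: \<delta>_def)
  have "\<delta> \<in> (\<lambda>i. \<bar>y i - nuc i\<bar>) ` N" unfolding \<delta>_def using fin i by (intro Max_in) auto
  then obtain i0 where i0: "i0 \<in> N" "\<bar>y i0 - nuc i0\<bar> = \<delta>" by auto
  have \<delta>R: "\<delta> \<ge> 1 / real R" using neg \<delta>[OF i] by linarith
  have Rp: "1 / real R > 0" using R by simp
  define t where "t = 1 / real R / \<delta>"
  have t: "0 < t" "t \<le> 1" "t * \<delta> = 1 / real R" 
  proof -
    have dp: "\<delta> > 0" using \<delta>R Rp by linarith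
    show "0 < t" unfolding t_def by (rule divide_pos_pos[OF Rp dp])
    show "t \<le> 1" unfolding t_def using \<delta>R divide_le_eq_1_pos[OF dp] by blast
    show "t * \<delta> = 1 / real R" unfolding t_def using dp by simp
  qed
  define z where "z = affine_comb N t nuc y"
  have z: "z j - nuc j = t * (y j - nuc j)" if "j \<in> N" for j
    using that by (simp add: z_def affine_comb_def algebra_simps)
  have "F M z + \<eta> \<le> F M nuc"
    unfolding \<eta>_def
  proof (rule F_gap_on_face[OF M R])
    show "z \<in> pre" using affine_comb_pre nuc_pre y z_def by blast
    show "\<bar>z j - nuc j\<bar> \<le> 1 / real R" if "j \<in> N" for j
      using z[OF that] \<delta>[OF that] t by (simp add: abs_mult flip: t(3))
    show "\<bar>z i0 - nuc i0\<bar> = 1 / real R" using z[OF i0(1)] i0(2) t by (simp add: abs_mult)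
  qed (rule i0)
  moreover have "(1 - t) * F M nuc + t * F M y \<le> F M z"
    unfolding z_def by (rule F_concave) (use M t in auto)
  moreover have "t * (F M nuc - \<eta>) < t * F M y" using y(2) t by (simp add: \<eta>_def)
  moreover have "t * \<eta> \<le> \<eta>" using t \<eta> by simp
  ultimately show False by (simp add: algebra_simps)
qed

lemma abs_F_le:
  assumes "\<And>i. i \<in> N \<Longrightarrow> \<bar>x i\<bar> \<le> v N + 1" "M \<ge> 2"
  shows "\<bar>F M x\<bar> \<le> HB * M ^ K"
proof -
  have "\<bar>F M x\<bar> * (M - 1) \<le> HB * (M ^ length (sort (map (H x) [0..<K])) - 1)"
    unfolding F_def by (rule abs_horner_le) (use assms abs_H_le in auto)
  then have "\<bar>F M x\<bar> * (M - 1) \<le> HB * (M ^ K - 1)" by simp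
  moreover have "\<bar>F M x\<bar> * 1 \<le> \<bar>F M x\<bar> * (M - 1)" using assms(2) by (intro mult_left_mono) auto
  moreover have "HB * (M ^ K - 1) \<le> HB * M ^ K" using HB_nonneg by (intro mult_left_mono) auto
  ultimately show ?thesis by linarith
qed

end

section \<open>Cutting a simplex\<close>

text \<open>Column \<open>i\<close> holds the barycentric coordinates of the \<open>i\<close>-th
  point with respect to the vertices.\<close>

definition col_stochastic :: "nat \<Rightarrow> (nat \<Rightarrow> nat \<Rightarrow> real) \<Rightarrow> bool" where
  "col_stochastic n L \<longleftrightarrow> (\<forall>i<n. (\<forall>j<n. 0 \<le> L j i) \<and> (\<Sum>j<n. L j i) = 1)"

definition fdet :: "nat \<Rightarrow> (nat \<Rightarrow> nat \<Rightarrow> real) \<Rightarrow> real" where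
  "fdet n L = det (mat n n (\<lambda>(i, j). L i j))"

text \<open>Plays the part of the fact that a simplex contained in another one has no larger volume;
  here all column sums are 1.\<close>

lemma fdet_le_1: "col_stochastic n L \<Longrightarrow> \<bar>fdet n L\<bar> \<le> 1"
proof -
  assume L: "col_stochastic n L"
  have "\<bar>fdet n L\<bar> \<le> (\<Prod>j<n. \<Sum>i<n. \<bar>mat n n (\<lambda>(i, j). L i j) $$ (i, j)\<bar>)"
    unfolding fdet_def by (rule abs_det_le_prod_column_sums) simp
  also have "\<dots> = (\<Prod>j<n. 1)"
  proof (rule prod.cong[OF refl])
    fix j assume j: "j \<in> {..<n}"
    then have "(\<Sum>i<n. \<bar>mat n n (\<lambda>(i, j). L i j) $$ (i, j)\<bar>) = (\<Sum>i<n. L i j)"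
      using L by (intro sum.cong) (auto simp: col_stochastic_def)
    then show "(\<Sum>i<n. \<bar>mat n n (\<lambda>(i, j). L i j) $$ (i, j)\<bar>) = 1"
      using L j by (simp add: col_stochastic_def)
  qed
  finally show ?thesis by simp
qed

lemma fdet_mult:
  "fdet n (\<lambda>i j. \<Sum>l<n. A i l * B l j) = fdet n A * fdet n B"
proof -
  have "mat n n (\<lambda>(i, j). \<Sum>l<n. A i l * B l j) = mat n n (\<lambda>(i, j). A i j) * mat n n (\<lambda>(i, j). B i j)"
    by (rule eq_matI) (auto simp: scalar_prod_def atLeast0LessThan)
  then show ?thesis unfolding fdet_def by (simp add: det_mult[of _ n])
qed

text \<open>A permutation that fixes all indices but one is the identity, so only one term of
  Leibniz's sum can be nonzero.\<close>

lemma fdet_diag_except_row: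
  assumes "k < n" "\<And>i j. i < n \<Longrightarrow> j < n \<Longrightarrow> i \<noteq> k \<Longrightarrow> i \<noteq> j \<Longrightarrow> A i j = 0"
  shows "fdet n A = (\<Prod>i<n. A i i)"
proof -
  let ?M = "mat n n (\<lambda>(i, j). A i j)"
  let ?P = "{p. p permutes {0..<n}}"
  have "fdet n A = (\<Sum>p\<in>?P. signof p * (\<Prod>i = 0..<n. ?M $$ (i, p i)))"
    unfolding fdet_def by (rule det_def') simp
  also have "\<dots> = (\<Sum>p\<in>{id}. signof p * (\<Prod>i = 0..<n. ?M $$ (i, p i)))"
  proof (rule sum.mono_neutral_right)
    show "finite ?P" by (rule finite_permutations) simp
    show "{id} \<subseteq> ?P" by (simp add: permutes_id)
    show "\<forall>p\<in>?P - {id}. signof p * (\<Prod>i = 0..<n. ?M $$ (i, p i)) = 0"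
    proof
      fix p assume p: "p \<in> ?P - {id}"
      then have pp: "p permutes {0..<n}" by simp
      have "\<exists>i<n. i \<noteq> k \<and> p i \<noteq> i"
      proof (rule ccontr)
        assume "\<not> ?thesis"
        then have fixed: "p i = i" if "i \<noteq> k" for i
          using that pp by (cases "i < n") (auto simp: permutes_def)
        have "p k = k"
        proof (rule ccontr)
          assume "p k \<noteq> k"
          then have "p (p k) = p k" by (rule fixed)
          then show False using \<open>p k \<noteq> k\<close> permutes_inj[OF pp] by (metis injD)
        qed
        with fixed have "p = id" by (metis eq_id_iff)
        then show False using p by simp
      qed
      then obtain i where i: "i < n" "i \<noteq> k" "p i \<noteq> i" by blast
      have "p i < n" using permutes_in_image[OF pp, of i] i by simp
      then have "?M $$ (i, p i) = 0" using i assms(2)[of i "p i"] by simp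
      then have "(\<Prod>i = 0..<n. ?M $$ (i, p i)) = 0" using i by (intro prod_zero) auto
      then show "signof p * (\<Prod>i = 0..<n. ?M $$ (i, p i)) = 0" by simp
    qed
  qed
  also have "\<dots> = (\<Prod>i<n. A i i)" by (simp add: atLeast0LessThan)
  finally show ?thesis .
qed

text \<open>\<open>L\<close> is \<open>s\<close> times the identity plus a matrix of rank one, so
  its inverse \<open>B\<close> is explicit. The columns of \<open>B\<close> have absolute sums at
  most \<open>2 / s\<close>, which bounds its determinant by \<open>(2 / s) ^ n\<close>.\<close>

lemma fdet_start:
  assumes s: "0 < s" "s \<le> 1" and l: "\<And>j. j < n \<Longrightarrow> 0 \<le> l j" "(\<Sum>j<n. l j) = 1"
  defines "L \<equiv> \<lambda>j i. (1 - s) * l j + (if j = i then s else 0)"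
  shows "col_stochastic n L" "(s / 2) ^ n \<le> \<bar>fdet n L\<bar>"
proof -
  show "col_stochastic n L"
    using assms by (simp add: col_stochastic_def sum.distrib flip: sum_distrib_left)
  define B where "B = (\<lambda>j i. ((if j = i then 1 else 0) - (1 - s) * l j) / s)"
  have prod: "(\<Sum>h<n. L j h * B h i) = (if j = i then 1 else 0)" if "i < n" "j < n" for i j
  proof -
    have "(\<Sum>h<n. L j h * B h i) = (\<Sum>h<n. (1 - s) * l j * B h i) + (\<Sum>h<n. if j = h then s * B h i else 0)"
      unfolding sum.distrib[symmetric] by (rule sum.cong) (auto simp: L_def algebra_simps)
    also have "\<dots> = (1 - s) * l j * (\<Sum>h<n. B h i) + s * B j i"
      using that by (simp add: sum_distrib_left)
    also have "(\<Sum>h<n. B h i) = 1"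
    proof -
      have "(\<Sum>h<n. B h i) = ((\<Sum>h<n. if h = i then 1 else 0) - (1 - s) * (\<Sum>h<n. l h)) / s"
        by (simp add: B_def sum_subtractf sum_distrib_left flip: sum_divide_distrib)
      then show ?thesis using that l(2) s by simp
    qed
    finally show ?thesis using s by (simp add: B_def)
  qed
  have "fdet n L * fdet n B = fdet n (\<lambda>j i. \<Sum>h<n. L j h * B h i)" by (rule fdet_mult[symmetric])
  also have "\<dots> = det (1\<^sub>m n)"
    unfolding fdet_def by (rule arg_cong[of _ _ det], rule eq_matI) (auto simp: prod)
  finally have LB: "fdet n L * fdet n B = 1" by simp
  have "\<bar>fdet n B\<bar> \<le> (\<Prod>j<n. \<Sum>i<n. \<bar>mat n n (\<lambda>(i, j). B i j) $$ (i, j)\<bar>)"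
    unfolding fdet_def by (rule abs_det_le_prod_column_sums) simp
  also have "\<dots> \<le> (\<Prod>j<n. 2 / s)"
  proof (intro prod_mono conjI)
    fix j assume j: "j \<in> {..<n}"
    have "(\<Sum>i<n. \<bar>mat n n (\<lambda>(i, j). B i j) $$ (i, j)\<bar>) = (\<Sum>i<n. \<bar>B i j\<bar>)"
      using j by (intro sum.cong) auto
    also have "\<dots> \<le> (\<Sum>i<n. ((if i = j then 1 else 0) + l i) / s)"
    proof (rule sum_mono)
      fix i assume "i \<in> {..<n}"
      then have "0 \<le> (1 - s) * l i" "(1 - s) * l i \<le> l i"
        using s l(1)[of i] by (auto simp: mult_left_le_one_le)
      then have "\<bar>(if i = j then 1 else 0) - (1 - s) * l i\<bar> \<le> (if i = j then 1 else 0) + l i" by auto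
      then show "\<bar>B i j\<bar> \<le> ((if i = j then 1 else 0) + l i) / s"
        using s by (simp add: B_def abs_divide divide_right_mono)
    qed
    also have "\<dots> = ((\<Sum>i<n. if i = j then 1 else 0) + (\<Sum>i<n. l i)) / s"
      by (simp add: sum.distrib flip: sum_divide_distrib)
    also have "\<dots> = 2 / s" using j l(2) by simp
    finally show "(\<Sum>i<n. \<bar>mat n n (\<lambda>(i, j). B i j) $$ (i, j)\<bar>) \<le> 2 / s" .
  qed (auto intro: sum_nonneg)
  finally have B: "\<bar>fdet n B\<bar> \<le> (2 / s) ^ n" by simp
  have "1 = \<bar>fdet n L\<bar> * \<bar>fdet n B\<bar>" using LB by (metis abs_mult abs_one)
  also have "\<dots> \<le> \<bar>fdet n L\<bar> * (2 / s) ^ n" using B by (intro mult_left_mono) auto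
  finally have "(s / 2) ^ n * 1 \<le> (s / 2) ^ n * (\<bar>fdet n L\<bar> * (2 / s) ^ n)"
    using s by (intro mult_left_mono) auto
  also have "\<dots> = \<bar>fdet n L\<bar>" using s by (simp add: power_divide)
  finally show "(s / 2) ^ n \<le> \<bar>fdet n L\<bar>" by simp
qed

text \<open>
  One step of the cutting-simplex method. The columns \<open>V j / W\<close> span a simplex with centre
  \<open>X / (n W)\<close>; the points \<open>P i\<close> (with barycentric coordinates \<open>L\<close>) lie on the positive side of the
  hyperplane with normal \<open>g\<close> through the centre. All vertices but the \<open>k\<close>-th are moved along the
  line through the \<open>k\<close>-th by an amount that is rounded to a multiple of \<open>1 / (32 n ^ 4)\<close>; since
  this rounding is in the safe direction no further rounding is ever needed.
\<close>

lemma simplex_cut: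
  fixes V V' :: "nat \<Rightarrow> nat \<Rightarrow> int" and g X z t :: "nat \<Rightarrow> int" and W q :: int and P L :: "nat \<Rightarrow> nat \<Rightarrow> real"
  assumes n: "n \<ge> 1"
    and X: "\<And>l. l < n \<Longrightarrow> X l = (\<Sum>j<n. V j l)"
    and t: "\<And>j. j < n \<Longrightarrow> t j = (\<Sum>l<n. g l * (int n * V j l - X l))"
    and k: "k < n" "\<And>j. j < n \<Longrightarrow> t j \<le> t k"
    and z: "\<And>j. j < n \<Longrightarrow> z j = 1 - (- (4 * int n * t j)) div t k"
    and q: "q = 32 * int n ^ 4"
    and V': "\<And>j l. j < n \<Longrightarrow> l < n \<Longrightarrow> V' j l = q * V j l + z j * (V j l - V k l)"
    and L: "col_stochastic n L"
    and P: "\<And>i l. i < n \<Longrightarrow> l < n \<Longrightarrow> P i l * W = (\<Sum>j<n. L j i * V j l)"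
    and pos: "\<And>i. i < n \<Longrightarrow> 0 < (\<Sum>l<n. g l * (P i l * (real n * W) - X l))"
  shows "\<exists>L' :: nat \<Rightarrow> nat \<Rightarrow> real. col_stochastic n L' \<and>
    (\<forall>i<n. \<forall>l<n. P i l * (q * W) = (\<Sum>j<n. L' j i * V' j l)) \<and>
    \<bar>fdet n L\<bar> * exp (1 / (16 * real n ^ 3)) \<le> \<bar>fdet n L'\<bar>"
proof -
  have Lnn: "0 \<le> L j i" if "i < n" "j < n" for i j using L that by (simp add: col_stochastic_def)
  have Lsum: "(\<Sum>j<n. L j i) = 1" if "i < n" for i using L that by (simp add: col_stochastic_def)
  have tsum: "(\<Sum>j<n. t j) = 0"
  proof -
    have "(\<Sum>j<n. t j) = (\<Sum>l<n. \<Sum>j<n. g l * (int n * V j l - X l))"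
      by (subst sum.swap) (simp add: t)
    also have "\<dots> = (\<Sum>l<n. g l * (int n * X l - int n * X l))"
      by (intro sum.cong refl) (simp add: X sum_subtractf flip: sum_distrib_left)
    finally show ?thesis by simp
  qed
  have Lt: "0 < (\<Sum>j<n. L j i * t j)" if i: "i < n" for i
  proof -
    have "(\<Sum>l<n. g l * (P i l * (real n * W) - X l)) = (\<Sum>l<n. \<Sum>j<n. L j i * (g l * (real n * V j l - X l)))"
    proof (rule sum.cong[OF refl])
      fix l assume l: "l \<in> {..<n}"
      have "P i l * (real n * W) = real n * (\<Sum>j<n. L j i * V j l)"
        using P[OF i, of l] l by (simp add: mult_ac)
      moreover have "real_of_int (X l) = (\<Sum>j<n. L j i * X l)"
        using Lsum[OF i] by (simp flip: sum_distrib_right)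
      ultimately have "P i l * (real n * W) - X l = (\<Sum>j<n. L j i * (real n * V j l - X l))"
        by (simp add: sum_distrib_left right_diff_distrib sum_subtractf mult.left_commute)
      then show "g l * (P i l * (real n * W) - X l) = (\<Sum>j<n. L j i * (g l * (real n * V j l - X l)))"
        by (simp add: sum_distrib_left mult.left_commute)
    qed
    also have "\<dots> = (\<Sum>j<n. L j i * t j)"
      by (subst sum.swap) (simp add: t sum_distrib_left)
    finally show ?thesis using pos[OF i] by simp
  qed
  have tk: "t k > 0"
  proof (rule ccontr)
    assume "\<not> t k > 0"
    then have "real_of_int (t j) \<le> 0" if "j < n" for j using k(2)[OF that] by simp
    then have "(\<Sum>j<n. L j 0 * t j) \<le> 0"
      using Lnn n by (intro sum_nonpos mult_nonneg_nonpos) auto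
    then show False using Lt[of 0] n by simp
  qed
  \<comment> \<open>Heights of the vertices over the cutting hyperplane, normalized to 1 at the
    highest vertex \<open>k\<close>. They sum to 0 because the hyperplane passes through the
    centre.\<close>
  define a where "a j = real_of_int (t j) / real_of_int (t k)" for j
  have ak: "a k = 1" using tk by (simp add: a_def)
  have a1: "a j \<le> 1" if "j < n" for j using k(2)[OF that] tk by (simp add: a_def)
  have asum: "(\<Sum>j<n. a j) = 0"
    using tsum by (simp add: a_def flip: sum_divide_distrib of_int_sum)
  have alow: "- real n \<le> a j" if j: "j < n" for j
  proof -
    have "(\<Sum>i\<in>{..<n} - {j}. a i) \<le> (\<Sum>i\<in>{..<n} - {j}. 1)" by (intro sum_mono a1) auto
    also have "\<dots> \<le> real n" using j by (simp add: card_Diff_singleton)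
    finally show ?thesis using asum j by (simp add: sum_diff1)
  qed
  \<comment> \<open>\<open>div\<close> rounds down, so the two signs make \<open>z j\<close> equal
    to 1 plus \<open>4 * n * a j\<close> rounded up. The extra 1 is the safety margin.\<close>
  have z1: "4 * real n * a j + 1 \<le> z j" and z2: "z j \<le> 4 * real n * a j + 2" if j: "j < n" for j
  proof -
    let ?m = "- (4 * int n * t j)"
    have eq: "real_of_int ?m / real_of_int (t k) = - (4 * real n * a j)" by (simp add: a_def)
    have "real_of_int (?m div t k) \<le> - (4 * real n * a j)"
      using real_of_int_div4[of ?m "t k"] eq by simp
    then show "4 * real n * a j + 1 \<le> z j" using z[OF j] by simp
    have "- (4 * real n * a j) - 1 \<le> real_of_int (?m div t k)"
      using real_of_int_div3[of ?m "t k"] eq by simp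
    then show "z j \<le> 4 * real n * a j + 2" using z[OF j] by simp
  qed
  define N where "N = real n"
  have N: "N \<ge> 1" using n by (simp add: N_def)
  have qN: "real_of_int q = 32 * N ^ 4" by (simp add: q N_def)
  have q0: "real_of_int q > 0" using N by (simp add: qN)
  \<comment> \<open>\<open>r j\<close> exceeds \<open>\<gamma> * a j\<close> by an amount between
    \<open>\<delta>\<close> and \<open>2 * \<delta>\<close>. The constants are tuned so that
    \<open>\<delta>\<close> covers the second-order term \<open>(\<gamma> * a j)\<^sup>2\<close>, at
    most \<open>\<delta> / 2\<close>, while the total surplus \<open>2 * N * \<delta>\<close> is
    only half of \<open>\<gamma>\<close>.\<close>
  define r where "r j = real_of_int (z j) / q" for j
  define \<gamma> where "\<gamma> = 1 / (8 * N ^ 3)"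
  define \<delta> where "\<delta> = 1 / (32 * N ^ 4)"
  have \<gamma>: "0 < \<gamma>" "\<gamma> \<le> 1 / 8" using N by (auto simp: \<gamma>_def field_simps)
  have \<delta>: "0 < \<delta>" using N by (simp add: \<delta>_def)
  have \<gamma>\<delta>: "4 * N * \<delta> = \<gamma>" using N by (simp add: \<gamma>_def \<delta>_def field_simps eval_nat_numeral)
  have rj: "r j = z j * \<delta>" for j by (simp add: r_def qN \<delta>_def)
  have aff: "(4 * N * a j + c) * \<delta> = \<gamma> * a j + c * \<delta>" for j c
    unfolding \<gamma>\<delta>[symmetric] by (simp add: algebra_simps)
  have r1: "\<gamma> * a j + \<delta> \<le> r j" if "j < n" for j
  proof -
    have "(4 * N * a j + 1) * \<delta> \<le> z j * \<delta>" using z1[OF that] \<delta> by (intro mult_right_mono) (auto simp: N_def)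
    then show ?thesis by (simp add: aff rj)
  qed
  have r2: "r j \<le> \<gamma> * a j + 2 * \<delta>" if "j < n" for j
  proof -
    have "z j * \<delta> \<le> (4 * N * a j + 2) * \<delta>" using z2[OF that] \<delta> by (intro mult_right_mono) (auto simp: N_def)
    then show ?thesis by (simp add: aff rj)
  qed
  have "\<gamma> * N \<le> \<gamma> * N ^ 3" using N \<gamma> power_increasing[of 1 3 N] by (intro mult_left_mono) auto
  also have "\<dots> = 1 / 8" using N by (simp add: \<gamma>_def)
  finally have \<gamma>N: "\<gamma> * N \<le> 1 / 8" "\<gamma> * N * (\<gamma> * N) = \<delta> / 2"
    using N by (auto simp: \<gamma>_def \<delta>_def field_simps eval_nat_numeral)
  have \<gamma>a: "\<bar>\<gamma> * a j\<bar> \<le> \<gamma> * N" if "j < n" for j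
    using a1[OF that] alow[OF that] \<gamma> N by (auto simp: abs_mult N_def intro!: mult_left_mono)
  have r7: "7 / 8 \<le> 1 + r j" if "j < n" for j using r1[OF that] \<gamma>a[OF that] \<gamma>N(1) \<delta> by linarith
  have rr: "\<gamma> * a j \<le> r j / (1 + r j)" if j: "j < n" for j
  proof -
    have sq: "(\<gamma> * a j) * (\<gamma> * a j) \<le> \<delta> / 2"
    proof -
      have "\<bar>\<gamma> * a j\<bar> * \<bar>\<gamma> * a j\<bar> \<le> (\<gamma> * N) * (\<gamma> * N)" using \<gamma>a[OF j] by (intro mult_mono) auto
      then show ?thesis using \<gamma>N(2) by (simp add: abs_mult[symmetric])
    qed
    have le: "\<gamma> * a j \<le> 1 / 8" using \<gamma>a[OF j] \<gamma>N(1) by linarith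
    have "\<delta> * (\<gamma> * a j) \<le> \<delta> * (1 / 8)" using le \<delta> by (intro mult_left_mono) auto
    moreover have "(\<gamma> * a j + \<delta>) * (1 - \<gamma> * a j) = \<gamma> * a j + \<delta> - (\<gamma> * a j) * (\<gamma> * a j) - \<delta> * (\<gamma> * a j)"
      by (simp add: algebra_simps)
    ultimately have "\<gamma> * a j \<le> (\<gamma> * a j + \<delta>) * (1 - \<gamma> * a j)" using sq \<delta> by linarith
    also have "\<dots> \<le> r j * (1 - \<gamma> * a j)" using r1[OF j] le by (intro mult_right_mono) auto
    finally have "\<gamma> * a j * (1 + r j) \<le> r j" by (simp add: algebra_simps)
    then show ?thesis using r7[OF j] by (simp add: pos_le_divide_eq)
  qed
  \<comment> \<open>Change of barycentric coordinates. Up to the common denominator,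
    \<open>V j = (V' j + r j * V k) / (1 + r j)\<close>: the weight of vertex \<open>j\<close> is
    divided by \<open>1 + r j\<close>, and the rest goes to vertex \<open>k\<close>.\<close>
  define A where "A j i = (if j = k then if i = k then 1 else r i / (1 + r i) else if i = j then 1 / (1 + r j) else 0)" for j i
  define L' where "L' j i = (\<Sum>h<n. A j h * L h i)" for j i
  have L'j: "L' j i = L j i / (1 + r j)" if "j < n" "j \<noteq> k" for i j
  proof -
    have "L' j i = (\<Sum>h<n. if h = j then L h i / (1 + r j) else 0)"
      unfolding L'_def by (rule sum.cong) (use that in \<open>auto simp: A_def\<close>)
    then show ?thesis using that by simp
  qed
  have split: "(\<Sum>j<n. f j) = f k + (\<Sum>j\<in>{..<n} - {k}. f j)" for f :: "nat \<Rightarrow> real"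
    using k(1) by (simp add: sum.remove)
  have L'k: "L' k i = L k i + (\<Sum>j\<in>{..<n} - {k}. L j i * (r j / (1 + r j)))" for i
  proof -
    have "(\<Sum>h\<in>{..<n} - {k}. A k h * L h i) = (\<Sum>j\<in>{..<n} - {k}. L j i * (r j / (1 + r j)))"
      by (rule sum.cong) (auto simp: A_def)
    then show ?thesis unfolding L'_def split by (simp add: A_def)
  qed
  have nz: "1 + r j \<noteq> 0" if "j < n" for j using r7[OF that] by linarith
  have stoch: "col_stochastic n L'"
    unfolding col_stochastic_def
  proof (intro allI impI conjI)
    fix i j assume ij: "i < n" "j < n"
    show "0 \<le> L' j i"
    proof (cases "j = k")
      case False
      then show ?thesis using L'j[OF ij(2)] Lnn[OF ij] r7[OF ij(2)] by simp
    next
      case True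
      \<comment> \<open>The point lies on the positive side, so its height is positive; the weight
        of \<open>k\<close> then loses at most the fraction \<open>\<gamma>\<close> of
        itself.\<close>
      have "(\<Sum>j<n. L j i * a j) = (\<Sum>j<n. L j i * t j) / t k" by (simp add: a_def sum_divide_distrib)
      then have "0 \<le> (\<Sum>j<n. L j i * a j)" using Lt[OF ij(1)] tk by simp
      then have "- L k i \<le> (\<Sum>j\<in>{..<n} - {k}. L j i * a j)" unfolding split using ak by simp
      then have "\<gamma> * (- L k i) \<le> \<gamma> * (\<Sum>j\<in>{..<n} - {k}. L j i * a j)" using \<gamma> by (intro mult_left_mono) auto
      also have "\<dots> = (\<Sum>j\<in>{..<n} - {k}. L j i * (\<gamma> * a j))" by (simp add: sum_distrib_left mult_ac)
      also have "\<dots> \<le> (\<Sum>j\<in>{..<n} - {k}. L j i * (r j / (1 + r j)))"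
        using Lnn[OF ij(1)] rr by (intro sum_mono mult_left_mono) auto
      finally have "L k i - \<gamma> * L k i \<le> L' k i" unfolding L'k by simp
      moreover have "\<gamma> * L k i \<le> 1 * L k i" using \<gamma> Lnn[OF ij(1) k(1)] by (intro mult_right_mono) auto
      ultimately show ?thesis using True by simp
    qed
  next
    fix i assume i: "i < n"
    have "(\<Sum>j\<in>{..<n} - {k}. L' j i) = (\<Sum>j\<in>{..<n} - {k}. L j i / (1 + r j))"
      by (rule sum.cong) (auto simp: L'j)
    then have "(\<Sum>j<n. L' j i) = L k i + (\<Sum>j\<in>{..<n} - {k}. L j i * (r j / (1 + r j)) + L j i / (1 + r j))"
      unfolding split L'k by (simp add: sum.distrib)
    also have "(\<Sum>j\<in>{..<n} - {k}. L j i * (r j / (1 + r j)) + L j i / (1 + r j)) = (\<Sum>j\<in>{..<n} - {k}. L j i)"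
    proof (rule sum.cong[OF refl])
      fix j assume "j \<in> {..<n} - {k}"
      then have "1 + r j \<noteq> 0" using nz by simp
      then have "L j i * (1 + r j) / (1 + r j) = L j i" by simp
      moreover have "L j i * (1 + r j) = L j i * r j + L j i" by (simp add: distrib_left)
      ultimately show "L j i * (r j / (1 + r j)) + L j i / (1 + r j) = L j i"
        by (simp add: add_divide_distrib)
    qed
    finally show "(\<Sum>j<n. L' j i) = 1" using Lsum[OF i] unfolding split by simp
  qed
  have P': "P i l * (q * W) = (\<Sum>j<n. L' j i * V' j l)" if il: "i < n" "l < n" for i l
  proof -
    have V'r: "real_of_int (V' j l) = q * ((1 + r j) * V j l - r j * V k l)" if "j < n" for j
    proof -
      have "real_of_int q * r j = z j" using q0 by (simp add: r_def)
      then have "real_of_int q * ((1 + r j) * V j l - r j * V k l) = q * V j l + z j * (V j l - V k l)"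
        by (simp add: algebra_simps) (simp flip: mult.assoc)
      then show ?thesis using V'[OF that il(2)] by simp
    qed
    have V'k: "real_of_int (V' k l) = q * V k l" using V'r[OF k(1)] by (simp add: algebra_simps)
    have "(\<Sum>j\<in>{..<n} - {k}. L' j i * V' j l) = (\<Sum>j\<in>{..<n} - {k}. q * (L j i * V j l) - q * V k l * (L j i * (r j / (1 + r j))))"
    proof (rule sum.cong[OF refl])
      fix j assume "j \<in> {..<n} - {k}"
      then have j: "j < n" "j \<noteq> k" by auto
      show "L' j i * V' j l = q * (L j i * V j l) - q * V k l * (L j i * (r j / (1 + r j)))"
        unfolding L'j[OF j] V'r[OF j(1)] using nz[OF j(1)] by (simp add: field_simps)
    qed
    also have "\<dots> = q * (\<Sum>j\<in>{..<n} - {k}. L j i * V j l) - q * V k l * (\<Sum>j\<in>{..<n} - {k}. L j i * (r j / (1 + r j)))"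
      by (simp add: sum_subtractf sum_distrib_left)
    finally have "(\<Sum>j<n. L' j i * V' j l) = q * (\<Sum>j<n. L j i * V j l)"
      unfolding split[of "\<lambda>j. L' j i * V' j l"] split[of "\<lambda>j. L j i * V j l"] L'k V'k by (simp add: algebra_simps)
    then show ?thesis using P[OF il] by (simp add: mult_ac)
  qed
  have "fdet n L' = fdet n A * fdet n L" unfolding L'_def by (rule fdet_mult)
  moreover have "fdet n A = (\<Prod>j<n. A j j)" by (rule fdet_diag_except_row[OF k(1)]) (simp add: A_def)
  moreover have "(\<Prod>j<n. A j j) = (\<Prod>j\<in>{..<n} - {k}. 1 / (1 + r j))"
  proof -
    have "(\<Prod>j<n. A j j) = A k k * (\<Prod>j\<in>{..<n} - {k}. A j j)" using k(1) by (simp add: prod.remove)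
    also have "(\<Prod>j\<in>{..<n} - {k}. A j j) = (\<Prod>j\<in>{..<n} - {k}. 1 / (1 + r j))"
      by (rule prod.cong) (auto simp: A_def)
    also have "A k k = 1" by (simp add: A_def)
    finally show ?thesis by simp
  qed
  moreover have "exp (1 / (16 * real n ^ 3)) \<le> (\<Prod>j\<in>{..<n} - {k}. 1 / (1 + r j))"
  proof -
    have "(\<Sum>j\<in>{..<n} - {k}. r j) \<le> (\<Sum>j\<in>{..<n} - {k}. \<gamma> * a j + 2 * \<delta>)" by (intro sum_mono r2) auto
    also have "\<dots> = \<gamma> * (\<Sum>j\<in>{..<n} - {k}. a j) + (N - 1) * (2 * \<delta>)"
      using n k(1) by (simp add: sum.distrib sum_distrib_left N_def of_nat_diff)
    \<comment> \<open>The first-order effect on the volume: the vertices other than \<open>k\<close>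
      have total height -1, so on balance they move inwards.\<close>
    also have "(\<Sum>j\<in>{..<n} - {k}. a j) = -1" using asum ak unfolding split[of a] by simp
    also have "\<gamma> * (-1) + (N - 1) * (2 * \<delta>) \<le> - (\<gamma> / 2)" using \<gamma>\<delta> \<delta> by (simp add: algebra_simps)
    finally have s: "\<gamma> / 2 \<le> (\<Sum>j\<in>{..<n} - {k}. - r j)" by (simp add: sum_negf)
    have "exp (1 / (16 * real n ^ 3)) = exp (\<gamma> / 2)" by (simp add: \<gamma>_def N_def)
    also have "\<dots> \<le> exp (\<Sum>j\<in>{..<n} - {k}. - r j)" using s by simp
    also have "\<dots> = (\<Prod>j\<in>{..<n} - {k}. exp (- r j))" by (simp add: exp_sum)
    also have "\<dots> \<le> (\<Prod>j\<in>{..<n} - {k}. 1 / (1 + r j))"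
    proof (intro prod_mono conjI)
      fix j assume "j \<in> {..<n} - {k}"
      then have "1 + r j > 0" using r7[of j] by simp
      moreover have "1 + r j \<le> exp (r j)" by (rule exp_ge_add_one_self)
      ultimately show "exp (- r j) \<le> 1 / (1 + r j)" by (simp add: exp_minus field_simps)
    qed simp
    finally show ?thesis .
  qed
  ultimately have eq: "fdet n L' = (\<Prod>j\<in>{..<n} - {k}. 1 / (1 + r j)) * fdet n L"
    and ge: "exp (1 / (16 * real n ^ 3)) \<le> (\<Prod>j\<in>{..<n} - {k}. 1 / (1 + r j))" by simp_all
  have "\<bar>fdet n L\<bar> * exp (1 / (16 * real n ^ 3)) \<le> \<bar>fdet n L\<bar> * \<bar>\<Prod>j\<in>{..<n} - {k}. 1 / (1 + r j)\<bar>"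
    using ge by (intro mult_left_mono) auto
  also have "\<dots> = \<bar>fdet n L'\<bar>" unfolding eq abs_mult by (rule mult.commute)
  finally have "\<bar>fdet n L\<bar> * exp (1 / (16 * real n ^ 3)) \<le> \<bar>fdet n L'\<bar>" .
  then show ?thesis using stoch P' by blast
qed

section \<open>Total correctness and running time of programs\<close>

text \<open>One unit of the 2 is for the sign, the other because \<open>2 ^ e\<close> itself has
  \<open>e + 1\<close> bits.\<close>

lemma int_size_le: "\<bar>z\<bar> \<le> 2 ^ e \<Longrightarrow> int_size z \<le> e + 2"
proof -
  assume "\<bar>z\<bar> \<le> 2 ^ e"
  then have "\<bar>z\<bar> < 2 ^ nat (int (e + 1))"
    using power_strict_increasing[of e "e + 1" "2::int"] by (simp only: nat_int) linarith
  then have "bitlen \<bar>z\<bar> \<le> int (e + 1)" by (subst bitlen_le_iff_power) auto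
  then show ?thesis by (simp add: int_size_def)
qed

text \<open>One bit bound for the whole memory. Under it each elementary step costs at most a
  constant of the program text times \<open>l + 2\<close>, so time analysis becomes counting of
  steps.\<close>

definition bnd :: "nat \<Rightarrow> state \<Rightarrow> bool" where
  "bnd l s \<longleftrightarrow> 1 \<le> l \<and> (\<forall>x k. \<bar>s x k\<bar> \<le> 2 ^ l)"

text \<open>Tuned so that values have about \<open>l * asz a\<close> bits: multiplication adds bit
  lengths, and constants are charged crudely by their absolute value. Costs are then quadratic in
  \<open>asz\<close>.\<close>

fun asz :: "aexp \<Rightarrow> nat" where
  "asz (Num k) = 1 + nat \<bar>k\<bar>"
| "asz (Cell x a) = asz a + 1"
| "asz (Plus a b) = asz a + asz b + 1"
| "asz (Minus a b) = asz a + asz b + 1"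
| "asz (Times a b) = asz a + asz b + 1"
| "asz (Div a b) = asz a + asz b + 1"

fun bsz :: "bexp \<Rightarrow> nat" where
  "bsz (Less a b) = (asz a)\<^sup>2 + (asz b)\<^sup>2 + asz a + asz b"
| "bsz (Not b) = bsz b + 1"
| "bsz (And b c) = bsz b + bsz c + 1"

section \<open>Sizes of values and costs of expressions\<close>

lemma asz_pos: "asz a \<ge> 1"
  by (induction a) auto

lemma abs_add_le_pow:
  fixes x y :: int
  assumes "\<bar>x\<bar> \<le> 2 ^ a" "\<bar>y\<bar> \<le> 2 ^ b" "1 \<le> a" "1 \<le> b"
  shows "\<bar>x\<bar> + \<bar>y\<bar> \<le> 2 ^ (a + b)"
proof -
  have "(2::int) \<le> 2 ^ a" "(2::int) \<le> 2 ^ b"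
    using power_increasing[OF assms(3), of "2::int"] power_increasing[OF assms(4), of "2::int"] by auto
  then have "(2 ^ a - 1) * (2 ^ b - 1) \<ge> (1::int) * 1" by (intro mult_mono) auto
  then have "(2::int) ^ a + 2 ^ b \<le> 2 ^ (a + b)" by (simp add: power_add algebra_simps)
  then show ?thesis using assms(1,2) by linarith
qed

lemma abs_div_le_abs: "\<bar>x div y\<bar> \<le> \<bar>x :: int\<bar>"
proof (cases "y = 0")
  case False
  have *: "\<bar>x div y\<bar> \<le> \<bar>x\<bar>" if "y > 0" for x y :: int
  proof (cases "x \<ge> 0")
    case True
    then have "x div y \<le> x div 1" using that by (intro zdiv_mono2) auto
    then show ?thesis using that True by (simp add: pos_imp_zdiv_nonneg_iff)
  next
    case False
    then have "x div 1 \<le> x div y" using that by (intro zdiv_mono2_neg) auto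
    moreover have "x div y < 0" using False that by (simp add: neg_imp_zdiv_neg_iff pos_imp_zdiv_neg_iff)
    ultimately show ?thesis by simp
  qed
  show ?thesis
  proof (cases "y > 0")
    case True then show ?thesis by (rule *)
  next
    case neg: False
    then have "\<bar>(- x) div (- y)\<bar> \<le> \<bar>- x\<bar>" using False by (intro *) auto
    then show ?thesis by simp
  qed
qed simp

lemma abs_aval_le: "bnd l s \<Longrightarrow> \<bar>aval a s\<bar> \<le> 2 ^ (l * asz a)"
proof (induction a)
  case (Num k)
  have "\<bar>k\<bar> \<le> 2 ^ nat \<bar>k\<bar>" using of_nat_less_two_power[of "nat \<bar>k\<bar>"] by (metis int_nat_eq abs_ge_zero of_nat_le_iff of_nat_numeral of_nat_power less_exp order_less_imp_le)
  also have "\<dots> \<le> 2 ^ (l * (1 + nat \<bar>k\<bar>))" using Num by (intro power_increasing) (auto simp: bnd_def intro: trans_le_add2)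
  finally show ?case by simp
next
  case (Cell x a)
  then have "\<bar>s x (aval a s)\<bar> \<le> 2 ^ l" by (simp add: bnd_def)
  also have "(2::int) ^ l \<le> 2 ^ (l * asz (Cell x a))" by (intro power_increasing) auto
  finally show ?case by simp
next
  case (Plus a b)
  have l: "1 \<le> l * asz a" "1 \<le> l * asz b" using Plus.prems asz_pos[of a] asz_pos[of b] by (auto simp: bnd_def)
  have "\<bar>aval a s\<bar> + \<bar>aval b s\<bar> \<le> 2 ^ (l * asz a + l * asz b)"
    by (rule abs_add_le_pow[OF Plus.IH(1)[OF Plus.prems] Plus.IH(2)[OF Plus.prems] l])
  also have "(2::int) ^ (l * asz a + l * asz b) \<le> 2 ^ (l * asz (Plus a b))" by (intro power_increasing) (auto simp: algebra_simps)
  finally show ?case by simp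
next
  case (Minus a b)
  have l: "1 \<le> l * asz a" "1 \<le> l * asz b" using Minus.prems asz_pos[of a] asz_pos[of b] by (auto simp: bnd_def)
  have "\<bar>aval a s\<bar> + \<bar>aval b s\<bar> \<le> 2 ^ (l * asz a + l * asz b)"
    by (rule abs_add_le_pow[OF Minus.IH(1)[OF Minus.prems] Minus.IH(2)[OF Minus.prems] l])
  also have "(2::int) ^ (l * asz a + l * asz b) \<le> 2 ^ (l * asz (Minus a b))" by (intro power_increasing) (auto simp: algebra_simps)
  finally show ?case by simp
next
  case (Times a b)
  have "\<bar>aval a s\<bar> * \<bar>aval b s\<bar> \<le> 2 ^ (l * asz a) * 2 ^ (l * asz b)"
    using Times by (intro mult_mono) auto
  also have "\<dots> = 2 ^ (l * asz a + l * asz b)" by (simp add: power_add)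
  also have "(2::int) ^ (l * asz a + l * asz b) \<le> 2 ^ (l * asz (Times a b))" by (intro power_increasing) (auto simp: algebra_simps)
  finally show ?case by (simp add: abs_mult)
next
  case (Div a b)
  have "\<bar>aval (Div a b) s\<bar> \<le> \<bar>aval a s\<bar>" by (simp add: abs_div_le_abs)
  also have "\<dots> \<le> 2 ^ (l * asz a)" using Div by simp
  also have "(2::int) ^ (l * asz a) \<le> 2 ^ (l * asz (Div a b))" by (intro power_increasing mult_left_mono) auto
  finally show ?case .
qed

lemma int_size_aval_le: "bnd l s \<Longrightarrow> int_size (aval a s) \<le> asz a * (l + 2)"
  using int_size_le[OF abs_aval_le, of l s a] asz_pos[of a] by (auto simp: algebra_simps intro: order_trans)

lemma binary_cost_le:
  assumes "bnd l s" "ca \<le> (asz a)\<^sup>2 * (l + 2)" "cb \<le> (asz b)\<^sup>2 * (l + 2)"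
  shows "ca + cb + int_size (aval a s) + int_size (aval b s) \<le> (asz a + asz b + 1)\<^sup>2 * (l + 2)"
proof -
  have "ca + cb + int_size (aval a s) + int_size (aval b s) \<le>
      (asz a)\<^sup>2 * (l + 2) + (asz b)\<^sup>2 * (l + 2) + asz a * (l + 2) + asz b * (l + 2)"
    using assms int_size_aval_le[OF assms(1)] by (intro add_mono)
  also have "\<dots> = ((asz a)\<^sup>2 + (asz b)\<^sup>2 + asz a + asz b) * (l + 2)" by (simp only: distrib_right)
  also have "\<dots> \<le> (asz a + asz b + 1)\<^sup>2 * (l + 2)"
    by (intro mult_right_mono) (simp_all add: power2_eq_square algebra_simps)
  finally show ?thesis .
qed

lemma acost_le: "bnd l s \<Longrightarrow> acost a s \<le> (asz a)\<^sup>2 * (l + 2)"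
proof (induction a)
  case (Num k)
  have "int_size k \<le> asz (Num k) * (l + 2)" using int_size_aval_le[OF Num, of "Num k"] by simp
  also have "\<dots> \<le> (asz (Num k) * asz (Num k)) * (l + 2)" by (intro mult_right_mono) simp_all
  finally show ?case by (simp only: power2_eq_square acost.simps)
next
  case (Cell x a)
  have "int_size (s x (aval a s)) \<le> l + 2" using Cell.prems by (intro int_size_le) (simp add: bnd_def)
  then have "acost (Cell x a) s \<le> (asz a)\<^sup>2 * (l + 2) + asz a * (l + 2) + (l + 2)"
    using Cell.IH[OF Cell.prems] int_size_aval_le[OF Cell.prems, of a] by simp
  also have "\<dots> = ((asz a)\<^sup>2 + asz a + 1) * (l + 2)" by (simp add: algebra_simps)
  also have "\<dots> \<le> (asz (Cell x a))\<^sup>2 * (l + 2)" by (intro mult_right_mono) (auto simp: power2_eq_square)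
  finally show ?case .
next
  case (Plus a b)
  from binary_cost_le[OF Plus.prems Plus.IH(1)[OF Plus.prems] Plus.IH(2)[OF Plus.prems]] show ?case by simp
next
  case (Minus a b)
  from binary_cost_le[OF Minus.prems Minus.IH(1)[OF Minus.prems] Minus.IH(2)[OF Minus.prems]] show ?case by simp
next
  case (Times a b)
  from binary_cost_le[OF Times.prems Times.IH(1)[OF Times.prems] Times.IH(2)[OF Times.prems]] show ?case by simp
next
  case (Div a b)
  from binary_cost_le[OF Div.prems Div.IH(1)[OF Div.prems] Div.IH(2)[OF Div.prems]] show ?case by simp
qed

lemma two_acost_le:
  assumes "bnd l s"
  shows "acost a s + acost b s + int_size (aval a s) + int_size (aval b s)
    \<le> ((asz a)\<^sup>2 + (asz b)\<^sup>2 + asz a + asz b) * (l + 2)"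
  unfolding distrib_right
  using acost_le[OF assms] int_size_aval_le[OF assms] by (intro add_mono)

lemma bcost_le: "bnd l s \<Longrightarrow> bcost b s \<le> bsz b * (l + 2)"
proof (induction b)
  case (Less a b)
  then show ?case using two_acost_le by simp
qed (auto simp: algebra_simps)

text \<open>
  \<open>tm N c\<close> bounds, up to the factor for the size of the numbers, the running time of \<open>c\<close> if no
  execution of a loop takes more than \<open>N\<close> rounds.
\<close>

fun tm :: "nat \<Rightarrow> com \<Rightarrow> nat" where
  "tm N Skip = 1"
| "tm N (Store x a b) = (asz a)\<^sup>2 + (asz b)\<^sup>2 + asz a + asz b"
| "tm N (Seq c1 c2) = tm N c1 + tm N c2"
| "tm N (If b c1 c2) = bsz b + tm N c1 + tm N c2"
| "tm N (While b c) = (N + 1) * bsz b + N * tm N c"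

lemma tm_poly: "\<exists>p :: nat poly. \<forall>N. tm N c = poly p N"
proof (induction c)
  case Skip
  show ?case by (intro exI[of _ "[:1:]"]) simp
next
  case (Store x a b)
  show ?case by (intro exI[of _ "[:(asz a)\<^sup>2 + (asz b)\<^sup>2 + asz a + asz b:]"]) simp
next
  case (Seq c1 c2)
  then obtain p1 p2 where "\<forall>N. tm N c1 = poly p1 N" "\<forall>N. tm N c2 = poly p2 N" by blast
  then show ?case by (intro exI[of _ "p1 + p2"]) simp
next
  case (If b c1 c2)
  then obtain p1 p2 where "\<forall>N. tm N c1 = poly p1 N" "\<forall>N. tm N c2 = poly p2 N" by blast
  then show ?case by (intro exI[of _ "[:bsz b:] + p1 + p2"]) simp
next
  case (While b c)
  then obtain p where "\<forall>N. tm N c = poly p N" by blast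
  then show ?case by (intro exI[of _ "[:1, 1:] * [:bsz b:] + [:0, 1:] * p"]) (simp add: algebra_simps)
qed

section \<open>Program logic with time bounds\<close>

fun mods :: "com \<Rightarrow> string set" where
  "mods Skip = {}"
| "mods (Store x a b) = {x}"
| "mods (Seq c1 c2) = mods c1 \<union> mods c2"
| "mods (If b c1 c2) = mods c1 \<union> mods c2"
| "mods (While b c) = mods c"

lemma exec_mods: "exec c s t s' \<Longrightarrow> y \<notin> mods c \<Longrightarrow> s' y = s y"
  by (induction rule: exec.induct) auto

text \<open>Total correctness with the time bound built in. The invariant \<open>bnd l\<close> is
  assumed and re-established here, so a program proof only has to bound each stored value by
  \<open>2 ^ l\<close>.\<close>

definition wp :: "nat \<Rightarrow> nat \<Rightarrow> com \<Rightarrow> (state \<Rightarrow> bool) \<Rightarrow> state \<Rightarrow> bool" where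
  "wp N l c Q s \<longleftrightarrow> (bnd l s \<longrightarrow>
    (\<exists>t s'. exec c s t s' \<and> t \<le> tm N c * (l + 2) \<and> bnd l s' \<and> Q s'))"

lemma wp_frame: "wp N l c Q s \<Longrightarrow> wp N l c (\<lambda>s'. Q s' \<and> (\<forall>y. y \<notin> mods c \<longrightarrow> s' y = s y)) s"
  unfolding wp_def using exec_mods by blast

lemma wp_mono: "wp N l c Q s \<Longrightarrow> (\<And>s'. Q s' \<Longrightarrow> Q' s') \<Longrightarrow> wp N l c Q' s"
  unfolding wp_def by blast

lemma wp_use:
  assumes "wp N l c Q s" "\<And>s'. Q s' \<Longrightarrow> (\<And>y. y \<notin> mods c \<Longrightarrow> s' y = s y) \<Longrightarrow> Q' s'"
  shows "wp N l c Q' s"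
  using wp_mono[OF wp_frame[OF assms(1)]] assms(2) by blast

lemma wp_Skip: "Q s \<Longrightarrow> wp N l Skip Q s"
  unfolding wp_def by (auto intro!: exI exec.Skip)

lemma wp_Store:
  assumes "\<bar>aval b s\<bar> \<le> 2 ^ l" "Q (s(x := (s x)(aval a s := aval b s)))"
  shows "wp N l (Store x a b) Q s"
  unfolding wp_def
proof
  assume b: "bnd l s"
  then have "bnd l (s(x := (s x)(aval a s := aval b s)))" using assms(1) by (simp add: bnd_def)
  then show "\<exists>t s'. exec (Store x a b) s t s' \<and> t \<le> tm N (Store x a b) * (l + 2) \<and> bnd l s' \<and> Q s'"
    using exec.Store two_acost_le[OF b] assms(2) by (intro exI conjI) auto
qed

lemma wp_Seq:
  assumes "wp N l c1 (wp N l c2 Q) s"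
  shows "wp N l (Seq c1 c2) Q s"
  unfolding wp_def
proof
  assume "bnd l s"
  then obtain t1 s1 where 1: "exec c1 s t1 s1" "t1 \<le> tm N c1 * (l + 2)" "bnd l s1" "wp N l c2 Q s1"
    using assms unfolding wp_def[of N l c1] by blast
  then obtain t2 s2 where 2: "exec c2 s1 t2 s2" "t2 \<le> tm N c2 * (l + 2)" "bnd l s2" "Q s2"
    unfolding wp_def by blast
  show "\<exists>t s'. exec (Seq c1 c2) s t s' \<and> t \<le> tm N (Seq c1 c2) * (l + 2) \<and> bnd l s' \<and> Q s'"
    using exec.Seq[OF 1(1) 2(1)] 1 2 by (intro exI[of _ "t1 + t2"] exI[of _ s2]) (auto simp: algebra_simps)
qed

lemma wp_If:
  assumes "bval b s \<Longrightarrow> wp N l c1 Q s" "\<not> bval b s \<Longrightarrow> wp N l c2 Q s"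
  shows "wp N l (If b c1 c2) Q s"
  unfolding wp_def
proof
  assume bd: "bnd l s"
  have bc: "bcost b s \<le> bsz b * (l + 2)" by (rule bcost_le[OF bd])
  show "\<exists>t s'. exec (If b c1 c2) s t s' \<and> t \<le> tm N (If b c1 c2) * (l + 2) \<and> bnd l s' \<and> Q s'"
  proof (cases "bval b s")
    case True
    then obtain t s' where "exec c1 s t s'" "t \<le> tm N c1 * (l + 2)" "bnd l s'" "Q s'"
      using assms(1) bd unfolding wp_def by blast
    then show ?thesis using exec.IfTrue[OF True] bc
      by (intro exI[of _ "bcost b s + t"] exI[of _ s']) (auto simp: algebra_simps)
  next
    case False
    then obtain t s' where "exec c2 s t s'" "t \<le> tm N c2 * (l + 2)" "bnd l s'" "Q s'"
      using assms(2) bd unfolding wp_def by blast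
    then show ?thesis using exec.IfFalse[OF False] bc
      by (intro exI[of _ "bcost b s + t"] exI[of _ s']) (auto simp: algebra_simps)
  qed
qed

text \<open>\<open>k\<close> counts the completed rounds. That \<open>step\<close> keeps it below
  \<open>M\<close> gives both termination and the time: the guard is evaluated once more often than
  the body.\<close>

lemma wp_While:
  assumes "M \<le> N" "I 0 s"
    and step: "\<And>k s. I k s \<Longrightarrow> bval b s \<Longrightarrow> k < M \<and> wp N l c (I (Suc k)) s"
    and finish: "\<And>k s. I k s \<Longrightarrow> \<not> bval b s \<Longrightarrow> Q s"
  shows "wp N l (While b c) Q s"
proof -
  have "\<exists>t s'. exec (While b c) s t s' \<and> t \<le> ((M - k + 1) * bsz b + (M - k) * tm N c) * (l + 2) \<and> bnd l s' \<and> Q s'"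
    if "bnd l s" "I k s" "k \<le> M" for k s
    using that
  proof (induction "M - k" arbitrary: k s rule: less_induct)
    case less
    have bc: "bcost b s \<le> bsz b * (l + 2)" by (rule bcost_le[OF less.prems(1)])
    show ?case
    proof (cases "bval b s")
      case False
      have "bcost b s \<le> ((M - k + 1) * bsz b + (M - k) * tm N c) * (l + 2)"
        using bc by (rule order_trans) (simp add: algebra_simps)
      then show ?thesis using exec.WhileFalse[OF False] less.prems finish[OF less.prems(2) False] by blast
    next
      case True
      from step[OF less.prems(2) True] have kM: "k < M" and w: "wp N l c (I (Suc k)) s" by auto
      from w obtain t1 s1 where 1: "exec c s t1 s1" "t1 \<le> tm N c * (l + 2)" "bnd l s1" "I (Suc k) s1"
        using less.prems(1) unfolding wp_def by blast
      have "M - Suc k < M - k" "Suc k \<le> M" using kM by auto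
      from less.hyps[OF this(1) 1(3,4) this(2)] obtain t2 s2 where
        2: "exec (While b c) s1 t2 s2" "t2 \<le> ((M - Suc k + 1) * bsz b + (M - Suc k) * tm N c) * (l + 2)"
          "bnd l s2" "Q s2" by blast
      have Mk: "M - k = Suc (M - Suc k)" using kM by simp
      have "bcost b s + t1 + t2 \<le> ((M - k + 1) * bsz b + (M - k) * tm N c) * (l + 2)"
        using bc 1(2) 2(2) unfolding Mk by (simp add: algebra_simps)
      then show ?thesis using exec.WhileTrue[OF True 1(1) 2(1)] 2 by blast
    qed
  qed
  note * = this[of s 0]
  have "((M - 0 + 1) * bsz b + (M - 0) * tm N c) * (l + 2) \<le> tm N (While b c) * (l + 2)"
  proof (intro mult_right_mono)
    show "(M - 0 + 1) * bsz b + (M - 0) * tm N c \<le> tm N (While b c)"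
      unfolding tm.simps diff_zero
      by (rule add_mono; rule mult_right_mono) (use assms(1) in simp_all)
  qed simp
  then show ?thesis unfolding wp_def using * assms(2) le_trans by blast
qed

abbreviation Var :: "string \<Rightarrow> aexp" where "Var x \<equiv> Cell x (Num 0)"
abbreviation Assign :: "string \<Rightarrow> aexp \<Rightarrow> com" (infix "::=" 61) where "x ::= e \<equiv> Store x (Num 0) e"
abbreviation seq :: "com \<Rightarrow> com \<Rightarrow> com" (infixr ";;" 60) where "c1 ;; c2 \<equiv> Seq c1 c2"

definition For :: "string \<Rightarrow> aexp \<Rightarrow> com \<Rightarrow> com" where
  "For x b c = (x ::= Num 0 ;; While (Less (Var x) b) (c ;; x ::= Plus (Var x) (Num 1)))"

lemma mods_For [simp]: "mods (For x b c) = insert x (mods c)"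
  by (auto simp: For_def)

text \<open>The loop evaluates its bound anew in every round, so \<open>b\<close> must have the
  value \<open>M\<close> in all states of the invariant. Arrays outside \<open>mods c\<close> and
  the counter are passed on unchanged to each obligation.\<close>

lemma wp_For:
  fixes I :: "nat \<Rightarrow> state \<Rightarrow> bool"
  assumes "M \<le> N" "int M \<le> 2 ^ l"
    and init: "I 0 (s(x := (s x)(0 := 0)))"
    and bound: "\<And>k s'. k \<le> M \<Longrightarrow> I k s' \<Longrightarrow> s' x 0 = int k \<Longrightarrow> (\<And>y. y \<noteq> x \<Longrightarrow> y \<notin> mods c \<Longrightarrow> s' y = s y) \<Longrightarrow>
      aval b s' = int M"
    and step: "\<And>k s'. k < M \<Longrightarrow> I k s' \<Longrightarrow> s' x 0 = int k \<Longrightarrow> (\<And>y. y \<noteq> x \<Longrightarrow> y \<notin> mods c \<Longrightarrow> s' y = s y) \<Longrightarrow>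
      wp N l c (\<lambda>s''. s'' x 0 = int k \<and> I (Suc k) (s''(x := (s'' x)(0 := int k + 1)))) s'"
    and final: "\<And>s'. I M s' \<Longrightarrow> s' x 0 = int M \<Longrightarrow> (\<And>y. y \<noteq> x \<Longrightarrow> y \<notin> mods c \<Longrightarrow> s' y = s y) \<Longrightarrow> Q s'"
  shows "wp N l (For x b c) Q s"
  unfolding For_def
proof (intro wp_Seq wp_Store)
  let ?s = "s(x := (s x)(aval (Num 0) s := aval (Num 0) s))"
  define J where "J k s' \<longleftrightarrow> k \<le> M \<and> I k s' \<and> s' x 0 = int k \<and> (\<forall>y. y \<noteq> x \<longrightarrow> y \<notin> mods c \<longrightarrow> s' y = s y)" for k s'
  show "wp N l (While (Less (Var x) b) (c ;; x ::= Plus (Var x) (Num 1))) Q ?s"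
  proof (rule wp_While[where I = J])
    show "M \<le> N" by (rule assms(1))
    show "J 0 ?s" using init by (simp add: J_def)
  next
    fix k s' assume J: "J k s'" and b: "bval (Less (Var x) b) s'"
    then have k: "k < M" using bound[of k s'] by (simp add: J_def)
    have "wp N l c (\<lambda>s''. s'' x 0 = int k \<and> I (Suc k) (s''(x := (s'' x)(0 := int k + 1)))) s'"
      by (rule step) (use J k in \<open>auto simp: J_def\<close>)
    then have "wp N l c (wp N l (x ::= Plus (Var x) (Num 1)) (J (Suc k))) s'"
    proof (rule wp_use)
      fix s'' assume h: "s'' x 0 = int k \<and> I (Suc k) (s''(x := (s'' x)(0 := int k + 1)))"
        and fr: "\<And>y. y \<notin> mods c \<Longrightarrow> s'' y = s' y"
      show "wp N l (x ::= Plus (Var x) (Num 1)) (J (Suc k)) s''"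
      proof (rule wp_Store)
        show "\<bar>aval (Plus (Var x) (Num 1)) s''\<bar> \<le> 2 ^ l" 
        proof -
          have "int k + 1 \<le> 2 ^ l" using k assms(2) by linarith
          then show ?thesis using h by simp
        qed
        show "J (Suc k) (s''(x := (s'' x)(aval (Num 0) s'' := aval (Plus (Var x) (Num 1)) s'')))"
          using h k fr J by (simp add: J_def add.commute)
      qed
    qed
    then show "k < M \<and> wp N l (c ;; x ::= Plus (Var x) (Num 1)) (J (Suc k)) s'"
      using k by (intro conjI wp_Seq)
  next
    fix k s' assume J: "J k s'" and b: "\<not> bval (Less (Var x) b) s'"
    then have "k = M" using bound[of k s'] by (simp add: J_def)
    then show "Q s'" using J final by (simp add: J_def)
  qed
qed simp

section \<open>Continued fractions\<close>

text \<open>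
  Continued fractions on an interval: the loop computes the fraction of smallest denominator in
  \<open>[a/b, c/d]\<close>. While the interval contains no integer, its integer part is split off and the
  reciprocal interval is taken; \<open>p1, p0, q1, q0\<close> hold the linear fractional map leading back.
\<close>

definition cf_loop :: com where
  "cf_loop = While (Less (Var ''c'') (Times (Var ''d'') (Minus (Num 0) (Div (Minus (Num 0) (Var ''a'')) (Var ''b'')))))
    (''f'' ::= Div (Var ''a'') (Var ''b'') ;;
     ''x'' ::= Minus (Var ''c'') (Times (Var ''f'') (Var ''d'')) ;;
     ''y'' ::= Minus (Var ''a'') (Times (Var ''f'') (Var ''b'')) ;;
     ''c'' ::= Var ''b'' ;; ''a'' ::= Var ''d'' ;; ''b'' ::= Var ''x'' ;; ''d'' ::= Var ''y'' ;;
     ''x'' ::= Plus (Times (Var ''p1'') (Var ''f'')) (Var ''p0'') ;;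
     ''p0'' ::= Var ''p1'' ;; ''p1'' ::= Var ''x'' ;;
     ''x'' ::= Plus (Times (Var ''q1'') (Var ''f'')) (Var ''q0'') ;;
     ''q0'' ::= Var ''q1'' ;; ''q1'' ::= Var ''x'')"

section \<open>Invariant and result of the continued fraction loop\<close>

definition inside :: "int \<Rightarrow> int \<Rightarrow> int \<Rightarrow> int \<Rightarrow> int \<Rightarrow> int \<Rightarrow> bool" where
  "inside a b c d p q \<longleftrightarrow> 0 < q \<and> a * q \<le> p * b \<and> p * d \<le> c * q"

text \<open>The linear fractional map with coefficients \<open>p1, p0, q1, q0\<close> matches the
  fractions of the current interval with those of the original one. It sends endpoints to endpoints,
  either in order or exchanged; as all current numbers are positive after the first round, these
  equations bound the coefficients by the input. The last clause is a potential that loses a factor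
  4 per round.\<close>

definition cf_inv :: "int \<Rightarrow> int \<Rightarrow> int \<Rightarrow> int \<Rightarrow> nat \<Rightarrow> nat \<Rightarrow>
    int \<Rightarrow> int \<Rightarrow> int \<Rightarrow> int \<Rightarrow> int \<Rightarrow> int \<Rightarrow> int \<Rightarrow> int \<Rightarrow> bool" where
  "cf_inv A B C D z k a b c d p1 p0 q1 q0 \<longleftrightarrow>
    0 < b \<and> 0 < d \<and> a * d \<le> c * b \<and> 0 \<le> c \<and> 0 \<le> p1 \<and> 0 \<le> p0 \<and> 0 \<le> q1 \<and> 0 \<le> q0 \<and>
    \<bar>a\<bar> \<le> 2 ^ z \<and> b \<le> 2 ^ z \<and> c \<le> 2 ^ z \<and> d \<le> 2 ^ z \<and>
    (\<forall>p q. inside A B C D p q \<longrightarrow> (\<exists>p' q'. inside a b c d p' q' \<and> p = p1 * p' + p0 * q' \<and> q = q1 * p' + q0 * q')) \<and>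
    (\<forall>p' q'. inside a b c d p' q' \<longrightarrow> inside A B C D (p1 * p' + p0 * q') (q1 * p' + q0 * q')) \<and>
    (A = p1 * a + p0 * b \<and> B = q1 * a + q0 * b \<and> C = p1 * c + p0 * d \<and> D = q1 * c + q0 * d \<or>
     A = p1 * c + p0 * d \<and> B = q1 * c + q0 * d \<and> C = p1 * a + p0 * b \<and> D = q1 * a + q0 * b) \<and>
    (if k = 0 then p1 = 1 \<and> p0 = 0 \<and> q1 = 0 \<and> q0 = 1
     else b < a \<and> d \<le> c \<and> 4 ^ (k - 1) * ((a * b) * (c * d)) \<le> 2 ^ (4 * z))"

text \<open>For positive \<open>b\<close>, the ceiling of \<open>a / b\<close>.\<close>

definition cl :: "int \<Rightarrow> int \<Rightarrow> int" where "cl a b = - ((- a) div b)"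

lemma cl_le: "0 < b \<Longrightarrow> a \<le> b * cl a b"
proof -
  assume b: "0 < b"
  have "(- a) div b * b + (- a) mod b = - a" by (rule div_mult_mod_eq)
  moreover have "0 \<le> (- a) mod b" using b by (rule pos_mod_sign)
  ultimately have "(- a) div b * b \<le> - a" by linarith
  then show ?thesis by (simp add: cl_def mult.commute)
qed

lemma cl_least: "0 < b \<Longrightarrow> a \<le> b * p \<Longrightarrow> cl a b \<le> p"
proof -
  assume b: "0 < b" and p: "a \<le> b * p"
  have "((- p) * b) div b \<le> (- a) div b" using p b by (intro zdiv_mono1) (auto simp: algebra_simps)
  moreover have "((- p) * b) div b = - p" using b by (intro nonzero_mult_div_cancel_right) simp
  ultimately show ?thesis unfolding cl_def by linarith
qed

lemma inside_scale_num:
  assumes "inside a b c d p q" "0 < b" "0 \<le> a"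
  shows "cl a b \<le> p"
proof (rule cl_least[OF assms(2)])
  have "a * 1 \<le> a * q" using assms by (intro mult_left_mono) (auto simp: inside_def)
  then show "a \<le> b * p" using assms(1) by (simp add: inside_def algebra_simps)
qed

text \<open>Without an integer in the interval both endpoints lie strictly between \<open>f\<close>
  and \<open>f + 1\<close>; subtracting \<open>f\<close> and inverting exchanges them. From the
  second round on \<open>f\<close> is at least 1, so the remainders are at most half of
  \<open>a\<close> and \<open>c\<close>, which gives the factor 4.\<close>

lemma cf_step:
  assumes I: "cf_inv A B C D z k a b c d p1 p0 q1 q0" and loop: "c < d * cl a b"
  defines "f \<equiv> a div b"
  shows "cf_inv A B C D z (Suc k) d (c - f * d) b (a - f * b) (p1 * f + p0) p1 (q1 * f + q0) q1"
    "0 < a" "0 \<le> f"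
proof -
  have b: "0 < b" and d: "0 < d" and ad: "a * d \<le> c * b" and c: "0 \<le> c"
    and nn: "0 \<le> p1" "0 \<le> p0" "0 \<le> q1" "0 \<le> q0"
    and sz: "\<bar>a\<bar> \<le> 2 ^ z" "b \<le> 2 ^ z" "c \<le> 2 ^ z" "d \<le> 2 ^ z"
    and fw: "\<And>p q. inside A B C D p q \<Longrightarrow> \<exists>p' q'. inside a b c d p' q' \<and> p = p1 * p' + p0 * q' \<and> q = q1 * p' + q0 * q'"
    and bw: "\<And>p' q'. inside a b c d p' q' \<Longrightarrow> inside A B C D (p1 * p' + p0 * q') (q1 * p' + q0 * q')"
    and par: "A = p1 * a + p0 * b \<and> B = q1 * a + q0 * b \<and> C = p1 * c + p0 * d \<and> D = q1 * c + q0 * d \<or>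
     A = p1 * c + p0 * d \<and> B = q1 * c + q0 * d \<and> C = p1 * a + p0 * b \<and> D = q1 * a + q0 * b"
    and k: "if k = 0 then p1 = 1 \<and> p0 = 0 \<and> q1 = 0 \<and> q0 = 1
     else b < a \<and> d \<le> c \<and> 4 ^ (k - 1) * ((a * b) * (c * d)) \<le> 2 ^ (4 * z)"
    using I unfolding cf_inv_def by blast+
  have "0 < d * cl a b" using loop c by simp
  then have clp: "1 \<le> cl a b" using d by (simp add: zero_less_mult_iff)
  show a: "0 < a"
  proof (rule ccontr)
    assume "\<not> 0 < a"
    then have "cl a b \<le> 0" using b by (intro cl_least) auto
    then show False using clp by simp
  qed
  show f: "0 \<le> f" using a b by (simp add: f_def pos_imp_zdiv_nonneg_iff)
  define x where "x = c - f * d"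
  define y where "y = a - f * b"
  have y: "y = a mod b" by (simp add: y_def f_def minus_div_mult_eq_mod)
  have cl1: "cl a b \<le> f + 1"
  proof (rule cl_least[OF b])
    have "a mod b < b" using b by simp
    then show "a \<le> b * (f + 1)" using y by (simp add: y_def algebra_simps)
  qed
  have y0: "0 < y"
  proof (rule ccontr)
    assume "\<not> 0 < y"
    moreover have "0 \<le> y" unfolding y using b by (rule pos_mod_sign)
    ultimately have "a = f * b" by (simp add: y_def)
    then have "cl a b \<le> f" by (intro cl_least[OF b]) (simp add: mult.commute)
    then have "d * cl a b \<le> d * f" using d by (intro mult_left_mono) auto
    then have "c * b < d * f * b" using loop b by simp
    then show False using ad \<open>a = f * b\<close> by (simp add: algebra_simps)
  qed
  have yb: "y < b" using y b by simp
  have x0: "0 < x"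
  proof -
    have "f * b * d < a * d" using y0 d by (simp add: y_def)
    then have "f * d * b < c * b" using ad by (simp add: algebra_simps)
    then have "f * d < c" using b by simp
    then show ?thesis by (simp add: x_def)
  qed
  have xd: "x < d"
  proof -
    have "d * cl a b \<le> d * (f + 1)" using cl1 d by (intro mult_left_mono) auto
    then show ?thesis using loop by (simp add: x_def algebra_simps)
  qed
  have tr: "inside a b c d p q \<longleftrightarrow> inside d x b y q (p - f * q)" if "0 < q \<or> 0 < p - f * q" for p q
  proof
    assume h: "inside a b c d p q"
    then have q: "0 < q" "a * q \<le> p * b" "p * d \<le> c * q" by (auto simp: inside_def)
    have "0 < y * q" using y0 q(1) by simp
    then have "f * q * b < p * b" using q(2) by (simp add: y_def algebra_simps)
    then have "0 < p - f * q" using b by simp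
    then show "inside d x b y q (p - f * q)" using q by (simp add: inside_def x_def y_def algebra_simps)
  next
    assume h: "inside d x b y q (p - f * q)"
    then have r: "0 < p - f * q" "d * (p - f * q) \<le> q * x" by (auto simp: inside_def)
    have "0 < q * x" using r d by (metis less_le_trans mult_pos_pos)
    then have "0 < q" using x0 by (simp add: zero_less_mult_iff)
    then show "inside a b c d p q" using h by (simp add: inside_def x_def y_def algebra_simps)
  qed
  have fw': "\<exists>p' q'. inside d x b y p' q' \<and> p = (p1 * f + p0) * p' + p1 * q' \<and> q = (q1 * f + q0) * p' + q1 * q'"
    if "inside A B C D p q" for p q
  proof -
    obtain p' q' where h: "inside a b c d p' q'" "p = p1 * p' + p0 * q'" "q = q1 * p' + q0 * q'"
      using fw[OF \<open>inside A B C D p q\<close>] by blast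
    then have "inside d x b y q' (p' - f * q')" using tr[of q' p'] by (simp add: inside_def)
    then show ?thesis using h(2,3) by (intro exI[of _ q'] exI[of _ "p' - f * q'"]) (simp add: algebra_simps)
  qed
  have bw': "inside A B C D ((p1 * f + p0) * p' + p1 * q') ((q1 * f + q0) * p' + q1 * q')"
    if "inside d x b y p' q'" for p' q'
  proof -
    have "inside a b c d (q' + f * p') p'" using tr[of p' "q' + f * p'"] that by (simp add: inside_def)
    from bw[OF this] show ?thesis by (simp add: algebra_simps)
  qed
  have par': "A = (p1 * f + p0) * d + p1 * x \<and> B = (q1 * f + q0) * d + q1 * x \<and> C = (p1 * f + p0) * b + p1 * y \<and> D = (q1 * f + q0) * b + q1 * y \<or>
     A = (p1 * f + p0) * b + p1 * y \<and> B = (q1 * f + q0) * b + q1 * y \<and> C = (p1 * f + p0) * d + p1 * x \<and> D = (q1 * f + q0) * d + q1 * x"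
  proof -
    have "(p1 * f + p0) * d + p1 * x = p1 * c + p0 * d" "(q1 * f + q0) * d + q1 * x = q1 * c + q0 * d"
      "(p1 * f + p0) * b + p1 * y = p1 * a + p0 * b" "(q1 * f + q0) * b + q1 * y = q1 * a + q0 * b"
      by (simp_all add: x_def y_def algebra_simps)
    then show ?thesis using par by presburger
  qed
  have pot: "4 ^ k * ((d * x) * (b * y)) \<le> 2 ^ (4 * z)"
  proof (cases "k = 0")
    case True
    have "(d * x) * (b * y) \<le> (2 ^ z * 2 ^ z) * (2 ^ z * 2 ^ z)"
      using sz x0 y0 xd yb b d by (intro mult_mono) auto
    also have "\<dots> = (2::int) ^ (4 * z)" by (simp add: power_add[symmetric])
    finally show ?thesis using True by simp
  next
    case False
    then have h: "b < a" "d \<le> c" "4 ^ (k - 1) * ((a * b) * (c * d)) \<le> 2 ^ (4 * z)" using k by auto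
    have "b div b \<le> a div b" using h(1) b by (intro zdiv_mono1) auto
    then have f1: "1 \<le> f" using b by (simp add: f_def)
    have "b * 1 \<le> b * f" using b f1 by (intro mult_left_mono) auto
    then have "2 * y \<le> a" using yb by (simp add: y_def algebra_simps)
    moreover have "d * 1 \<le> d * f" using d f1 by (intro mult_left_mono) auto
    then have "2 * x \<le> c" using xd by (simp add: x_def algebra_simps)
    ultimately have "(d * (2 * x)) * (b * (2 * y)) \<le> (d * c) * (b * a)"
      using x0 y0 b d by (intro mult_mono) auto
    then have "4 * ((d * x) * (b * y)) \<le> (a * b) * (c * d)" by (simp add: algebra_simps)
    then have "4 ^ (k - 1) * (4 * ((d * x) * (b * y))) \<le> 4 ^ (k - 1) * ((a * b) * (c * d))"
      by (intro mult_left_mono) auto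
    moreover have "(4::int) ^ k * ((d * x) * (b * y)) = 4 ^ (k - 1) * (4 * ((d * x) * (b * y)))"
      using False by (cases k) auto
    ultimately show ?thesis using h(3) by linarith
  qed
  have "d * y \<le> b * x" using ad by (simp add: x_def y_def algebra_simps)
  moreover have "0 \<le> p1 * f + p0" "0 \<le> q1 * f + q0" using nn f by auto
  ultimately show "cf_inv A B C D z (Suc k) d (c - f * d) b (a - f * b) (p1 * f + p0) p1 (q1 * f + q0) q1"
    unfolding x_def[symmetric] y_def[symmetric] cf_inv_def
    using x0 y0 xd yb b d nn sz fw' bw' par' pot by (intro conjI) (auto simp: mult.commute)
qed

lemma cf_inv_D:
  assumes "cf_inv A B C D z k a b c d p1 p0 q1 q0"
  shows "0 < b" "0 < d" "a * d \<le> c * b" "0 \<le> c" "0 \<le> p1" "0 \<le> p0" "0 \<le> q1" "0 \<le> q0"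
    "\<bar>a\<bar> \<le> 2 ^ z" "b \<le> 2 ^ z" "c \<le> 2 ^ z" "d \<le> 2 ^ z"
    "\<And>p q. inside A B C D p q \<Longrightarrow> \<exists>p' q'. inside a b c d p' q' \<and> p = p1 * p' + p0 * q' \<and> q = q1 * p' + q0 * q'"
    "\<And>p' q'. inside a b c d p' q' \<Longrightarrow> inside A B C D (p1 * p' + p0 * q') (q1 * p' + q0 * q')"
    "A = p1 * a + p0 * b \<and> B = q1 * a + q0 * b \<and> C = p1 * c + p0 * d \<and> D = q1 * c + q0 * d \<or>
     A = p1 * c + p0 * d \<and> B = q1 * c + q0 * d \<and> C = p1 * a + p0 * b \<and> D = q1 * a + q0 * b"
    "if k = 0 then p1 = 1 \<and> p0 = 0 \<and> q1 = 0 \<and> q0 = 1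
     else b < a \<and> d \<le> c \<and> 4 ^ (k - 1) * ((a * b) * (c * d)) \<le> 2 ^ (4 * z)"
  using assms unfolding cf_inv_def by blast+

text \<open>After the first round the four numbers are positive integers, so
  \<open>4 ^ (k - 1)\<close> alone is below the initial potential.\<close>

lemma cf_rounds:
  assumes "cf_inv A B C D z k a b c d p1 p0 q1 q0"
  shows "k < 2 * z + 2"
proof (cases "k = 0")
  case False
  note I = cf_inv_D[OF assms]
  have h: "b < a" "d \<le> c" "4 ^ (k - 1) * ((a * b) * (c * d)) \<le> 2 ^ (4 * z)" using I(16) False by auto
  have "0 < (a * b) * (c * d)" using h I(1,2) by (intro mult_pos_pos) auto
  then have "(4::int) ^ (k - 1) * 1 \<le> 4 ^ (k - 1) * ((a * b) * (c * d))" by (intro mult_left_mono) auto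
  moreover have "(4::int) ^ (k - 1) = 2 ^ (2 * (k - 1))" by (simp add: power_mult)
  ultimately have "(2::int) ^ (2 * (k - 1)) \<le> 2 ^ (4 * z)" using h(3) by linarith
  then have "2 * (k - 1) \<le> 4 * z" by (subst (asm) power_increasing_iff) auto
  then show ?thesis by simp
qed simp

text \<open>Each original number is \<open>p1 * x + p0 * y\<close> or \<open>q1 * x + q0 * y\<close>
  with current \<open>x\<close> and \<open>y\<close> at least 1, so the coefficients cannot outgrow
  the input.\<close>

lemma cf_bounds:
  assumes "cf_inv A B C D z k a b c d p1 p0 q1 q0"
    and "\<bar>A\<bar> \<le> 2 ^ z" "B \<le> 2 ^ z" "C \<le> 2 ^ z" "D \<le> 2 ^ z"
  shows "p1 \<le> 2 ^ z" "p0 \<le> 2 ^ z" "q1 \<le> 2 ^ z" "q0 \<le> 2 ^ z"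
proof -
  note I = cf_inv_D[OF assms(1)]
  have "p1 \<le> 2 ^ z \<and> p0 \<le> 2 ^ z \<and> q1 \<le> 2 ^ z \<and> q0 \<le> 2 ^ z"
  proof (cases "k = 0")
    case True
    then show ?thesis using I(16) by auto
  next
    case False
    have pos: "1 \<le> a" "1 \<le> b" "1 \<le> c" "1 \<le> d" using I(1,2,16) False by auto
    have mono: "p * 1 + q * 1 \<le> p * x + q * y" if "0 \<le> p" "0 \<le> q" "1 \<le> x" "1 \<le> y" for p q x y :: int
      using that by (intro add_mono mult_left_mono) auto
    have "p1 + p0 \<le> 2 ^ z"
      using mono[OF I(5,6) pos(1,2)] I(15) assms(2,4) by linarith
    moreover have "q1 + q0 \<le> 2 ^ z"
      using mono[OF I(7,8) pos(1,2)] I(15) assms(3,5) by linarith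
    ultimately show ?thesis using I(5-8) by linarith
  qed
  then show "p1 \<le> 2 ^ z" "p0 \<le> 2 ^ z" "q1 \<le> 2 ^ z" "q0 \<le> 2 ^ z" by auto
qed

text \<open>The loop stops at the least integer of its interval, whose image has the smallest
  denominator in the original interval. Two different fractions with denominators at most
  \<open>Q\<close> differ by at least \<open>1 / Q\<^sup>2\<close>, which is more than the interval
  allows, so the image is the target. A common factor would yield a smaller denominator.\<close>

lemma cf_result:
  assumes I: "cf_inv A B C D z k a b c d p1 p0 q1 q0" and stop: "\<not> c < d * cl a b"
    and target: "inside A B C D P Q" "(C * B - A * D) * Q\<^sup>2 < B * D" and BD: "0 < B" "0 < D"
  defines "p \<equiv> p1 * cl a b + p0" and "q \<equiv> q1 * cl a b + q0"
  shows "0 < q" "p * Q = P * q" "coprime p q"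
proof -
  note I' = cf_inv_D[OF I]
  have "inside a b c d (cl a b) 1"
    using stop cl_le[OF I'(1), of a] by (simp add: inside_def mult.commute)
  from I'(14)[OF this] have ins: "inside A B C D p q" by (simp add: p_def q_def)
  then show q: "0 < q" by (simp add: inside_def)
  have min: "q \<le> q'" if "inside A B C D p' q'" for p' q'
  proof -
    from I'(13)[OF that] obtain x y where xy: "inside a b c d x y" "q' = q1 * x + q0 * y" by blast
    have y: "1 \<le> y" using xy(1) by (simp add: inside_def)
    have "q1 * cl a b \<le> q1 * x"
    \<comment> \<open>Before the first round \<open>a\<close> may be negative, but then
      \<open>q1 = 0\<close>; afterwards \<open>a\<close> is positive and the ceiling is a lower
      bound for all numerators.\<close>
    proof (cases "k = 0")
      case False
      then have "0 \<le> a" using I'(1,16) by auto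
      from inside_scale_num[OF xy(1) I'(1) this] show ?thesis using I'(7) by (intro mult_left_mono)
    qed (use I'(16) in simp)
    moreover have "q0 * 1 \<le> q0 * y" using I'(8) y by (intro mult_left_mono)
    ultimately show ?thesis unfolding q_def xy(2) by linarith
  qed
  have Q: "0 < Q" "q \<le> Q" using target(1) min by (auto simp: inside_def)
  have key: "(p * Q - P * q) * (B * D) \<le> (C * B - A * D) * (Q * q)"
    if h: "inside A B C D p q" "inside A B C D P Q" for p q P Q
  proof -
    have "p * D \<le> C * q" "A * Q \<le> P * B" "0 < q" "0 < Q" using h by (auto simp: inside_def)
    then have "p * D * (B * Q) \<le> C * q * (B * Q)" "A * Q * (D * q) \<le> P * B * (D * q)"
      using BD by (auto intro!: mult_right_mono)
    then show ?thesis by (simp add: algebra_simps)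
  qed
  have le0: "x \<le> 0" if "x * (B * D) \<le> (C * B - A * D) * (Q * q)" for x
  proof (rule ccontr)
    assume "\<not> x \<le> 0"
    then have "1 * (B * D) \<le> x * (B * D)" using BD by (intro mult_right_mono) auto
    then have 1: "B * D \<le> (C * B - A * D) * (Q * q)" using that by simp
    then have "0 < (C * B - A * D) * (Q * q)" using BD by (meson less_le_trans mult_pos_pos)
    moreover have "0 < Q * q" using Q(1) q by (rule mult_pos_pos)
    ultimately have "0 < C * B - A * D" by (rule zero_less_mult_pos2)
    then have "(C * B - A * D) * (Q * q) \<le> (C * B - A * D) * (Q * Q)"
      using Q by (intro mult_left_mono) auto
    then show False using 1 target(2) by (simp add: power2_eq_square)
  qed
  have "p * Q - P * q \<le> 0" by (rule le0[OF key[OF ins target(1)]])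
  moreover have "P * q - p * Q \<le> 0" by (rule le0) (use key[OF target(1) ins] in \<open>simp add: mult.commute\<close>)
  ultimately show "p * Q = P * q" by simp
  show "coprime p q"
  proof (rule coprimeI)
    fix g assume g: "g dvd p" "g dvd q"
    define h where "h = \<bar>g\<bar>"
    have h: "h dvd p" "h dvd q" using g by (auto simp: h_def)
    obtain p' q' where pq: "p = h * p'" "q = h * q'" using h by (metis dvdE)
    have h0: "0 < h" using q g by (auto simp: h_def)
    have q': "0 < q'" using q h0 pq(2) by (simp add: zero_less_mult_iff)
    have "inside A B C D p' q'"
    proof -
      have "h * (A * q') \<le> h * (p' * B)" "h * (p' * D) \<le> h * (C * q')"
        using ins by (simp_all add: inside_def pq mult_ac)
      then show ?thesis using h0 q' by (simp add: inside_def)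
    qed
    then have "h * q' \<le> 1 * q'" using min pq(2) by simp
    then have "h \<le> 1" using q' by (simp only: mult_le_cancel_right)
    then have "h = 1" using h0 by simp
    then show "is_unit g" by (simp add: h_def)
  qed
qed

lemma wp_cf_loop:
  assumes init: "s ''a'' 0 = A" "s ''b'' 0 = B" "s ''c'' 0 = C" "s ''d'' 0 = D"
      "s ''p1'' 0 = 1" "s ''p0'' 0 = 0" "s ''q1'' 0 = 0" "s ''q0'' 0 = 1"
    and ABCD: "0 < B" "0 < D" "0 \<le> C" "A * D \<le> C * B"
    and sz: "\<bar>A\<bar> \<le> 2 ^ z" "B \<le> 2 ^ z" "C \<le> 2 ^ z" "D \<le> 2 ^ z" and zl: "z \<le> l" "2 * z + 2 \<le> N"
    and post: "\<And>s' k. cf_inv A B C D z k (s' ''a'' 0) (s' ''b'' 0) (s' ''c'' 0) (s' ''d'' 0)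
        (s' ''p1'' 0) (s' ''p0'' 0) (s' ''q1'' 0) (s' ''q0'' 0) \<Longrightarrow>
      \<not> s' ''c'' 0 < s' ''d'' 0 * cl (s' ''a'' 0) (s' ''b'' 0) \<Longrightarrow> Q s'"
  shows "wp N l cf_loop Q s"
  unfolding cf_loop_def
proof (rule wp_While[where I = "\<lambda>k s'. cf_inv A B C D z k (s' ''a'' 0) (s' ''b'' 0) (s' ''c'' 0) (s' ''d'' 0)
        (s' ''p1'' 0) (s' ''p0'' 0) (s' ''q1'' 0) (s' ''q0'' 0)", OF zl(2)])
  show "cf_inv A B C D z 0 (s ''a'' 0) (s ''b'' 0) (s ''c'' 0) (s ''d'' 0) (s ''p1'' 0) (s ''p0'' 0) (s ''q1'' 0) (s ''q0'' 0)"
    unfolding init cf_inv_def using ABCD sz by simp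
next
  fix k s'
  assume I: "cf_inv A B C D z k (s' ''a'' 0) (s' ''b'' 0) (s' ''c'' 0) (s' ''d'' 0)
        (s' ''p1'' 0) (s' ''p0'' 0) (s' ''q1'' 0) (s' ''q0'' 0)"
    and b: "bval (Less (Var ''c'') (Times (Var ''d'') (Minus (Num 0) (Div (Minus (Num 0) (Var ''a'')) (Var ''b''))))) s'"
  have lt: "s' ''c'' 0 < s' ''d'' 0 * cl (s' ''a'' 0) (s' ''b'' 0)" using b by (simp add: cl_def)
  note J = cf_step[OF I lt]
  have zz: "(2::int) ^ z \<le> 2 ^ l" using zl(1) by (intro power_increasing) auto
  define f where "f = s' ''a'' 0 div s' ''b'' 0"
  note J' = J(1)[folded f_def]
  have bd: "\<bar>f\<bar> \<le> 2 ^ l" unfolding f_def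
    using abs_div_le_abs[of "s' ''a'' 0" "s' ''b'' 0"] cf_inv_D(9)[OF I] zz by linarith
  have bds: "\<bar>s' ''c'' 0 - f * s' ''d'' 0\<bar> \<le> 2 ^ l" "\<bar>s' ''a'' 0 - f * s' ''b'' 0\<bar> \<le> 2 ^ l"
    "\<bar>s' ''b'' 0\<bar> \<le> 2 ^ l" "\<bar>s' ''d'' 0\<bar> \<le> 2 ^ l"
    "\<bar>s' ''p1'' 0 * f + s' ''p0'' 0\<bar> \<le> 2 ^ l" "\<bar>s' ''p1'' 0\<bar> \<le> 2 ^ l"
    "\<bar>s' ''q1'' 0 * f + s' ''q0'' 0\<bar> \<le> 2 ^ l" "\<bar>s' ''q1'' 0\<bar> \<le> 2 ^ l"
    using cf_bounds[OF J' sz] cf_inv_D(5-8)[OF J'] cf_inv_D(1,2,4,9-12)[OF J'] zz by linarith+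
  show "k < 2 * z + 2 \<and> wp N l (''f'' ::= Div (Var ''a'') (Var ''b'') ;;
     ''x'' ::= Minus (Var ''c'') (Times (Var ''f'') (Var ''d'')) ;;
     ''y'' ::= Minus (Var ''a'') (Times (Var ''f'') (Var ''b'')) ;;
     ''c'' ::= Var ''b'' ;; ''a'' ::= Var ''d'' ;; ''b'' ::= Var ''x'' ;; ''d'' ::= Var ''y'' ;;
     ''x'' ::= Plus (Times (Var ''p1'') (Var ''f'')) (Var ''p0'') ;;
     ''p0'' ::= Var ''p1'' ;; ''p1'' ::= Var ''x'' ;;
     ''x'' ::= Plus (Times (Var ''q1'') (Var ''f'')) (Var ''q0'') ;;
     ''q0'' ::= Var ''q1'' ;; ''q1'' ::= Var ''x'')
     (\<lambda>s'. cf_inv A B C D z (Suc k) (s' ''a'' 0) (s' ''b'' 0) (s' ''c'' 0) (s' ''d'' 0)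
        (s' ''p1'' 0) (s' ''p0'' 0) (s' ''q1'' 0) (s' ''q0'' 0)) s'"
    apply (rule conjI[OF cf_rounds[OF I]])
    apply (rule wp_Seq, rule wp_Store, simp add: f_def[symmetric] bd bds, simp add: f_def[symmetric])+
    apply (rule wp_Store, simp add: bds, simp add: J')
    done
next
  fix k s'
  assume "cf_inv A B C D z k (s' ''a'' 0) (s' ''b'' 0) (s' ''c'' 0) (s' ''d'' 0)
        (s' ''p1'' 0) (s' ''p0'' 0) (s' ''q1'' 0) (s' ''q0'' 0)"
    "\<not> bval (Less (Var ''c'') (Times (Var ''d'') (Minus (Num 0) (Div (Minus (Num 0) (Var ''a'')) (Var ''b''))))) s'"
  then show "Q s'" by (intro post) (auto simp: cl_def)
qed

lemma cf_output_bounds: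
  assumes I: "cf_inv A B C D z k a b c d p1 p0 q1 q0" and stop: "\<not> c < d * cl a b"
    and sz: "\<bar>A\<bar> \<le> 2 ^ z" "B \<le> 2 ^ z" "C \<le> 2 ^ z" "D \<le> 2 ^ z"
  shows "\<bar>p1 * cl a b + p0\<bar> \<le> 2 ^ z" "\<bar>q1 * cl a b + q0\<bar> \<le> 2 ^ z" "\<bar>cl a b\<bar> \<le> 2 ^ z"
proof -
  note I' = cf_inv_D[OF I]
  show cl: "\<bar>cl a b\<bar> \<le> 2 ^ z" using abs_div_le_abs[of "- a" b] I'(9) by (simp add: cl_def)
  have "\<bar>p1 * cl a b + p0\<bar> \<le> 2 ^ z \<and> \<bar>q1 * cl a b + q0\<bar> \<le> 2 ^ z"
  proof (cases "k = 0")
    case True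
    then show ?thesis using I'(16) cl by simp
  next
    case False
    then have "0 < a" using I'(1,16) by auto
    moreover have "a \<le> b * cl a b" by (rule cl_le[OF I'(1)])
    ultimately have "0 < b * cl a b" by simp
    then have r: "0 < cl a b" using I'(1) by (simp add: zero_less_mult_iff)
    have *: "p * cl a b + q \<le> p * c + q * d" if "0 \<le> p" "0 \<le> q" for p q
    proof -
      have "1 * cl a b \<le> d * cl a b" using r I'(2) by (intro mult_right_mono) auto
      then have "cl a b \<le> c" using stop by simp
      then have "p * cl a b \<le> p * c" using that by (intro mult_left_mono) auto
      moreover have "q * 1 \<le> q * d" using that I'(2) by (intro mult_left_mono) auto
      ultimately show ?thesis by simp
    qed
    have nn: "0 \<le> p1 * cl a b + p0" "0 \<le> q1 * cl a b + q0" using r I'(5-8) by auto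
    have "p1 * c + p0 * d \<le> 2 ^ z" "q1 * c + q0 * d \<le> 2 ^ z" using I'(15) sz by linarith+
    then show ?thesis using *[OF I'(5,6)] *[OF I'(7,8)] nn by linarith
  qed
  then show "\<bar>p1 * cl a b + p0\<bar> \<le> 2 ^ z" "\<bar>q1 * cl a b + q0\<bar> \<le> 2 ^ z" by auto
qed

section \<open>Blocks of the production-distribution game\<close>

lemma ex_digits:
  fixes k :: "nat \<Rightarrow> nat"
  assumes "\<And>h. h < m \<Longrightarrow> k h < n"
  shows "\<exists>t<n ^ m. \<forall>h<m. (t div n ^ h) mod n = k h"
  using assms
proof (induction m arbitrary: k)
  case 0
  then show ?case by auto
next
  case (Suc m)
  have k: "k (Suc h) < n" if "h < m" for h using Suc.prems that by simp
  obtain t where t: "t < n ^ m" "\<And>h. h < m \<Longrightarrow> (t div n ^ h) mod n = k (Suc h)"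
    using Suc.IH[of "\<lambda>h. k (Suc h)"] k by blast
  have k0: "k 0 < n" using Suc.prems by simp
  define t' where "t' = k 0 + n * t"
  have "t' < n * (t + 1)" using k0 by (simp add: t'_def algebra_simps)
  also have "\<dots> \<le> n * n ^ m" using t(1) by (intro mult_left_mono) auto
  finally have "t' < n ^ Suc m" by simp
  moreover have "(t' div n ^ h) mod n = k h" if "h < Suc m" for h
  proof (cases h)
    case 0
    then show ?thesis using k0 by (simp add: t'_def)
  next
    case (Suc h')
    have "t' div n ^ h = (t' div n) div n ^ h'" unfolding Suc by (simp add: div_mult2_eq)
    also have "t' div n = t" using k0 by (simp add: t'_def)
    finally show ?thesis using t(2) that Suc by simp
  qed
  ultimately show ?case by blast
qed

locale pd_data =
  fixes n m :: nat and ai bi :: "nat \<Rightarrow> nat \<Rightarrow> int" and al dl :: "nat \<Rightarrow> nat \<Rightarrow> real"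
  assumes n1: "1 \<le> n" and m1: "1 \<le> m"
    and ai: "\<And>i j. i < n \<Longrightarrow> j < m \<Longrightarrow> 0 \<le> ai i j" and bi: "\<And>i j. i < n \<Longrightarrow> j < m \<Longrightarrow> 0 \<le> bi i j"
    and al: "\<And>i j. i < n \<Longrightarrow> j < m \<Longrightarrow> al (Suc i) (Suc j) = real_of_int (ai i j)"
    and dl: "\<And>i j. i < n \<Longrightarrow> j < m \<Longrightarrow> dl (Suc i) (Suc j) = real_of_int (bi i j)"
begin

definition v :: "nat set \<Rightarrow> real" where "v = pd_game m al dl"

text \<open>
  A row \<open>t < n ^ m\<close> names one player per market by the base-\<open>n\<close> digits of \<open>t\<close>; on the coalitions that
  contain these players and only players whose profits do not exceed theirs, the game is additive.
  In \<open>St\<close> the values 1, 2, 0 stand for named, admissible and excluded players. The block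
  \<open>b = 2 * (t * n + i) + r\<close> consists of the coalitions of row \<open>t\<close>, those with \<open>i\<close> for \<open>r = 1\<close> and those
  without \<open>i\<close> for \<open>r = 0\<close> (if \<open>i\<close> is admissible but not named). Players and markets count from 0 here.
\<close>

definition dig :: "nat \<Rightarrow> nat \<Rightarrow> nat" where "dig t h = (t div n ^ h) mod n"
definition pm :: "nat \<Rightarrow> nat \<Rightarrow> int" where "pm t j = Max ((\<lambda>h. ai (dig t h) j) ` {..<m})"
definition inT :: "nat \<Rightarrow> nat \<Rightarrow> bool" where "inT t l \<longleftrightarrow> (\<exists>h<m. dig t h = l)"
definition inD :: "nat \<Rightarrow> nat \<Rightarrow> bool" where "inD t l \<longleftrightarrow> (\<forall>j<m. ai l j \<le> pm t j)"
definition Cc :: "nat \<Rightarrow> nat \<Rightarrow> int" where "Cc t l = (\<Sum>j<m. pm t j * bi l j)"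
definition St :: "nat \<Rightarrow> nat \<Rightarrow> int" where "St t l = (if inT t l then 1 else if inD t l then 2 else 0)"
definition Rn :: nat where "Rn = n ^ m"
definition KK :: nat where "KK = 2 * n * Rn"

definition row :: "nat \<Rightarrow> nat" where "row b = b div (2 * n)"
definition pl :: "nat \<Rightarrow> nat" where "pl b = (b div 2) mod n"
definition bit :: "nat \<Rightarrow> nat" where "bit b = b mod 2"

definition blk :: "nat \<Rightarrow> nat set set" where
  "blk b = {S. S \<subseteq> {1..n} \<and> (\<forall>l<n. (inT (row b) l \<longrightarrow> Suc l \<in> S) \<and> (Suc l \<in> S \<longrightarrow> inD (row b) l) \<and>
     (l = pl b \<and> \<not> inT (row b) l \<and> inD (row b) l \<longrightarrow> (Suc l \<in> S \<longleftrightarrow> bit b = 1)))}"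

definition wt :: "(nat \<Rightarrow> real) \<Rightarrow> nat \<Rightarrow> nat \<Rightarrow> real" where "wt x t l = x (Suc l) - Cc t l"

text \<open>On a row the excess is a sum of weights, so it is minimized player by player: named
  players are forced in, an unnamed admissible \<open>i\<close> is forced by \<open>r\<close>, and
  any other admissible player joins exactly if this lowers the sum.\<close>

definition Hf :: "(nat \<Rightarrow> real) \<Rightarrow> nat \<Rightarrow> nat \<Rightarrow> nat \<Rightarrow> real" where
  "Hf x t i r = (\<Sum>l<n. if inT t l then wt x t l else if inD t l then
     (if l = i then (if r = 1 then wt x t l else 0) else min 0 (wt x t l)) else 0)"

section \<open>Additivity on a row and the least excess of a block\<close>

lemma dig_less: "dig t h < n"
  using n1 by (simp add: dig_def)

lemma inT_dig: "h < m \<Longrightarrow> inT t (dig t h)"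
  by (auto simp: inT_def)

lemma pm_ge: "h < m \<Longrightarrow> ai (dig t h) j \<le> pm t j"
  by (simp add: pm_def)

lemma pm_attained: "\<exists>h<m. pm t j = ai (dig t h) j"
proof -
  have "pm t j \<in> (\<lambda>h. ai (dig t h) j) ` {..<m}" unfolding pm_def using m1 by (intro Max_in) (auto simp: lessThan_empty_iff)
  then show ?thesis by auto
qed

lemma pm_nonneg: "j < m \<Longrightarrow> 0 \<le> pm t j"
  using pm_attained[of t j] ai[OF dig_less] by auto

lemma inT_inD: "inT t l \<Longrightarrow> inD t l"
  using pm_ge by (auto simp: inT_def inD_def)

lemma Cc_nonneg: "l < n \<Longrightarrow> 0 \<le> Cc t l"
  unfolding Cc_def by (intro sum_nonneg mult_nonneg_nonneg pm_nonneg bi) auto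

lemma sum_coalition:
  fixes f :: "nat \<Rightarrow> real"
  assumes "S \<subseteq> {1..n}"
  shows "sum f S = (\<Sum>l<n. if Suc l \<in> S then f (Suc l) else 0)"
proof -
  have "sum f S = (\<Sum>i\<in>{1..n}. if i \<in> S then f i else 0)"
    using assms by (simp add: sum.inter_restrict[symmetric] Int_absorb1)
  then show ?thesis by (simp add: sum.atLeast1_atMost_eq)
qed

text \<open>The named players attain the market maxima \<open>pm t j\<close> and admissibility keeps
  all others from exceeding them, so a player contributes \<open>Cc t\<close> whatever the rest of
  the coalition is.\<close>

lemma v_eq:
  assumes S: "S \<subseteq> {1..n}" and T: "\<And>l. l < n \<Longrightarrow> inT t l \<Longrightarrow> Suc l \<in> S"
    and D: "\<And>l. l < n \<Longrightarrow> Suc l \<in> S \<Longrightarrow> inD t l"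
  shows "v S = (\<Sum>i\<in>S. real_of_int (Cc t (i - 1)))"
proof -
  have finS: "finite S" using S finite_subset by blast
  have Smem: "\<exists>l<n. i = Suc l" if "i \<in> S" for i
  proof -
    have "i \<in> {1..n}" using S that by blast
    then show ?thesis by (intro exI[of _ "i - 1"]) auto
  qed
  have "Suc (dig t 0) \<in> S" by (rule T[OF dig_less inT_dig]) (use m1 in simp)
  then have ne: "S \<noteq> {}" by blast
  have mx: "Max ((\<lambda>k. al k (Suc j)) ` S) = pm t j" if j: "j < m" for j
  proof (rule Max_eqI)
    show "finite ((\<lambda>k. al k (Suc j)) ` S)" using finS by simp
    show "y \<le> pm t j" if "y \<in> (\<lambda>k. al k (Suc j)) ` S" for y
    proof -
      from that obtain k where k: "k \<in> S" "y = al k (Suc j)" by blast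
      obtain l where l: "l < n" "k = Suc l" using Smem k by blast
      have "ai l j \<le> pm t j" using D[OF l(1)] k l j by (simp add: inD_def)
      then show ?thesis using k l al[OF l(1) j] by simp
    qed
    obtain h where h: "h < m" "pm t j = ai (dig t h) j" using pm_attained by blast
    have "Suc (dig t h) \<in> S" by (rule T[OF dig_less inT_dig[OF h(1)]])
    then show "real_of_int (pm t j) \<in> (\<lambda>k. al k (Suc j)) ` S"
      using h al[OF dig_less j, of t h] by (metis image_eqI)
  qed
  have "v S = (\<Sum>j<m. (\<Sum>i\<in>S. dl i (Suc j)) * Max ((\<lambda>k. al k (Suc j)) ` S))"
    using ne by (simp add: v_def pd_game_def sum.atLeast1_atMost_eq)
  also have "\<dots> = (\<Sum>j<m. \<Sum>i\<in>S. dl i (Suc j) * pm t j)"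
    by (intro sum.cong refl) (simp add: mx sum_distrib_right)
  also have "\<dots> = (\<Sum>i\<in>S. \<Sum>j<m. dl i (Suc j) * pm t j)" by (rule sum.swap)
  also have "\<dots> = (\<Sum>i\<in>S. real_of_int (Cc t (i - 1)))"
  proof (rule sum.cong[OF refl])
    fix i assume "i \<in> S"
    then obtain l where l: "l < n" "i = Suc l" using Smem by blast
    show "(\<Sum>j<m. dl i (Suc j) * pm t j) = real_of_int (Cc t (i - 1))"
      using l dl by (simp add: Cc_def mult.commute)
  qed
  finally show ?thesis .
qed

lemma excess_eq:
  assumes S: "S \<subseteq> {1..n}" and T: "\<And>l. l < n \<Longrightarrow> inT t l \<Longrightarrow> Suc l \<in> S"
    and D: "\<And>l. l < n \<Longrightarrow> Suc l \<in> S \<Longrightarrow> inD t l"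
  shows "excess v x S = (\<Sum>l<n. if Suc l \<in> S then wt x t l else 0)"
proof -
  have "excess v x S = (\<Sum>i\<in>S. x i - real_of_int (Cc t (i - 1)))"
    by (simp add: excess_def v_eq[OF assms] sum_subtractf)
  also have "\<dots> = (\<Sum>l<n. if Suc l \<in> S then wt x t l else 0)"
    by (simp add: sum_coalition[OF S] wt_def cong: if_cong)
  finally show ?thesis .
qed

lemma excess_blk: "S \<in> blk b \<Longrightarrow> excess v x S = (\<Sum>l<n. if Suc l \<in> S then wt x (row b) l else 0)"
  by (rule excess_eq) (auto simp: blk_def)

lemma Hf_le: "S \<in> blk b \<Longrightarrow> Hf x (row b) (pl b) (bit b) \<le> excess v x S"
  unfolding excess_blk Hf_def
  by (rule sum_mono) (auto simp: blk_def min_def)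

definition sel :: "(nat \<Rightarrow> real) \<Rightarrow> nat \<Rightarrow> nat set" where
  "sel x b = Suc ` {l. l < n \<and> (inT (row b) l \<or> inD (row b) l \<and>
     (if l = pl b then bit b = 1 else wt x (row b) l < 0))}"

lemma Suc_mem_sel: "l < n \<Longrightarrow> Suc l \<in> sel x b \<longleftrightarrow> (inT (row b) l \<or> inD (row b) l \<and>
     (if l = pl b then bit b = 1 else wt x (row b) l < 0))"
  by (auto simp: sel_def)

lemma sel_blk: "sel x b \<in> blk b"
proof -
  have "sel x b \<subseteq> {1..n}" by (auto simp: sel_def)
  then show ?thesis using inT_inD by (auto simp: blk_def Suc_mem_sel)
qed

lemma excess_sel: "excess v x (sel x b) = Hf x (row b) (pl b) (bit b)"
  unfolding excess_blk[OF sel_blk] Hf_def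
  by (rule sum.cong) (auto simp: Suc_mem_sel min_def)

lemma blk_Pow: "blk b \<subseteq> Pow {1..n}"
  by (auto simp: blk_def)

lemma Min_blk: "Min (excess v x ` blk b) = Hf x (row b) (pl b) (bit b)"
proof (rule Min_eqI)
  show "finite (excess v x ` blk b)" using blk_Pow finite_subset by (intro finite_imageI) blast
  show "Hf x (row b) (pl b) (bit b) \<in> excess v x ` blk b" using sel_blk excess_sel by (metis image_eqI)
qed (use Hf_le in auto)

lemma block_of:
  assumes "t < Rn" "i < n" "r < 2"
  shows "\<exists>b<KK. row b = t \<and> pl b = i \<and> bit b = r"
proof (intro exI conjI)
  define x where "x = t * n + i"
  let ?b = "x * 2 + r"
  have d2: "?b div 2 = x" using assms(3) by simp
  show "bit ?b = r" using assms(3) by (simp add: bit_def)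
  have "x mod n = i" "x div n = t" using assms(2) by (simp_all add: x_def)
  moreover have "row ?b = (?b div 2) div n" unfolding row_def by (rule div_mult2_eq)
  ultimately show "pl ?b = i" "row ?b = t" by (simp_all add: pl_def d2)
  have "x + 1 \<le> (t + 1) * n" using assms(2) by (simp add: x_def)
  also have "\<dots> \<le> Rn * n" using assms(1) by (intro mult_right_mono) auto
  finally have "2 * (x + 1) \<le> KK" by (simp add: KK_def mult.commute mult.left_commute)
  then show "?b < KK" using assms(3) by simp
qed

text \<open>In each market a member of \<open>S\<close> with the largest profit is named; the digits
  of a row can spell any such choice.\<close>

lemma ex_row:
  assumes S: "S \<subseteq> {1..n}" "S \<noteq> {}"
  shows "\<exists>t<Rn. (\<forall>l<n. (inT t l \<longrightarrow> Suc l \<in> S) \<and> (Suc l \<in> S \<longrightarrow> inD t l))"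
proof -
  have finS: "finite S" using S(1) finite_subset by blast
  have "\<exists>k. k < n \<and> Suc k \<in> S \<and> (\<forall>l<n. Suc l \<in> S \<longrightarrow> ai l j \<le> ai k j)" for j
  proof -
    define A where "A = {l. l < n \<and> Suc l \<in> S}"
    obtain s where "s \<in> S" using S(2) by blast
    then have "s \<in> {1..n}" using S(1) by blast
    with \<open>s \<in> S\<close> have "s - 1 \<in> A" by (auto simp: A_def)
    then have A: "finite ((\<lambda>l. ai l j) ` A)" "(\<lambda>l. ai l j) ` A \<noteq> {}" by (auto simp: A_def)
    obtain k where "k \<in> A" "ai k j = Max ((\<lambda>l. ai l j) ` A)" using Max_in[OF A] by auto
    then have "k < n \<and> Suc k \<in> S" "\<And>l. l \<in> A \<Longrightarrow> ai l j \<le> ai k j" using A(1) by (auto simp: A_def)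
    then show ?thesis unfolding A_def by blast
  qed
  then obtain k where k: "\<And>j. k j < n" "\<And>j. Suc (k j) \<in> S"
    "\<And>j l. l < n \<Longrightarrow> Suc l \<in> S \<Longrightarrow> ai l j \<le> ai (k j) j" by metis
  have "\<exists>t<n ^ m. \<forall>h<m. dig t h = k h" unfolding dig_def by (rule ex_digits) (rule k(1))
  then obtain t where t: "t < n ^ m" "\<And>h. h < m \<Longrightarrow> dig t h = k h" by blast
  show ?thesis
  proof (intro exI[of _ t] conjI allI impI)
    show "t < Rn" using t by (simp add: Rn_def)
    show "Suc l \<in> S" if "inT t l" for l
    proof -
      from that obtain h where "h < m" "dig t h = l" unfolding inT_def by blast
      then show ?thesis using k(2)[of h] t(2)[of h] by simp
    qed
    show "inD t l" if "l < n" "Suc l \<in> S" for l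
      unfolding inD_def
    proof (intro allI impI)
      fix j assume j: "j < m"
      have "ai l j \<le> ai (dig t j) j" using k(3)[OF that] t(2)[OF j] by simp
      also have "\<dots> \<le> pm t j" by (rule pm_ge[OF j])
      finally show "ai l j \<le> pm t j" .
    qed
  qed
qed

text \<open>Least excess over the whole row, with no condition on a further player.\<close>

definition Hg :: "(nat \<Rightarrow> real) \<Rightarrow> nat \<Rightarrow> real" where
  "Hg x t = (\<Sum>l<n. if inT t l then wt x t l else if inD t l then min 0 (wt x t l) else 0)"

lemma Hf_eq_Hg: "inT t i \<Longrightarrow> Hf x t i r = Hg x t"
  unfolding Hf_def Hg_def by (rule sum.cong) auto

lemma Hf_minus_Hg:
  assumes "\<not> inT t i" "inD t i" "i < n"
  shows "Hf x t i r - Hg x t = (if r = 1 then wt x t i else 0) - min 0 (wt x t i)"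
proof -
  have "Hf x t i r - Hg x t = (\<Sum>l<n. if l = i then (if r = 1 then wt x t i else 0) - min 0 (wt x t i) else 0)"
    unfolding Hf_def Hg_def sum_subtractf[symmetric] by (rule sum.cong) (use assms in auto)
  then show ?thesis using assms by simp
qed

text \<open>In the row of \<open>S\<close> the excess is the row minimum \<open>Hg\<close> plus, for
  each admissible unnamed player, the price of forcing the player's status in \<open>S\<close>; this
  price is the difference between one block minimum and \<open>Hg\<close>. The row minimum is itself
  a block minimum: the condition of a block is void if its player is named.\<close>

lemma blk_repr:
  assumes S: "S \<subseteq> {1..n}" "S \<noteq> {}"
  shows "\<exists>g J. g < KK \<and> J \<subseteq> {..<KK} \<and> (\<forall>x.
        excess v x S = Min (excess v x ` blk g) + (\<Sum>B\<in>J. Min (excess v x ` blk B) - Min (excess v x ` blk g))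
        \<and> (\<forall>B\<in>J. Min (excess v x ` blk g) \<le> Min (excess v x ` blk B)))"
proof -
  obtain t where t: "t < Rn" "\<And>l. l < n \<Longrightarrow> inT t l \<Longrightarrow> Suc l \<in> S" "\<And>l. l < n \<Longrightarrow> Suc l \<in> S \<Longrightarrow> inD t l"
    using ex_row[OF S] by blast
  have i0: "inT t (dig t 0)" by (rule inT_dig) (use m1 in simp)
  have "\<exists>b<KK. row b = t \<and> pl b = dig t 0 \<and> bit b = 0"
    by (rule block_of[OF t(1) dig_less]) simp
  then obtain g where g: "g < KK" "row g = t" "pl g = dig t 0" "bit g = 0" by blast
  define FD where "FD = {l. l < n \<and> \<not> inT t l \<and> inD t l}"
  define rr where "rr l = (if Suc l \<in> S then 1 else 0 :: nat)" for l
  define be where "be l = (SOME b. b < KK \<and> row b = t \<and> pl b = l \<and> bit b = rr l)" for l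
  have be: "be l < KK \<and> row (be l) = t \<and> pl (be l) = l \<and> bit (be l) = rr l" if "l < n" for l
    unfolding be_def by (rule someI_ex, rule block_of[OF t(1) that]) (simp add: rr_def)
  have ee: "excess v x S = (\<Sum>l<n. if Suc l \<in> S then wt x t l else 0)" for x
  proof (rule excess_eq[OF S(1)])
    show "Suc l \<in> S" if "l < n" "inT t l" for l using t(2) that by blast
    show "inD t l" if "l < n" "Suc l \<in> S" for l using t(3) that by blast
  qed
  have FDn: "{..<n} \<inter> FD = FD" by (auto simp: FD_def)
  have inj: "inj_on be FD"
  proof (rule inj_onI)
    fix l l' assume h: "l \<in> FD" "l' \<in> FD" "be l = be l'"
    have "l < n" "l' < n" using h(1,2) unfolding FD_def by blast+
    from be[OF this(1)] be[OF this(2)] have "pl (be l) = l" "pl (be l') = l'" by blast+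
    then show "l = l'" unfolding h(3) by (rule subst)
  qed
  have ming: "Min (excess v x ` blk g) = Hg x t" for x
    unfolding Min_blk g by (rule Hf_eq_Hg[OF i0])
  have minb: "Min (excess v x ` blk (be l)) - Hg x t = (if Suc l \<in> S then wt x t l else 0) - min 0 (wt x t l)"
    if "l \<in> FD" for x l
  proof -
    have l: "l < n" "\<not> inT t l" "inD t l" using that by (simp_all add: FD_def)
    have b: "row (be l) = t" "pl (be l) = l" "bit (be l) = rr l" using be[OF l(1)] by simp_all
    show ?thesis unfolding Min_blk b Hf_minus_Hg[OF l(2,3,1)] by (simp add: rr_def)
  qed
  show ?thesis
  proof (intro exI conjI allI ballI)
    show "g < KK" by (rule g)
    show "be ` FD \<subseteq> {..<KK}"
    proof
      fix B assume "B \<in> be ` FD"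
      then obtain l where "l \<in> FD" "B = be l" by blast
      then show "B \<in> {..<KK}" using be[of l] by (simp add: FD_def)
    qed
    fix x
    let ?f = "\<lambda>l. (if Suc l \<in> S then wt x t l else 0) - min 0 (wt x t l)"
    have "(\<Sum>B\<in>be ` FD. Min (excess v x ` blk B) - Min (excess v x ` blk g)) =
      (\<Sum>l\<in>FD. Min (excess v x ` blk (be l)) - Hg x t)"
      unfolding ming by (rule sum.reindex_cong[OF inj refl refl])
    also have "\<dots> = (\<Sum>l\<in>FD. ?f l)" by (rule sum.cong[OF refl minb])
    also have "\<dots> = (\<Sum>l\<in>{..<n}. if l \<in> FD then ?f l else 0)"
      unfolding sum.inter_restrict[OF finite_lessThan, symmetric] FDn ..
    finally have "Min (excess v x ` blk g) + (\<Sum>B\<in>be ` FD. Min (excess v x ` blk B) - Min (excess v x ` blk g)) =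
      Hg x t + (\<Sum>l<n. if l \<in> FD then ?f l else 0)" by (simp only: ming)
    also have "\<dots> = (\<Sum>l<n. (if inT t l then wt x t l else if inD t l then min 0 (wt x t l) else 0) +
        (if l \<in> FD then ?f l else 0))" by (simp only: Hg_def sum.distrib)
    also have "\<dots> = (\<Sum>l<n. if Suc l \<in> S then wt x t l else 0)"
    proof (rule sum.cong[OF refl])
      fix l assume "l \<in> {..<n}"
      then have l: "l < n" by simp
      show "(if inT t l then wt x t l else if inD t l then min 0 (wt x t l) else 0) +
        (if l \<in> FD then (if Suc l \<in> S then wt x t l else 0) - min 0 (wt x t l) else 0) =
        (if Suc l \<in> S then wt x t l else 0)"
        using t(2)[OF l] t(3)[OF l] inT_inD[of t l] l
        by (cases "inT t l"; cases "inD t l"; cases "Suc l \<in> S") (simp_all add: FD_def)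
    qed
    also have "\<dots> = excess v x S" by (rule ee[symmetric])
    finally show "excess v x S = Min (excess v x ` blk g) + (\<Sum>B\<in>be ` FD. Min (excess v x ` blk B) - Min (excess v x ` blk g))" ..
    show "Min (excess v x ` blk g) \<le> Min (excess v x ` blk B)" if "B \<in> be ` FD" for B
    proof -
      from that obtain l where "l \<in> FD" "B = be l" by blast
      have "0 \<le> (if Suc l \<in> S then wt x t l else 0) - min 0 (wt x t l)" by (simp add: min_def)
      then show ?thesis using minb[OF \<open>l \<in> FD\<close>, of x] ming[of x]
        unfolding \<open>B = be l\<close> by linarith
    qed
  qed
qed

text \<open>Every player is paid the own demand at the best profit overall in each market. No
  coalition can earn more per unit, and the grand coalition earns exactly this.\<close>

definition core_pt :: "nat \<Rightarrow> real" where
  "core_pt = (\<lambda>i\<in>{1..n}. \<Sum>j<m. real_of_int (bi (i - 1) j) * Max ((\<lambda>k. al k (Suc j)) ` {1..n}))"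

lemma v_alt: "S \<noteq> {} \<Longrightarrow> v S = (\<Sum>j<m. (\<Sum>i\<in>S. dl i (Suc j)) * Max ((\<lambda>k. al k (Suc j)) ` S))"
  by (simp add: v_def pd_game_def sum.atLeast1_atMost_eq)

lemma dl_nonneg: "i \<in> {1..n} \<Longrightarrow> j < m \<Longrightarrow> 0 \<le> dl i (Suc j)"
  using dl[of "i - 1" j] bi[of "i - 1" j] by auto

lemma al_nonneg: "i \<in> {1..n} \<Longrightarrow> j < m \<Longrightarrow> 0 \<le> al i (Suc j)"
  using al[of "i - 1" j] ai[of "i - 1" j] by auto

lemma core_pt_sum: "S \<subseteq> {1..n} \<Longrightarrow> sum core_pt S = (\<Sum>j<m. (\<Sum>i\<in>S. dl i (Suc j)) * Max ((\<lambda>k. al k (Suc j)) ` {1..n}))"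
proof -
  assume S: "S \<subseteq> {1..n}"
  have "sum core_pt S = (\<Sum>i\<in>S. \<Sum>j<m. dl i (Suc j) * Max ((\<lambda>k. al k (Suc j)) ` {1..n}))"
  proof (rule sum.cong[OF refl])
    fix i assume "i \<in> S"
    then have i: "i \<in> {1..n}" using S by blast
    then have "dl i (Suc j) = bi (i - 1) j" if "j < m" for j using dl[of "i - 1" j] that by auto
    then show "core_pt i = (\<Sum>j<m. dl i (Suc j) * Max ((\<lambda>k. al k (Suc j)) ` {1..n}))"
      using i by (simp add: core_pt_def)
  qed
  also have "\<dots> = (\<Sum>j<m. (\<Sum>i\<in>S. dl i (Suc j)) * Max ((\<lambda>k. al k (Suc j)) ` {1..n}))"
    by (subst sum.swap) (simp add: sum_distrib_right)
  finally show ?thesis .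
qed

lemma v_nonneg: "S \<subseteq> {1..n} \<Longrightarrow> 0 \<le> v S"
proof (cases "S = {}")
  case False
  assume S: "S \<subseteq> {1..n}"
  then have finS: "finite S" using finite_subset by blast
  obtain i where i: "i \<in> S" using False by blast
  show ?thesis unfolding v_alt[OF False]
  proof (intro sum_nonneg mult_nonneg_nonneg)
    fix j assume j: "j \<in> {..<m}"
    show "0 \<le> dl i (Suc j)" if "i \<in> S" for i using dl_nonneg S that j by auto
    have "0 \<le> al i (Suc j)" using al_nonneg S i j by auto
    also have "\<dots> \<le> Max ((\<lambda>k. al k (Suc j)) ` S)" using finS i by simp
    finally show "0 \<le> Max ((\<lambda>k. al k (Suc j)) ` S)" .
  qed
qed (simp add: v_def pd_game_def)

lemma v_le_core: "S \<subseteq> {1..n} \<Longrightarrow> v S \<le> sum core_pt S"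
proof (cases "S = {}")
  case False
  assume S: "S \<subseteq> {1..n}"
  show ?thesis unfolding v_alt[OF False] core_pt_sum[OF S]
  proof (intro sum_mono mult_left_mono sum_nonneg)
    fix j assume j: "j \<in> {..<m}"
    show "Max ((\<lambda>k. al k (Suc j)) ` S) \<le> Max ((\<lambda>k. al k (Suc j)) ` {1..n})"
      using S False by (intro Max_mono image_mono) auto
    show "0 \<le> dl i (Suc j)" if "i \<in> S" for i using dl_nonneg S that j by auto
  qed
qed (simp add: v_def pd_game_def)

lemma v_N: "v {1..n} = sum core_pt {1..n}"
  using n1 by (subst v_alt) (auto simp: core_pt_sum)

lemma core_pt_nonneg: "i \<in> {1..n} \<Longrightarrow> 0 \<le> core_pt i"
  using v_le_core[of "{i}"] v_nonneg[of "{i}"] by simp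

lemma v_Ints: "S \<subseteq> {1..n} \<Longrightarrow> v S \<in> \<int>"
proof (cases "S = {}")
  case False
  assume S: "S \<subseteq> {1..n}"
  obtain t where "\<And>l. l < n \<Longrightarrow> inT t l \<Longrightarrow> Suc l \<in> S" "\<And>l. l < n \<Longrightarrow> Suc l \<in> S \<Longrightarrow> inD t l"
    using ex_row[OF S False] by blast
  then have "v S = (\<Sum>i\<in>S. real_of_int (Cc t (i - 1)))" by (rule v_eq[OF S])
  also have "\<dots> \<in> \<int>" by (rule Ints_sum) simp
  finally show ?thesis .
qed (simp add: v_def pd_game_def)

sublocale int_block_game "{1..n}" v core_pt KK blk n
proof
  show "finite {1..n}" "{1..n} \<noteq> {}" "{1..n} = {1..n}" using n1 by auto
  show "v {} = 0" by (simp add: v_def pd_game_def)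
  show "0 \<le> v {i}" if "i \<in> {1..n}" for i using v_nonneg that by simp
  show "core_pt \<in> extensional {1..n}" by (simp add: core_pt_def)
  show "sum core_pt {1..n} = v {1..n}" by (rule v_N[symmetric])
  show "0 \<le> excess v core_pt S" if "S \<subseteq> {1..n}" for S using v_le_core[OF that] by (simp add: excess_def)
  show "blk B \<subseteq> Pow {1..n}" for B by (rule blk_Pow)
  show "blk B \<noteq> {}" for B using sel_blk by blast
  show "\<exists>g J. g < KK \<and> J \<subseteq> {..<KK} \<and> (\<forall>x.
        excess v x S = Min (excess v x ` blk g) + (\<Sum>B\<in>J. Min (excess v x ` blk B) - Min (excess v x ` blk g))
        \<and> (\<forall>B\<in>J. Min (excess v x ` blk g) \<le> Min (excess v x ` blk B)))"
    if "S \<subseteq> {1..n}" "S \<noteq> {}" for S by (rule blk_repr[OF that])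
  show "v S \<in> \<int>" "0 \<le> v S" if "S \<subseteq> {1..n}" for S using v_Ints v_nonneg that by auto
  show "v S \<le> v {1..n}" if "S \<subseteq> {1..n}" for S
  proof -
    have "sum core_pt S \<le> sum core_pt {1..n}" using that core_pt_nonneg by (intro sum_mono2) auto
    then show ?thesis using v_le_core[OF that] v_N by simp
  qed
qed

end

section \<open>The program for one round\<close>

text \<open>Closed form of the state inside a loop that accumulates into one cell, as
  \<open>map_st\<close> is for a loop that fills an array; the loop invariant becomes an equation of
  states.\<close>

definition sum_st :: "state \<Rightarrow> string \<Rightarrow> string \<Rightarrow> int \<Rightarrow> nat \<Rightarrow> int \<Rightarrow> state" where
  "sum_st s x y i k v = s(x := (s x)(0 := int k), y := (s y)(i := s y i + v))"

definition map_st :: "state \<Rightarrow> string \<Rightarrow> string \<Rightarrow> nat \<Rightarrow> (nat \<Rightarrow> int) \<Rightarrow> state" where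
  "map_st s x y k f = s(x := (s x)(0 := int k), y := (\<lambda>i. if 0 \<le> i \<and> i < int k then f (nat i) else s y i))"

lemma sum_st_apply [simp]:
  "sum_st s x y i k v z = (if z = y then (s y)(i := s y i + v) else if z = x then (s x)(0 := int k) else s z)"
  by (simp add: sum_st_def)

lemma map_st_apply [simp]:
  "map_st s x y k f z = (if z = y then (\<lambda>i. if 0 \<le> i \<and> i < int k then f (nat i) else s y i)
    else if z = x then (s x)(0 := int k) else s z)"
  by (simp add: map_st_def)

lemma wp_sum_loop:
  fixes f :: "nat \<Rightarrow> int"
  assumes MN: "M \<le> N" "int M \<le> 2 ^ l" and xy: "x \<noteq> y"
    and b: "\<And>k. k \<le> M \<Longrightarrow> aval b (sum_st s x y i k (\<Sum>j<k. f j)) = int M"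
    and a: "\<And>k. k < M \<Longrightarrow> aval a (sum_st s x y i k (\<Sum>j<k. f j)) = i"
    and e: "\<And>k. k < M \<Longrightarrow> aval e (sum_st s x y i k (\<Sum>j<k. f j)) = f k"
    and sz: "\<And>k. k < M \<Longrightarrow> \<bar>s y i + (\<Sum>j<Suc k. f j)\<bar> \<le> 2 ^ l"
    and Q: "Q (sum_st s x y i M (\<Sum>j<M. f j))"
  shows "wp N l (For x b (Store y a (Plus (Cell y a) e))) Q s"
proof (rule wp_For[where M = M and I = "\<lambda>k s'. s' = sum_st s x y i k (\<Sum>j<k. f j)"])
  show "s(x := (s x)(0 := 0)) = sum_st s x y i 0 (\<Sum>j<0. f j)" using xy by (auto simp: fun_eq_iff)
next
  fix k s' assume k: "k < M" and s': "s' = sum_st s x y i k (\<Sum>j<k. f j)"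
  let ?t = "sum_st s x y i k (\<Sum>j<k. f j)"
  have val: "aval (Plus (Cell y a) e) ?t = s y i + (\<Sum>j<Suc k. f j)"
    using a[OF k] e[OF k] by simp
  show "wp N l (Store y a (Plus (Cell y a) e)) (\<lambda>s''. s'' x 0 = int k \<and>
      s''(x := (s'' x)(0 := int k + 1)) = sum_st s x y i (Suc k) (\<Sum>j<Suc k. f j)) s'"
    unfolding s'
  proof (rule wp_Store)
    show "\<bar>aval (Plus (Cell y a) e) ?t\<bar> \<le> 2 ^ l" unfolding val by (rule sz[OF k])
    show "(?t(y := (?t y)(aval a ?t := aval (Plus (Cell y a) e) ?t))) x 0 = int k \<and>
      (?t(y := (?t y)(aval a ?t := aval (Plus (Cell y a) e) ?t)))
        (x := ((?t(y := (?t y)(aval a ?t := aval (Plus (Cell y a) e) ?t))) x)(0 := int k + 1)) =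
      sum_st s x y i (Suc k) (\<Sum>j<Suc k. f j)"
      unfolding val a[OF k] using xy by (auto simp: fun_eq_iff simp del: sum.lessThan_Suc)
  qed
qed (use MN b Q in auto)

lemma wp_map_loop:
  fixes f :: "nat \<Rightarrow> int"
  assumes MN: "M \<le> N" "int M \<le> 2 ^ l" and xy: "x \<noteq> y"
    and b: "\<And>k. k \<le> M \<Longrightarrow> aval b (map_st s x y k f) = int M"
    and e: "\<And>k. k < M \<Longrightarrow> aval e (map_st s x y k f) = f k"
    and sz: "\<And>k. k < M \<Longrightarrow> \<bar>f k\<bar> \<le> 2 ^ l"
    and Q: "Q (map_st s x y M f)"
  shows "wp N l (For x b (Store y (Var x) e)) Q s"
proof (rule wp_For[where M = M and I = "\<lambda>k s'. s' = map_st s x y k f"])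
  show "s(x := (s x)(0 := 0)) = map_st s x y 0 f" using xy by (auto simp: fun_eq_iff)
next
  fix k s' assume k: "k < M" and s': "s' = map_st s x y k f"
  let ?t = "map_st s x y k f"
  have x: "aval (Var x) ?t = int k" using xy by simp
  show "wp N l (Store y (Var x) e) (\<lambda>s''. s'' x 0 = int k \<and> s''(x := (s'' x)(0 := int k + 1)) = map_st s x y (Suc k) f) s'"
    unfolding s'
  proof (rule wp_Store)
    show "\<bar>aval e ?t\<bar> \<le> 2 ^ l" using e[OF k] sz[OF k] by simp
    show "(?t(y := (?t y)(aval (Var x) ?t := aval e ?t))) x 0 = int k \<and>
      (?t(y := (?t y)(aval (Var x) ?t := aval e ?t)))
        (x := ((?t(y := (?t y)(aval (Var x) ?t := aval e ?t))) x)(0 := int k + 1)) =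
      map_st s x y (Suc k) f"
      unfolding e[OF k] x using xy by (auto simp: fun_eq_iff)
  qed
qed (use MN b Q in auto)

lemma wp_Assign:
  assumes "aval b s = v" "\<bar>v\<bar> \<le> 2 ^ l" "Q (s(x := (s x)(0 := v)))"
  shows "wp N l (x ::= b) Q s"
  by (rule wp_Store) (use assms in simp_all)

lemma wp_Assign_seq:
  assumes "aval b s = v" "\<bar>v\<bar> \<le> 2 ^ l" "wp N l c Q (s(x := (s x)(0 := v)))"
  shows "wp N l (x ::= b ;; c) Q s"
  by (rule wp_Seq, rule wp_Assign) (use assms in simp_all)

lemma wp_Store_seq:
  assumes "aval a s = i" "aval b s = v" "\<bar>v\<bar> \<le> 2 ^ l" "wp N l c Q (s(x := (s x)(i := v)))"
  shows "wp N l (Store x a b ;; c) Q s"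
  by (rule wp_Seq, rule wp_Store) (use assms in simp_all)

text \<open>Stated for partial sums because every intermediate value of an accumulating loop has to
  fit the size bound.\<close>

lemma abs_sum_le:
  fixes f :: "nat \<Rightarrow> int"
  assumes "\<And>j. j < n \<Longrightarrow> \<bar>f j\<bar> \<le> B" "k < n" "int n * B \<le> Z"
  shows "\<bar>\<Sum>j<Suc k. f j\<bar> \<le> Z"
proof -
  have B: "0 \<le> B" using assms(1)[OF assms(2)] by linarith
  have "\<bar>\<Sum>j<Suc k. f j\<bar> \<le> (\<Sum>j<Suc k. \<bar>f j\<bar>)" by (rule sum_abs)
  also have "\<dots> \<le> (\<Sum>j<Suc k. B)" by (intro sum_mono) (use assms in auto)
  also have "\<dots> = int (Suc k) * B" by simp
  also have "\<dots> \<le> int n * B" using assms(2) B by (intro mult_right_mono) auto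
  finally show ?thesis using assms(3) by simp
qed

definition idx :: "aexp \<Rightarrow> aexp \<Rightarrow> aexp" where
  "idx i j = Plus (Times i (Var ''n'')) j"

lemma aval_idx [simp]: "aval (idx i j) s = aval i s * s ''n'' 0 + aval j s"
  by (simp add: idx_def)

text \<open>The centre is \<open>X / w\<close> with \<open>w = n * W\<close>; storing the vertex sum
  and the denominator apart avoids a division.\<close>

definition centre :: com where
  "centre = ''w'' ::= Times (Var ''n'') (Var ''W'') ;;
     For ''l'' (Var ''n'') (Store ''X'' (Var ''l'') (Num 0) ;;
       For ''j'' (Var ''n'') (Store ''X'' (Var ''l'')
         (Plus (Cell ''X'' (Var ''l'')) (Cell ''V'' (idx (Var ''j'') (Var ''l''))))))"

lemma wp_centre:
  assumes n: "s ''n'' 0 = int n" and W: "s ''W'' 0 = W"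
    and V: "\<And>j l. j < n \<Longrightarrow> l < n \<Longrightarrow> s ''V'' (int j * int n + int l) = Vm j l"
    and N: "n \<le> N" "int n \<le> 2 ^ l" and B: "\<And>j l. j < n \<Longrightarrow> l < n \<Longrightarrow> \<bar>Vm j l\<bar> \<le> B" "int n * B \<le> 2 ^ l"
    and W2: "\<bar>int n * W\<bar> \<le> 2 ^ l"
  shows "wp N l centre (\<lambda>s'. s' ''w'' 0 = int n * W \<and> (\<forall>i<n. s' ''X'' (int i) = (\<Sum>j<n. Vm j i))) s"
  unfolding centre_def
  apply (rule wp_Seq, rule wp_Store)
   apply (simp add: n W W2)
  apply (simp add: n W)
  apply (rule wp_For[where M = n and I = "\<lambda>k s'. \<forall>i<k. s' ''X'' (int i) = (\<Sum>j<n. Vm j i)"])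
  apply (rule N)+
  subgoal by simp
  subgoal by (simp add: n)
  subgoal for k s'
    apply (rule wp_Seq, rule wp_Store)
     apply simp
    apply simp
    apply (rule wp_sum_loop[where M = n and i = "int k" and f = "\<lambda>j. Vm j k"])
    apply (rule N)+
    subgoal by simp
    subgoal by (simp add: n)
    subgoal by simp
    subgoal by (simp add: n V)
    subgoal using abs_sum_le[OF B(1) _ B(2)] by (simp del: sum.lessThan_Suc)
    subgoal by (simp add: less_Suc_eq)
    done
  subgoal by simp
  done

text \<open>\<open>y\<close> is \<open>w\<close> times the weight of a player, and \<open>I\<close>
  records the coalition attaining the block minimum, from which the supergradient is formed later.
  \<open>h\<close> holds half of \<open>b\<close> at first and the accumulated minimum
  afterwards.\<close>

definition blocks :: com where
  "blocks = For ''b'' (Var ''K'') (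
     ''h'' ::= Div (Var ''b'') (Num 2) ;;
     ''r'' ::= Minus (Var ''b'') (Times (Var ''h'') (Num 2)) ;;
     ''t'' ::= Div (Var ''h'') (Var ''n'') ;;
     ''i'' ::= Minus (Var ''h'') (Times (Var ''t'') (Var ''n'')) ;;
     ''h'' ::= Num 0 ;;
     For ''l'' (Var ''n'') (
       ''y'' ::= Minus (Cell ''X'' (Var ''l'')) (Times (Var ''w'') (Cell ''C'' (idx (Var ''t'') (Var ''l'')))) ;;
       ''s'' ::= Num 0 ;;
       If (Not (Less (Cell ''S'' (idx (Var ''t'') (Var ''l''))) (Num 1)))
         (If (Less (Cell ''S'' (idx (Var ''t'') (Var ''l''))) (Num 2)) (''s'' ::= Num 1)
           (If (And (Not (Less (Var ''l'') (Var ''i''))) (Not (Less (Var ''i'') (Var ''l''))))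
             (''s'' ::= Var ''r'')
             (If (Less (Var ''y'') (Num 0)) (''s'' ::= Num 1) Skip)))
         Skip ;;
       Store ''I'' (idx (Var ''b'') (Var ''l'')) (Var ''s'') ;;
       ''h'' ::= Plus (Var ''h'') (Times (Var ''s'') (Var ''y''))) ;;
     Store ''H'' (Var ''b'') (Var ''h'') ;;
     Store ''u'' (Var ''b'') (Num 0))"

text \<open>The indicator of the minimizing coalition \<open>sel\<close>, written in terms of the
  integral tables that the program uses.\<close>

definition memb :: "nat \<Rightarrow> (nat \<Rightarrow> nat \<Rightarrow> int) \<Rightarrow> (nat \<Rightarrow> nat \<Rightarrow> int) \<Rightarrow> int \<Rightarrow> (nat \<Rightarrow> int) \<Rightarrow> nat \<Rightarrow> nat \<Rightarrow> int" where
  "memb n S C w X b l = (let t = b div 2 div n in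
     if S t l = 1 then 1 else if S t l = 2 then
       (if l = b div 2 mod n then int (b mod 2) else if X l - w * C t l < 0 then 1 else 0) else 0)"

lemma memb_01: "memb n S C w X b l \<in> {0, 1}"
  by (auto simp: memb_def Let_def)

lemma idx_inj: "l < n \<Longrightarrow> l' < n \<Longrightarrow> int b * int n + int l = int b' * int n + int l' \<longleftrightarrow> b = b' \<and> l = l'"
proof
  assume h: "l < n" "l' < n" "int b * int n + int l = int b' * int n + int l'"
  then have e: "b * n + l = b' * n + l'" by (metis of_nat_add of_nat_eq_iff of_nat_mult)
  have "(b * n + l) div n = b" "(b' * n + l') div n = b'" using h by auto
  then have "b = b'" using e by metis
  then show "b = b' \<and> l = l'" using e by simp
qed simp

lemma wp_blocks:
  assumes n: "s ''n'' 0 = int n" "1 \<le> n" and w: "s ''w'' 0 = w" and K: "s ''K'' 0 = int (2 * n * R)"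
    and C: "\<And>t l. t < R \<Longrightarrow> l < n \<Longrightarrow> s ''C'' (int t * int n + int l) = C t l"
    and S: "\<And>t l. t < R \<Longrightarrow> l < n \<Longrightarrow> s ''S'' (int t * int n + int l) = S t l"
    and S012: "\<And>t l. S t l \<in> {0, 1, 2}"
    and X: "\<And>l. l < n \<Longrightarrow> s ''X'' (int l) = X l"
    and N: "2 * n * R \<le> N" "int (2 * n * R) \<le> 2 ^ l" "n \<le> N" "int n \<le> 2 ^ l" "2 \<le> l"
    and B: "\<And>t l. t < R \<Longrightarrow> l < n \<Longrightarrow> \<bar>X l - w * C t l\<bar> \<le> B" "int n * B \<le> 2 ^ l" "B \<le> 2 ^ l"
  shows "wp N l blocks (\<lambda>s'. \<forall>b<2 * n * R. s' ''u'' (int b) = 0 \<and>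
    (\<forall>i<n. s' ''I'' (int b * int n + int i) = memb n S C w X b i) \<and>
    s' ''H'' (int b) = (\<Sum>i<n. memb n S C w X b i * (X i - w * C (b div 2 div n) i))) s"
  unfolding blocks_def
  apply (rule wp_For[where M = "2 * n * R" and I = "\<lambda>k s'. \<forall>b<k. s' ''u'' (int b) = 0 \<and>
    (\<forall>i<n. s' ''I'' (int b * int n + int i) = memb n S C w X b i) \<and>
    s' ''H'' (int b) = (\<Sum>i<n. memb n S C w X b i * (X i - w * C (b div 2 div n) i))"])
  apply (rule N)+
  subgoal by simp
  subgoal using K by simp
  subgoal premises prems for b s1
  proof -
    define h where "h = b div 2"
    define t where "t = h div n"
    have hb: "int b div 2 = int h" by (simp add: h_def)
    have ht: "int h div int n = int t" by (simp add: t_def zdiv_int)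
    have "b = h * 2 + b mod 2" unfolding h_def by (rule div_mult_mod_eq[symmetric])
    then have "int b = int (h * 2 + b mod 2)" by (rule arg_cong)
    then have rb: "int b - int h * 2 = int (b mod 2)" by simp
    have "h = t * n + h mod n" unfolding t_def by (rule div_mult_mod_eq[symmetric])
    then have "int h = int (t * n + h mod n)" by (rule arg_cong)
    then have ih: "int h - int t * int n = int (h mod n)" by simp
    have tR: "t < R"
    proof -
      have "h < n * R" using prems(1) by (simp add: h_def less_mult_imp_div_less mult.commute mult.left_commute)
      then show ?thesis by (simp add: t_def less_mult_imp_div_less mult.commute)
    qed
    have le: "int h \<le> 2 ^ l" "int t \<le> 2 ^ l" "int (h mod n) \<le> 2 ^ l"
    proof -
      have "h \<le> b" by (simp add: h_def)
      then show "int h \<le> 2 ^ l" using prems(1) N(2) by linarith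
      have "t \<le> h" by (simp add: t_def)
      then show "int t \<le> 2 ^ l" using \<open>int h \<le> 2 ^ l\<close> by linarith
      have "h mod n \<le> h" by simp
      then show "int (h mod n) \<le> 2 ^ l" using \<open>int h \<le> 2 ^ l\<close> by linarith
    qed
    have l2: "(2::int) \<le> 2 ^ l" using power_increasing[of 1 l "2::int"] N(5) by simp
    have "b mod 2 < 2" by simp
    then have b2: "int (b mod 2) \<le> 2 ^ l" using l2 by linarith
    note fr = prems(4) and IH = prems(2) and b0 = prems(3)
    have c: "s1 ''n'' 0 = int n" "s1 ''w'' 0 = w" "\<And>l. l < n \<Longrightarrow> s1 ''X'' (int l) = X l"
      "\<And>l. l < n \<Longrightarrow> s1 ''C'' (int t * int n + int l) = C t l" "\<And>l. l < n \<Longrightarrow> s1 ''S'' (int t * int n + int l) = S t l"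
      using n w X C[OF tR] S[OF tR] by (simp_all add: fr)
    define m where "m i = memb n S C w X b i" for i
    have m_eq: "m i = (if S t i = 1 then 1 else if S t i = 2 then
       (if i = h mod n then int (b mod 2) else if X i - w * C t i < 0 then 1 else 0) else 0)" for i
      by (simp add: m_def memb_def h_def t_def Let_def)
    have m01: "m i \<in> {0, 1}" for i unfolding m_def by (rule memb_01)
    have sz: "\<bar>\<Sum>j<Suc i. m j * (X j - w * C t j)\<bar> \<le> 2 ^ l" if "i < n" for i
    proof (rule abs_sum_le[OF _ that B(2)])
      fix j assume "j < n"
      then have "\<bar>X j - w * C t j\<bar> \<le> B" using B(1) tR by blast
      then show "\<bar>m j * (X j - w * C t j)\<bar> \<le> B" using m01[of j] by auto
    qed
    show ?thesis
      apply (rule wp_Assign_seq[where v = "int h"], simp add: b0 h_def zdiv_int, simp only: abs_of_nat le)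
      apply (rule wp_Assign_seq[where v = "int (b mod 2)"], simp add: b0 rb, simp only: abs_of_nat b2)
      apply (rule wp_Assign_seq[where v = "int t"], simp add: c t_def zdiv_int, simp only: abs_of_nat le)
      apply (rule wp_Assign_seq[where v = "int (h mod n)"], simp add: c ih, simp only: abs_of_nat le)
      apply (rule wp_Assign_seq[where v = 0], simp, simp)
      apply (rule wp_Seq)
      apply (rule wp_For[where M = n and I = "\<lambda>k s'. s' ''h'' 0 = (\<Sum>i<k. m i * (X i - w * C t i)) \<and>
        (\<forall>i<k. s' ''I'' (int b * int n + int i) = m i) \<and>
        (\<forall>b'<b. \<forall>i<n. s' ''I'' (int b' * int n + int i) = memb n S C w X b' i)"])
      apply (rule N)+
      subgoal using IH by simp
      subgoal by (simp add: c)
      subgoal premises p for i s2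
      proof -
        note fr2 = p(4) and i = p(1,3)
        have I2: "s2 ''h'' 0 = (\<Sum>i<i. m i * (X i - w * C t i))"
          "\<And>i'. i' < i \<Longrightarrow> s2 ''I'' (int b * int n + int i') = m i'"
          "\<And>b' i'. b' < b \<Longrightarrow> i' < n \<Longrightarrow> s2 ''I'' (int b' * int n + int i') = memb n S C w X b' i'"
          using p(2) by blast+
        have c2: "s2 ''n'' 0 = int n" "s2 ''w'' 0 = w" "s2 ''X'' (int i) = X i"
          "s2 ''C'' (int t * int n + int i) = C t i" "s2 ''S'' (int t * int n + int i) = S t i"
          "s2 ''t'' 0 = int t" "s2 ''i'' 0 = int (h mod n)" "s2 ''r'' 0 = int (b mod 2)" "s2 ''b'' 0 = int b"
          using i(1) c b0 by (simp_all add: fr2)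
        have yB: "\<bar>X i - w * C t i\<bar> \<le> 2 ^ l" using B(1)[OF tR i(1)] B(3) by linarith
        have S012': "S t i = 0 \<or> S t i = 1 \<or> S t i = 2" using S012[of t i] by auto
        let ?s = "s2(''y'' := (s2 ''y'')(0 := X i - w * C t i), ''s'' := (s2 ''s'')(0 := m i))"
        have fin: "wp N l (Store ''I'' (idx (Var ''b'') (Var ''l'')) (Var ''s'') ;;
            ''h'' ::= Plus (Var ''h'') (Times (Var ''s'') (Var ''y'')))
          (\<lambda>s''. s'' ''l'' 0 = int i \<and>
             (s''(''l'' := (s'' ''l'')(0 := int i + 1))) ''h'' 0 = (\<Sum>i<Suc i. m i * (X i - w * C t i)) \<and>
             (\<forall>ia<Suc i. (s''(''l'' := (s'' ''l'')(0 := int i + 1))) ''I'' (int b * int n + int ia) = m ia) \<and>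
             (\<forall>b'<b. \<forall>ia<n. (s''(''l'' := (s'' ''l'')(0 := int i + 1))) ''I'' (int b' * int n + int ia) = memb n S C w X b' ia)) s3" if s3: "s3 = ?s" for s3
          unfolding s3
          apply (rule wp_Store_seq[where i = "int b * int n + int i" and v = "m i"])
             apply (simp add: c2 i)
            apply simp
          using m01[of i] l2 apply auto[1]
          apply (rule wp_Assign[where v = "\<Sum>i<Suc i. m i * (X i - w * C t i)"])
            apply (simp add: I2(1))
           apply (rule sz[OF i(1)])
          using i I2 idx_inj[OF _ i(1)] by (simp add: less_Suc_eq)
        show ?thesis
          apply (rule wp_Assign_seq[where v = "X i - w * C t i"], simp add: c2 i, rule yB)
          apply (rule wp_Assign_seq[where v = 0], simp, simp)
          apply (rule wp_Seq)
          apply (rule wp_If)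
          subgoal
            apply (rule wp_If)
            subgoal
              apply (rule wp_Assign[where v = 1], simp, simp)
              by (rule fin) (use S012' in \<open>auto simp: c2 i m_eq fun_eq_iff\<close>)
            subgoal
              apply (rule wp_If)
              subgoal
                apply (rule wp_Assign[where v = "int (b mod 2)"], simp add: c2, simp only: abs_of_nat b2)
                by (rule fin) (use S012' in \<open>auto simp: c2 i m_eq fun_eq_iff\<close>)
              subgoal
                apply (rule wp_If)
                subgoal
                  apply (rule wp_Assign[where v = 1], simp, simp)
                  by (rule fin) (use S012' in \<open>auto simp: c2 i m_eq fun_eq_iff\<close>)
                subgoal
                  apply (rule wp_Skip)
                  by (rule fin) (use S012' in \<open>auto simp: c2 i m_eq fun_eq_iff\<close>)
                done
              done
            done
          subgoal
            apply (rule wp_Skip)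
            by (rule fin) (use S012' in \<open>auto simp: c2 i m_eq fun_eq_iff\<close>)
          done
      qed
      subgoal premises p for s2
      proof -
        note fr2 = p(3)
        have I2: "s2 ''h'' 0 = (\<Sum>i<n. m i * (X i - w * C t i))"
          "\<And>i'. i' < n \<Longrightarrow> s2 ''I'' (int b * int n + int i') = m i'"
          "\<And>b' i'. b' < b \<Longrightarrow> i' < n \<Longrightarrow> s2 ''I'' (int b' * int n + int i') = memb n S C w X b' i'"
          using p(1) by blast+
        have sz': "\<bar>\<Sum>i<n. m i * (X i - w * C t i)\<bar> \<le> 2 ^ l"
          using sz[of "n - 1"] n(2) by simp
        have o: "s2 ''b'' 0 = int b" "s2 ''u'' = s1 ''u''" "s2 ''H'' = s1 ''H''" using b0 by (simp_all add: fr2)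
        show ?thesis
          apply (rule wp_Store_seq[where i = "int b" and v = "\<Sum>i<n. m i * (X i - w * C t i)"])
             apply (simp add: o)
            apply (simp add: I2)
           apply (rule sz')
          apply (rule wp_Store)
           apply simp
          using IH I2 by (auto simp: o less_Suc_eq m_def t_def h_def)
      qed
      done
  qed
  subgoal by simp
  done

lemma abs_horner_int_le:
  fixes xs :: "int list"
  assumes "\<And>e. e \<in> set xs \<Longrightarrow> \<bar>e\<bar> \<le> A" "M \<ge> 2" "A \<ge> 0"
  shows "\<bar>horner M xs\<bar> \<le> A * M ^ length xs"
  using assms(1)
proof (induction xs)
  case (Cons x xs)
  have "\<bar>horner M (x # xs)\<bar> \<le> \<bar>x\<bar> * M ^ length xs + \<bar>horner M xs\<bar>"
    using assms(2) abs_triangle_ineq[of "x * M ^ length xs" "horner M xs"] by (simp add: abs_mult)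
  also have "\<dots> \<le> A * M ^ length xs + A * M ^ length xs"
    using Cons assms(2) by (intro add_mono mult_right_mono) auto
  also have "\<dots> = A * (2 * M ^ length xs)" by simp
  also have "\<dots> \<le> A * (M * M ^ length xs)" using assms by (intro mult_left_mono mult_right_mono) auto
  finally show ?case by simp
qed (use assms in simp)

text \<open>
  Selection sort of the blocks by their minima (\<open>u\<close> marks the used ones), evaluating the Horner sums of
  the value of \<open>F\<close> and of a supergradient on the way.
\<close>

definition select :: com where
  "select = ''F'' ::= Num 0 ;;
    For ''l'' (Var ''n'') (Store ''g'' (Var ''l'') (Num 0)) ;;
    For ''r'' (Var ''K'') (
      ''k'' ::= Num (-1) ;;
      For ''b'' (Var ''K'')
        (If (And (Less (Cell ''u'' (Var ''b'')) (Num 1))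
               (Not (And (Not (Less (Var ''k'') (Num 0))) (Not (Less (Cell ''H'' (Var ''b'')) (Cell ''H'' (Var ''k'')))))))
          (''k'' ::= Var ''b'') Skip) ;;
      Store ''u'' (Var ''k'') (Num 1) ;;
      ''F'' ::= Plus (Times (Var ''F'') (Var ''M'')) (Cell ''H'' (Var ''k'')) ;;
      For ''l'' (Var ''n'') (Store ''g'' (Var ''l'')
        (Plus (Times (Cell ''g'' (Var ''l'')) (Var ''M'')) (Cell ''I'' (idx (Var ''k'') (Var ''l''))))))"

lemma wp_select:
  fixes Hm :: "nat \<Rightarrow> int" and Im :: "nat \<Rightarrow> nat \<Rightarrow> int"
  assumes n: "s ''n'' 0 = int n" and K: "s ''K'' 0 = int K" and M: "s ''M'' 0 = M" "2 \<le> M"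
    and u: "\<And>b. b < K \<Longrightarrow> s ''u'' (int b) = 0"
    and Hm: "\<And>b. b < K \<Longrightarrow> s ''H'' (int b) = Hm b"
    and Im: "\<And>b l. b < K \<Longrightarrow> l < n \<Longrightarrow> s ''I'' (int b * int n + int l) = Im b l" "\<And>b l. Im b l \<in> {0, 1}"
    and N: "K \<le> N" "int K \<le> 2 ^ l" "n \<le> N" "int n \<le> 2 ^ l" "1 \<le> l"
    and B: "\<And>b. b < K \<Longrightarrow> \<bar>Hm b\<bar> \<le> A" "1 \<le> A" "A * M ^ K \<le> 2 ^ l"
  shows "wp N l select (\<lambda>s'. \<exists>p. mset p = mset [0..<K] \<and> sorted (map Hm p) \<and>
    s' ''F'' 0 = horner M (map Hm p) \<and> (\<forall>i<n. s' ''g'' (int i) = horner M (map (\<lambda>b. Im b i) p))) s"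
proof -
  have hb: "\<bar>horner M (map f p)\<bar> \<le> 2 ^ l"
    if "\<And>b. b < K \<Longrightarrow> \<bar>f b\<bar> \<le> A" "set p \<subseteq> {..<K}" "length p \<le> K" for f p
  proof -
    have "\<bar>horner M (map f p)\<bar> \<le> A * M ^ length (map f p)"
      by (rule abs_horner_int_le) (use that M B in auto)
    also have "\<dots> \<le> A * M ^ K" using that M B by (intro mult_left_mono power_increasing) auto
    finally show ?thesis using B(3) by simp
  qed
  have Ib: "\<bar>Im b i\<bar> \<le> A" for b i using Im(2)[of b i] B(2) by auto
  define Inv where "Inv r s' p \<longleftrightarrow> distinct p \<and> length p = r \<and> set p \<subseteq> {..<K} \<and> sorted (map Hm p) \<and>
      (\<forall>b<K. s' ''u'' (int b) = (if b \<in> set p then 1 else 0)) \<and>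
      (\<forall>b\<in>set p. \<forall>b'<K. b' \<notin> set p \<longrightarrow> Hm b \<le> Hm b') \<and>
      s' ''F'' 0 = horner M (map Hm p) \<and> (\<forall>i<n. s' ''g'' (int i) = horner M (map (\<lambda>b. Im b i) p))" for r s' p
  have two: "(2::int) \<le> 2 ^ l" using power_increasing[of 1 l "2::int"] N(5) by simp
  show ?thesis
    unfolding select_def
    apply (rule wp_Assign_seq[where v = 0], simp, simp)
    apply (rule wp_Seq)
    apply (rule wp_map_loop[where M = n and f = "\<lambda>_. 0"])
    apply (rule N)+
    subgoal by simp
    subgoal by (simp add: n)
    subgoal by simp
    subgoal by simp
    apply (rule wp_For[where M = K and I = "\<lambda>r s'. \<exists>p. Inv r s' p"])
    apply (rule N)+
    subgoal by (rule exI[of _ "[]"]) (simp add: Inv_def u)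
    subgoal by (simp add: K)
    subgoal premises prems for r s1
    proof -
      obtain p where p: "Inv r s1 p" using prems(2) by blast
      note fr = prems(4)
      have rK: "r < K" and r: "s1 ''r'' 0 = int r" using prems by auto
      have p': "distinct p" "length p = r" "set p \<subseteq> {..<K}" "sorted (map Hm p)"
        "\<And>b. b < K \<Longrightarrow> s1 ''u'' (int b) = (if b \<in> set p then 1 else 0)"
        "\<And>b b'. b \<in> set p \<Longrightarrow> b' < K \<Longrightarrow> b' \<notin> set p \<Longrightarrow> Hm b \<le> Hm b'"
        "s1 ''F'' 0 = horner M (map Hm p)" "\<And>i. i < n \<Longrightarrow> s1 ''g'' (int i) = horner M (map (\<lambda>b. Im b i) p)"
        using p unfolding Inv_def by blast+
      have c: "s1 ''n'' 0 = int n" "s1 ''K'' 0 = int K" "s1 ''M'' 0 = M" "\<And>b. b < K \<Longrightarrow> s1 ''H'' (int b) = Hm b"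
        "\<And>b l. b < K \<Longrightarrow> l < n \<Longrightarrow> s1 ''I'' (int b * int n + int l) = Im b l"
        using n K M Hm Im by (simp_all add: fr)
      have "card (set p) < card {..<K}" using p'(1,2) rK by (simp add: distinct_card)
      then have ex: "\<exists>b<K. b \<notin> set p" using p'(3) card_mono[of "set p" "{..<K}"]
        by (metis List.finite_set lessThan_iff linorder_not_less subsetI)
      define J where "J j (k::int) \<longleftrightarrow> (if \<exists>b<j. b \<notin> set p then \<exists>k'<j. k = int k' \<and> k' \<notin> set p \<and> (\<forall>b<j. b \<notin> set p \<longrightarrow> Hm k' \<le> Hm b)
         else k = -1)" for j k
      have Jstep: "J (Suc j) (if j \<notin> set p \<and> (k < 0 \<or> Hm j < s1 ''H'' k) then int j else k)" if J: "J j k" and j: "j < K" for j k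
      proof (cases "\<exists>b<j. b \<notin> set p")
        case False
        then have "k = -1" using J by (simp add: J_def)
        then show ?thesis using False by (auto simp: J_def less_Suc_eq)
      next
        case True
        then obtain k' where k': "k' < j" "k = int k'" "k' \<notin> set p" "\<And>b. b < j \<Longrightarrow> b \<notin> set p \<Longrightarrow> Hm k' \<le> Hm b"
          using J unfolding J_def by auto
        have Hk: "s1 ''H'' k = Hm k'" using c(4)[of k'] k' j by simp
        have T: "\<exists>b<Suc j. b \<notin> set p" using True less_SucI by blast
        show ?thesis
        proof (cases "j \<notin> set p \<and> Hm j < Hm k'")
          case True
          then have "\<forall>b<Suc j. b \<notin> set p \<longrightarrow> Hm j \<le> Hm b" using k'(4) by (force simp: less_Suc_eq)
          then have "J (Suc j) (int j)" using True T by (auto simp: J_def intro!: exI[of _ j])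
          then show ?thesis using True Hk by simp
        next
          case False
          then have "\<forall>b<Suc j. b \<notin> set p \<longrightarrow> Hm k' \<le> Hm b" using k'(4) by (force simp: less_Suc_eq)
          then have "J (Suc j) (int k')" using T k'(1,3) by (auto simp: J_def intro!: exI[of _ k'])
          then show ?thesis using False k'(2) Hk by auto
        qed
      qed
      show ?thesis
        apply (rule wp_Assign_seq[where v = "-1"], simp, simp)
        apply (rule wp_Seq)
        apply (rule wp_For[where M = K and I = "\<lambda>j s'. J j (s' ''k'' 0)"])
        apply (rule N)+
        subgoal by (simp add: J_def)
        subgoal by (simp add: c)
        subgoal premises q for j s2
        proof -
          note fr2 = q(4) and jK = q(1) and b = q(3) and Jj = q(2)
          have uj: "s2 ''u'' (int j) < 1 \<longleftrightarrow> j \<notin> set p" using p'(5)[OF jK] by (simp add: fr2)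
          have Hj: "s2 ''H'' = s1 ''H''" by (simp add: fr2)
          have jl: "int j \<le> 2 ^ l" using jK N(2) by linarith
          show ?thesis
            apply (rule wp_If)
            subgoal premises w
            proof (rule wp_Assign[where v = "int j"])
              have "j \<notin> set p \<and> (s2 ''k'' 0 < 0 \<or> Hm j < s1 ''H'' (s2 ''k'' 0))"
                using w b uj c(4)[OF jK] by (auto simp: Hj)
              then show "(s2(''k'' := (s2 ''k'')(0 := int j))) ''b'' 0 = int j \<and>
                 J (Suc j) ((s2(''k'' := (s2 ''k'')(0 := int j), ''b'' := ((s2(''k'' := (s2 ''k'')(0 := int j))) ''b'')(0 := int j + 1))) ''k'' 0)"
                using Jstep[OF Jj jK] b by simp
            qed (use b jl in simp_all)
            subgoal premises w
            proof (rule wp_Skip)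
              have "\<not> (j \<notin> set p \<and> (s2 ''k'' 0 < 0 \<or> Hm j < s1 ''H'' (s2 ''k'' 0)))"
                using w b uj c(4)[OF jK] by (auto simp: Hj)
              then have "J (Suc j) (s2 ''k'' 0)" using Jstep[OF Jj jK] by auto
              then show "s2 ''b'' 0 = int j \<and> J (Suc j) ((s2(''b'' := (s2 ''b'')(0 := int j + 1))) ''k'' 0)"
                using b by simp
            qed
            done
        qed
        subgoal premises q for s2
        proof -
          note fr2 = q(3)
          obtain k where k: "k < K" "s2 ''k'' 0 = int k" "k \<notin> set p" "\<And>b. b < K \<Longrightarrow> b \<notin> set p \<Longrightarrow> Hm k \<le> Hm b"
            using q(1) ex unfolding J_def by auto
          have c2: "s2 ''n'' 0 = int n" "s2 ''M'' 0 = M" "s2 ''H'' (int k) = Hm k" "s2 ''F'' 0 = horner M (map Hm p)"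
            "\<And>i. i < n \<Longrightarrow> s2 ''g'' (int i) = horner M (map (\<lambda>b. Im b i) p)"
            "\<And>l. l < n \<Longrightarrow> s2 ''I'' (int k * int n + int l) = Im k l" "s2 ''u'' = s1 ''u''" "s2 ''r'' 0 = int r"
            using c p'(7,8) k(1) r by (simp_all add: fr2)
          have pk: "set (p @ [k]) \<subseteq> {..<K}" "length (p @ [k]) \<le> K" using p'(2,3) k(1) rK by auto
          have new: "distinct (p @ [k])" "length (p @ [k]) = Suc r" "sorted (map Hm (p @ [k]))"
            "\<forall>b\<in>set (p @ [k]). \<forall>b'<K. b' \<notin> set (p @ [k]) \<longrightarrow> Hm b \<le> Hm b'"
            using p'(1,2,4,6) k by (auto simp: sorted_append)
          show ?thesis
            apply (rule wp_Store_seq[where i = "int k" and v = 1], simp add: k, simp, simp)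
            apply (rule wp_Assign_seq[where v = "horner M (map Hm (p @ [k]))"])
            subgoal by (simp add: c2 k horner_append)
            subgoal by (rule hb[OF B(1) pk]) 
            apply (rule wp_map_loop[where M = n and f = "\<lambda>i. horner M (map (\<lambda>b. Im b i) (p @ [k]))"])
            apply (rule N)+
            subgoal by simp
            subgoal by (simp add: c2)
            subgoal by (simp add: c2 k horner_append)
            subgoal by (rule hb[OF Ib pk])
            subgoal
              using new pk p'(5) k(1,3) by (auto simp: c2 Inv_def intro!: exI[of _ "p @ [k]"])
            done
        qed
        done
    qed
    subgoal premises q for s'
    proof -
      obtain p where p: "distinct p" "length p = K" "set p \<subseteq> {..<K}" "sorted (map Hm p)"
        "s' ''F'' 0 = horner M (map Hm p)" "\<forall>i<n. s' ''g'' (int i) = horner M (map (\<lambda>b. Im b i) p)"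
        using q(1) unfolding Inv_def by blast
      have "set p = {..<K}" using p(1-3) by (metis card_lessThan card_subset_eq distinct_card finite_lessThan)
      then have "mset p = mset [0..<K]" using p(1)
        by (metis atLeast_upt distinct_upt set_eq_iff_mset_eq_distinct)
      then show ?thesis using p by blast
    qed
    done
qed

text \<open>The first round stores its centre unconditionally, because the initial
  \<open>Fb = 0\<close> is not a value of \<open>F\<close>.\<close>

definition keep_best :: com where
  "keep_best = If (And (Not (Less (Var ''it'') (Num 1))) (Not (Less (Var ''Fb'') (Var ''F'')))) Skip
     (''Fb'' ::= Var ''F'' ;; For ''l'' (Var ''n'') (Store ''Xb'' (Var ''l'') (Cell ''X'' (Var ''l''))))"

lemma wp_keep_best:
  assumes n: "s ''n'' 0 = int n" and N: "n \<le> N" "int n \<le> 2 ^ l"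
    and F: "\<bar>s ''F'' 0\<bar> \<le> 2 ^ l" and X: "\<And>i. i < n \<Longrightarrow> \<bar>s ''X'' (int i)\<bar> \<le> 2 ^ l"
  shows "wp N l keep_best (\<lambda>s'. if s ''it'' 0 < 1 \<or> s ''Fb'' 0 < s ''F'' 0
      then s' ''Fb'' 0 = s ''F'' 0 \<and> (\<forall>i<n. s' ''Xb'' (int i) = s ''X'' (int i))
      else s' ''Fb'' 0 = s ''Fb'' 0 \<and> (\<forall>i<n. s' ''Xb'' (int i) = s ''Xb'' (int i))) s"
  unfolding keep_best_def
  apply (rule wp_If)
  subgoal by (rule wp_Skip) auto
  apply (rule wp_Assign_seq[where v = "s ''F'' 0"], simp, rule F)
  apply (rule wp_map_loop[where M = n and f = "\<lambda>i. s ''X'' (int i)"])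
  apply (rule N)+
  subgoal by simp
  subgoal by (simp add: n)
  subgoal by simp
  subgoal by (rule X)
  subgoal by auto
  done

text \<open>Vertex \<open>k\<close> is saved in \<open>U\<close> beforehand, since its row of
  \<open>V\<close> is rescaled while later rows still refer to the old one.\<close>

definition cut :: com where
  "cut = For ''j'' (Var ''n'') (
      Store ''a'' (Var ''j'') (Num 0) ;;
      For ''l'' (Var ''n'') (Store ''a'' (Var ''j'') (Plus (Cell ''a'' (Var ''j''))
        (Times (Cell ''g'' (Var ''l'')) (Minus (Times (Var ''n'') (Cell ''V'' (idx (Var ''j'') (Var ''l'')))) (Cell ''X'' (Var ''l''))))))) ;;
    ''k'' ::= Num 0 ;;
    For ''j'' (Var ''n'') (If (Less (Cell ''a'' (Var ''k'')) (Cell ''a'' (Var ''j''))) (''k'' ::= Var ''j'') Skip) ;;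
    For ''l'' (Var ''n'') (Store ''U'' (Var ''l'') (Cell ''V'' (idx (Var ''k'') (Var ''l'')))) ;;
    For ''j'' (Var ''n'') (
      ''z'' ::= Minus (Num 1) (Div (Minus (Num 0) (Times (Times (Num 4) (Var ''n'')) (Cell ''a'' (Var ''j'')))) (Cell ''a'' (Var ''k''))) ;;
      For ''l'' (Var ''n'') (Store ''V'' (idx (Var ''j'') (Var ''l''))
        (Plus (Times (Var ''q'') (Cell ''V'' (idx (Var ''j'') (Var ''l''))))
          (Times (Var ''z'') (Minus (Cell ''V'' (idx (Var ''j'') (Var ''l''))) (Cell ''U'' (Var ''l'')))))))"

lemma wp_cut:
  fixes Vm :: "nat \<Rightarrow> nat \<Rightarrow> int" and X g t :: "nat \<Rightarrow> int" and z :: "nat \<Rightarrow> nat \<Rightarrow> int" and n :: nat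
  assumes t_def: "\<And>j. t j = (\<Sum>i<n. g i * (int n * Vm j i - X i))"
    and z_def: "\<And>k j. z k j = 1 - (- (4 * int n * t j)) div t k"
    and n: "s ''n'' 0 = int n" "1 \<le> n" and q: "s ''q'' 0 = q"
    and V: "\<And>j i. j < n \<Longrightarrow> i < n \<Longrightarrow> s ''V'' (int j * int n + int i) = Vm j i"
    and X: "\<And>i. i < n \<Longrightarrow> s ''X'' (int i) = X i" and g: "\<And>i. i < n \<Longrightarrow> s ''g'' (int i) = g i"
    and N: "n \<le> N" "int n \<le> 2 ^ l"
    and B: "\<And>j i. j < n \<Longrightarrow> i < n \<Longrightarrow> \<bar>g i * (int n * Vm j i - X i)\<bar> \<le> B" "int n * B \<le> 2 ^ l"
    and BV: "\<And>j i. j < n \<Longrightarrow> i < n \<Longrightarrow> \<bar>Vm j i\<bar> \<le> 2 ^ l"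
    and Bz: "\<And>k j. k < n \<Longrightarrow> (\<And>j. j < n \<Longrightarrow> t j \<le> t k) \<Longrightarrow> j < n \<Longrightarrow> \<bar>z k j\<bar> \<le> 2 ^ l"
      "\<And>k j i. k < n \<Longrightarrow> (\<And>j. j < n \<Longrightarrow> t j \<le> t k) \<Longrightarrow> j < n \<Longrightarrow> i < n \<Longrightarrow>
        \<bar>q * Vm j i + z k j * (Vm j i - Vm k i)\<bar> \<le> 2 ^ l"
  shows "wp N l cut (\<lambda>s'. \<exists>k<n. (\<forall>j<n. t j \<le> t k) \<and>
    (\<forall>j<n. \<forall>i<n. s' ''V'' (int j * int n + int i) = q * Vm j i + z k j * (Vm j i - Vm k i))) s"
proof -
  have sz: "\<bar>\<Sum>i<Suc i. g i * (int n * Vm j i - X i)\<bar> \<le> 2 ^ l" if "j < n" "i < n" for i j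
    by (rule abs_sum_le[OF B(1)[OF that(1)] that(2) B(2)])
  show ?thesis
    unfolding cut_def
    apply (rule wp_Seq)
    apply (rule wp_For[where M = n and I = "\<lambda>j s'. \<forall>j'<j. s' ''a'' (int j') = t j'"])
    apply (rule N)+
    subgoal by simp
    subgoal by (simp add: n)
    subgoal premises p for j s1
    proof -
      note fr = p(4) and jn = p(1) and j = p(3) and I = p(2)
      have c: "s1 ''n'' 0 = int n" "\<And>i. i < n \<Longrightarrow> s1 ''V'' (int j * int n + int i) = Vm j i"
        "\<And>i. i < n \<Longrightarrow> s1 ''X'' (int i) = X i" "\<And>i. i < n \<Longrightarrow> s1 ''g'' (int i) = g i"
        using n V[OF jn] X g by (simp_all add: fr)
      show ?thesis
        apply (rule wp_Store_seq[where i = "int j" and v = 0], simp add: j, simp, simp)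
        apply (rule wp_sum_loop[where M = n and i = "int j" and f = "\<lambda>i. g i * (int n * Vm j i - X i)"])
        apply (rule N)+
        subgoal by simp
        subgoal by (simp add: c)
        subgoal by (simp add: j)
        subgoal by (simp add: c j)
        subgoal using sz[OF jn] by (simp del: sum.lessThan_Suc)
        subgoal using I j by (simp add: less_Suc_eq t_def)
        done
    qed
    apply (rule wp_Assign_seq[where v = 0], simp, simp)
    apply (rule wp_Seq)
    subgoal premises p1 for s1
    proof -
      note fr1 = p1(3)
      have a1: "\<And>j. j < n \<Longrightarrow> s1 ''a'' (int j) = t j" using p1(1) by blast
      have c1: "s1 ''n'' 0 = int n" "s1 ''q'' 0 = q" "\<And>j i. j < n \<Longrightarrow> i < n \<Longrightarrow> s1 ''V'' (int j * int n + int i) = Vm j i"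
        using n q V by (simp_all add: fr1)
      show ?thesis
        apply (rule wp_For[where M = n and I = "\<lambda>j s'. \<exists>k<n. s' ''k'' 0 = int k \<and> (\<forall>j'<j. t j' \<le> t k)"])
        apply (rule N)+
        subgoal using n(2) by (intro exI[of _ 0]) simp
        subgoal by (simp add: c1)
        subgoal premises p2 for j s2
        proof -
          note fr2 = p2(4) and jn = p2(1) and j = p2(3)
          obtain k where k: "k < n" "s2 ''k'' 0 = int k" "\<And>j'. j' < j \<Longrightarrow> t j' \<le> t k" using p2(2) by blast
          have a2: "s2 ''a'' (int k) = t k" "s2 ''a'' (int j) = t j" using a1 k(1) jn by (simp_all add: fr2)
          have jl: "int j \<le> 2 ^ l" using jn N(2) by linarith
          show ?thesis
            apply (rule wp_If)
            subgoal premises w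
              apply (rule wp_Assign[where v = "int j"], simp add: j, simp only: abs_of_nat jl)
              using w jn j k by (auto simp: a2 less_Suc_eq intro!: exI[of _ j] intro: order_trans less_imp_le)
            subgoal premises w
              apply (rule wp_Skip)
              using w jn j k by (auto simp: a2 less_Suc_eq intro!: exI[of _ k])
            done
        qed
        apply (rule wp_Seq)
        subgoal premises p2 for s2
        proof -
          note fr2 = p2(3)
          obtain k where k: "k < n" "s2 ''k'' 0 = int k" "\<And>j'. j' < n \<Longrightarrow> t j' \<le> t k" using p2(1) by blast
          have c2: "s2 ''n'' 0 = int n" "s2 ''q'' 0 = q" "\<And>j i. j < n \<Longrightarrow> i < n \<Longrightarrow> s2 ''V'' (int j * int n + int i) = Vm j i"
            "\<And>j. j < n \<Longrightarrow> s2 ''a'' (int j) = t j" using c1 a1 by (simp_all add: fr2)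
          show ?thesis
            apply (rule wp_map_loop[where M = n and f = "\<lambda>i. Vm k i"])
            apply (rule N)+
            subgoal by simp
            subgoal by (simp add: c2)
            subgoal by (simp add: c2 k)
            subgoal by (rule BV[OF k(1)])
            apply (rule wp_For[where M = n and I = "\<lambda>j s'. (\<forall>j'<j. \<forall>i<n. s' ''V'' (int j' * int n + int i) = q * Vm j' i + z k j' * (Vm j' i - Vm k i)) \<and>
              (\<forall>j'<n. j \<le> j' \<longrightarrow> (\<forall>i<n. s' ''V'' (int j' * int n + int i) = Vm j' i))"])
            apply (rule N)+
            subgoal by (simp add: c2)
            subgoal by (simp add: c2)
            subgoal premises p3 for j s3
            proof -
              note fr3 = p3(4) and jn = p3(1) and j = p3(3) and I = p3(2)
              have c3: "s3 ''n'' 0 = int n" "s3 ''q'' 0 = q" "s3 ''k'' 0 = int k" "s3 ''a'' (int j) = t j" "s3 ''a'' (int k) = t k"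
                "\<And>i. i < n \<Longrightarrow> s3 ''U'' (int i) = Vm k i"
                using c2 k jn by (simp_all add: fr3)
              show ?thesis
                apply (rule wp_Assign_seq[where v = "z k j"])
                subgoal by (simp add: c3 j z_def)
                subgoal by (rule Bz(1)[OF k(1) k(3) jn])
                apply (rule wp_For[where M = n and I = "\<lambda>i s'.
                   (\<forall>j'<j. \<forall>i<n. s' ''V'' (int j' * int n + int i) = q * Vm j' i + z k j' * (Vm j' i - Vm k i)) \<and>
                   (\<forall>j'<n. Suc j \<le> j' \<longrightarrow> (\<forall>i<n. s' ''V'' (int j' * int n + int i) = Vm j' i)) \<and>
                   (\<forall>i'<i. s' ''V'' (int j * int n + int i') = q * Vm j i' + z k j * (Vm j i' - Vm k i')) \<and>
                   (\<forall>i'<n. i \<le> i' \<longrightarrow> s' ''V'' (int j * int n + int i') = Vm j i')"])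
                apply (rule N)+
                subgoal using I jn by simp
                subgoal by (simp add: c3)
                subgoal premises p4 for i s4
                proof -
                  note fr4 = p4(4) and il = p4(1) and i = p4(3)
                  have I4: "\<And>j' i. j' < j \<Longrightarrow> i < n \<Longrightarrow> s4 ''V'' (int j' * int n + int i) = q * Vm j' i + z k j' * (Vm j' i - Vm k i)"
                    "\<And>j' i. j' < n \<Longrightarrow> Suc j \<le> j' \<Longrightarrow> i < n \<Longrightarrow> s4 ''V'' (int j' * int n + int i) = Vm j' i"
                    "\<And>i'. i' < i \<Longrightarrow> s4 ''V'' (int j * int n + int i') = q * Vm j i' + z k j * (Vm j i' - Vm k i')"
                    "\<And>i'. i' < n \<Longrightarrow> i \<le> i' \<Longrightarrow> s4 ''V'' (int j * int n + int i') = Vm j i'"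
                    using p4(2) by blast+
                  have c4: "s4 ''n'' 0 = int n" "s4 ''q'' 0 = q" "s4 ''z'' 0 = z k j" "s4 ''j'' 0 = int j" "s4 ''U'' (int i) = Vm k i"
                    using c3 j il by (simp_all add: fr4)
                  have ne: "int j' * int n + int i' = int j * int n + int i \<longleftrightarrow> j' = j \<and> i' = i" if "i' < n" for j' i'
                    by (rule idx_inj[OF that il])
                  show ?thesis
                    apply (rule wp_Store)
                     apply (simp add: c4 i I4(4)[OF il order_refl])
                     apply (rule Bz(2)[OF k(1) k(3) jn il])
                     apply assumption
                    apply (simp add: c4 i I4(4)[OF il order_refl])
                    using I4 by (auto simp: ne less_Suc_eq il)
                qed
                subgoal premises p4 for s4
                proof -
                  have I4: "\<And>j' i. j' < j \<Longrightarrow> i < n \<Longrightarrow> s4 ''V'' (int j' * int n + int i) = q * Vm j' i + z k j' * (Vm j' i - Vm k i)"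
                    "\<And>j' i. j' < n \<Longrightarrow> Suc j \<le> j' \<Longrightarrow> i < n \<Longrightarrow> s4 ''V'' (int j' * int n + int i) = Vm j' i"
                    "\<And>i'. i' < n \<Longrightarrow> s4 ''V'' (int j * int n + int i') = q * Vm j i' + z k j * (Vm j i' - Vm k i')"
                    using p4(1) by blast+
                  have "s4 ''j'' 0 = int j" using p4(3) j by simp
                  then show ?thesis using I4 by (auto simp: less_Suc_eq)
                qed
                done
            qed
            subgoal using k by (intro exI[of _ k]) auto
            done
        qed
        done
    qed
    done
qed

text \<open>A round multiplies the common denominator by \<open>q\<close>. Scaling the stored best
  point and value along keeps them comparable, as integers, with those of the next round.\<close>

definition rescale :: com where
  "rescale = ''W'' ::= Times (Var ''W'') (Var ''q'') ;; ''Fb'' ::= Times (Var ''Fb'') (Var ''q'') ;;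
    For ''l'' (Var ''n'') (Store ''Xb'' (Var ''l'') (Times (Cell ''Xb'' (Var ''l'')) (Var ''q'')))"

lemma wp_rescale:
  assumes n: "s ''n'' 0 = int n" and N: "n \<le> N" "int n \<le> 2 ^ l"
    and B: "\<bar>s ''W'' 0 * s ''q'' 0\<bar> \<le> 2 ^ l" "\<bar>s ''Fb'' 0 * s ''q'' 0\<bar> \<le> 2 ^ l"
      "\<And>i. i < n \<Longrightarrow> \<bar>s ''Xb'' (int i) * s ''q'' 0\<bar> \<le> 2 ^ l"
  shows "wp N l rescale (\<lambda>s'. s' ''W'' 0 = s ''W'' 0 * s ''q'' 0 \<and> s' ''Fb'' 0 = s ''Fb'' 0 * s ''q'' 0 \<and>
    (\<forall>i<n. s' ''Xb'' (int i) = s ''Xb'' (int i) * s ''q'' 0)) s"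
  unfolding rescale_def
  apply (rule wp_Assign_seq[where v = "s ''W'' 0 * s ''q'' 0"], simp, rule B)
  apply (rule wp_Assign_seq[where v = "s ''Fb'' 0 * s ''q'' 0"], simp, rule B)
  apply (rule wp_map_loop[where M = n and f = "\<lambda>i. s ''Xb'' (int i) * s ''q'' 0"])
  apply (rule N)+
  subgoal by simp
  subgoal by (simp add: n)
  subgoal by simp
  subgoal by (rule B)
  subgoal by simp
  done

section \<open>The invariant of the rounds\<close>

declare One_nat_def [simp del]

lemma horner_sum:
  "horner M (map (\<lambda>b. \<Sum>l\<in>A. f b l * c l) p) = (\<Sum>l\<in>A. horner M (map (\<lambda>b. f b l) p) * c l)"
  by (induction p) (auto simp: sum.distrib sum_distrib_left sum_distrib_right algebra_simps)

lemma real_horner: "real_of_int (horner M xs) = horner (real_of_int M) (map real_of_int xs)"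
  by (induction xs) auto

context pd_data
begin

definition point :: "(nat \<Rightarrow> int) \<Rightarrow> int \<Rightarrow> nat \<Rightarrow> real" where
  "point X w = (\<lambda>i\<in>{1..n}. real_of_int (X (i - 1)) / real_of_int w)"

lemma point_Suc: "l < n \<Longrightarrow> point X w (Suc l) = X l / w"
  by (simp add: point_def)

lemma point_pre:
  assumes "0 < w" "(\<Sum>l<n. X l) = w * E" "real_of_int E = v {1..n}"
  shows "point X w \<in> pre"
proof -
  have "sum (point X w) {1..n} = (\<Sum>l<n. real_of_int (X l) / w)"
    unfolding One_nat_def sum.atLeast1_atMost_eq by (simp add: point_Suc)
  also have "\<dots> = real_of_int (\<Sum>l<n. X l) / w" by (simp add: sum_divide_distrib)
  also have "\<dots> = v {1..n}" unfolding assms(2) using assms(1,3) by simp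
  finally show ?thesis by (simp add: pre_def point_def)
qed

lemma memb_sel:
  assumes "0 < w" "l < n"
  shows "memb n St Cc w X b l = (if Suc l \<in> sel (point X w) b then 1 else 0)"
proof -
  have row: "b div 2 div n = row b" unfolding row_def by (rule div_mult2_eq[symmetric])
  have "wt (point X w) (row b) l < 0 \<longleftrightarrow> X l - w * Cc (row b) l < 0"
  proof -
    have "wt (point X w) (row b) l < 0 \<longleftrightarrow> real_of_int (X l) < real_of_int (w * Cc (row b) l)"
      using assms by (simp add: wt_def point_Suc divide_less_eq mult.commute)
    then show ?thesis by (simp only: of_int_less_iff) simp
  qed
  then show ?thesis using assms(2)
    by (simp add: memb_def Let_def row Suc_mem_sel St_def pl_def[symmetric] bit_def[symmetric])
      (auto simp: bit_def)
qed

lemma block_value: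
  assumes "0 < w" "b < KK"
  shows "real_of_int (\<Sum>l<n. memb n St Cc w X b l * (X l - w * Cc (b div 2 div n) l)) = w * H (point X w) b"
proof -
  have row: "b div 2 div n = row b" unfolding row_def by (rule div_mult2_eq[symmetric])
  have "H (point X w) b = excess v (point X w) (sel (point X w) b)"
    by (simp add: H_def Min_blk excess_sel)
  also have "\<dots> = (\<Sum>l<n. if Suc l \<in> sel (point X w) b then wt (point X w) (row b) l else 0)"
    by (rule excess_blk[OF sel_blk])
  finally have "w * H (point X w) b = (\<Sum>l<n. w * (if Suc l \<in> sel (point X w) b then wt (point X w) (row b) l else 0))"
    by (simp add: sum_distrib_left)
  also have "\<dots> = (\<Sum>l<n. real_of_int (memb n St Cc w X b l * (X l - w * Cc (row b) l)))"
    by (rule sum.cong) (use assms in \<open>auto simp: memb_sel wt_def point_Suc algebra_simps\<close>)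
  finally show ?thesis by (simp add: row)
qed

text \<open>The choice of coalitions and the arrangement that attain \<open>F\<close> at
  \<open>x\<close> define an affine function that lies above \<open>F\<close> and touches it at
  \<open>x\<close>; its slope in a coordinate is the base-\<open>M\<close> value of the membership
  bits.\<close>

lemma supergradient:
  fixes X :: "nat \<Rightarrow> int" and w M :: int and p :: "nat list"
  defines "x \<equiv> point X w"
  defines "Hm \<equiv> \<lambda>b. \<Sum>l<n. memb n St Cc w X b l * (X l - w * Cc (b div 2 div n) l)"
  defines "g \<equiv> \<lambda>l. horner M (map (\<lambda>b. memb n St Cc w X b l) p)"
  assumes w: "0 < w" and M: "1 \<le> M" and p: "mset p = mset [0..<KK]" "sorted (map Hm p)"
  shows "real_of_int (horner M (map Hm p)) = w * F M x"
    and "F M y \<le> F M x + (\<Sum>l<n. g l * (y (Suc l) - X l / w))"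
proof -
  have pK: "b < KK" if "b \<in> set p" for b using p(1) that by (metis atLeastLessThan_iff set_mset_mset set_upt)
  have Hb: "real_of_int (Hm b) = w * H x b" if "b < KK" for b
    unfolding Hm_def x_def by (rule block_value[OF w that])
  have "sorted (map (H x) p)"
  proof -
    have "sorted_wrt (\<lambda>b b'. Hm b \<le> Hm b') p" using p(2) by (simp add: sorted_map)
    then have "sorted_wrt (\<lambda>b b'. H x b \<le> H x b') p"
    proof (rule sorted_wrt_mono_rel[rotated])
      fix b b' assume b: "b \<in> set p" "b' \<in> set p" "Hm b \<le> Hm b'"
      then have "real_of_int (Hm b) \<le> real_of_int (Hm b')" by simp
      then have "w * H x b \<le> w * H x b'" using Hb pK b by simp
      then show "H x b \<le> H x b'" using w by simp
    qed
    then show ?thesis by (simp add: sorted_map)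
  qed
  then have Fx: "F M x = horner (real_of_int M) (map (\<lambda>B. excess v x (sel x B)) p)"
    by (rule F_eq_selection[OF p(1)]) (simp add: H_def Min_blk excess_sel)
  have "map (\<lambda>B. excess v x (sel x B)) p = map (H x) p" by (simp add: H_def Min_blk excess_sel)
  then have "w * F M x = horner (real_of_int M) (map (\<lambda>b. w * H x b + 0 * 0) p)"
    by (simp only: Fx horner_lincomb)
  also have "map (\<lambda>b. w * H x b + 0 * 0) p = map real_of_int (map Hm p)" using Hb pK by simp
  finally show "real_of_int (horner M (map Hm p)) = w * F M x" by (simp add: real_horner)
  have ex: "excess v y (sel x b) = 1 * excess v x (sel x b) + 1 * (\<Sum>l<n. real_of_int (memb n St Cc w X b l) * (y (Suc l) - X l / w))" for b
  proof -
    have "(\<Sum>l<n. real_of_int (memb n St Cc w X b l) * (y (Suc l) - X l / w)) =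
      (\<Sum>l<n. (if Suc l \<in> sel x b then wt y (row b) l else 0) - (if Suc l \<in> sel x b then wt x (row b) l else 0))"
      by (rule sum.cong) (use w in \<open>auto simp: memb_sel wt_def point_Suc x_def\<close>)
    then show ?thesis unfolding excess_blk[OF sel_blk] sum_subtractf by simp
  qed
  have "F M y \<le> horner (real_of_int M) (map (\<lambda>B. excess v y (sel x B)) p)"
    by (rule F_le_selection) (use M p sel_blk in auto)
  also have "\<dots> = F M x + horner (real_of_int M) (map (\<lambda>b. \<Sum>l<n. real_of_int (memb n St Cc w X b l) * (y (Suc l) - X l / w)) p)"
    unfolding ex horner_lincomb Fx by simp
  also have "horner (real_of_int M) (map (\<lambda>b. \<Sum>l<n. real_of_int (memb n St Cc w X b l) * (y (Suc l) - X l / w)) p) =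
    (\<Sum>l<n. g l * (y (Suc l) - X l / w))"
    unfolding horner_sum g_def real_horner by (simp add: comp_def)
  finally show "F M y \<le> F M x + (\<Sum>l<n. g l * (y (Suc l) - X l / w))" .
qed

end

text \<open>The heights sum to 0 and none exceeds \<open>t k\<close>, so none is below
  \<open>- (int n * t k)\<close>. If \<open>t k = 0\<close>, the division yields 0.\<close>

lemma cut_coefficient_bound:
  fixes t :: "nat \<Rightarrow> int"
  assumes "k < n" "\<And>j. j < n \<Longrightarrow> t j \<le> t k" "(\<Sum>j<n. t j) = 0" "j < n"
  shows "\<bar>1 - (- (4 * int n * t j)) div t k\<bar> \<le> 4 * int n * int n + 1"
proof -
  have low: "- (int n * t k) \<le> t j" and tk0: "0 \<le> t k"
  proof -
    have "(\<Sum>i<n. t i) \<le> (\<Sum>i<n. t k)" using assms(2) by (intro sum_mono) auto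
    then have "0 \<le> int n * t k" using assms(3) by simp
    then show tk0: "0 \<le> t k" using assms(1) by (simp add: zero_le_mult_iff)
    have "(\<Sum>i\<in>{..<n} - {j}. t i) \<le> (\<Sum>i\<in>{..<n} - {j}. t k)" using assms(2) by (intro sum_mono) auto
    also have "\<dots> = (int n - 1) * t k" using assms(4) by (simp add: of_nat_diff)
    also have "(\<Sum>i\<in>{..<n} - {j}. t i) = - t j" using assms(3,4) by (simp add: sum_diff1)
    finally show "- (int n * t k) \<le> t j" using tk0 by (simp add: algebra_simps)
  qed
  show ?thesis
  proof (cases "t k = 0")
    case False
    then have tk: "0 < t k" using tk0 by simp
    have up: "t j \<le> t k" by (rule assms(2)[OF assms(4)])
    have n0: "0 \<le> 4 * int n" by simp
    have "- (4 * int n * t j) \<le> (4 * int n * int n) * t k"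
      using mult_left_mono[OF low n0] by (simp add: algebra_simps)
    then have "(- (4 * int n * t j)) div t k \<le> ((4 * int n * int n) * t k) div t k" using tk by (intro zdiv_mono1)
    then have u: "(- (4 * int n * t j)) div t k \<le> 4 * int n * int n" using tk by simp
    have "(- (4 * int n)) * t k \<le> - (4 * int n * t j)"
      using mult_left_mono[OF up n0] by (simp add: algebra_simps)
    then have "((- (4 * int n)) * t k) div t k \<le> (- (4 * int n * t j)) div t k" using tk by (intro zdiv_mono1)
    moreover have "((- (4 * int n)) * t k) div t k = - (4 * int n)" using tk by (intro nonzero_mult_div_cancel_right) simp
    ultimately have l: "- (4 * int n) \<le> (- (4 * int n * t j)) div t k" by linarith
    have "4 * int n * 1 \<le> 4 * int n * int n" using assms(1) by (intro mult_left_mono) auto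
    moreover have "0 \<le> 4 * int n * int n" by simp
    ultimately show ?thesis using u l by linarith
  qed simp
qed

text \<open>\<open>P\<close> dominates the value of the grand coalition and the number of blocks, so
  that all later sizes can be bounded by powers of it; \<open>L\<close> measures its bits.\<close>

locale pd_run = pd_data +
  fixes E P :: int and L :: nat
  assumes E: "real_of_int E = v {1..n}" and P: "E + int KK + 64 \<le> P" "P \<le> 2 ^ L"
begin

text \<open>
  \<open>\<eta>\<close> is the gap of \<open>F_sharp\<close> at distance \<open>1 / Rr\<close> from the nucleolus. The points \<open>Gp i\<close> span a copy of the
  initial simplex shrunk towards the nucleolus by \<open>s\<close>, so small that \<open>F\<close> exceeds \<open>F nuc - \<eta>\<close> on it; as long
  as no centre is that good, no cut removes them. \<open>T\<close> rounds would make the determinant of their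
  barycentric coordinates larger than 1.
\<close>

definition M :: int where "M = P ^ (4 * n + 6)"
definition Rr :: int where "Rr = P ^ (2 * n + 3)"
definition ex :: nat where "ex = (4 * n + 6) * KK + 4 * n + 8"
definition T :: nat where "T = 16 * n ^ 3 * (n * L * ex)"
definition q :: int where "q = 32 * int n ^ 4"
definition \<eta> :: real where "\<eta> = 1 / (real n ^ n * real n ^ n * real (nat Rr))"
definition s :: real where "s = \<eta> / (4 * real_of_int P ^ 2 * real_of_int M ^ KK)"
definition G :: "nat \<Rightarrow> nat \<Rightarrow> real" where "G i l = (1 - s) * nuc (Suc l) + s * (if l = i then E else 0)"

lemma E_nonneg: "0 \<le> E"
  using E v_nonneg[of "{1..n}"] by simp

lemma Rn_pos: "1 \<le> Rn"
  using n1 by (simp add: Rn_def)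

lemma P_bounds: "64 \<le> P" "2 * int n \<le> P" "E + 1 \<le> P" "int KK \<le> P" "E + 2 * int n + 64 \<le> P"
proof -
  have "2 * n * 1 \<le> KK" using Rn_pos unfolding KK_def by (intro mult_left_mono) auto
  then have "2 * int n \<le> int KK" by simp
  then show "64 \<le> P" "2 * int n \<le> P" "E + 1 \<le> P" "int KK \<le> P" "E + 2 * int n + 64 \<le> P"
    using P(1) E_nonneg by linarith+
qed

lemma HB_le: "HB \<le> P ^ 2"
proof -
  have "HB = real_of_int (int n * (E + 1) + E)" by (simp add: HB_def E[symmetric])
  also have "int n * (E + 1) + E \<le> (int n + 1) * (E + 1)" by (simp add: algebra_simps)
  also have "(int n + 1) * (E + 1) \<le> P * P"
    using P_bounds E_nonneg n1 by (intro mult_mono) auto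
  finally show ?thesis by (simp add: power2_eq_square)
qed

lemma Rr_pos: "1 \<le> Rr"
  using P_bounds unfolding Rr_def by (intro one_le_power) simp

lemma real_Rr: "real (nat Rr) = real_of_int Rr"
  using Rr_pos by simp

lemma n_pow: "real n ^ n \<le> real_of_int P ^ n"
  using P_bounds by (intro power_mono) auto

lemma \<eta>_pos: "0 < \<eta>"
  using n1 Rr_pos by (simp add: \<eta>_def)

lemma inv_\<eta>_le: "real n ^ n * real n ^ n * real (nat Rr) \<le> real_of_int P ^ (4 * n + 3)"
proof -
  have "real n ^ n * real n ^ n * real (nat Rr) \<le> real_of_int P ^ n * real_of_int P ^ n * real_of_int P ^ (2 * n + 3)"
    unfolding real_Rr using n_pow P_bounds by (intro mult_mono) (auto simp: Rr_def)
  also have "\<dots> = real_of_int P ^ (4 * n + 3)" by (simp add: power_add[symmetric])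
  finally show ?thesis .
qed

text \<open>Accounts for the exponent of \<open>M\<close>: \<open>2 * n\<close> for the two factors
  \<open>n ^ n\<close>, \<open>2 * n + 3\<close> for \<open>Rr\<close>, 2 for \<open>HB\<close>, and
  1 to absorb the constants.\<close>

lemma M_large: "1 + 2 * HB * (real n ^ n * real n ^ n * real (nat Rr)) \<le> real_of_int M"
proof -
  let ?P = "real_of_int P"
  have P1: "64 \<le> ?P" using P_bounds by simp
  have "2 * HB * (real n ^ n * real n ^ n * real (nat Rr)) \<le> 2 * ?P ^ 2 * ?P ^ (4 * n + 3)"
    using HB_le HB_nonneg inv_\<eta>_le P1 by (intro mult_mono) auto
  also have "\<dots> = 2 * ?P ^ (4 * n + 5)" by (simp add: power_add[symmetric] add.commute)
  finally have "1 + 2 * HB * (real n ^ n * real n ^ n * real (nat Rr)) \<le> 1 + 2 * ?P ^ (4 * n + 5)" by simp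
  also have "\<dots> \<le> ?P * ?P ^ (4 * n + 5)"
  proof -
    have "1 \<le> ?P ^ (4 * n + 5)" using P1 by (intro one_le_power) simp
    then have "3 * ?P ^ (4 * n + 5) \<le> ?P * ?P ^ (4 * n + 5)" using P1 by (intro mult_right_mono) auto
    then show ?thesis using \<open>1 \<le> ?P ^ (4 * n + 5)\<close> by linarith
  qed
  also have "\<dots> = real_of_int M" by (simp add: M_def add.commute flip: power_Suc)
  finally show ?thesis .
qed

lemma M_ge: "2 \<le> M"
proof -
  have "P ^ 1 \<le> P ^ (4 * n + 6)" using P_bounds by (intro power_increasing) auto
  then show ?thesis using P_bounds(1) by (simp add: M_def)
qed

text \<open>\<open>s\<close> is measured against the oscillation \<open>2 * HB * M ^ KK\<close> of
  \<open>F\<close>; since \<open>HB \<le> P ^ 2\<close>, a factor 2 is left over.\<close>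

lemma s_props: "0 < s" "s \<le> 1" "s * (2 * HB * real_of_int M ^ KK) < \<eta>"
proof -
  let ?P = "real_of_int P" and ?M = "real_of_int M"
  have M1: "1 \<le> ?M ^ KK" using M_ge by (intro one_le_power) simp
  have P1: "64 \<le> ?P" using P_bounds by simp
  have d: "0 < 4 * ?P ^ 2 * ?M ^ KK" using P1 M1 by (intro mult_pos_pos) auto
  show "0 < s" unfolding s_def using \<eta>_pos d by simp
  have "\<eta> \<le> 1"
  proof -
    have "1 * 1 * 1 \<le> real n ^ n * real n ^ n * real (nat Rr)"
      using n1 Rr_pos by (intro mult_mono one_le_power) auto
    moreover have "1 / a \<le> 1" if "1 * 1 * 1 \<le> a" for a :: real using that by simp
    ultimately show ?thesis unfolding \<eta>_def by blast
  qed
  moreover have "1 * 1 \<le> (4 * ?P ^ 2) * ?M ^ KK"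
  proof (rule mult_mono)
    have "1 \<le> ?P ^ 2" using P1 by (intro one_le_power) simp
    then show "1 \<le> 4 * ?P ^ 2" by simp
  qed (use M1 in auto)
  ultimately show "s \<le> 1" unfolding s_def using \<eta>_pos by (simp add: divide_le_eq)
  have "s * (2 * HB * ?M ^ KK) \<le> s * (2 * ?P ^ 2 * ?M ^ KK)"
    using \<open>0 < s\<close> HB_le M1 by (intro mult_left_mono mult_right_mono) auto
  also have "\<dots> = \<eta> / 2"
  proof -
    have "\<eta> / (4 * Z) * (2 * Z) = \<eta> / 2" if "Z \<noteq> 0" for Z using that by simp
    moreover have "?P ^ 2 * ?M ^ KK \<noteq> 0" using d M_ge by auto
    ultimately show ?thesis unfolding s_def mult.assoc by blast
  qed
  also have "\<dots> < \<eta>" using \<eta>_pos by simp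
  finally show "s * (2 * HB * real_of_int M ^ KK) < \<eta>" by simp
qed

definition Gp :: "nat \<Rightarrow> nat \<Rightarrow> real" where
  "Gp i = affine_comb {1..n} s nuc (\<lambda>k\<in>{1..n}. if k = Suc i then real_of_int E else 0)"

lemma Gp_Suc: "l < n \<Longrightarrow> Gp i (Suc l) = G i l"
  by (simp add: Gp_def affine_comb_def G_def)

text \<open>\<open>Gp i\<close> is a short step from the nucleolus towards a vertex of the initial
  simplex, and by concavity the loss is at most \<open>s\<close> times the oscillation of
  \<open>F\<close>.\<close>

lemma F_Gp: "F M nuc - \<eta> < F M (Gp i)" if i: "i < n"
proof -
  define u where "u = (\<lambda>k\<in>{1..n}. if k = Suc i then real_of_int E else 0)"
  have M2: "2 \<le> real_of_int M" using M_ge by simp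
  have ub: "\<bar>u k\<bar> \<le> v {1..n} + 1" if "k \<in> {1..n}" for k using that E E_nonneg by (simp add: u_def)
  have 1: "\<bar>F M u\<bar> \<le> HB * real_of_int M ^ KK" by (rule abs_F_le[OF ub M2])
  have nb: "\<bar>nuc k\<bar> \<le> v {1..n} + 1" if "k \<in> {1..n}" for k using nuc_bounds[OF that] by simp
  have 2: "\<bar>F M nuc\<bar> \<le> HB * real_of_int M ^ KK" by (rule abs_F_le[OF nb M2])
  have "(1 - s) * F M nuc + s * F M u \<le> F M (Gp i)"
    unfolding Gp_def u_def[symmetric] by (rule F_concave) (use M2 s_props in auto)
  moreover have "s * (F M nuc - F M u) \<le> s * (2 * HB * real_of_int M ^ KK)"
    using s_props 1 2 by (intro mult_left_mono) auto
  ultimately show ?thesis using s_props(3) by (simp add: algebra_simps)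
qed

text \<open>\<open>ex\<close> is an exponent with
  \<open>2 / s \<le> P ^ ex \<le> 2 ^ (L * ex)\<close>. In \<open>T\<close> rounds the determinant
  gains the factor \<open>exp (n * L * ex)\<close>, and \<open>2 < exp 1\<close>.\<close>

lemma growth: "1 < (s / 2) ^ n * exp (T / (16 * real n ^ 3))"
proof -
  let ?P = "real_of_int P" and ?M = "real_of_int M"
  define N2 where "N2 = n * L * ex"
  have M1: "1 \<le> ?M ^ KK" using M_ge by (intro one_le_power) simp
  have P1: "64 \<le> ?P" using P_bounds by simp
  have inv: "2 / s = 8 * ?P ^ 2 * ?M ^ KK * (real n ^ n * real n ^ n * real (nat Rr))"
    by (simp add: s_def \<eta>_def)
  also have "\<dots> \<le> ?P * ?P ^ 2 * ?M ^ KK * ?P ^ (4 * n + 3)"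
    using P1 inv_\<eta>_le M1 by (intro mult_mono mult_right_mono) auto
  also have "\<dots> = ?P ^ ((4 * n + 6) * KK + 4 * n + 6)"
  proof -
    have "?P * ?P ^ 2 * (?P ^ (4 * n + 6)) ^ KK * ?P ^ (4 * n + 3) = ?P ^ (1 + 2 + (4 * n + 6) * KK + (4 * n + 3))"
      by (simp only: power_add power_mult power_one_right)
    also have "1 + 2 + (4 * n + 6) * KK + (4 * n + 3) = (4 * n + 6) * KK + 4 * n + 6" by simp
    finally show ?thesis by (simp only: M_def of_int_power)
  qed
  also have "\<dots> \<le> ?P ^ ex" using P1 by (intro power_increasing) (auto simp: ex_def)
  also have "\<dots> \<le> (2 ^ L) ^ ex"
  proof (rule power_mono)
    have "real_of_int P \<le> real_of_int (2 ^ L)" using P(2) by (simp only: of_int_le_iff)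
    then show "?P \<le> 2 ^ L" by simp
  qed (use P1 in simp)
  also have "\<dots> = 2 ^ (L * ex)" by (simp add: power_mult)
  finally have "(2 / s) ^ n \<le> (2 ^ (L * ex)) ^ n" using s_props by (intro power_mono) auto
  also have "\<dots> = 2 ^ N2" by (simp add: N2_def power_mult[symmetric] mult_ac)
  finally have le: "(2 / s) ^ n \<le> 2 ^ N2" .
  have "L \<noteq> 0" using P P_bounds(1) by (cases L) auto
  then have N2: "N2 \<noteq> 0" using n1 by (simp add: N2_def ex_def)
  have "(2::real) < exp 1"
  proof -
    have "(2::real) < (1 + 1 / 2)\<^sup>2" by (simp add: power2_eq_square)
    also have "\<dots> \<le> exp (1 / 2) ^ 2" by (intro power_mono exp_ge_add_one_self) simp
    also have "\<dots> = exp (1::real)" by (simp add: exp_double[symmetric])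
    finally show ?thesis .
  qed
  then have "(2::real) ^ N2 < exp 1 ^ N2" using N2 by (intro power_strict_mono) auto
  also have "\<dots> = exp (real N2)" by (simp add: exp_of_nat_mult[symmetric] mult.commute)
  also have "real N2 = T / (16 * real n ^ 3)" using n1 by (simp add: T_def N2_def)
  finally have lt: "(2 / s) ^ n < exp (T / (16 * real n ^ 3))" using le by simp
  have "(s / 2) ^ n * (2 / s) ^ n = 1" using s_props by (simp add: power_mult_distrib[symmetric])
  moreover have "(s / 2) ^ n * (2 / s) ^ n < (s / 2) ^ n * exp (T / (16 * real n ^ 3))"
    using lt s_props by (intro mult_strict_left_mono) auto
  ultimately show ?thesis by simp
qed

text \<open>Vertices live on the denominator \<open>q ^ t\<close>, centres on
  \<open>n * q ^ t\<close>. As long as no stored value is within \<open>\<eta>\<close> of the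
  maximum, the last clause keeps the points \<open>G\<close> inside the current simplex, with a
  grown determinant; \<open>t = 0\<close> is separate because nothing is stored yet. Exponents grow
  by 5 since a round enlarges numbers by at most \<open>P ^ 5\<close>.\<close>

definition run_inv :: "nat \<Rightarrow> (nat \<Rightarrow> nat \<Rightarrow> int) \<Rightarrow> int \<Rightarrow> (nat \<Rightarrow> int) \<Rightarrow> bool" where
  "run_inv t V Fb Xb \<longleftrightarrow>
    (\<forall>j<n. (\<Sum>l<n. V j l) = E * q ^ t) \<and>
    (\<forall>j<n. \<forall>l<n. \<bar>V j l\<bar> \<le> P ^ (5 * t + 1)) \<and>
    (\<forall>l<n. \<bar>Xb l\<bar> \<le> P ^ (5 * t + 2)) \<and> \<bar>Fb\<bar> \<le> P ^ (5 * t + 4) * M ^ KK \<and>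
    (0 < t \<longrightarrow> (\<Sum>l<n. Xb l) = int n * q ^ t * E \<and> real_of_int Fb = (int n * q ^ t) * F M (point Xb (int n * q ^ t))) \<and>
    (t = 0 \<or> Fb \<le> (int n * q ^ t) * (F M nuc - \<eta>) \<longrightarrow>
      (\<exists>L. col_stochastic n L \<and> (\<forall>i<n. \<forall>l<n. G i l * (q ^ t) = (\<Sum>j<n. L j i * V j l)) \<and>
        (s / 2) ^ n * exp (t / (16 * real n ^ 3)) \<le> \<bar>fdet n L\<bar>))"

lemma q_pos: "0 < q"
  using n1 by (simp add: q_def)

lemma run_inv_start: "run_inv 0 (\<lambda>j l. if j = l then E else 0) 0 (\<lambda>_. 0)"
proof -
  have "\<exists>L. col_stochastic n L \<and> (\<forall>i<n. \<forall>l<n. G i l = (\<Sum>j<n. L j i * (if j = l then E else 0))) \<and>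
        (s / 2) ^ n \<le> \<bar>fdet n L\<bar>"
  proof -
    \<comment> \<open>Barycentric coordinates of the nucleolus in the simplex spanned by
      \<open>E\<close> times the unit vectors. For \<open>E = 0\<close> this simplex is a single
      point, and equal weights do.\<close>
    define lam where "lam j = (if E = 0 then 1 / real n else nuc (Suc j) / E)" for j
    have nE: "nuc (Suc j) = lam j * E" if "j < n" for j
      using nuc_bounds[of "Suc j"] that E by (auto simp: lam_def)
    have lam: "0 \<le> lam j" if "j < n" for j
      using nuc_bounds[of "Suc j"] that E_nonneg by (simp add: lam_def)
    have "(\<Sum>j<n. nuc (Suc j)) = E"
    proof -
      have "sum nuc {1..n} = (\<Sum>j<n. nuc (Suc j))" unfolding One_nat_def by (rule sum.atLeast1_atMost_eq)
      then show ?thesis using nuc_pre E by (simp add: pre_def)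
    qed
    then have lam1: "(\<Sum>j<n. lam j) = 1"
      using n1 by (cases "E = 0") (simp_all add: lam_def flip: sum_divide_distrib)
    show ?thesis
    proof (intro exI conjI allI impI)
      show "col_stochastic n (\<lambda>j i. (1 - s) * lam j + (if j = i then s else 0))"
        "(s / 2) ^ n \<le> \<bar>fdet n (\<lambda>j i. (1 - s) * lam j + (if j = i then s else 0))\<bar>"
        by (rule fdet_start[OF s_props(1,2) lam lam1]; simp)+
      fix i l assume "i < n" "l < n"
      then have "(\<Sum>j<n. ((1 - s) * lam j + (if j = i then s else 0)) * real_of_int (if j = l then E else 0)) =
        (\<Sum>j<n. if j = l then ((1 - s) * lam j + (if j = i then s else 0)) * E else 0)"
        by (intro sum.cong) auto
      also have "\<dots> = ((1 - s) * lam l + (if l = i then s else 0)) * E" using \<open>l < n\<close> by simp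
      also have "\<dots> = G i l" using nE[OF \<open>l < n\<close>] by (simp add: G_def algebra_simps)
      finally show "G i l = (\<Sum>j<n. ((1 - s) * lam j + (if j = i then s else 0)) * real_of_int (if j = l then E else 0))" ..
    qed
  qed
  moreover have "1 \<le> M ^ KK" using M_ge by (intro one_le_power) simp
  ultimately show ?thesis
    unfolding run_inv_def using E_nonneg P_bounds by simp
qed

text \<open>If the best value were still too low, \<open>growth\<close> would push the determinant
  of a column-stochastic matrix above 1. So the best centre is good in value, and
  \<open>F_sharp\<close> makes it good in distance.\<close>

lemma run_inv_end:
  assumes I: "run_inv T V Fb Xb"
  shows "\<forall>l<n. \<bar>Xb l / (int n * q ^ T) - nuc (Suc l)\<bar> < 1 / Rr"
proof (intro allI impI)
  fix l assume l: "l < n"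
  have w: "0 < int n * q ^ T" using n1 q_pos by simp
  have "T \<noteq> 0"
  proof
    assume "T = 0"
    then have "1 < (s / 2) ^ n" using growth by simp
    moreover have "(s / 2) ^ n \<le> 1" using s_props by (intro power_le_one) auto
    ultimately show False by simp
  qed
  then have c: "(\<Sum>l<n. Xb l) = int n * q ^ T * E" "real_of_int Fb = (int n * q ^ T) * F M (point Xb (int n * q ^ T))"
    using I unfolding run_inv_def by auto
  have "\<not> Fb \<le> (int n * q ^ T) * (F M nuc - \<eta>)"
  proof
    assume "Fb \<le> (int n * q ^ T) * (F M nuc - \<eta>)"
    then obtain L where "col_stochastic n L" "(s / 2) ^ n * exp (T / (16 * real n ^ 3)) \<le> \<bar>fdet n L\<bar>"
      using I unfolding run_inv_def by blast
    then show False using growth fdet_le_1[of n L] by linarith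
  qed
  then have "(int n * q ^ T) * (F M nuc - \<eta>) < (int n * q ^ T) * F M (point Xb (int n * q ^ T))"
    unfolding c(2) by simp
  then have "F M nuc - \<eta> < F M (point Xb (int n * q ^ T))" using w by (simp only: mult_less_cancel_left_pos of_int_0_less_iff)
  then have "\<bar>point Xb (int n * q ^ T) (Suc l) - nuc (Suc l)\<bar> < 1 / real (nat Rr)"
    unfolding \<eta>_def
    using M_large M_ge Rr_pos point_pre[OF w c(1) E] l
    by (intro F_sharp) auto
  then show "\<bar>Xb l / (int n * q ^ T) - nuc (Suc l)\<bar> < 1 / Rr"
    using l by (simp add: point_Suc real_Rr)
qed

end

lemma Suc_exponents: "Suc (5 * t) = 5 * t + 1" "Suc (5 * t + 1) = 5 * t + 2" "Suc (5 * t + 2) = 5 * t + 3" "Suc (5 * t + 3) = 5 * t + 4"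
  by auto

context pd_run
begin

text \<open>\<open>core_pt\<close> pays the player at least \<open>Cc t l\<close>, and its
  nonnegative payments add up to \<open>E\<close>.\<close>

lemma Cc_le_E: "l < n \<Longrightarrow> Cc t l \<le> E"
proof -
  assume l: "l < n"
  have "real_of_int (Cc t l) = (\<Sum>j<m. real_of_int (bi l j) * real_of_int (pm t j))"
    by (simp add: Cc_def mult.commute)
  also have "\<dots> \<le> (\<Sum>j<m. real_of_int (bi l j) * Max ((\<lambda>k. al k (Suc j)) ` {1..n}))"
  proof (intro sum_mono mult_left_mono)
    fix j assume j: "j \<in> {..<m}"
    obtain h where h: "pm t j = ai (dig t h) j" using pm_attained by blast
    have "real_of_int (pm t j) = al (Suc (dig t h)) (Suc j)" using al[OF dig_less, of j t h] j h by simp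
    moreover have "Suc (dig t h) \<in> {1..n}" using dig_less by (simp add: Suc_leI)
    ultimately show "real_of_int (pm t j) \<le> Max ((\<lambda>k. al k (Suc j)) ` {1..n})" by (intro Max_ge) auto
    show "0 \<le> real_of_int (bi l j)" using bi[OF l, of j] j by simp
  qed
  also have "\<dots> = core_pt (Suc l)" using l by (simp add: core_pt_def)
  also have "\<dots> \<le> sum core_pt {1..n}"
    using l core_pt_nonneg by (intro member_le_sum) auto
  finally show ?thesis using v_N E by simp
qed

section \<open>Sizes within one round and preservation of the invariant\<close>

definition cen :: "(nat \<Rightarrow> nat \<Rightarrow> int) \<Rightarrow> nat \<Rightarrow> int" where
  "cen V l = (\<Sum>j<n. V j l)"
definition hval :: "(nat \<Rightarrow> nat \<Rightarrow> int) \<Rightarrow> int \<Rightarrow> nat \<Rightarrow> int" where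
  "hval V w b = (\<Sum>l<n. memb n St Cc w (cen V) b l * (cen V l - w * Cc (b div 2 div n) l))"
definition grad :: "(nat \<Rightarrow> nat \<Rightarrow> int) \<Rightarrow> int \<Rightarrow> nat list \<Rightarrow> nat \<Rightarrow> int" where
  "grad V w p l = horner M (map (\<lambda>b. memb n St Cc w (cen V) b l) p)"
definition tilt :: "(nat \<Rightarrow> nat \<Rightarrow> int) \<Rightarrow> (nat \<Rightarrow> int) \<Rightarrow> nat \<Rightarrow> int" where
  "tilt V g j = (\<Sum>l<n. g l * (int n * V j l - cen V l))"
definition zc :: "(nat \<Rightarrow> int) \<Rightarrow> nat \<Rightarrow> nat \<Rightarrow> int" where
  "zc t k j = 1 - (- (4 * int n * t j)) div t k"

lemma q_le: "q \<le> 2 * P ^ 4" "42 * int n ^ 4 \<le> P ^ 5"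
proof -
  have "(2 * int n) ^ 4 \<le> P ^ 4" using P_bounds by (intro power_mono) auto
  then have a: "16 * int n ^ 4 \<le> P ^ 4" by (simp add: power_mult_distrib)
  then show "q \<le> 2 * P ^ 4" by (simp add: q_def)
  have "42 * x \<le> 64 * y" if "16 * x \<le> y" "0 \<le> x" for x y :: int using that by simp
  from this[OF a] have "42 * int n ^ 4 \<le> 64 * P ^ 4" by simp
  also have "\<dots> \<le> P * P ^ 4" using P_bounds by (intro mult_right_mono) auto
  also have "\<dots> = P ^ 5" by (simp add: power_Suc[symmetric] del: power_Suc)
  finally show "42 * int n ^ 4 \<le> P ^ 5" .
qed

lemma q_le_P5: "q \<le> P ^ 5"
proof -
  have "32 * x \<le> y" if "42 * x \<le> y" "0 \<le> x" for x y :: int using that by simp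
  from this[OF q_le(2)] show ?thesis by (simp add: q_def)
qed

lemma n_le_P: "int n \<le> P" "2 * int n \<le> P"
  using P_bounds by auto

lemma P_pow_pos: "1 \<le> P ^ a"
  using P_bounds by (intro one_le_power) simp

lemma q_pow_le: "q ^ t \<le> P ^ (5 * t)"
proof -
  have "q ^ t \<le> (P ^ 5) ^ t" using q_le_P5 q_pos by (intro power_mono) auto
  then show ?thesis by (simp add: power_mult)
qed

lemma P_mult_mono: "a \<le> P \<Longrightarrow> 0 \<le> b \<Longrightarrow> b \<le> P ^ k \<Longrightarrow> a * b \<le> P ^ Suc k"
  using mult_mono[of a P b "P ^ k"] P_bounds by simp

context
  fixes t :: nat and V :: "nat \<Rightarrow> nat \<Rightarrow> int" and Fb :: int and Xb :: "nat \<Rightarrow> int"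
  assumes I: "run_inv t V Fb Xb"
begin

lemma V_sum: "j < n \<Longrightarrow> (\<Sum>l<n. V j l) = E * q ^ t"
  and V_bound: "j < n \<Longrightarrow> l < n \<Longrightarrow> \<bar>V j l\<bar> \<le> P ^ (5 * t + 1)"
  and Xb_bound: "l < n \<Longrightarrow> \<bar>Xb l\<bar> \<le> P ^ (5 * t + 2)"
  and Fb_bound: "\<bar>Fb\<bar> \<le> P ^ (5 * t + 4) * M ^ KK"
  and best: "0 < t \<Longrightarrow> (\<Sum>l<n. Xb l) = int n * q ^ t * E"
      "0 < t \<Longrightarrow> real_of_int Fb = (int n * q ^ t) * F M (point Xb (int n * q ^ t))"
  using I unfolding run_inv_def by blast+

lemma cen_bound: "l < n \<Longrightarrow> \<bar>cen V l\<bar> \<le> P ^ (5 * t + 2)"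
proof -
  assume l: "l < n"
  have "\<bar>cen V l\<bar> \<le> (\<Sum>j<n. \<bar>V j l\<bar>)" unfolding cen_def by (rule sum_abs)
  also have "\<dots> \<le> (\<Sum>j<n. P ^ (5 * t + 1))" using V_bound l by (intro sum_mono) auto
  also have "\<dots> = int n * P ^ (5 * t + 1)" by simp
  also have "\<dots> \<le> P ^ Suc (5 * t + 1)" using n_le_P P_pow_pos[of "5 * t + 1"] by (intro P_mult_mono) auto
  finally show ?thesis by simp
qed

lemma w_bound: "\<bar>int n * q ^ t\<bar> \<le> P ^ (5 * t + 1)"
proof -
  have "int n * q ^ t \<le> P ^ (5 * t + 1)" unfolding Suc_exponents[symmetric] using n_le_P q_pow_le q_pos by (intro P_mult_mono) auto
  then show ?thesis using q_pos by (simp add: abs_mult)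
qed

lemma slack_bound: "l < n \<Longrightarrow> \<bar>cen V l - (int n * q ^ t) * Cc r l\<bar> \<le> P ^ (5 * t + 3)"
proof -
  assume l: "l < n"
  have "\<bar>(int n * q ^ t) * Cc r l\<bar> = Cc r l * \<bar>int n * q ^ t\<bar>" using Cc_nonneg[OF l] by (simp add: abs_mult)
  also have "\<dots> \<le> P ^ Suc (5 * t + 1)"
    using w_bound Cc_le_E[OF l, of r] P_bounds by (intro P_mult_mono) auto
  finally have "\<bar>cen V l - (int n * q ^ t) * Cc r l\<bar> \<le> 2 * P ^ (5 * t + 2)" using cen_bound[OF l] by simp
  also have "\<dots> \<le> P ^ Suc (5 * t + 2)" using P_bounds P_pow_pos[of "5 * t + 2"] by (intro P_mult_mono) auto
  finally show ?thesis by (simp only: Suc_exponents)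
qed

lemma hval_bound: "\<bar>hval V (int n * q ^ t) b\<bar> \<le> P ^ (5 * t + 4)"
proof -
  have "\<bar>hval V (int n * q ^ t) b\<bar> \<le> (\<Sum>l<n. \<bar>memb n St Cc (int n * q ^ t) (cen V) b l * (cen V l - (int n * q ^ t) * Cc (b div 2 div n) l)\<bar>)"
    unfolding hval_def by (rule sum_abs)
  also have "\<dots> \<le> (\<Sum>l<n. P ^ (5 * t + 3))"
  proof (rule sum_mono)
    fix l assume l: "l \<in> {..<n}"
    show "\<bar>memb n St Cc (int n * q ^ t) (cen V) b l * (cen V l - (int n * q ^ t) * Cc (b div 2 div n) l)\<bar> \<le> P ^ (5 * t + 3)"
      using memb_01[of n St Cc "int n * q ^ t" "cen V" b l] slack_bound[of l "b div 2 div n"] l P_pow_pos[of "5 * t + 3"] by auto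
  qed
  also have "\<dots> = int n * P ^ (5 * t + 3)" by simp
  also have "\<dots> \<le> P ^ Suc (5 * t + 3)" using n_le_P P_pow_pos[of "5 * t + 3"] by (intro P_mult_mono) auto
  finally show ?thesis by (simp only: Suc_exponents)
qed

lemma fval_bound: "length p = KK \<Longrightarrow> \<bar>horner M (map (hval V (int n * q ^ t)) p)\<bar> \<le> P ^ (5 * t + 4) * M ^ KK"
  using abs_horner_int_le[of "map (hval V (int n * q ^ t)) p" "P ^ (5 * t + 4)" M] hval_bound M_ge P_pow_pos[of "5 * t + 4"]
  by auto

lemma tilt_sum: "(\<Sum>j<n. tilt V g j) = 0"
proof -
  have "(\<Sum>j<n. tilt V g j) = (\<Sum>l<n. \<Sum>j<n. g l * (int n * V j l - cen V l))"
    unfolding tilt_def by (rule sum.swap)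
  also have "\<dots> = (\<Sum>l<n. g l * (int n * cen V l - int n * cen V l))"
  proof (rule sum.cong[OF refl])
    fix l
    have "(\<Sum>j<n. int n * V j l - cen V l) = int n * cen V l - int n * cen V l"
      by (simp add: sum_subtractf cen_def sum_distrib_left)
    then show "(\<Sum>j<n. g l * (int n * V j l - cen V l)) = g l * (int n * cen V l - int n * cen V l)"
      by (simp only: sum_distrib_left[symmetric])
  qed
  finally show ?thesis by simp
qed

lemma zc_bound:
  assumes "k < n" "\<And>j. j < n \<Longrightarrow> tilt V g j \<le> tilt V g k" "j < n"
  shows "\<bar>zc (tilt V g) k j\<bar> \<le> 4 * int n * int n + 1"
  unfolding zc_def by (rule cut_coefficient_bound) (use assms tilt_sum in auto)

text \<open>The factor of a round is \<open>q\<close> plus twice the bound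
  \<open>4 * n\<^sup>2 + 1\<close> for a cut coefficient, in total at most
  \<open>42 * n ^ 4\<close>.\<close>

lemma moved_bound:
  assumes "k < n" "\<And>j. j < n \<Longrightarrow> tilt V g j \<le> tilt V g k" "j < n" "l < n"
  shows "\<bar>q * V j l + zc (tilt V g) k j * (V j l - V k l)\<bar> \<le> P ^ (5 * Suc t + 1)"
proof -
  let ?B = "P ^ (5 * t + 1)"
  have B: "0 \<le> ?B" using P_pow_pos[of "5 * t + 1"] by simp
  have "\<bar>V j l - V k l\<bar> \<le> 2 * ?B" using V_bound[of j l] V_bound[of k l] assms by linarith
  then have "\<bar>zc (tilt V g) k j * (V j l - V k l)\<bar> \<le> (4 * int n * int n + 1) * (2 * ?B)"
    unfolding abs_mult using zc_bound[OF assms(1-3)] by (intro mult_mono) auto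
  moreover have "\<bar>q * V j l\<bar> \<le> q * ?B"
    unfolding abs_mult using V_bound[of j l] assms q_pos by (intro mult_mono) auto
  ultimately have "\<bar>q * V j l + zc (tilt V g) k j * (V j l - V k l)\<bar> \<le> q * ?B + (4 * int n * int n + 1) * (2 * ?B)"
    by linarith
  also have "\<dots> = (q + 8 * int n ^ 2 + 2) * ?B" by (simp add: algebra_simps power2_eq_square)
  also have "\<dots> \<le> P ^ 5 * ?B"
  proof (rule mult_right_mono[OF _ B])
    have "int n ^ 2 \<le> int n ^ 4" "int n ^ 0 \<le> int n ^ 4" using n1 by (intro power_increasing; simp)+
    then have "q + 8 * int n ^ 2 + 2 \<le> 42 * int n ^ 4" by (simp add: q_def)
    then show "q + 8 * int n ^ 2 + 2 \<le> P ^ 5" using q_le(2) by linarith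
  qed
  also have "\<dots> = P ^ (5 * Suc t + 1)" by (simp only: power_add[symmetric]) (simp add: add_ac)
  finally show ?thesis .
qed

lemma scaled_bound: "\<bar>x\<bar> \<le> P ^ (5 * t + a) \<Longrightarrow> \<bar>x * q\<bar> \<le> P ^ (5 * Suc t + a)"
proof -
  assume "\<bar>x\<bar> \<le> P ^ (5 * t + a)"
  then have "\<bar>x\<bar> * q \<le> P ^ (5 * t + a) * P ^ 5" using q_le_P5 q_pos P_pow_pos[of "5 * t + a"] by (intro mult_mono) auto
  also have "\<dots> = P ^ (5 * Suc t + a)" by (simp only: power_add[symmetric]) (simp add: add_ac)
  finally show ?thesis using q_pos by (simp add: abs_mult)
qed

lemma cen_sum: "(\<Sum>l<n. cen V l) = int n * q ^ t * E"
proof -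
  have "(\<Sum>l<n. cen V l) = (\<Sum>j<n. \<Sum>l<n. V j l)" unfolding cen_def by (rule sum.swap)
  also have "\<dots> = (\<Sum>j<n. E * q ^ t)" by (rule sum.cong) (use V_sum in auto)
  finally show ?thesis by simp
qed

lemma point_scale: "0 < c \<Longrightarrow> point (\<lambda>l. X l * c) (w * c) = point X w"
  unfolding point_def by (rule restrict_ext) simp

text \<open>If even the updated best value is too low, so is the value at this round's centre. The
  points \<open>Gp i\<close> have larger values, hence the supergradient inequality puts them
  strictly on the positive side of the cut, and \<open>simplex_cut\<close> applies.\<close>

lemma run_inv_step:
  fixes V' :: "nat \<Rightarrow> nat \<Rightarrow> int" and Xb' :: "nat \<Rightarrow> int" and Fb' :: int
  defines "w \<equiv> int n * q ^ t"
  assumes p: "mset p = mset [0..<KK]" "sorted (map (hval V w) p)"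
    and k: "k < n" "\<And>j. j < n \<Longrightarrow> tilt V (grad V w p) j \<le> tilt V (grad V w p) k"
    and V': "\<And>j l. j < n \<Longrightarrow> l < n \<Longrightarrow> V' j l = q * V j l + zc (tilt V (grad V w p)) k j * (V j l - V k l)"
    and new: "t = 0 \<or> Fb < horner M (map (hval V w) p) \<Longrightarrow>
      Fb' = horner M (map (hval V w) p) * q \<and> (\<forall>l<n. Xb' l = cen V l * q)"
    and old: "\<not> (t = 0 \<or> Fb < horner M (map (hval V w) p)) \<Longrightarrow> Fb' = Fb * q \<and> (\<forall>l<n. Xb' l = Xb l * q)"
  shows "run_inv (Suc t) V' Fb' Xb'"
proof -
  let ?Fm = "horner M (map (hval V w) p)" and ?g = "grad V w p" and ?x = "point (cen V) w"
  have w0: "0 < w" using n1 q_pos by (simp add: w_def)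
  have M1: "1 \<le> M" using M_ge by simp
  have pK: "length p = KK" using p(1) by (metis length_upt minus_nat.diff_0 size_mset)
  have Fm: "real_of_int ?Fm = w * F M ?x"
    using supergradient(1)[OF w0 M1 p(1), of "cen V"] p(2) unfolding hval_def by blast
  have sg: "F M y \<le> F M ?x + (\<Sum>l<n. ?g l * (y (Suc l) - cen V l / w))" for y
    using supergradient(2)[OF w0 M1 p(1), of "cen V" y] p(2) unfolding hval_def grad_def by blast
  \<comment> \<open>Best value and centre including this round, still on the old denominator
    \<open>w\<close>.\<close>
  define Fk Xk where "Fk = (if t = 0 \<or> Fb < ?Fm then ?Fm else Fb)" and "Xk = (if t = 0 \<or> Fb < ?Fm then cen V else Xb)"
  have F': "Fb' = Fk * q" and X': "\<And>l. l < n \<Longrightarrow> Xb' l = Xk l * q"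
    using new old by (simp_all add: Fk_def Xk_def)
  have Fk_bound: "\<bar>Fk\<bar> \<le> P ^ (5 * t + 4) * M ^ KK" using fval_bound[OF pK] Fb_bound by (simp add: Fk_def w_def)
  have Xk_bound: "\<bar>Xk l\<bar> \<le> P ^ (5 * t + 2)" if "l < n" for l using cen_bound[OF that] Xb_bound[OF that] by (simp add: Xk_def)
  have Fk: "real_of_int Fk = w * F M (point Xk w)"
    using Fm best(2) by (auto simp: Fk_def Xk_def w_def)
  have Xk_sum: "(\<Sum>l<n. Xk l) = w * E" using cen_sum best(1) by (auto simp: Xk_def w_def)
  have wq: "int n * q ^ Suc t = w * q" by (simp add: w_def)
  have "(\<Sum>l<n. V' j l) = E * q ^ Suc t" if "j < n" for j
  proof -
    have "(\<Sum>l<n. V' j l) = (\<Sum>l<n. q * V j l + zc (tilt V ?g) k j * (V j l - V k l))"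
      by (rule sum.cong) (use V' that in auto)
    also have "\<dots> = q * (E * q ^ t) + zc (tilt V ?g) k j * (E * q ^ t - E * q ^ t)"
      by (simp only: sum.distrib sum_distrib_left[symmetric] sum_subtractf V_sum[OF that] V_sum[OF k(1)])
    finally show ?thesis by simp
  qed
  moreover have "\<bar>V' j l\<bar> \<le> P ^ (5 * Suc t + 1)" if "j < n" "l < n" for j l
    unfolding V'[OF that] by (rule moved_bound[OF k that])
  moreover have "\<bar>Xb' l\<bar> \<le> P ^ (5 * Suc t + 2)" if "l < n" for l
    unfolding X'[OF that] by (rule scaled_bound[OF Xk_bound[OF that]])
  moreover have "\<bar>Fb'\<bar> \<le> P ^ (5 * Suc t + 4) * M ^ KK"
  proof -
    have "\<bar>Fb'\<bar> = \<bar>Fk\<bar> * q" using q_pos by (simp add: F' abs_mult)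
    also have "\<dots> \<le> (P ^ (5 * t + 4) * M ^ KK) * P ^ 5"
      using Fk_bound q_le_P5 q_pos by (intro mult_mono) auto
    also have "\<dots> = P ^ (5 * t + 4 + 5) * M ^ KK" by (simp only: power_add mult_ac)
    finally show ?thesis by (simp add: add_ac)
  qed
  moreover have "(\<Sum>l<n. Xb' l) = int n * q ^ Suc t * E"
  proof -
    have "(\<Sum>l<n. Xb' l) = (\<Sum>l<n. Xk l) * q" using X' by (simp add: sum_distrib_right)
    then show ?thesis unfolding Xk_sum wq by simp
  qed
  moreover have "real_of_int Fb' = (int n * q ^ Suc t) * F M (point Xb' (int n * q ^ Suc t))"
  proof -
    have "point Xb' (w * q) = point (\<lambda>l. Xk l * q) (w * q)"
      unfolding point_def by (rule restrict_ext) (use X' in auto)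
    then show ?thesis unfolding wq F' point_scale[OF q_pos] using Fk by simp
  qed
  moreover have "\<exists>L :: nat \<Rightarrow> nat \<Rightarrow> real. col_stochastic n L \<and> (\<forall>i<n. \<forall>l<n. G i l * (q ^ Suc t) = (\<Sum>j<n. L j i * V' j l)) \<and>
        (s / 2) ^ n * exp (Suc t / (16 * real n ^ 3)) \<le> \<bar>fdet n L\<bar>"
    if bad: "real_of_int Fb' \<le> (int n * q ^ Suc t) * (F M nuc - \<eta>)"
  proof -
    have "real_of_int Fk * q \<le> (w * (F M nuc - \<eta>)) * q" using bad unfolding wq F' of_int_mult by (simp only: mult_ac)
    then have Fk_le: "real_of_int Fk \<le> w * (F M nuc - \<eta>)" using q_pos by (simp only: mult_le_cancel_right_pos of_int_0_less_iff)
    have "real_of_int ?Fm \<le> real_of_int Fk" by (simp add: Fk_def)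
    then have "w * F M ?x \<le> w * (F M nuc - \<eta>)" using Fk_le Fm by linarith
    then have Fx: "F M ?x \<le> F M nuc - \<eta>" using w0 by (simp only: mult_le_cancel_left_pos of_int_0_less_iff)
    have "t = 0 \<or> real_of_int Fb \<le> w * (F M nuc - \<eta>)"
    proof (cases "t = 0")
      case False
      then have "Fb \<le> Fk" by (simp add: Fk_def)
      then have "real_of_int Fb \<le> real_of_int Fk" by simp
      then show ?thesis using Fk_le by linarith
    qed simp
    then obtain L :: "nat \<Rightarrow> nat \<Rightarrow> real" where L: "col_stochastic n L" "\<And>i l. i < n \<Longrightarrow> l < n \<Longrightarrow> G i l * (q ^ t) = (\<Sum>j<n. L j i * V j l)"
      "(s / 2) ^ n * exp (t / (16 * real n ^ 3)) \<le> \<bar>fdet n L\<bar>"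
      using I unfolding run_inv_def w_def by blast
    have pos: "0 < (\<Sum>l<n. ?g l * (G i l * (real n * (q ^ t)) - cen V l))" if i: "i < n" for i
    proof -
      have "F M nuc - \<eta> < F M ?x + (\<Sum>l<n. ?g l * (Gp i (Suc l) - cen V l / w))"
        using F_Gp[OF i] sg[of "Gp i"] by linarith
      then have "0 < (\<Sum>l<n. ?g l * (Gp i (Suc l) - cen V l / w))" using Fx by linarith
      then have "0 < (\<Sum>l<n. ?g l * (Gp i (Suc l) - cen V l / w)) * w" using w0 by simp
      also have "(\<Sum>l<n. ?g l * (Gp i (Suc l) - cen V l / w)) * w = (\<Sum>l<n. ?g l * (G i l * (real n * (q ^ t)) - cen V l))"
        unfolding sum_distrib_right
      proof (rule sum.cong[OF refl])
        fix l assume "l \<in> {..<n}"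
        then have "Gp i (Suc l) = G i l" by (simp add: Gp_Suc)
        moreover have "(G i l - cen V l / w) * w = G i l * w - cen V l" using w0 by (simp add: left_diff_distrib)
        ultimately show "?g l * (Gp i (Suc l) - cen V l / w) * w = ?g l * (G i l * (real n * (q ^ t)) - cen V l)"
          by (simp add: mult.assoc) (simp add: w_def)
      qed
      finally show ?thesis .
    qed
    obtain L' :: "nat \<Rightarrow> nat \<Rightarrow> real" where L': "col_stochastic n L'"
      "\<forall>i<n. \<forall>l<n. G i l * (q * q ^ t) = (\<Sum>j<n. L' j i * V' j l)"
      "\<bar>fdet n L\<bar> * exp (1 / (16 * real n ^ 3)) \<le> \<bar>fdet n L'\<bar>"
      using simplex_cut[OF n1 cen_def tilt_def k zc_def q_def V' L(1), of G "q ^ t"] L(2) pos by auto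
    have "(s / 2) ^ n * exp (Suc t / (16 * real n ^ 3)) = ((s / 2) ^ n * exp (t / (16 * real n ^ 3))) * exp (1 / (16 * real n ^ 3))"
      by (simp add: add_divide_distrib exp_add)
    also have "\<dots> \<le> \<bar>fdet n L\<bar> * exp (1 / (16 * real n ^ 3))" using L(3) by (intro mult_right_mono) auto
    finally show ?thesis using L' by (intro exI[of _ L']) auto
  qed
  ultimately show ?thesis unfolding run_inv_def by blast
qed

end

end

section \<open>The main loop\<close>

lemma mods_centre [simp]: "mods centre = {''w'', ''l'', ''X'', ''j''}"
  by (auto simp: centre_def)

lemma mods_blocks [simp]: "mods blocks = {''b'', ''h'', ''r'', ''t'', ''i'', ''l'', ''y'', ''s'', ''I'', ''H'', ''u''}"
  by (auto simp: blocks_def)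

lemma mods_select [simp]: "mods select = {''F'', ''l'', ''g'', ''r'', ''k'', ''b'', ''u''}"
  by (auto simp: select_def)

lemma mods_keep_best [simp]: "mods keep_best = {''Fb'', ''l'', ''Xb''}"
  by (auto simp: keep_best_def)

lemma mods_cut [simp]: "mods cut = {''j'', ''a'', ''l'', ''k'', ''U'', ''z'', ''V''}"
  by (auto simp: cut_def)

lemma mods_rescale [simp]: "mods rescale = {''W'', ''Fb'', ''l'', ''Xb''}"
  by (auto simp: rescale_def)

definition cutting_round :: com where
  "cutting_round = centre ;; blocks ;; select ;; keep_best ;; cut ;; rescale"

definition cutting_loop :: com where
  "cutting_loop = For ''it'' (Var ''T'') cutting_round"

lemma mods_cutting_round: "mods cutting_round \<inter> {''n'', ''q'', ''K'', ''M'', ''T'', ''C'', ''S'', ''it''} = {}"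
  by (simp add: cutting_round_def)

context pd_run
begin

lemma grad_bound: "length p = KK \<Longrightarrow> \<bar>grad V w p i\<bar> \<le> M ^ KK"
proof -
  assume p: "length p = KK"
  have "\<bar>grad V w p i\<bar> \<le> 1 * M ^ length (map (\<lambda>b. memb n St Cc w (cen V) b i) p)"
    unfolding grad_def
  proof (rule abs_horner_int_le)
    fix e assume "e \<in> set (map (\<lambda>b. memb n St Cc w (cen V) b i) p)"
    then obtain b where "e = memb n St Cc w (cen V) b i" by auto
    then show "\<bar>e\<bar> \<le> 1" using memb_01[of n St Cc w "cen V" b i] by auto
  qed (use M_ge in auto)
  then show ?thesis using p by simp
qed

definition round_inv :: "nat \<Rightarrow> state \<Rightarrow> bool" where
  "round_inv t s' \<longleftrightarrow> (\<exists>V. run_inv t V (s' ''Fb'' 0) (\<lambda>l. s' ''Xb'' (int l)) \<and>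
    (\<forall>j<n. \<forall>l<n. s' ''V'' (int j * int n + int l) = V j l) \<and> s' ''W'' 0 = q ^ t)"

lemma round_inv_it [simp]: "round_inv t (s'(''it'' := f)) = round_inv t s'"
  by (simp add: round_inv_def)

lemma wp_cutting_round:
  fixes s :: state
  assumes inv: "round_inv t s" and t: "t < T" "s ''it'' 0 = int t"
    and c: "s ''n'' 0 = int n" "s ''q'' 0 = q" "s ''K'' 0 = int KK" "s ''M'' 0 = M"
      "\<And>r l. r < Rn \<Longrightarrow> l < n \<Longrightarrow> s ''C'' (int r * int n + int l) = Cc r l"
      "\<And>r l. r < Rn \<Longrightarrow> l < n \<Longrightarrow> s ''S'' (int r * int n + int l) = St r l"
    and N: "KK \<le> N" "n \<le> N" and big: "P ^ (5 * T + 10) * M ^ KK \<le> 2 ^ l" "2 \<le> l"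
  shows "wp N l cutting_round (round_inv (Suc t)) s"
proof -
  obtain V where I: "run_inv t V (s ''Fb'' 0) (\<lambda>l. s ''Xb'' (int l))" and W: "s ''W'' 0 = q ^ t"
    and V: "\<And>j l. j < n \<Longrightarrow> l < n \<Longrightarrow> s ''V'' (int j * int n + int l) = V j l"
    using inv unfolding round_inv_def by blast
  have MK: "1 \<le> M ^ KK" using M_ge by (intro one_le_power) simp
  \<comment> \<open>Powers of \<open>P\<close> come from coordinates and \<open>M ^ KK\<close> from
    base-\<open>M\<close> values; the exponent \<open>5 * t + 10\<close> leaves room for the final
    rescaling by \<open>q\<close>.\<close>
  have bigM: "P ^ a * M ^ KK \<le> 2 ^ l" if "a \<le> 5 * t + 10" for a
  proof -
    have "P ^ a \<le> P ^ (5 * T + 10)" using that t(1) P_bounds by (intro power_increasing) auto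
    then have "P ^ a * M ^ KK \<le> P ^ (5 * T + 10) * M ^ KK" using MK by (intro mult_right_mono) auto
    then show ?thesis using big(1) by linarith
  qed
  have bigP: "P ^ a \<le> 2 ^ l" if "a \<le> 5 * t + 10" for a
  proof -
    have "P ^ a * 1 \<le> P ^ a * M ^ KK" using MK P_pow_pos[of a] by (intro mult_left_mono) auto
    then show ?thesis using bigM[OF that] by linarith
  qed
  have P1: "P ^ 1 \<le> 2 ^ l" by (rule bigP) simp
  have nl: "int n \<le> 2 ^ l" "int KK \<le> 2 ^ l" using P1 P_bounds(4) n_le_P(1) by (simp_all only: power_one_right)
  have nP: "int n * P ^ a \<le> P ^ Suc a" for a
    using n_le_P(1) P_pow_pos[of a] by (intro P_mult_mono) auto
  define w where "w = int n * q ^ t"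
  have "wp N l centre (\<lambda>s'. s' ''w'' 0 = int n * q ^ t \<and> (\<forall>i<n. s' ''X'' (int i) = (\<Sum>j<n. V j i))) s"
  proof (rule wp_centre[OF c(1) W V N(2) nl(1)])
    show "\<bar>V j l\<bar> \<le> P ^ (5 * t + 1)" if "j < n" "l < n" for j l by (rule V_bound[OF I that])
    show "int n * P ^ (5 * t + 1) \<le> 2 ^ l" by (rule order_trans[OF nP bigP]) simp
    show "\<bar>int n * q ^ t\<bar> \<le> 2 ^ l" by (rule order_trans[OF w_bound[OF I] bigP]) simp
  qed auto
  then have "wp N l centre (wp N l (blocks ;; select ;; keep_best ;; cut ;; rescale) (round_inv (Suc t))) s"
  proof (rule wp_use)
    fix s1 assume h1: "s1 ''w'' 0 = int n * q ^ t \<and> (\<forall>i<n. s1 ''X'' (int i) = (\<Sum>j<n. V j i))"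
      and f1: "\<And>y. y \<notin> mods centre \<Longrightarrow> s1 y = s y"
    have w1: "s1 ''w'' 0 = w" using h1 by (simp add: w_def)
    have X1: "s1 ''X'' (int i) = cen V i" if "i < n" for i using h1 that by (simp add: cen_def)
    have c1: "s1 ''n'' 0 = int n" "s1 ''K'' 0 = int (2 * n * Rn)"
      "\<And>r l. r < Rn \<Longrightarrow> l < n \<Longrightarrow> s1 ''C'' (int r * int n + int l) = Cc r l"
      "\<And>r l. r < Rn \<Longrightarrow> l < n \<Longrightarrow> s1 ''S'' (int r * int n + int l) = St r l"
      using c by (simp_all add: f1 KK_def)
    have "wp N l blocks (\<lambda>s'. \<forall>b<2 * n * Rn. s' ''u'' (int b) = 0 \<and>
      (\<forall>i<n. s' ''I'' (int b * int n + int i) = memb n St Cc w (cen V) b i) \<and>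
      s' ''H'' (int b) = (\<Sum>i<n. memb n St Cc w (cen V) b i * (cen V i - w * Cc (b div 2 div n) i))) s1"
    proof (rule wp_blocks[OF c1(1) n1 w1 c1(2,3,4) _ X1 _ _ N(2) nl(1) big(2)])
      show "St r l \<in> {0, 1, 2}" for r l by (simp add: St_def)
      show "\<bar>cen V l - w * Cc r l\<bar> \<le> P ^ (5 * t + 3)" if "r < Rn" "l < n" for r l
        unfolding w_def by (rule slack_bound[OF I that(2)])
      show "int n * P ^ (5 * t + 3) \<le> 2 ^ l" by (rule order_trans[OF nP bigP]) simp
      show "P ^ (5 * t + 3) \<le> 2 ^ l" by (rule bigP) simp
      show "2 * n * Rn \<le> N" using N(1) by (simp only: KK_def)
      show "int (2 * n * Rn) \<le> 2 ^ l" using nl(2) by (simp only: KK_def)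
    qed auto
    then show "wp N l (blocks ;; select ;; keep_best ;; cut ;; rescale) (round_inv (Suc t)) s1"
    proof (intro wp_Seq[of N l blocks], elim wp_use)
      fix s2 assume h2: "\<forall>b<2 * n * Rn. s2 ''u'' (int b) = 0 \<and>
      (\<forall>i<n. s2 ''I'' (int b * int n + int i) = memb n St Cc w (cen V) b i) \<and>
      s2 ''H'' (int b) = (\<Sum>i<n. memb n St Cc w (cen V) b i * (cen V i - w * Cc (b div 2 div n) i))"
        and f2: "\<And>y. y \<notin> mods blocks \<Longrightarrow> s2 y = s1 y"
      have c2: "s2 ''n'' 0 = int n" "s2 ''K'' 0 = int KK" "s2 ''M'' 0 = M"
        using c by (simp_all add: f1 f2)
      have h2': "s2 ''u'' (int b) = 0" "s2 ''H'' (int b) = hval V w b" if "b < KK" for b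
        using h2 that by (simp_all add: KK_def hval_def)
      have h2'': "s2 ''I'' (int b * int n + int i) = memb n St Cc w (cen V) b i" if "b < KK" "i < n" for b i
        using h2 that by (simp add: KK_def)
      have "wp N l select (\<lambda>s'. \<exists>p. mset p = mset [0..<KK] \<and> sorted (map (hval V w) p) \<and>
        s' ''F'' 0 = horner M (map (hval V w) p) \<and> (\<forall>i<n. s' ''g'' (int i) = horner M (map (\<lambda>b. memb n St Cc w (cen V) b i) p))) s2"
      proof (rule wp_select[OF c2 M_ge h2' h2'' memb_01 N(1) nl(2) N(2) nl(1)])
        show "\<bar>hval V w b\<bar> \<le> P ^ (5 * t + 4)" for b unfolding w_def by (rule hval_bound[OF I])
        show "1 \<le> P ^ (5 * t + 4)" by (rule P_pow_pos)
        show "P ^ (5 * t + 4) * M ^ KK \<le> 2 ^ l" by (rule bigM) simp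
      qed (use big(2) in auto)
      then show "wp N l (select ;; keep_best ;; cut ;; rescale) (round_inv (Suc t)) s2"
      proof (intro wp_Seq[of N l select], elim wp_use exE conjE)
        fix s3 p assume p: "mset p = mset [0..<KK]" "sorted (map (hval V w) p)"
          and F: "s3 ''F'' 0 = horner M (map (hval V w) p)"
          and g: "\<forall>i<n. s3 ''g'' (int i) = horner M (map (\<lambda>b. memb n St Cc w (cen V) b i) p)"
          and f3: "\<And>y. y \<notin> mods select \<Longrightarrow> s3 y = s2 y"
        have pK: "length p = KK" using p(1) by (metis length_upt minus_nat.diff_0 size_mset)
        have c3: "s3 ''n'' 0 = int n" "s3 ''it'' 0 = int t" using c t by (simp_all add: f1 f2 f3)
        have X3: "s3 ''X'' (int i) = cen V i" if "i < n" for i using X1[OF that] by (simp add: f2 f3)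
        have Fb3: "s3 ''Fb'' 0 = s ''Fb'' 0" and Xb3: "\<And>i. s3 ''Xb'' i = s ''Xb'' i" by (simp_all add: f1 f2 f3)
        have Fl: "\<bar>horner M (map (hval V w) p)\<bar> \<le> P ^ (5 * t + 4) * M ^ KK"
          unfolding w_def by (rule fval_bound[OF I pK])
        have "wp N l keep_best (\<lambda>s'. if s3 ''it'' 0 < 1 \<or> s3 ''Fb'' 0 < s3 ''F'' 0
          then s' ''Fb'' 0 = s3 ''F'' 0 \<and> (\<forall>i<n. s' ''Xb'' (int i) = s3 ''X'' (int i))
          else s' ''Fb'' 0 = s3 ''Fb'' 0 \<and> (\<forall>i<n. s' ''Xb'' (int i) = s3 ''Xb'' (int i))) s3"
        proof (rule wp_keep_best[where s = s3, OF c3(1) N(2) nl(1)])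
          show "\<bar>s3 ''F'' 0\<bar> \<le> 2 ^ l" unfolding F by (rule order_trans[OF Fl bigM]) simp
          show "\<bar>s3 ''X'' (int i)\<bar> \<le> 2 ^ l" if "i < n" for i
            unfolding X3[OF that] by (rule order_trans[OF cen_bound[OF I that] bigP]) simp
        qed
        then show "wp N l (keep_best ;; cut ;; rescale) (round_inv (Suc t)) s3"
        proof (intro wp_Seq[of N l keep_best], elim wp_use)
          fix s4 assume h4: "if s3 ''it'' 0 < 1 \<or> s3 ''Fb'' 0 < s3 ''F'' 0
            then s4 ''Fb'' 0 = s3 ''F'' 0 \<and> (\<forall>i<n. s4 ''Xb'' (int i) = s3 ''X'' (int i))
            else s4 ''Fb'' 0 = s3 ''Fb'' 0 \<and> (\<forall>i<n. s4 ''Xb'' (int i) = s3 ''Xb'' (int i))"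
            and f4: "\<And>y. y \<notin> mods keep_best \<Longrightarrow> s4 y = s3 y"
          have new4: "s4 ''Fb'' 0 = horner M (map (hval V w) p) \<and> (\<forall>i<n. s4 ''Xb'' (int i) = cen V i)"
            if "t = 0 \<or> s ''Fb'' 0 < horner M (map (hval V w) p)"
            using h4 that unfolding F Fb3 c3(2) by (auto simp: X3)
          have old4: "s4 ''Fb'' 0 = s ''Fb'' 0 \<and> (\<forall>i<n. s4 ''Xb'' (int i) = s ''Xb'' (int i))"
            if "\<not> (t = 0 \<or> s ''Fb'' 0 < horner M (map (hval V w) p))"
            using h4 that unfolding F Fb3 Xb3 c3(2) by auto
          have b4: "\<bar>s4 ''Fb'' 0\<bar> \<le> P ^ (5 * t + 4) * M ^ KK" "\<And>i. i < n \<Longrightarrow> \<bar>s4 ''Xb'' (int i)\<bar> \<le> P ^ (5 * t + 2)"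
            using new4 old4 Fl Fb_bound[OF I] Xb_bound[OF I] cen_bound[OF I] by fastforce+
          have c4: "s4 ''n'' 0 = int n" "s4 ''q'' 0 = q" "s4 ''W'' 0 = q ^ t" using c W by (simp_all add: f1 f2 f3 f4)
          have V4: "s4 ''V'' (int j * int n + int i) = V j i" if "j < n" "i < n" for j i
            using V[OF that] by (simp add: f1 f2 f3 f4)
          have X4: "s4 ''X'' (int i) = cen V i" if "i < n" for i using X3[OF that] by (simp add: f4)
          have g4: "s4 ''g'' (int i) = grad V w p i" if "i < n" for i using g that by (simp add: f4 grad_def)
          let ?t = "tilt V (grad V w p)"
          have "wp N l cut (\<lambda>s'. \<exists>k<n. (\<forall>j<n. ?t j \<le> ?t k) \<and>
            (\<forall>j<n. \<forall>i<n. s' ''V'' (int j * int n + int i) = q * V j i + zc ?t k j * (V j i - V k i))) s4"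
          proof (rule wp_cut[OF tilt_def zc_def c4(1) n1 c4(2) V4 X4 g4 N(2) nl(1)])
            show "\<bar>grad V w p i * (int n * V j i - cen V i)\<bar> \<le> M ^ KK * P ^ (5 * t + 3)" if "j < n" "i < n" for j i
            proof -
              have "\<bar>int n * V j i\<bar> \<le> int n * P ^ (5 * t + 1)"
                unfolding abs_mult using V_bound[OF I that] by (simp add: mult_left_mono)
              then have "\<bar>int n * V j i\<bar> \<le> P ^ (5 * t + 2)" using nP[of "5 * t + 1"] by simp
              then have "\<bar>int n * V j i - cen V i\<bar> \<le> 2 * P ^ (5 * t + 2)" using cen_bound[OF I that(2)] by linarith
              also have "\<dots> \<le> P ^ Suc (5 * t + 2)" using P_bounds P_pow_pos[of "5 * t + 2"] by (intro P_mult_mono) auto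
              finally have "\<bar>int n * V j i - cen V i\<bar> \<le> P ^ (5 * t + 3)" by (simp only: Suc_exponents)
              then show ?thesis unfolding abs_mult using grad_bound[OF pK] MK by (intro mult_mono) auto
            qed
            have "int n * (M ^ KK * P ^ (5 * t + 3)) = (int n * P ^ (5 * t + 3)) * M ^ KK" by (simp only: mult_ac)
            also have "\<dots> \<le> P ^ Suc (5 * t + 3) * M ^ KK" by (rule mult_right_mono[OF nP]) (use MK in simp)
            also have "\<dots> \<le> 2 ^ l" by (rule bigM) simp
            finally show "int n * (M ^ KK * P ^ (5 * t + 3)) \<le> 2 ^ l" .
            show "\<bar>V j i\<bar> \<le> 2 ^ l" if "j < n" "i < n" for j i
              by (rule order_trans[OF V_bound[OF I that] bigP]) simp
            fix k j assume k: "k < n" and j: "j < n"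
              and kmax: "\<And>j. j < n \<Longrightarrow> ?t j \<le> ?t k"
            have "4 * int n * int n + 1 \<le> P ^ 3"
            proof -
              have "(2 * int n) * (2 * int n) \<le> P * P" using n_le_P by (intro mult_mono) auto
              moreover have "1 * 1 \<le> P * P" using P_bounds by (intro mult_mono) auto
              moreover have "2 * (P * P) \<le> P * (P * P)" using P_bounds by (intro mult_right_mono) auto
              ultimately show ?thesis by (simp add: power3_eq_cube mult.assoc)
            qed
            also have "\<dots> \<le> 2 ^ l" by (rule bigP) simp
            finally have "4 * int n * int n + 1 \<le> 2 ^ l" .
            then show "\<bar>zc ?t k j\<bar> \<le> 2 ^ l"
              using zc_bound[OF I k kmax j] by linarith
            fix i assume i: "i < n"
            have "P ^ (5 * Suc t + 1) \<le> 2 ^ l" by (rule bigP) simp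
            then show "\<bar>q * V j i + zc ?t k j * (V j i - V k i)\<bar> \<le> 2 ^ l"
              using moved_bound[OF I k kmax j i] by linarith
          qed auto
          then show "wp N l (cut ;; rescale) (round_inv (Suc t)) s4"
          proof (intro wp_Seq[of N l cut], elim wp_use exE conjE)
            fix s5 k assume k: "k < n" and kmax: "\<forall>j<n. ?t j \<le> ?t k"
              and V5: "\<forall>j<n. \<forall>i<n. s5 ''V'' (int j * int n + int i) = q * V j i + zc ?t k j * (V j i - V k i)"
              and f5: "\<And>y. y \<notin> mods cut \<Longrightarrow> s5 y = s4 y"
            have c5: "s5 ''n'' 0 = int n" "s5 ''q'' 0 = q" "s5 ''W'' 0 = q ^ t" using c4 by (simp_all add: f5)
            have FX5: "s5 ''Fb'' 0 = s4 ''Fb'' 0" "\<And>i. s5 ''Xb'' i = s4 ''Xb'' i" by (simp_all add: f5)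
            have "wp N l rescale (\<lambda>s'. s' ''W'' 0 = s5 ''W'' 0 * s5 ''q'' 0 \<and> s' ''Fb'' 0 = s5 ''Fb'' 0 * s5 ''q'' 0 \<and>
              (\<forall>i<n. s' ''Xb'' (int i) = s5 ''Xb'' (int i) * s5 ''q'' 0)) s5"
            proof (rule wp_rescale[where s = s5, OF c5(1) N(2) nl(1)])
              have "q ^ Suc t \<le> P ^ (5 * Suc t)" by (rule q_pow_le)
              also have "\<dots> \<le> 2 ^ l" by (rule bigP) simp
              finally show "\<bar>s5 ''W'' 0 * s5 ''q'' 0\<bar> \<le> 2 ^ l" unfolding c5 using q_pos by (simp add: mult.commute)
              have "\<bar>s4 ''Fb'' 0\<bar> * q \<le> (P ^ (5 * t + 4) * M ^ KK) * P ^ 5"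
                using b4(1) q_le_P5 q_pos by (intro mult_mono) auto
              also have "\<dots> = P ^ (5 * t + 4 + 5) * M ^ KK" by (simp only: power_add mult_ac)
              also have "\<dots> \<le> 2 ^ l" by (rule bigM) simp
              finally show "\<bar>s5 ''Fb'' 0 * s5 ''q'' 0\<bar> \<le> 2 ^ l" unfolding c5 FX5 using q_pos by (simp add: abs_mult)
              show "\<bar>s5 ''Xb'' (int i) * s5 ''q'' 0\<bar> \<le> 2 ^ l" if "i < n" for i
                unfolding c5 FX5 by (rule order_trans[OF scaled_bound[OF I b4(2)[OF that]] bigP]) simp
            qed
            then show "wp N l rescale (round_inv (Suc t)) s5"
            proof (rule wp_use)
              fix s6 assume h6: "s6 ''W'' 0 = s5 ''W'' 0 * s5 ''q'' 0 \<and> s6 ''Fb'' 0 = s5 ''Fb'' 0 * s5 ''q'' 0 \<and>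
                (\<forall>i<n. s6 ''Xb'' (int i) = s5 ''Xb'' (int i) * s5 ''q'' 0)"
                and f6: "\<And>y. y \<notin> mods rescale \<Longrightarrow> s6 y = s5 y"
              define V' where "V' j i = q * V j i + zc (tilt V (grad V w p)) k j * (V j i - V k i)" for j i
              have "run_inv (Suc t) V' (s6 ''Fb'' 0) (\<lambda>l. s6 ''Xb'' (int l))"
              proof (rule run_inv_step[OF I p[unfolded w_def] k])
                show "tilt V (grad V (int n * q ^ t) p) j \<le> tilt V (grad V (int n * q ^ t) p) k" if "j < n" for j
                  using kmax that unfolding w_def by blast
                show "V' j l = q * V j l + zc (tilt V (grad V (int n * q ^ t) p)) k j * (V j l - V k l)" for j l
                  by (simp add: V'_def w_def)
                show "s6 ''Fb'' 0 = horner M (map (hval V (int n * q ^ t)) p) * q \<and> (\<forall>l<n. s6 ''Xb'' (int l) = cen V l * q)"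
                  if "t = 0 \<or> s ''Fb'' 0 < horner M (map (hval V (int n * q ^ t)) p)"
                  using new4[unfolded w_def, OF that] h6 unfolding c5 FX5 by simp
                show "s6 ''Fb'' 0 = s ''Fb'' 0 * q \<and> (\<forall>l<n. s6 ''Xb'' (int l) = s ''Xb'' (int l) * q)"
                  if "\<not> (t = 0 \<or> s ''Fb'' 0 < horner M (map (hval V (int n * q ^ t)) p))"
                  using old4[unfolded w_def, OF that] h6 unfolding c5 FX5 by simp
              qed
              moreover have "\<forall>j<n. \<forall>l<n. s6 ''V'' (int j * int n + int l) = V' j l"
                using V5 unfolding V'_def by (simp add: f6)
              moreover have "s6 ''W'' 0 = q ^ Suc t" using h6 c5 by (simp add: mult.commute)
              ultimately show "round_inv (Suc t) s6" unfolding round_inv_def by blast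
            qed
          qed
        qed
      qed
    qed
  qed
  then show ?thesis unfolding cutting_round_def by (rule wp_Seq)
qed

lemma wp_cutting_loop:
  fixes s :: state
  assumes W: "s ''W'' 0 = 1" and V: "\<And>j l. j < n \<Longrightarrow> l < n \<Longrightarrow> s ''V'' (int j * int n + int l) = (if j = l then E else 0)"
    and zero: "s ''Fb'' 0 = 0" "\<And>i. i < n \<Longrightarrow> s ''Xb'' (int i) = 0"
    and c: "s ''n'' 0 = int n" "s ''q'' 0 = q" "s ''K'' 0 = int KK" "s ''M'' 0 = M" "s ''T'' 0 = int T"
      "\<And>r l. r < Rn \<Longrightarrow> l < n \<Longrightarrow> s ''C'' (int r * int n + int l) = Cc r l"
      "\<And>r l. r < Rn \<Longrightarrow> l < n \<Longrightarrow> s ''S'' (int r * int n + int l) = St r l"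
    and N: "KK \<le> N" "n \<le> N" "T \<le> N" "int T \<le> 2 ^ l" and big: "P ^ (5 * T + 10) * M ^ KK \<le> 2 ^ l" "2 \<le> l"
  shows "wp N l cutting_loop (\<lambda>s'. s' ''W'' 0 = q ^ T \<and>
    (\<forall>i<n. \<bar>real_of_int (s' ''Xb'' (int i)) / (int n * q ^ T) - nuc (Suc i)\<bar> < 1 / Rr) \<and>
    (\<forall>i<n. \<bar>s' ''Xb'' (int i)\<bar> \<le> P ^ (5 * T + 2))) s"
  unfolding cutting_loop_def
proof (rule wp_For[where M = T and I = round_inv])
  show "T \<le> N" "int T \<le> 2 ^ l" using N by auto
  have "run_inv 0 (\<lambda>j l. if j = l then E else 0) (s ''Fb'' 0) (\<lambda>l. s ''Xb'' (int l))"
  proof -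
    have "run_inv 0 V 0 (\<lambda>l. s ''Xb'' (int l))" if "run_inv 0 V 0 (\<lambda>_. 0)" for V
      using that zero(2) unfolding run_inv_def by simp
    then show ?thesis using run_inv_start zero(1) by simp
  qed
  then have "round_inv 0 s"
    unfolding round_inv_def using V W by (intro exI[of _ "\<lambda>j l. if j = l then E else 0"]) simp
  then show "round_inv 0 (s(''it'' := (s ''it'')(0 := 0)))" by simp
next
  fix k s' assume "\<And>y. y \<noteq> ''it'' \<Longrightarrow> y \<notin> mods cutting_round \<Longrightarrow> s' y = s y"
  then have "s' ''T'' = s ''T''" using mods_cutting_round by blast
  then show "aval (Var ''T'') s' = int T" using c by simp
next
  fix t s' assume t: "t < T" "s' ''it'' 0 = int t" and inv: "round_inv t s'"
    and fr: "\<And>y. y \<noteq> ''it'' \<Longrightarrow> y \<notin> mods cutting_round \<Longrightarrow> s' y = s y"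
  have "s' ''n'' = s ''n''" "s' ''q'' = s ''q''" "s' ''K'' = s ''K''" "s' ''M'' = s ''M''" "s' ''C'' = s ''C''" "s' ''S'' = s ''S''"
    using mods_cutting_round by (auto intro!: fr)
  note c' = c(1-4,6,7)[folded this]
  show "wp N l cutting_round (\<lambda>s''. s'' ''it'' 0 = int t \<and> round_inv (Suc t) (s''(''it'' := (s'' ''it'')(0 := int t + 1)))) s'"
  proof (rule wp_use[OF wp_cutting_round[OF inv t c' N(1,2) big]])
    fix s'' assume "round_inv (Suc t) s''" and fr2: "\<And>y. y \<notin> mods cutting_round \<Longrightarrow> s'' y = s' y"
    moreover have "s'' ''it'' = s' ''it''" using mods_cutting_round by (auto intro!: fr2)
    ultimately show "s'' ''it'' 0 = int t \<and> round_inv (Suc t) (s''(''it'' := (s'' ''it'')(0 := int t + 1)))" using t(2) by simp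
  qed
next
  fix s' assume "round_inv T s'"
  then obtain V where V: "run_inv T V (s' ''Fb'' 0) (\<lambda>l. s' ''Xb'' (int l))" "s' ''W'' 0 = q ^ T"
    unfolding round_inv_def by blast
  show "s' ''W'' 0 = q ^ T \<and>
    (\<forall>i<n. \<bar>real_of_int (s' ''Xb'' (int i)) / (int n * q ^ T) - nuc (Suc i)\<bar> < 1 / Rr) \<and>
    (\<forall>i<n. \<bar>s' ''Xb'' (int i)\<bar> \<le> P ^ (5 * T + 2))"
    using V(2) run_inv_end[OF V(1)] Xb_bound[OF V(1)] by blast
qed

end

section \<open>Reading the input and filling the tables\<close>

definition fold_st :: "state \<Rightarrow> string \<Rightarrow> string \<Rightarrow> int \<Rightarrow> nat \<Rightarrow> int \<Rightarrow> state" where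
  "fold_st s x y i k v = s(x := (s x)(0 := int k), y := (s y)(i := v))"

lemma fold_st_apply [simp]:
  "fold_st s x y i k v z = (if z = y then (s y)(i := v) else if z = x then (s x)(0 := int k) else s z)"
  by (simp add: fold_st_def)

lemma wp_fold_loop:
  fixes g :: "nat \<Rightarrow> int"
  assumes MN: "M \<le> N" "int M \<le> 2 ^ l" and xy: "x \<noteq> y" and g0: "s y i = g 0"
    and b: "\<And>k. k \<le> M \<Longrightarrow> aval b (fold_st s x y i k (g k)) = int M"
    and c: "\<And>k. k < M \<Longrightarrow> wp N l c (\<lambda>s'. s' = fold_st s x y i k (g (Suc k))) (fold_st s x y i k (g k))"
    and Q: "Q (fold_st s x y i M (g M))"
  shows "wp N l (For x b c) Q s"
proof (rule wp_For[where M = M and I = "\<lambda>k s'. s' = fold_st s x y i k (g k)"])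
  show "s(x := (s x)(0 := 0)) = fold_st s x y i 0 (g 0)" using xy g0 by (auto simp: fun_eq_iff)
next
  fix k s' assume k: "k < M" and s': "s' = fold_st s x y i k (g k)"
  show "wp N l c (\<lambda>s''. s'' x 0 = int k \<and> s''(x := (s'' x)(0 := int k + 1)) = fold_st s x y i (Suc k) (g (Suc k))) s'"
    unfolding s'
  proof (rule wp_mono[OF c[OF k]])
    fix s'' assume s'': "s'' = fold_st s x y i k (g (Suc k))"
    show "s'' x 0 = int k \<and> s''(x := (s'' x)(0 := int k + 1)) = fold_st s x y i (Suc k) (g (Suc k))"
      unfolding s'' using xy by (auto simp: fun_eq_iff)
  qed
qed (use MN b Q in auto)

text \<open>What a running maximum started at 0 computes; on nonnegative data it is the
  maximum.\<close>

definition mx :: "(nat \<Rightarrow> int) \<Rightarrow> nat \<Rightarrow> int" where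
  "mx f k = Max (insert 0 (f ` {..<k}))"

lemma mx_0 [simp]: "mx f 0 = 0"
  by (simp add: mx_def)

lemma mx_Suc: "mx f (Suc k) = (if mx f k < f k then f k else mx f k)"
proof -
  have "mx f (Suc k) = max (f k) (mx f k)"
    unfolding mx_def lessThan_Suc image_insert insert_commute[of 0 "f k"] by (rule Max_insert) auto
  then show ?thesis by (simp add: max_def)
qed

lemma mx_eq_Max:
  assumes "0 < k" "\<And>h. h < k \<Longrightarrow> 0 \<le> f h"
  shows "mx f k = Max (f ` {..<k})"
proof -
  have "0 \<le> Max (f ` {..<k})" using assms by (intro order_trans[OF assms(2)[OF assms(1)]] Max_ge) auto
  moreover have "f ` {..<k} \<noteq> {}" using assms(1) by (auto simp: lessThan_empty_iff)
  ultimately show ?thesis unfolding mx_def by (subst Max_insert) auto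
qed

lemma wp_max_loop:
  fixes f :: "nat \<Rightarrow> int"
  assumes MN: "M \<le> N" "int M \<le> 2 ^ l" and xy: "x \<noteq> y" and g0: "s y i = 0"
    and b: "\<And>k. k \<le> M \<Longrightarrow> aval b (fold_st s x y i k (mx f k)) = int M"
    and a: "\<And>k. k < M \<Longrightarrow> aval a (fold_st s x y i k (mx f k)) = i"
    and e: "\<And>k. k < M \<Longrightarrow> aval e (fold_st s x y i k (mx f k)) = f k"
    and sz: "\<And>k. k < M \<Longrightarrow> \<bar>f k\<bar> \<le> 2 ^ l"
    and Q: "Q (fold_st s x y i M (mx f M))"
  shows "wp N l (For x b (If (Less (Cell y a) e) (Store y a e) Skip)) Q s"
proof (rule wp_fold_loop[where g = "mx f", OF MN xy])
  show "s y i = mx f 0" using g0 by simp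
  fix k assume k: "k < M"
  let ?s = "fold_st s x y i k (mx f k)"
  have v: "aval (Cell y a) ?s = mx f k" using a[OF k] by simp
  show "wp N l (If (Less (Cell y a) e) (Store y a e) Skip) (\<lambda>s'. s' = fold_st s x y i k (mx f (Suc k))) ?s"
  proof (rule wp_If)
    assume "bval (Less (Cell y a) e) ?s"
    then have lt: "mx f k < f k" using v e[OF k] by simp
    show "wp N l (Store y a e) (\<lambda>s'. s' = fold_st s x y i k (mx f (Suc k))) ?s"
    proof (rule wp_Store)
      show "\<bar>aval e ?s\<bar> \<le> 2 ^ l" using e[OF k] sz[OF k] by simp
      show "?s(y := (?s y)(aval a ?s := aval e ?s)) = fold_st s x y i k (mx f (Suc k))"
        unfolding a[OF k] e[OF k] using lt xy by (auto simp: fun_eq_iff mx_Suc)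
    qed
  next
    assume "\<not> bval (Less (Cell y a) e) ?s"
    then have "\<not> mx f k < f k" using v e[OF k] by simp
    then show "wp N l Skip (\<lambda>s'. s' = fold_st s x y i k (mx f (Suc k))) ?s"
      by (intro wp_Skip) (simp add: mx_Suc)
  qed
qed (use b Q in auto)

definition entry :: "nat \<Rightarrow> aexp" where
  "entry k = Cell ''input'' (Plus (Num (int k)) (Times (Num 4) (Var ''e'')))"

text \<open>Cell 1 of the input holds \<open>n\<close>; the fields 2 to 5 of \<open>entry\<close>
  are numerator and denominator of a profit, then of a demand. \<open>D\<close> is the product of
  all denominators: in general not the least common one, but of polynomial length and without gcd
  computations.\<close>

definition read_data :: "nat \<Rightarrow> com" where
  "read_data m = ''n'' ::= Cell ''input'' (Num 1) ;; ''D'' ::= Num 1 ;;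
    For ''e'' (Times (Var ''n'') (Num (int m))) (''D'' ::= Times (Var ''D'') (Times (entry 3) (entry 5))) ;;
    For ''e'' (Times (Var ''n'') (Num (int m))) (Store ''A'' (Var ''e'') (Times (entry 2) (Div (Var ''D'') (entry 3)))) ;;
    For ''e'' (Times (Var ''n'') (Num (int m))) (Store ''B'' (Var ''e'') (Times (entry 4) (Div (Var ''D'') (entry 5))))"

lemma mods_read_data [simp]: "mods (read_data m) = {''n'', ''D'', ''e'', ''A'', ''B''}"
  by (auto simp: read_data_def)

lemma wp_read_data:
  fixes x :: "nat \<Rightarrow> nat \<Rightarrow> int"
  assumes n: "s ''input'' 1 = int n"
    and x: "\<And>e k. e < n * m \<Longrightarrow> 2 \<le> k \<Longrightarrow> k \<le> 5 \<Longrightarrow> s ''input'' (int k + 4 * int e) = x k e"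
    and den: "\<And>e. e < n * m \<Longrightarrow> 1 \<le> x 3 e" "\<And>e. e < n * m \<Longrightarrow> 1 \<le> x 5 e"
    and D: "D = (\<Prod>e<n * m. x 3 e * x 5 e)"
    and N: "n * m \<le> N" "int (n * m) \<le> 2 ^ l" "int n \<le> 2 ^ l" "D \<le> 2 ^ l"
    and sz: "\<And>e. e < n * m \<Longrightarrow> \<bar>x 2 e * (D div x 3 e)\<bar> \<le> 2 ^ l" "\<And>e. e < n * m \<Longrightarrow> \<bar>x 4 e * (D div x 5 e)\<bar> \<le> 2 ^ l"
  shows "wp N l (read_data m) (\<lambda>s'. s' ''n'' 0 = int n \<and> s' ''D'' 0 = D \<and>
    (\<forall>e<n * m. s' ''A'' (int e) = x 2 e * (D div x 3 e) \<and> s' ''B'' (int e) = x 4 e * (D div x 5 e))) s"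
proof -
  have part: "1 \<le> (\<Prod>e<k. x 3 e * x 5 e)" "(\<Prod>e<k. x 3 e * x 5 e) \<le> D" if "k \<le> n * m" for k
  proof -
    have f: "1 \<le> x 3 e * x 5 e" if "e < n * m" for e
      using mult_mono[of 1 "x 3 e" 1 "x 5 e"] den[OF that] by simp
    show p1: "1 \<le> (\<Prod>e<k. x 3 e * x 5 e)" using f that by (intro prod_ge_1) auto
    have "1 \<le> (\<Prod>e\<in>{k..<n * m}. x 3 e * x 5 e)" using f by (intro prod_ge_1) auto
    moreover have "D = (\<Prod>e<k. x 3 e * x 5 e) * (\<Prod>e\<in>{k..<n * m}. x 3 e * x 5 e)"
      unfolding D using that by (subst prod.union_disjoint[symmetric]) (auto intro!: prod.cong)
    ultimately show "(\<Prod>e<k. x 3 e * x 5 e) \<le> D" using p1 mult_left_mono[of 1 _ "\<Prod>e<k. x 3 e * x 5 e"] by simp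
  qed
  show ?thesis
    unfolding read_data_def
    apply (rule wp_Assign_seq[where v = "int n"], simp add: n, simp only: abs_of_nat N)
    apply (rule wp_Assign_seq[where v = 1], simp, simp)
    apply (rule wp_Seq)
    apply (rule wp_fold_loop[where M = "n * m" and x = "''e''" and y = "''D''" and i = 0 and g = "\<lambda>k. \<Prod>e<k. x 3 e * x 5 e"])
    apply (rule N)+
    subgoal by simp
    subgoal by simp
    subgoal by simp
    subgoal premises p for k
    proof (rule wp_Assign)
      show "\<bar>\<Prod>e<Suc k. x 3 e * x 5 e\<bar> \<le> 2 ^ l" using part[of "Suc k"] p N(4) by (simp del: prod.lessThan_Suc)
    qed (use x[OF p, of 3] x[OF p, of 5] in \<open>auto simp: entry_def fold_st_def fun_eq_iff\<close>)
    apply (rule wp_Seq)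
    apply (rule wp_map_loop[where M = "n * m" and f = "\<lambda>e. x 2 e * (D div x 3 e)"])
    apply (rule N)+
    subgoal by simp
    subgoal by simp
    subgoal for k using x[of k 2] x[of k 3] by (simp add: entry_def D)
    subgoal by (rule sz)
    apply (rule wp_map_loop[where M = "n * m" and f = "\<lambda>e. x 4 e * (D div x 5 e)"])
    apply (rule N)+
    subgoal by simp
    subgoal by simp
    subgoal for k using x[of k 4] x[of k 5] by (simp add: entry_def D)
    subgoal by (rule sz)
    subgoal by (simp add: D del: of_nat_mult)
    done
qed

section \<open>Tables of market maxima, player status and contributions\<close>

definition powers :: "nat \<Rightarrow> com" where
  "powers m = Store ''np'' (Num 0) (Num 1) ;;
    For ''j'' (Num (int m)) (Store ''np'' (Plus (Var ''j'') (Num 1)) (Times (Cell ''np'' (Var ''j'')) (Var ''n''))) ;;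
    ''R'' ::= Cell ''np'' (Num (int m))"

lemma mods_powers [simp]: "mods (powers m) = {''np'', ''j'', ''R''}"
  by (auto simp: powers_def)

lemma wp_powers:
  assumes n: "s ''n'' 0 = int n" "1 \<le> n" and N: "m \<le> N" "int m \<le> 2 ^ l" "int (n ^ m) \<le> 2 ^ l"
  shows "wp N l (powers m) (\<lambda>s'. s' ''R'' 0 = int (n ^ m) \<and> (\<forall>h<m. s' ''np'' (int h) = int (n ^ h))) s"
proof -
  have pw: "int n ^ h \<le> 2 ^ l" if "h \<le> m" for h
  proof -
    have "int n ^ h \<le> int n ^ m" using that n by (intro power_increasing) auto
    then show ?thesis using N(3) by simp
  qed
  show ?thesis
    unfolding powers_def
    apply (rule wp_Store_seq[where i = 0 and v = 1], simp, simp, simp)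
    apply (rule wp_Seq)
    apply (rule wp_For[where M = m and I = "\<lambda>k s'. \<forall>h\<le>k. s' ''np'' (int h) = int n ^ h"])
    apply (rule N)+
    subgoal by simp
    subgoal by simp
    subgoal premises p for k s1
    proof (rule wp_Store)
      have c: "s1 ''n'' 0 = int n" "s1 ''np'' (int k) = int n ^ k" using p n by simp_all
      show "\<bar>aval (Times (Cell ''np'' (Var ''j'')) (Var ''n'')) s1\<bar> \<le> 2 ^ l"
        using pw[of "Suc k"] p(1,3) c by (simp add: mult.commute)
    qed (use p n in \<open>auto simp: le_Suc_eq mult.commute\<close>)
    subgoal premises p for s1
    proof (rule wp_Assign)
      show "\<bar>int n ^ m\<bar> \<le> 2 ^ l" using pw[of m] by simp
    qed (use p(1) in auto)
    done
qed


definition mat :: "nat \<Rightarrow> aexp \<Rightarrow> aexp \<Rightarrow> aexp" where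
  "mat m i j = Plus (Times i (Num (int m))) j"

lemma aval_mat [simp]: "aval (mat m i j) s = aval i s * int m + aval j s"
  by (simp add: mat_def)

text \<open>The language has no remainder operation, so it is spelled out as
  \<open>a - a div n * n\<close>.\<close>

definition digits :: "nat \<Rightarrow> com" where
  "digits m = For ''h'' (Num (int m)) (Store ''g'' (Var ''h'')
    (Minus (Div (Var ''t'') (Cell ''np'' (Var ''h'')))
      (Times (Div (Div (Var ''t'') (Cell ''np'' (Var ''h''))) (Var ''n'')) (Var ''n''))))"

definition maxima :: "nat \<Rightarrow> com" where
  "maxima m = For ''j'' (Num (int m)) (Store ''p'' (Var ''j'') (Num 0) ;;
    For ''h'' (Num (int m)) (If (Less (Cell ''p'' (Var ''j'')) (Cell ''A'' (mat m (Cell ''g'' (Var ''h'')) (Var ''j''))))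
      (Store ''p'' (Var ''j'') (Cell ''A'' (mat m (Cell ''g'' (Var ''h'')) (Var ''j'')))) Skip))"

definition classify :: "nat \<Rightarrow> com" where
  "classify m = For ''l'' (Var ''n'') (
    ''y'' ::= Num 2 ;;
    For ''j'' (Num (int m)) (If (Less (Cell ''p'' (Var ''j'')) (Cell ''A'' (mat m (Var ''l'') (Var ''j'')))) (''y'' ::= Num 0) Skip) ;;
    For ''h'' (Num (int m)) (If (And (Not (Less (Cell ''g'' (Var ''h'')) (Var ''l''))) (Not (Less (Var ''l'') (Cell ''g'' (Var ''h'')))))
      (''y'' ::= Num 1) Skip) ;;
    Store ''S'' (idx (Var ''t'') (Var ''l'')) (Var ''y'') ;;
    Store ''C'' (idx (Var ''t'') (Var ''l'')) (Num 0) ;;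
    For ''j'' (Num (int m)) (Store ''C'' (idx (Var ''t'') (Var ''l'')) (Plus (Cell ''C'' (idx (Var ''t'') (Var ''l'')))
      (Times (Cell ''p'' (Var ''j'')) (Cell ''B'' (mat m (Var ''l'') (Var ''j'')))))))"

definition fill_rows :: "nat \<Rightarrow> com" where
  "fill_rows m = For ''t'' (Var ''R'') (digits m ;; maxima m ;; classify m)"

definition total :: "nat \<Rightarrow> com" where
  "total m = ''E'' ::= Num 0 ;; For ''j'' (Num (int m)) (
    ''y'' ::= Num 0 ;;
    For ''l'' (Var ''n'') (If (Less (Var ''y'') (Cell ''A'' (mat m (Var ''l'') (Var ''j'')))) (''y'' ::= Cell ''A'' (mat m (Var ''l'') (Var ''j''))) Skip) ;;
    ''s'' ::= Num 0 ;;
    For ''l'' (Var ''n'') (''s'' ::= Plus (Var ''s'') (Cell ''B'' (mat m (Var ''l'') (Var ''j'')))) ;;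
    ''E'' ::= Plus (Var ''E'') (Times (Var ''y'') (Var ''s'')))"

lemma mods_rows [simp]:
  "mods (digits m) = {''h'', ''g''}" "mods (maxima m) = {''j'', ''p'', ''h''}"
  "mods (classify m) = {''l'', ''y'', ''j'', ''h'', ''S'', ''C''}"
  "mods (fill_rows m) = {''t'', ''h'', ''g'', ''j'', ''p'', ''l'', ''y'', ''S'', ''C''}"
  "mods (total m) = {''E'', ''j'', ''y'', ''l'', ''s''}"
  by (auto simp: digits_def maxima_def classify_def fill_rows_def total_def)

context pd_data
begin

lemma wp_digits:
  assumes n: "s ''n'' 0 = int n" and t: "s ''t'' 0 = int t" and np: "\<And>h. h < m \<Longrightarrow> s ''np'' (int h) = int (n ^ h)"
    and N: "m \<le> N" "int m \<le> 2 ^ l" "int n \<le> 2 ^ l"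
  shows "wp N l (digits m) (\<lambda>s'. \<forall>h<m. s' ''g'' (int h) = int (dig t h)) s"
proof -
  have d: "int t div int (n ^ h) - int t div int (n ^ h) div int n * int n = int (dig t h)" for h
  proof -
    have "int (dig t h) = (int t div int (n ^ h)) mod int n" by (simp add: dig_def zdiv_int zmod_int)
    then show ?thesis by (simp add: minus_div_mult_eq_mod)
  qed
  show ?thesis
    unfolding digits_def
    apply (rule wp_map_loop[where M = m and f = "\<lambda>h. int (dig t h)"])
    apply (rule N)+
    subgoal by simp
    subgoal by simp
    subgoal for k using d[of k] by (simp add: t n np)
    subgoal for k using dig_less[of t k] N(3) by simp
    subgoal by simp
    done
qed

lemma wp_maxima:
  assumes g: "\<And>h. h < m \<Longrightarrow> s ''g'' (int h) = int (dig t h)"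
    and A: "\<And>i j. i < n \<Longrightarrow> j < m \<Longrightarrow> s ''A'' (int i * int m + int j) = ai i j"
    and N: "m \<le> N" "int m \<le> 2 ^ l" and sz: "\<And>i j. i < n \<Longrightarrow> j < m \<Longrightarrow> ai i j \<le> 2 ^ l"
  shows "wp N l (maxima m) (\<lambda>s'. \<forall>j<m. s' ''p'' (int j) = pm t j) s"
proof -
  have mx: "mx (\<lambda>h. ai (dig t h) j) m = pm t j" if "j < m" for j
    unfolding pm_def by (rule mx_eq_Max) (use m1 ai[OF dig_less that] in auto)
  show ?thesis
    unfolding maxima_def
    apply (rule wp_For[where M = m and I = "\<lambda>k s'. \<forall>j<k. s' ''p'' (int j) = pm t j"])
    apply (rule N)+
    subgoal by simp
    subgoal by simp
    subgoal premises p for j s1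
      apply (rule wp_Store_seq[where i = "int j" and v = 0], simp add: p, simp, simp)
      apply (rule wp_max_loop[where M = m and i = "int j" and f = "\<lambda>h. ai (dig t h) j"])
      apply (rule N)+
      subgoal by simp
      subgoal by simp
      subgoal by simp
      subgoal by (simp add: p)
      subgoal using p(1) by (simp add: p(3,4) g A dig_less)
      subgoal using sz[OF dig_less p(1)] ai[OF dig_less p(1)] by simp
      subgoal using p(1,2) by (simp add: p(3) less_Suc_eq mx)
      done
    subgoal by simp
    done
qed

definition rows_filled :: "nat \<Rightarrow> state \<Rightarrow> bool" where
  "rows_filled k s \<longleftrightarrow> (\<forall>t<k. \<forall>i<n. s ''S'' (int t * int n + int i) = St t i \<and> s ''C'' (int t * int n + int i) = Cc t i)"

lemma wp_classify:
  assumes n: "s ''n'' 0 = int n" and t: "s ''t'' 0 = int t" and g: "\<And>h. h < m \<Longrightarrow> s ''g'' (int h) = int (dig t h)"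
    and p: "\<And>j. j < m \<Longrightarrow> s ''p'' (int j) = pm t j"
    and A: "\<And>i j. i < n \<Longrightarrow> j < m \<Longrightarrow> s ''A'' (int i * int m + int j) = ai i j"
    and B: "\<And>i j. i < n \<Longrightarrow> j < m \<Longrightarrow> s ''B'' (int i * int m + int j) = bi i j"
    and N: "m \<le> N" "int m \<le> 2 ^ l" "n \<le> N" "int n \<le> 2 ^ l" "1 \<le> l" and sz: "\<And>i. i < n \<Longrightarrow> Cc t i \<le> 2 ^ l"
    and old: "rows_filled t s"
  shows "wp N l (classify m) (rows_filled (Suc t)) s"
proof -
  have two: "(2::int) \<le> 2 ^ l" using power_increasing[of 1 l "2::int"] N(5) by simp
  have part: "\<bar>\<Sum>j<k. pm t j * bi i j\<bar> \<le> 2 ^ l" if "i < n" "k \<le> m" for i k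
  proof -
    have nn: "0 \<le> pm t j * bi i j" if "j < m" for j using pm_nonneg[OF that] bi[OF \<open>i < n\<close> that] by simp
    have "(\<Sum>j<k. pm t j * bi i j) \<le> Cc t i" unfolding Cc_def using nn that by (intro sum_mono2) auto
    moreover have "0 \<le> (\<Sum>j<k. pm t j * bi i j)" using nn that by (intro sum_nonneg) auto
    ultimately show ?thesis using sz[OF that(1)] by simp
  qed
  show ?thesis
    unfolding classify_def
    apply (rule wp_For[where M = n and I = "\<lambda>k s'. (\<forall>i<k. s' ''S'' (int t * int n + int i) = St t i \<and> s' ''C'' (int t * int n + int i) = Cc t i) \<and>
      rows_filled t s'"])
    apply (rule N)+
    subgoal using old by (simp add: rows_filled_def)
    subgoal using n by simp
    subgoal premises p1 for i s1
    proof -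
      note fr = p1(4) and i0 = p1(3) and il = p1(1)
      have c: "s1 ''n'' 0 = int n" "s1 ''t'' 0 = int t" "\<And>h. h < m \<Longrightarrow> s1 ''g'' (int h) = int (dig t h)"
        "\<And>j. j < m \<Longrightarrow> s1 ''p'' (int j) = pm t j"
        "\<And>j. j < m \<Longrightarrow> s1 ''A'' (int i * int m + int j) = ai i j"
        "\<And>j. j < m \<Longrightarrow> s1 ''B'' (int i * int m + int j) = bi i j"
        using n t g p A[OF il] B[OF il] by (simp_all add: fr)
      define y0 :: "nat \<Rightarrow> int" where "y0 k = (if \<forall>j<k. ai i j \<le> pm t j then 2 else 0)" for k
      define y1 where "y1 k = (if \<exists>h<k. dig t h = i then 1 else y0 m)" for k
      have y1m: "y1 m = St t i" by (simp add: y1_def y0_def St_def inT_def inD_def)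
      have ybd: "\<bar>St t i\<bar> \<le> 2 ^ l" using two by (simp add: St_def)
      show ?thesis
        apply (rule wp_Assign_seq[where v = 2], simp, simp add: two)
        apply (rule wp_Seq)
        apply (rule wp_fold_loop[where M = m and x = "''j''" and y = "''y''" and i = 0 and g = y0])
        apply (rule N)+
        subgoal by simp
        subgoal by (simp add: y0_def)
        subgoal by simp
        subgoal premises q for k
          apply (rule wp_If)
          subgoal premises b
            apply (rule wp_Assign[where v = 0], simp, simp)
            using b q by (auto simp: fun_eq_iff fold_st_def y0_def c i0)
          subgoal premises b
            apply (rule wp_Skip)
            using b q by (auto simp: fold_st_def y0_def c i0 less_Suc_eq)
          done
        apply (rule wp_Seq)
        apply (rule wp_fold_loop[where M = m and x = "''h''" and y = "''y''" and i = 0 and g = y1])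
        apply (rule N)+
        subgoal by simp
        subgoal by (simp add: y1_def)
        subgoal by simp
        subgoal premises q for k
          apply (rule wp_If)
          subgoal premises b
            apply (rule wp_Assign[where v = 1], simp, simp)
            using b q by (auto simp: fun_eq_iff fold_st_def y1_def c i0)
          subgoal premises b
            apply (rule wp_Skip)
            using b q by (auto simp: fold_st_def y1_def c i0 less_Suc_eq)
          done
        apply (rule wp_Store_seq[where i = "int t * int n + int i" and v = "St t i"])
           apply (simp add: c i0)
          apply (simp add: y1m)
         apply (rule ybd)
        apply (rule wp_Store_seq[where i = "int t * int n + int i" and v = 0])
           apply (simp add: c i0)
          apply simp
         apply simp
        apply (rule wp_sum_loop[where M = m and i = "int t * int n + int i" and f = "\<lambda>j. pm t j * bi i j"])
        apply (rule N)+
        subgoal by simp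
        subgoal by simp
        subgoal by (simp add: c i0)
        subgoal by (simp add: c i0)
        subgoal for k using part[OF il, of "Suc k"] by (simp del: sum.lessThan_Suc)
        subgoal
        proof -
          have ne: "int t' * int n + int i' = int t * int n + int i \<longleftrightarrow> t' = t \<and> i' = i" if "i' < n" for t' i'
            by (rule idx_inj[OF that il])
          show ?thesis using p1(2) il by (auto simp: rows_filled_def ne i0 less_Suc_eq Cc_def)
        qed
        done
    qed
    subgoal premises p1 for s1
      using p1(1) by (auto simp: rows_filled_def less_Suc_eq)
    done
qed

lemma wp_fill_rows:
  assumes n: "s ''n'' 0 = int n" and R: "s ''R'' 0 = int Rn" and np: "\<And>h. h < m \<Longrightarrow> s ''np'' (int h) = int (n ^ h)"
    and A: "\<And>i j. i < n \<Longrightarrow> j < m \<Longrightarrow> s ''A'' (int i * int m + int j) = ai i j"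
    and B: "\<And>i j. i < n \<Longrightarrow> j < m \<Longrightarrow> s ''B'' (int i * int m + int j) = bi i j"
    and N: "Rn \<le> N" "int Rn \<le> 2 ^ l" "m \<le> N" "int m \<le> 2 ^ l" "n \<le> N" "int n \<le> 2 ^ l" "1 \<le> l"
    and sz: "\<And>i j. i < n \<Longrightarrow> j < m \<Longrightarrow> ai i j \<le> 2 ^ l" "\<And>t i. i < n \<Longrightarrow> Cc t i \<le> 2 ^ l"
  shows "wp N l (fill_rows m) (rows_filled Rn) s"
  unfolding fill_rows_def
proof (rule wp_For[where M = Rn and I = rows_filled])
  show "Rn \<le> N" "int Rn \<le> 2 ^ l" by (rule N)+
next
  fix t s1
  assume I: "rows_filled t s1"
    and t: "s1 ''t'' 0 = int t" and fr: "\<And>y. y \<noteq> ''t'' \<Longrightarrow> y \<notin> mods (digits m ;; maxima m ;; classify m) \<Longrightarrow> s1 y = s y"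
  let ?Q = "\<lambda>s'. s' ''t'' 0 = int t \<and> rows_filled (Suc t) s'"
  have c: "s1 ''n'' 0 = int n" "\<And>h. h < m \<Longrightarrow> s1 ''np'' (int h) = int (n ^ h)"
    "\<And>i j. i < n \<Longrightarrow> j < m \<Longrightarrow> s1 ''A'' (int i * int m + int j) = ai i j"
    "\<And>i j. i < n \<Longrightarrow> j < m \<Longrightarrow> s1 ''B'' (int i * int m + int j) = bi i j"
    using n np A B by (simp_all add: fr)
  have "wp N l (digits m) (wp N l (maxima m ;; classify m) ?Q) s1"
  proof (rule wp_use[OF wp_digits[OF c(1) t c(2) N(3,4,6)]])
    fix s2 assume g: "\<forall>h<m. s2 ''g'' (int h) = int (dig t h)" and f2: "\<And>y. y \<notin> mods (digits m) \<Longrightarrow> s2 y = s1 y"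
    have c2: "\<And>h. h < m \<Longrightarrow> s2 ''g'' (int h) = int (dig t h)"
      "\<And>i j. i < n \<Longrightarrow> j < m \<Longrightarrow> s2 ''A'' (int i * int m + int j) = ai i j" using g c by (simp_all add: f2)
    have "wp N l (maxima m) (wp N l (classify m) ?Q) s2"
    proof (rule wp_use[OF wp_maxima[OF c2 N(3,4) sz(1)]])
      fix s3 assume p: "\<forall>j<m. s3 ''p'' (int j) = pm t j" and f3: "\<And>y. y \<notin> mods (maxima m) \<Longrightarrow> s3 y = s2 y"
      have c3: "s3 ''n'' 0 = int n" "s3 ''t'' 0 = int t" "\<And>h. h < m \<Longrightarrow> s3 ''g'' (int h) = int (dig t h)"
        "\<And>j. j < m \<Longrightarrow> s3 ''p'' (int j) = pm t j"
        "\<And>i j. i < n \<Longrightarrow> j < m \<Longrightarrow> s3 ''A'' (int i * int m + int j) = ai i j"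
        "\<And>i j. i < n \<Longrightarrow> j < m \<Longrightarrow> s3 ''B'' (int i * int m + int j) = bi i j"
        using c g p t by (simp_all add: f2 f3)
      have o: "rows_filled t s3" using I by (simp add: rows_filled_def f2 f3)
      show "wp N l (classify m) ?Q s3"
        by (rule wp_use[OF wp_classify[OF c3 N(3-7) sz(2) o]]) (use c3(2) in simp_all)
    qed
    then show "wp N l (maxima m ;; classify m) ?Q s2" by (rule wp_Seq)
  qed
  then have "wp N l (digits m ;; maxima m ;; classify m) ?Q s1" by (rule wp_Seq)
  then show "wp N l (digits m ;; maxima m ;; classify m) (\<lambda>s''. s'' ''t'' 0 = int t \<and>
      rows_filled (Suc t) (s''(''t'' := (s'' ''t'')(0 := int t + 1)))) s1"
    by (rule wp_mono) (simp add: rows_filled_def)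
qed (use R in \<open>auto simp: rows_filled_def\<close>)

lemma v_N_int: "v {1..n} = real_of_int (\<Sum>j<m. mx (\<lambda>i. ai i j) n * (\<Sum>i<n. bi i j))"
proof -
  have "v {1..n} = (\<Sum>j<m. (\<Sum>i\<in>{1..n}. dl i (Suc j)) * Max ((\<lambda>k. al k (Suc j)) ` {1..n}))"
    by (rule v_alt) (use n1 in simp)
  also have "\<dots> = (\<Sum>j<m. real_of_int (mx (\<lambda>i. ai i j) n * (\<Sum>i<n. bi i j)))"
  proof (rule sum.cong[OF refl])
    fix j assume j: "j \<in> {..<m}"
    have "{1..n} = Suc ` {..<n}" by (simp add: lessThan_atLeast0 image_Suc_atLeastLessThan atLeastLessThanSuc_atLeastAtMost One_nat_def)
    then have "(\<lambda>k. al k (Suc j)) ` {1..n} = (\<lambda>i. al (Suc i) (Suc j)) ` {..<n}" by (simp add: image_image)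
    also have "\<dots> = real_of_int ` ((\<lambda>i. ai i j) ` {..<n})" unfolding image_image by (rule image_cong) (use al j in auto)
    finally have "Max ((\<lambda>k. al k (Suc j)) ` {1..n}) = Max (real_of_int ` ((\<lambda>i. ai i j) ` {..<n}))" by simp
    also have "\<dots> = real_of_int (Max ((\<lambda>i. ai i j) ` {..<n}))"
      by (rule mono_Max_commute[symmetric]) (use n1 in \<open>auto simp: mono_def lessThan_empty_iff\<close>)
    also have "Max ((\<lambda>i. ai i j) ` {..<n}) = mx (\<lambda>i. ai i j) n"
      by (rule mx_eq_Max[symmetric]) (use n1 ai j in auto)
    finally have 1: "Max ((\<lambda>k. al k (Suc j)) ` {1..n}) = real_of_int (mx (\<lambda>i. ai i j) n)" .
    have "(\<Sum>i\<in>{1..n}. dl i (Suc j)) = (\<Sum>i<n. dl (Suc i) (Suc j))" unfolding One_nat_def by (rule sum.atLeast1_atMost_eq)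
    also have "\<dots> = real_of_int (\<Sum>i<n. bi i j)" using dl j by simp
    finally show "(\<Sum>i\<in>{1..n}. dl i (Suc j)) * Max ((\<lambda>k. al k (Suc j)) ` {1..n}) =
      real_of_int (mx (\<lambda>i. ai i j) n * (\<Sum>i<n. bi i j))" unfolding 1 by simp
  qed
  finally show ?thesis by simp
qed

lemma wp_total:
  assumes n: "s ''n'' 0 = int n" and E: "real_of_int E = v {1..n}"
    and A: "\<And>i j. i < n \<Longrightarrow> j < m \<Longrightarrow> s ''A'' (int i * int m + int j) = ai i j"
    and B: "\<And>i j. i < n \<Longrightarrow> j < m \<Longrightarrow> s ''B'' (int i * int m + int j) = bi i j"
    and N: "m \<le> N" "int m \<le> 2 ^ l" "n \<le> N" "int n \<le> 2 ^ l"
    and sz: "\<And>i j. i < n \<Longrightarrow> j < m \<Longrightarrow> ai i j \<le> 2 ^ l" "\<And>i j. i < n \<Longrightarrow> j < m \<Longrightarrow> int n * bi i j \<le> 2 ^ l" "E \<le> 2 ^ l"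
  shows "wp N l (total m) (\<lambda>s'. s' ''E'' 0 = E) s"
proof -
  define c where "c j = mx (\<lambda>i. ai i j) n * (\<Sum>i<n. bi i j)" for j
  have Ec: "E = (\<Sum>j<m. c j)"
  proof -
    have "real_of_int E = real_of_int (\<Sum>j<m. c j)" unfolding E v_N_int c_def ..
    then show ?thesis by (simp only: of_int_eq_iff)
  qed
  have c0: "0 \<le> c j" if "j < m" for j
    unfolding c_def using bi that by (intro mult_nonneg_nonneg sum_nonneg) (auto simp: mx_def)
  have part: "\<bar>\<Sum>j<k. c j\<bar> \<le> 2 ^ l" if "k \<le> m" for k
  proof -
    have "(\<Sum>j<k. c j) \<le> E" unfolding Ec using c0 that by (intro sum_mono2) auto
    moreover have "0 \<le> (\<Sum>j<k. c j)" using c0 that by (intro sum_nonneg) auto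
    ultimately show ?thesis using sz(3) by simp
  qed
  have bpart: "\<bar>\<Sum>i<k. bi i j\<bar> \<le> 2 ^ l" if "k \<le> n" "j < m" for k j
  proof -
    have "int n * (\<Sum>i<k. bi i j) = (\<Sum>i<k. int n * bi i j)" by (rule sum_distrib_left)
    also have "\<dots> \<le> (\<Sum>i<k. 2 ^ l)" using sz(2) that by (intro sum_mono) auto
    also have "\<dots> = int k * 2 ^ l" by simp
    also have "\<dots> \<le> int n * 2 ^ l" using that by (intro mult_right_mono) auto
    finally have "(\<Sum>i<k. bi i j) \<le> 2 ^ l" using n1 by (simp only: mult_le_cancel_left_pos of_nat_0_less_iff less_le_trans[OF zero_less_one])
    moreover have "0 \<le> (\<Sum>i<k. bi i j)" using bi that by (intro sum_nonneg) auto
    ultimately show ?thesis by simp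
  qed
  show ?thesis
    unfolding total_def
    apply (rule wp_Assign_seq[where v = 0], simp, simp)
    apply (rule wp_For[where M = m and I = "\<lambda>k s'. s' ''E'' 0 = (\<Sum>j<k. c j)"])
    apply (rule N)+
    subgoal by simp
    subgoal by simp
    subgoal premises p for j s1
    proof -
      note fr = p(4) and j0 = p(3) and jm = p(1)
      have d: "s1 ''n'' 0 = int n" "\<And>i. i < n \<Longrightarrow> s1 ''A'' (int i * int m + int j) = ai i j"
        "\<And>i. i < n \<Longrightarrow> s1 ''B'' (int i * int m + int j) = bi i j"
        using n A[OF _ jm] B[OF _ jm] by (simp_all add: fr)
      show ?thesis
        apply (rule wp_Assign_seq[where v = 0], simp, simp)
        apply (rule wp_Seq)
        apply (rule wp_max_loop[where M = n and i = 0 and f = "\<lambda>i. ai i j"])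
        apply (rule N)+
        subgoal by simp
        subgoal by simp
        subgoal by (simp add: d)
        subgoal by simp
        subgoal by (simp add: d j0)
        subgoal using sz(1)[OF _ jm] ai[OF _ jm] by simp
        apply (rule wp_Assign_seq[where v = 0], simp, simp)
        apply (rule wp_Seq)
        apply (rule wp_sum_loop[where M = n and i = 0 and f = "\<lambda>i. bi i j"])
        apply (rule N)+
        subgoal by simp
        subgoal by (simp add: d)
        subgoal by simp
        subgoal by (simp add: d j0)
        subgoal for k using bpart[of "Suc k" j] jm by (simp del: sum.lessThan_Suc)
        apply (rule wp_Assign[where v = "\<Sum>j<Suc j. c j"])
        subgoal using p(2) by (simp add: c_def)
        subgoal using part[of "Suc j"] jm by (simp del: sum.lessThan_Suc)
        subgoal by (simp add: j0)
        done
    qed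
    subgoal by (simp add: Ec)
    done
qed

end

section \<open>Constants and output\<close>

text \<open>The summand \<open>D\<close> in \<open>P\<close> ensures \<open>D \<le> P\<close>, on
  which the separation of fractions at the end relies. Only the diagonal of \<open>V\<close> is
  written, as memory starts at 0.\<close>

definition constants :: com where
  "constants = ''K'' ::= Times (Num 2) (Times (Var ''n'') (Var ''R'')) ;;
    ''P'' ::= Plus (Plus (Plus (Var ''E'') (Var ''D'')) (Var ''K'')) (Num 64) ;;
    ''L'' ::= Num 0 ;; ''y'' ::= Num 1 ;;
    While (Less (Var ''y'') (Var ''P'')) (''y'' ::= Times (Num 2) (Var ''y'') ;; ''L'' ::= Plus (Var ''L'') (Num 1)) ;;
    ''Rr'' ::= Num 1 ;;
    For ''j'' (Plus (Times (Num 2) (Var ''n'')) (Num 3)) (''Rr'' ::= Times (Var ''Rr'') (Var ''P'')) ;;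
    ''M'' ::= Num 1 ;;
    For ''j'' (Plus (Times (Num 4) (Var ''n'')) (Num 6)) (''M'' ::= Times (Var ''M'') (Var ''P'')) ;;
    ''q'' ::= Times (Num 32) (Times (Times (Var ''n'') (Var ''n'')) (Times (Var ''n'') (Var ''n''))) ;;
    ''T'' ::= Times (Times (Num 16) (Times (Var ''n'') (Times (Var ''n'') (Var ''n''))))
      (Times (Times (Var ''n'') (Var ''L'')) (Plus (Plus (Times (Plus (Times (Num 4) (Var ''n'')) (Num 6)) (Var ''K''))
        (Times (Num 4) (Var ''n''))) (Num 8))) ;;
    ''W'' ::= Num 1 ;;
    For ''j'' (Var ''n'') (Store ''V'' (idx (Var ''j'') (Var ''j'')) (Var ''E''))"

lemma mods_constants [simp]: "mods constants = {''K'', ''P'', ''L'', ''y'', ''Rr'', ''j'', ''M'', ''q'', ''T'', ''W'', ''V''}"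
  by (auto simp: constants_def)

lemma wp_power_loop:
  assumes "k \<le> N" "int k \<le> 2 ^ l" "x \<noteq> y" "x \<noteq> z" "y \<noteq> z" and y: "s y 0 = 1"
    and b: "\<And>i v. aval b (fold_st s x y 0 i v) = int k" and z: "s z 0 = c" and sz: "1 \<le> c" "c ^ k \<le> 2 ^ l"
    and Q: "Q (fold_st s x y 0 k (c ^ k))"
  shows "wp N l (For x b (y ::= Times (Var y) (Var z))) Q s"
proof (rule wp_fold_loop[where g = "\<lambda>i. c ^ i" and i = 0, OF assms(1-3)])
  fix i assume i: "i < k"
  have "c ^ Suc i \<le> c ^ k" using i sz by (intro power_increasing) auto
  then have le: "\<bar>c ^ Suc i\<bar> \<le> 2 ^ l" using sz by simp
  show "wp N l (y ::= Times (Var y) (Var z)) (\<lambda>s'. s' = fold_st s x y 0 i (c ^ Suc i)) (fold_st s x y 0 i (c ^ i))"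
    by (rule wp_Assign[OF _ le]) (use assms(3-5) z in \<open>auto simp: fun_eq_iff\<close>)
qed (use y b Q in auto)

context pd_run
begin

lemma M_props: "Rr \<le> M" "M \<le> M ^ KK" "64 * P \<le> M"
proof -
  show "Rr \<le> M" unfolding Rr_def M_def using P_bounds by (intro power_increasing) auto
  have "1 * 1 \<le> (2 * n) * Rn" using n1 Rn_pos by (intro mult_mono) auto
  then have "1 \<le> KK" by (simp only: KK_def)
  then have "M ^ 1 \<le> M ^ KK" using M_ge by (intro power_increasing) auto
  then show "M \<le> M ^ KK" by simp
  have "64 * P \<le> P * P" using P_bounds by (intro mult_right_mono) auto
  also have "\<dots> = P ^ 2" by (simp add: power2_eq_square)
  also have "\<dots> \<le> P ^ (4 * n + 6)" using P_bounds by (intro power_increasing) auto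
  finally show "64 * P \<le> M" by (simp add: M_def)
qed

lemma wp_constants:
  fixes s :: state
  assumes c: "s ''n'' 0 = int n" "s ''R'' 0 = int Rn" "s ''E'' 0 = E" "s ''D'' 0 = D" "\<And>i. s ''V'' i = 0"
    and PL: "P = E + D + int KK + 64" "0 \<le> D" "\<And>k. k < L \<Longrightarrow> 2 ^ k < P"
    and N: "n \<le> N" "4 * n + 6 \<le> N" "L \<le> N" and l: "2 * M \<le> 2 ^ l" "int T \<le> 2 ^ l"
  shows "wp N l constants (\<lambda>s'. s' ''K'' 0 = int KK \<and> s' ''Rr'' 0 = Rr \<and> s' ''M'' 0 = M \<and> s' ''q'' 0 = q \<and>
    s' ''T'' 0 = int T \<and> s' ''W'' 0 = 1 \<and> (\<forall>j<n. \<forall>i<n. s' ''V'' (int j * int n + int i) = (if j = i then E else 0))) s"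
proof -
  have Pl4: "64 * P \<le> 2 ^ l" using M_props l by linarith
  then have Pl: "2 * P \<le> 2 ^ l" using P_bounds by linarith
  have P64: "64 \<le> P" "int KK \<le> P" "E \<le> P" "0 \<le> E" "2 * int n \<le> P" using P_bounds E_nonneg by auto
  have KKe: "int KK = 2 * (int n * int Rn)" by (simp add: KK_def)
  have pw: "2 ^ k \<le> (2::int) ^ l" if "k \<le> L" for k
  proof (cases k)
    case 0
    then show ?thesis by simp
  next
    case (Suc k')
    then have "2 ^ k' < P" using PL(3) that by simp
    then show ?thesis using Pl Suc by simp
  qed
  have Lk: "int k \<le> 2 ^ l" if "k \<le> L" for k using pw[OF that] of_nat_less_two_power[of k, where 'a=int] by linarith
  have nle: "int (4 * n + 6) \<le> 2 ^ l" using Pl4 P64 by simp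
  have Mpow: "P ^ k \<le> 2 ^ l" if "k \<le> 4 * n + 6" for k
  proof -
    have "P ^ k \<le> P ^ (4 * n + 6)" using that P64 by (intro power_increasing) auto
    then show ?thesis using l(1) M_ge by (simp add: M_def)
  qed
  have ql: "\<bar>q\<bar> \<le> 2 ^ l" using q_le_P5 Mpow[of 5] q_pos by simp
  show ?thesis
    unfolding constants_def
    apply (rule wp_Assign_seq[where v = "int KK"], simp add: c KKe)
    subgoal using Pl P64 by linarith
    apply (rule wp_Assign_seq[where v = P], simp add: c PL)
    subgoal using Pl P64 by linarith
    apply (rule wp_Assign_seq[where v = 0], simp, simp)
    apply (rule wp_Assign_seq[where v = 1], simp, simp)
    apply (rule wp_Seq)
    apply (rule wp_While[where M = L and I = "\<lambda>k s'. k \<le> L \<and> s' ''y'' 0 = 2 ^ k \<and> s' ''L'' 0 = int k \<and>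
      s' ''P'' 0 = P \<and> s' ''K'' 0 = int KK \<and> s' ''n'' 0 = int n \<and> s' ''E'' 0 = E \<and> (\<forall>i. s' ''V'' i = 0)"])
    subgoal by (rule N)
    subgoal by (simp add: c)
    subgoal premises p for k s1
    proof
      have "k \<noteq> L" using p P(2) by auto
      then show k: "k < L" using p by simp
      show "wp N l (''y'' ::= Times (Num 2) (Var ''y'') ;; ''L'' ::= Plus (Var ''L'') (Num 1))
        (\<lambda>s'. Suc k \<le> L \<and> s' ''y'' 0 = 2 ^ Suc k \<and> s' ''L'' 0 = int (Suc k) \<and> s' ''P'' 0 = P \<and> s' ''K'' 0 = int KK \<and>
        s' ''n'' 0 = int n \<and> s' ''E'' 0 = E \<and> (\<forall>i. s' ''V'' i = 0)) s1"
        apply (rule wp_Assign_seq[where v = "2 ^ Suc k"])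
        subgoal using p by simp
        subgoal using pw[of "Suc k"] k by simp
        apply (rule wp_Assign[where v = "int (Suc k)"])
        subgoal using p by simp
        subgoal using Lk[of "Suc k"] k by (simp only: abs_of_nat)
        subgoal using p k by simp
        done
    qed
    subgoal premises p for k s1
    proof -
      have "\<not> k < L" using p PL(3)[of k] by auto
      then have kL: "k = L" using p(1) by simp
      have d: "s1 ''L'' 0 = int L" "s1 ''P'' 0 = P" "s1 ''K'' 0 = int KK" "s1 ''n'' 0 = int n" "s1 ''E'' 0 = E" "\<And>i. s1 ''V'' i = 0"
        using p(1) kL by auto
      show ?thesis
        apply (rule wp_Assign_seq[where v = 1], simp, simp)
        apply (rule wp_Seq)
        apply (rule wp_power_loop[where k = "2 * n + 3" and c = P])
        subgoal using N by simp
        subgoal using nle by simp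
        subgoal by simp
        subgoal by simp
        subgoal by simp
        subgoal by simp
        subgoal by (simp add: d)
        subgoal by (simp add: d)
        subgoal using P64 by simp
        subgoal by (rule Mpow) simp
        apply (rule wp_Assign_seq[where v = 1], simp, simp)
        apply (rule wp_Seq)
        apply (rule wp_power_loop[where k = "4 * n + 6" and c = P])
        subgoal using N by simp
        subgoal using nle by simp
        subgoal by simp
        subgoal by simp
        subgoal by simp
        subgoal by simp
        subgoal by (simp add: d)
        subgoal by (simp add: d)
        subgoal using P64 by simp
        subgoal by (rule Mpow) simp
        apply (rule wp_Assign_seq[where v = q])
        subgoal by (simp add: d q_def power4_eq_xxxx mult.assoc)
        subgoal by (rule ql)
        apply (rule wp_Assign_seq[where v = "int T"])
        subgoal by (simp add: d T_def ex_def power3_eq_cube)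
        subgoal using l(2) by (simp only: abs_of_nat)
        apply (rule wp_Assign_seq[where v = 1], simp, simp)
        apply (rule wp_For[where M = n and I = "\<lambda>k s'. \<forall>j<n. \<forall>i<n. s' ''V'' (int j * int n + int i) = (if j = i \<and> j < k then E else 0)"])
        subgoal by (rule N)
        subgoal using Pl P64 by linarith
        subgoal by (simp add: d)
        subgoal by (simp add: d)
        subgoal premises q for j s2
        proof -
          have e: "s2 ''n'' 0 = int n" "s2 ''E'' 0 = E" using q by (simp_all add: d)
          have ne: "int j' * int n + int i = int j * int n + int j \<longleftrightarrow> j' = j \<and> i = j" if "i < n" for j' i
            by (rule idx_inj[OF that q(1)])
          show ?thesis
          proof (rule wp_Store)
            show "\<bar>aval (Var ''E'') s2\<bar> \<le> 2 ^ l" using e Pl P64 by simp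
          qed (use q(1-3) in \<open>auto simp: e ne less_Suc_eq\<close>)
        qed
        subgoal premises q for s2
          using q by (auto simp: d Rr_def M_def)
        done
    qed
    done
qed

end

text \<open>The target is \<open>x / D\<^sup>2\<close>, because scaling profits and demands by
  \<open>D\<close> multiplies the game by \<open>D\<^sup>2\<close>. It has denominator
  \<open>D0 * D\<^sup>2\<close>, and the interval has length \<open>2 / (R * D\<^sup>2)\<close>; by
  \<open>sep\<close> this length times the squared denominator is below 1.\<close>

lemma fraction_window:
  fixes X w R D D0 p :: int and x :: real
  assumes "0 < w" "0 < R" "0 < D" "1 \<le> D0" "0 \<le> x" and x: "\<bar>X / w - x\<bar> < 1 / R" and p: "real_of_int D0 * x = p"
    and sep: "2 * D0\<^sup>2 * D\<^sup>2 < R"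
  defines "A \<equiv> X * R - w" and "B \<equiv> w * (D * D * R)" and "C \<equiv> X * R + w"
  shows "inside A B C B p (D0 * (D * D))" "0 < B" "0 \<le> C" "A * B \<le> C * B" "(C * B - A * B) * (D0 * (D * D))\<^sup>2 < B * B"
proof -
  have w: "0 < real_of_int w" "0 < real_of_int R" using assms by auto
  have "\<bar>X / w - x\<bar> * (w * R) < (1 / R) * (w * R)" using x w by (intro mult_strict_right_mono) auto
  moreover have "\<bar>X / w - x\<bar> * (w * R) = \<bar>(X / w - x) * (w * R)\<bar>" using w by (simp add: abs_mult)
  moreover have "(X / w - x) * (w * R) = X * R - x * w * R" using w by (simp add: field_simps)
  moreover have "(1 / R) * (w * R) = w" using w by simp
  ultimately have h: "\<bar>X * R - x * w * R\<bar> < w" by simp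
  show B: "0 < B" unfolding B_def using assms by simp
  have "0 \<le> x * w * R" using assms by simp
  then have "0 < real_of_int (X * R + w)" using h by simp
  then show "0 \<le> C" unfolding C_def by linarith
  have "A \<le> C" using assms(1) by (simp add: A_def C_def)
  then show "A * B \<le> C * B" using B by simp
  have k: "0 \<le> real_of_int (D0 * (D * D))" using assms by simp
  have pB: "real_of_int (p * B) = (x * w * R) * (D0 * (D * D))"
    unfolding B_def of_int_mult p[symmetric] by simp
  have "real_of_int (A * (D0 * (D * D))) \<le> real_of_int (p * B)"
    unfolding pB A_def using h k by (simp only: of_int_mult[of "X * R - w"]) (intro mult_right_mono, auto)
  moreover have "real_of_int (p * B) \<le> real_of_int (C * (D0 * (D * D)))"
    unfolding pB C_def using h k by (simp only: of_int_mult[of "X * R + w"]) (intro mult_right_mono, auto)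
  ultimately show "inside A B C B p (D0 * (D * D))" unfolding inside_def of_int_le_iff using assms by simp
  have "(2 * D0\<^sup>2 * D\<^sup>2) * (D * D) < R * (D * D)" using sep assms by (intro mult_strict_right_mono) auto
  then have "w * ((2 * D0\<^sup>2 * D\<^sup>2) * (D * D)) < w * (R * (D * D))" using assms(1) by (intro mult_strict_left_mono)
  moreover have "w * ((2 * D0\<^sup>2 * D\<^sup>2) * (D * D)) = 2 * w * (D0 * (D * D))\<^sup>2" by (simp add: power2_eq_square)
  moreover have "w * (R * (D * D)) = B" by (simp add: B_def)
  ultimately have "(2 * w * (D0 * (D * D))\<^sup>2) * B < B * B" using B by (intro mult_strict_right_mono) auto
  moreover have "C * B - A * B = 2 * w * B" by (simp add: A_def C_def left_diff_distrib[symmetric])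
  ultimately show "(C * B - A * B) * (D0 * (D * D))\<^sup>2 < B * B" by (simp only: mult_ac)
qed

text \<open>
  A nested function update mentions the previous state twice; hiding it behind a constant keeps
  the state after a long sequence of assignments from growing exponentially under simplification.
\<close>

definition set_var :: "state \<Rightarrow> string \<Rightarrow> int \<Rightarrow> state" where
  "set_var s x v = s(x := (s x)(0 := v))"

lemma set_var_apply [simp]: "set_var s x v y = (if y = x then (s x)(0 := v) else s y)"
  by (simp add: set_var_def)

lemma wp_set_var_seq:
  "aval b s = v \<Longrightarrow> \<bar>v\<bar> \<le> 2 ^ l \<Longrightarrow> wp N l c Q (set_var s x v) \<Longrightarrow> wp N l (x ::= b ;; c) Q s"
  unfolding set_var_def by (rule wp_Assign_seq)

text \<open>
  The coordinate is the only fraction of denominator at most \<open>n ^ n * D\<^sup>2\<close> in the interval of radius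
  \<open>1 / (Rr * D\<^sup>2)\<close> around the approximation, hence the one of smallest denominator.
\<close>

definition recover :: com where
  "recover = ''y'' ::= Times (Cell ''Xb'' (Var ''l'')) (Var ''Rr'') ;; ''s'' ::= Times (Var ''n'') (Var ''W'') ;;
    ''a'' ::= Minus (Var ''y'') (Var ''s'') ;; ''c'' ::= Plus (Var ''y'') (Var ''s'') ;;
    ''b'' ::= Times (Var ''s'') (Times (Times (Var ''D'') (Var ''D'')) (Var ''Rr'')) ;; ''d'' ::= Var ''b'' ;;
    ''p1'' ::= Num 1 ;; ''p0'' ::= Num 0 ;; ''q1'' ::= Num 0 ;; ''q0'' ::= Num 1 ;;
    cf_loop ;;
    ''r'' ::= Minus (Num 0) (Div (Minus (Num 0) (Var ''a'')) (Var ''b'')) ;;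
    Store ''output'' (Plus (Times (Num 2) (Var ''l'')) (Num 1)) (Plus (Times (Var ''p1'') (Var ''r'')) (Var ''p0'')) ;;
    Store ''output'' (Plus (Times (Num 2) (Var ''l'')) (Num 2)) (Plus (Times (Var ''q1'') (Var ''r'')) (Var ''q0''))"

definition write_output :: com where
  "write_output = Store ''output'' (Num 0) (Times (Num 2) (Var ''n'')) ;; For ''l'' (Var ''n'') recover"

lemma mods_cf_loop [simp]: "mods cf_loop = {''f'', ''x'', ''y'', ''c'', ''a'', ''b'', ''d'', ''p0'', ''p1'', ''q0'', ''q1''}"
  by (auto simp: cf_loop_def)

lemma mods_recover [simp]: "mods recover = {''f'', ''x'', ''y'', ''s'', ''c'', ''a'', ''b'', ''d'', ''p0'', ''p1'', ''q0'', ''q1'', ''r'', ''output''}"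
  by (auto simp: recover_def)

text \<open>Positivity and coprimality make the written pair the normal form of the fraction
  \<open>x / D\<^sup>2\<close>, as \<open>encode_rat\<close> requires.\<close>

definition written :: "state \<Rightarrow> nat \<Rightarrow> int \<Rightarrow> real \<Rightarrow> bool" where
  "written s i D x \<longleftrightarrow> 0 < s ''output'' (2 * int i + 2) \<and>
    coprime (s ''output'' (2 * int i + 1)) (s ''output'' (2 * int i + 2)) \<and>
    real_of_int (s ''output'' (2 * int i + 1)) * (real_of_int D)\<^sup>2 = x * s ''output'' (2 * int i + 2)"

lemma wp_recover:
  fixes X w R D D0 p :: int and x :: real
  assumes s: "s ''Xb'' (int i) = X" "s ''Rr'' 0 = R" "s ''n'' 0 * s ''W'' 0 = w" "s ''D'' 0 = D" "s ''l'' 0 = int i"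
    and pos: "0 < w" "0 < R" "0 < D" "1 \<le> D0" "0 \<le> x" and x: "\<bar>X / w - x\<bar> < 1 / R" and p: "real_of_int D0 * x = p"
    and sep: "2 * D0\<^sup>2 * D\<^sup>2 < R"
    and sz: "\<bar>X * R\<bar> + w \<le> 2 ^ l" "w * (D * D * R) \<le> 2 ^ l" and N: "2 * l + 2 \<le> N"
  shows "wp N l recover (\<lambda>s'. written s' i D x \<and>
    (\<forall>k. k \<noteq> 2 * int i + 1 \<longrightarrow> k \<noteq> 2 * int i + 2 \<longrightarrow> s' ''output'' k = s ''output'' k) \<and> s' ''l'' 0 = int i) s"
proof -
  note W = fraction_window[OF pos x p sep]
  let ?A = "X * R - w" and ?B = "w * (D * D * R)" and ?C = "X * R + w"
  have bd: "\<bar>X * R\<bar> \<le> 2 ^ l" "\<bar>w\<bar> \<le> 2 ^ l" "\<bar>?A\<bar> \<le> 2 ^ l" "\<bar>?C\<bar> \<le> 2 ^ l" "\<bar>?B\<bar> \<le> 2 ^ l" "?C \<le> 2 ^ l"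
    using sz pos(1) W(2) by linarith+
  have rest: "wp N l (cf_loop ;;
    ''r'' ::= Minus (Num 0) (Div (Minus (Num 0) (Var ''a'')) (Var ''b'')) ;;
    Store ''output'' (Plus (Times (Num 2) (Var ''l'')) (Num 1)) (Plus (Times (Var ''p1'') (Var ''r'')) (Var ''p0'')) ;;
    Store ''output'' (Plus (Times (Num 2) (Var ''l'')) (Num 2)) (Plus (Times (Var ''q1'') (Var ''r'')) (Var ''q0'')))
    (\<lambda>s'. written s' i D x \<and>
    (\<forall>k. k \<noteq> 2 * int i + 1 \<longrightarrow> k \<noteq> 2 * int i + 2 \<longrightarrow> s' ''output'' k = s ''output'' k) \<and> s' ''l'' 0 = int i) s0"
    if s0: "s0 ''a'' 0 = ?A" "s0 ''b'' 0 = ?B" "s0 ''c'' 0 = ?C" "s0 ''d'' 0 = ?B"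
      "s0 ''p1'' 0 = 1" "s0 ''p0'' 0 = 0" "s0 ''q1'' 0 = 0" "s0 ''q0'' 0 = 1" "s0 ''output'' = s ''output''" "s0 ''l'' 0 = int i" for s0
    apply (rule wp_Seq)
    apply (rule wp_use[OF wp_cf_loop[where A = ?A and B = ?B and C = ?C and D = ?B and z = l and
      Q = "\<lambda>s'. \<exists>k. cf_inv ?A ?B ?C ?B l k (s' ''a'' 0) (s' ''b'' 0) (s' ''c'' 0) (s' ''d'' 0)
        (s' ''p1'' 0) (s' ''p0'' 0) (s' ''q1'' 0) (s' ''q0'' 0) \<and> \<not> s' ''c'' 0 < s' ''d'' 0 * cl (s' ''a'' 0) (s' ''b'' 0)"]])
    subgoal by (rule s0)
    subgoal by (rule s0)
    subgoal by (rule s0)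
    subgoal by (rule s0)
    subgoal by (rule s0)
    subgoal by (rule s0)
    subgoal by (rule s0)
    subgoal by (rule s0)
    subgoal by (rule W)
    subgoal by (rule W)
    subgoal by (rule W)
    subgoal by (rule W)
    subgoal by (rule bd)
    subgoal using bd by linarith
    subgoal by (rule bd)
    subgoal using bd by linarith
    subgoal by simp
    subgoal by (rule N)
    subgoal by blast
    subgoal premises h for s1
    proof -
      obtain k where I: "cf_inv ?A ?B ?C ?B l k (s1 ''a'' 0) (s1 ''b'' 0) (s1 ''c'' 0) (s1 ''d'' 0)
        (s1 ''p1'' 0) (s1 ''p0'' 0) (s1 ''q1'' 0) (s1 ''q0'' 0)"
        and stop: "\<not> s1 ''c'' 0 < s1 ''d'' 0 * cl (s1 ''a'' 0) (s1 ''b'' 0)" using h(1) by blast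
      have f: "s1 ''output'' = s ''output''" "s1 ''l'' 0 = int i" using s0(9,10) by (simp_all add: h(2))
      define r where "r = cl (s1 ''a'' 0) (s1 ''b'' 0)"
      have rd: "- (- s1 ''a'' 0 div s1 ''b'' 0) = r" by (simp add: r_def cl_def)
      define u where "u = s1 ''p1'' 0 * r + s1 ''p0'' 0"
      define v where "v = s1 ''q1'' 0 * r + s1 ''q0'' 0"
      have B2: "?B \<le> 2 ^ l" using bd by linarith
      have o: "\<bar>u\<bar> \<le> 2 ^ l" "\<bar>v\<bar> \<le> 2 ^ l" "\<bar>r\<bar> \<le> 2 ^ l"
        using cf_output_bounds[OF I stop bd(3) B2 bd(6) B2] by (simp_all add: u_def v_def r_def)
      have res: "0 < v" "u * (D0 * (D * D)) = p * v" "coprime u v"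
        using cf_result[OF I stop W(1) W(5) W(2) W(2)] by (simp_all add: u_def v_def r_def)
      have "real_of_int (u * (D0 * (D * D))) = real_of_int (p * v)" unfolding res(2) ..
      then have "real_of_int D0 * (real_of_int u * (D * D)) = real_of_int D0 * (x * v)"
        using p by (simp add: mult_ac)
      then have val: "real_of_int u * (real_of_int D)\<^sup>2 = x * v" using pos(4) by (simp add: power2_eq_square)
      show ?thesis
        apply (rule wp_Assign_seq[where v = r])
        subgoal using rd by simp
        subgoal by (rule o)
        apply (rule wp_Store_seq[where i = "2 * int i + 1" and v = u])
        subgoal by (simp add: f)
        subgoal by (simp add: u_def)
        subgoal by (rule o)
        apply (rule wp_Store)
        subgoal using o by (simp add: v_def)
        subgoal using res val by (simp add: f written_def v_def[symmetric])
        done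
    qed
    done
  show ?thesis
    unfolding recover_def
    apply (rule wp_set_var_seq[where v = "X * R"], simp add: s, rule bd)
    apply (rule wp_set_var_seq[where v = w], simp add: s, rule bd)
    apply (rule wp_set_var_seq[where v = ?A], simp, rule bd)
    apply (rule wp_set_var_seq[where v = ?C], simp, rule bd)
    apply (rule wp_set_var_seq[where v = ?B], simp add: s, rule bd)
    apply (rule wp_set_var_seq[where v = ?B], simp, rule bd)
    apply (rule wp_set_var_seq[where v = 1], simp, simp)
    apply (rule wp_set_var_seq[where v = 0], simp, simp)
    apply (rule wp_set_var_seq[where v = 0], simp, simp)
    apply (rule wp_set_var_seq[where v = 1], simp, simp)
    apply (rule rest)
    apply (simp_all add: s)
    done
qed

context pd_run
begin

lemma wp_write_output:
  fixes s :: state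
  assumes c: "s ''n'' 0 = int n" "s ''Rr'' 0 = Rr" "s ''W'' 0 = q ^ T" "s ''D'' 0 = D"
    and X: "\<And>i. i < n \<Longrightarrow> \<bar>real_of_int (s ''Xb'' (int i)) / (int n * q ^ T) - nuc (Suc i)\<bar> < 1 / Rr"
      "\<And>i. i < n \<Longrightarrow> \<bar>s ''Xb'' (int i)\<bar> \<le> P ^ (5 * T + 2)"
    and D: "1 \<le> D" "D \<le> P" and N: "n \<le> N" "2 * l + 2 \<le> N" and big: "P ^ (5 * T + 10) * M ^ KK \<le> 2 ^ l"
  shows "wp N l write_output (\<lambda>s'. s' ''output'' 0 = 2 * int n \<and>
    (\<forall>i<n. written s' i D (nuc (Suc i)))) s"
proof -
  have w0: "0 < int n * q ^ T" using n1 q_pos by simp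
  have MK: "1 \<le> M ^ KK" using M_ge by (intro one_le_power) simp
  have "P ^ (5 * T + 10) * 1 \<le> P ^ (5 * T + 10) * M ^ KK" using MK P_pow_pos[of "5 * T + 10"] by (intro mult_left_mono) auto
  then have bigP: "P ^ (5 * T + 10) \<le> 2 ^ l" using big by linarith
  have "P ^ 1 \<le> P ^ (5 * T + 10)" using P_bounds by (intro power_increasing) auto
  then have nl: "2 * int n \<le> 2 ^ l" using bigP n_le_P by simp
  have big2: "P ^ (5 * T + 2 * n + 6) \<le> 2 ^ l"
  proof -
    have "P ^ (5 * T + 2 * n + 6) \<le> P ^ (5 * T + 10 + (4 * n + 6))" using P_bounds by (intro power_increasing) auto
    also have "\<dots> = P ^ (5 * T + 10) * M" by (simp only: power_add M_def)
    also have "\<dots> \<le> P ^ (5 * T + 10) * M ^ KK" using M_props P_pow_pos[of "5 * T + 10"] by (intro mult_left_mono) auto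
    finally show ?thesis using big by linarith
  qed
  have wb: "int n * q ^ T \<le> P ^ (5 * T + 1)"
  proof -
    have "int n * q ^ T \<le> P ^ Suc (5 * T)" using n_le_P q_pow_le q_pos by (intro P_mult_mono) auto
    moreover have "Suc (5 * T) = 5 * T + 1" by simp
    ultimately show ?thesis by simp
  qed
  obtain D0 where D0: "1 \<le> D0" "D0 \<le> int n ^ n" "\<And>i. i \<in> {1..n} \<Longrightarrow> real_of_int D0 * nuc i \<in> \<int>"
    using nuc_denominator by blast
  \<comment> \<open>Accounts for the exponent of \<open>Rr\<close>: \<open>2 * n\<close> for
    \<open>D0\<^sup>2\<close>, 2 for \<open>D\<^sup>2\<close>, and 1 for the factor 2.\<close>
  have sep: "2 * D0\<^sup>2 * D\<^sup>2 < Rr"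
  proof -
    have "D0 \<le> P ^ n" using D0(2) power_mono[of "int n" P n] n_le_P by simp
    then have "D0 ^ 2 \<le> (P ^ n) ^ 2" using D0(1) by (intro power_mono) auto
    then have "D0 ^ 2 * D ^ 2 \<le> (P ^ n) ^ 2 * P ^ 2" 
    proof (rule mult_mono)
      show "D ^ 2 \<le> P ^ 2" using D by (intro power_mono) auto
    qed auto
    also have "\<dots> = P ^ (n * 2 + 2)" by (simp only: power_mult power_add)
    also have "n * 2 + 2 = 2 * n + 2" by simp
    finally have "2 * D0\<^sup>2 * D\<^sup>2 \<le> 2 * P ^ (2 * n + 2)" by simp
    also have "\<dots> < P * P ^ (2 * n + 2)" using P_bounds P_pow_pos[of "2 * n + 2"] by (intro mult_strict_right_mono) auto
    also have "\<dots> = Rr" by (simp only: Rr_def power_Suc[symmetric]) (simp add: numeral_eq_Suc)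
    finally show ?thesis .
  qed
  show ?thesis
    unfolding write_output_def
    apply (rule wp_Store_seq[where i = 0 and v = "2 * int n"], simp, simp add: c)
    subgoal using nl by simp
    apply (rule wp_For[where M = n and I = "\<lambda>k s'. s' ''output'' 0 = 2 * int n \<and>
      (\<forall>i<k. written s' i D (nuc (Suc i)))"])
    subgoal by (rule N)
    subgoal using nl by linarith
    subgoal by simp
    subgoal by (simp add: c)
    subgoal premises h for i s1
    proof -
      have d: "s1 ''Xb'' (int i) = s ''Xb'' (int i)" "s1 ''Rr'' 0 = Rr" "s1 ''n'' 0 * s1 ''W'' 0 = int n * q ^ T" "s1 ''D'' 0 = D"
        using c by (simp_all add: h(4))
      have iN: "Suc i \<in> {1..n}" using h(1) by simp
      obtain p where p: "real_of_int D0 * nuc (Suc i) = real_of_int p" using D0(3)[OF iN] by (auto elim: Ints_cases)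
      have XR: "\<bar>s ''Xb'' (int i) * Rr\<bar> \<le> P ^ (5 * T + 2 * n + 5)"
      proof -
        have "\<bar>s ''Xb'' (int i) * Rr\<bar> \<le> P ^ (5 * T + 2) * P ^ (2 * n + 3)"
          unfolding abs_mult using X(2)[OF h(1)] Rr_pos by (intro mult_mono) (auto simp: Rr_def)
        also have "\<dots> = P ^ (5 * T + 2 + (2 * n + 3))" by (simp only: power_add)
        also have "5 * T + 2 + (2 * n + 3) = 5 * T + 2 * n + 5" by simp
        finally show ?thesis .
      qed
      have "int n * q ^ T \<le> P ^ (5 * T + 2 * n + 5)"
        by (rule order_trans[OF wb]) (use P_bounds in \<open>intro power_increasing; simp\<close>)
      then have "\<bar>s ''Xb'' (int i) * Rr\<bar> + int n * q ^ T \<le> 2 * P ^ (5 * T + 2 * n + 5)" using XR by linarith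
      also have "\<dots> \<le> P ^ Suc (5 * T + 2 * n + 5)" using P_bounds P_pow_pos[of "5 * T + 2 * n + 5"] by (intro P_mult_mono) auto
      also have "Suc (5 * T + 2 * n + 5) = 5 * T + 2 * n + 6" by simp
      finally have sz1: "\<bar>s ''Xb'' (int i) * Rr\<bar> + int n * q ^ T \<le> 2 ^ l" using big2 by linarith
      have "int n * q ^ T * (D * D * Rr) \<le> P ^ (5 * T + 1) * (P * P * P ^ (2 * n + 3))"
        using wb D w0 Rr_pos by (intro mult_mono) (auto simp: Rr_def)
      also have "\<dots> = P ^ (5 * T + 1 + (1 + 1 + (2 * n + 3)))" by (simp only: power_add power_one_right)
      also have "5 * T + 1 + (1 + 1 + (2 * n + 3)) = 5 * T + 2 * n + 6" by simp
      finally have sz2: "int n * q ^ T * (D * D * Rr) \<le> 2 ^ l" using big2 by linarith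
      have D1: "0 < D" using D by simp
      have Rr1: "0 < Rr" using Rr_pos by simp
      have "wp N l recover (\<lambda>s'. written s' i D (nuc (Suc i)) \<and>
        (\<forall>k. k \<noteq> 2 * int i + 1 \<longrightarrow> k \<noteq> 2 * int i + 2 \<longrightarrow> s' ''output'' k = s1 ''output'' k) \<and> s' ''l'' 0 = int i) s1"
        by (rule wp_recover[OF d h(3) w0 Rr1 D1 D0(1) nuc_bounds(1)[OF iN] _ p sep sz1 sz2 N(2)])
          (use X(1)[OF h(1)] in simp)
      then show ?thesis
      proof (rule wp_mono)
        fix s' assume h': "written s' i D (nuc (Suc i)) \<and>
          (\<forall>k. k \<noteq> 2 * int i + 1 \<longrightarrow> k \<noteq> 2 * int i + 2 \<longrightarrow> s' ''output'' k = s1 ''output'' k) \<and> s' ''l'' 0 = int i"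
        have old: "written s' i' D x = written s1 i' D x" if "i' < i" for i' x
          using h' that by (simp add: written_def)
        have "s' ''output'' 0 = s1 ''output'' 0" using h' by simp
        moreover have "written (s'(''l'' := (s' ''l'')(0 := int i + 1))) i' D x = written s' i' D x" for i' x
          by (simp add: written_def)
        ultimately show "s' ''l'' 0 = int i \<and> (s'(''l'' := (s' ''l'')(0 := int i + 1))) ''output'' 0 = 2 * int n \<and>
          (\<forall>i'<Suc i. written (s'(''l'' := (s' ''l'')(0 := int i + 1))) i' D (nuc (Suc i')))"
          using h' h(2) old by (simp add: less_Suc_eq)
      qed
    qed
    subgoal by simp
    done
qed

end

section \<open>Scaling and encoding\<close>

declare One_nat_def [simp del] upt_Suc [simp del]

lemma lex_less_map: "strict_mono h \<Longrightarrow> map h xs \<lless> map h ys \<longleftrightarrow> xs \<lless> ys"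
proof (induction xs arbitrary: ys)
  case Nil
  then show ?case by (cases ys) auto
next
  case (Cons x xs)
  then show ?case by (cases ys) (auto simp: strict_mono_less strict_mono_eq)
qed

lemma sorted_list_of_multiset_image:
  fixes h :: "real \<Rightarrow> real"
  assumes "mono h"
  shows "sorted_list_of_multiset (image_mset h A) = map h (sorted_list_of_multiset A)"
proof -
  let ?xs = "sorted_list_of_multiset A"
  have "sorted (map h ?xs)"
    unfolding sorted_map by (rule sorted_wrt_mono_rel[OF _ sorted_sorted_list_of_multiset]) (use assms in \<open>auto simp: mono_def\<close>)
  moreover have "image_mset h A = mset (map h ?xs)" by simp
  ultimately show ?thesis by (simp only: sorted_list_of_multiset_mset sorted_sort_id)
qed

text \<open>Multiplication by \<open>c\<close> is a bijection between the preimputations of the two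
  games and multiplies all excesses by \<open>c\<close>, which respects sorting and lexicographic
  comparison.\<close>

lemma nucleolus_scale:
  assumes c: "0 < c" and v': "\<And>S. S \<subseteq> {1..n} \<Longrightarrow> v' S = c * v S" and y: "nucleolus n v' = {y}"
  shows "nucleolus n v = {\<lambda>i\<in>{1..n}. y i / c}"
proof -
  define f g :: "(nat \<Rightarrow> real) \<Rightarrow> nat \<Rightarrow> real" where "f = (\<lambda>x. \<lambda>i\<in>{1..n}. c * x i)" and "g = (\<lambda>x. \<lambda>i\<in>{1..n}. x i / c)"
  have fsum: "sum (f x) S = c * sum x S" if "S \<subseteq> {1..n}" for x S
  proof -
    have "sum (f x) S = (\<Sum>i\<in>S. c * x i)" by (rule sum.cong) (use that in \<open>auto simp: f_def\<close>)
    then show ?thesis by (simp add: sum_distrib_left)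
  qed
  have gf: "g (f x) = x" if "x \<in> extensional {1..n}" for x
    using that c by (auto simp: f_def g_def extensional_def fun_eq_iff)
  have fg: "f (g x) = x" if "x \<in> extensional {1..n}" for x
    using that c by (auto simp: f_def g_def extensional_def fun_eq_iff)
  have fpre: "f x \<in> preimputations n v'" if "x \<in> preimputations n v" for x
    using that fsum[of "{1..n}" x] v'[of "{1..n}"] by (auto simp: preimputations_def f_def)
  have gpre: "g x \<in> preimputations n v" if "x \<in> preimputations n v'" for x
  proof -
    have x: "x \<in> extensional {1..n}" "sum x {1..n} = c * v {1..n}" using that v'[of "{1..n}"] by (auto simp: preimputations_def)
    have "c * sum (g x) {1..n} = sum (f (g x)) {1..n}" by (rule fsum[symmetric]) simp
    also have "\<dots> = c * v {1..n}" using x(2) by (simp only: fg[OF x(1)])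
    finally have "c * sum (g x) {1..n} = c * v {1..n}" .
    then have "sum (g x) {1..n} = v {1..n}" using c by (metis mult_left_cancel less_irrefl)
    then show ?thesis by (simp add: preimputations_def g_def)
  qed
  have ev: "excess_vector n v' (f x) = map ((*) c) (excess_vector n v x)" for x
  proof -
    have "image_mset (excess v' (f x)) (mset_set (Pow {1..n})) = image_mset (\<lambda>S. c * excess v x S) (mset_set (Pow {1..n}))"
      by (rule image_mset_cong) (auto simp: excess_def fsum v' right_diff_distrib)
    also have "\<dots> = image_mset ((*) c) (image_mset (excess v x) (mset_set (Pow {1..n})))"
      by (simp add: image_mset.compositionality comp_def)
    finally show ?thesis unfolding excess_vector_def
      using c by (simp add: sorted_list_of_multiset_image mono_def)
  qed
  have less: "excess_vector n v' (f x) \<lless> excess_vector n v' (f z) \<longleftrightarrow> excess_vector n v x \<lless> excess_vector n v z" for x z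
    unfolding ev using c by (intro lex_less_map) (simp add: strict_mono_def)
  have iff: "x \<in> nucleolus n v \<longleftrightarrow> x \<in> preimputations n v \<and> f x \<in> nucleolus n v'" for x
  proof
    assume x: "x \<in> nucleolus n v"
    have "\<not> excess_vector n v' (f x) \<lless> excess_vector n v' z" if z: "z \<in> preimputations n v'" for z
    proof -
      have "\<not> excess_vector n v x \<lless> excess_vector n v (g z)" using x gpre[OF z] by (simp add: nucleolus_def)
      then have "\<not> excess_vector n v' (f x) \<lless> excess_vector n v' (f (g z))" using less by blast
      then show ?thesis using z by (simp add: fg preimputations_def)
    qed
    then show "x \<in> preimputations n v \<and> f x \<in> nucleolus n v'" using x fpre by (simp add: nucleolus_def)
  next
    assume x: "x \<in> preimputations n v \<and> f x \<in> nucleolus n v'"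
    then have "\<not> excess_vector n v x \<lless> excess_vector n v z" if "z \<in> preimputations n v" for z
      using fpre[OF that] less unfolding nucleolus_def by blast
    then show "x \<in> nucleolus n v" using x by (simp add: nucleolus_def)
  qed
  have ypre: "y \<in> preimputations n v'" using y by (auto simp: nucleolus_def)
  then have yext: "y \<in> extensional {1..n}" by (simp add: preimputations_def)
  have "nucleolus n v = {g y}"
  proof (intro equalityI subsetI)
    fix x assume "x \<in> nucleolus n v"
    then have "x \<in> preimputations n v" "f x = y" using iff y by auto
    then show "x \<in> {g y}" using gf[of x] by (auto simp: preimputations_def)
  next
    fix x assume "x \<in> {g y}"
    then show "x \<in> nucleolus n v" using iff gpre[OF ypre] fg[OF yext] y by auto
  qed
  then show ?thesis by (simp add: g_def)
qed

lemma pd_game_scale: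
  assumes "finite S" "0 \<le> c"
  shows "pd_game m (\<lambda>i j. c * a i j) (\<lambda>i j. c * b i j) S = c * c * pd_game m a b S"
proof (cases "S = {}")
  case False
  have "Max ((\<lambda>k. c * a k j) ` S) = c * Max ((\<lambda>k. a k j) ` S)" for j
  proof -
    have "(*) c (Max ((\<lambda>k. a k j) ` S)) = Max ((*) c ` ((\<lambda>k. a k j) ` S))"
      by (rule mono_Max_commute) (use assms False in \<open>auto simp: mono_def mult_left_mono\<close>)
    then show ?thesis by (simp add: image_image)
  qed
  moreover have "(\<Sum>i\<in>S. c * b i j) = c * (\<Sum>i\<in>S. b i j)" for j by (simp add: sum_distrib_left)
  ultimately show ?thesis using False by (simp add: pd_game_def sum_distrib_left[of _ _ "{1..m}"] mult_ac)
qed (simp add: pd_game_def)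

lemma (in pd_data) nucleolus_eq_nuc: "nucleolus n v = {nuc}"
proof -
  have "preimputations n v = pre" by (simp add: preimputations_def pre_def)
  moreover have "excess_vector n v x = \<theta> x" for x by (simp add: excess_vector_def \<theta>_eq)
  ultimately show ?thesis using lexmax_set_eq_nuc by (simp add: nucleolus_def)
qed

section \<open>Layout and length of the encoded instance\<close>

lemma length_concat_uniform:
  "(\<And>ys. ys \<in> set xss \<Longrightarrow> length ys = k) \<Longrightarrow> length (concat xss) = length xss * k"
  by (induction xss) auto

lemma nth_concat_uniform:
  assumes "\<And>ys. ys \<in> set xss \<Longrightarrow> length ys = k" "i < length xss" "j < k"
  shows "concat xss ! (i * k + j) = xss ! i ! j"
  using assms
proof (induction xss arbitrary: i)
  case (Cons ys xss)
  show ?case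
  proof (cases i)
    case 0
    then show ?thesis using Cons.prems by (simp add: nth_append)
  next
    case (Suc i')
    have "length ys = k" using Cons.prems(1) by simp
    moreover have "concat xss ! (i' * k + j) = xss ! i' ! j" using Cons.prems Suc by (intro Cons.IH) auto
    ultimately show ?thesis by (simp add: Suc nth_append add.assoc)
  qed
qed simp

definition quad :: "pd_instance \<Rightarrow> nat \<Rightarrow> nat \<Rightarrow> int list" where
  "quad = (\<lambda>(n, \<alpha>, d) i j. encode_rat (\<alpha> i j) @ encode_rat (d i j))"

lemma length_quad [simp]: "length (quad a i j) = 4"
  by (cases a) (simp add: quad_def encode_rat_def)

text \<open>Two levels of concatenation are flattened: 4 numbers per pair and \<open>m\<close> pairs
  per player, behind the leading number \<open>n\<close>.\<close>

lemma encode_instance_nth: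
  assumes "i < n" "j < m" "k < 4"
  shows "encode_instance m (n, \<alpha>, d) ! Suc (4 * (i * m + j) + k) = quad (n, \<alpha>, d) (Suc i) (Suc j) ! k"
proof -
  let ?row = "\<lambda>i. map (quad (n, \<alpha>, d) i) [1..<m+1]"
  let ?rows = "map ?row [1..<n+1]"
  have enc: "encode_instance m (n, \<alpha>, d) = int n # concat (concat ?rows)"
    by (simp add: encode_instance_def quad_def)
  have 1: "length ys = 4" if "ys \<in> set (concat ?rows)" for ys using that by auto
  have 2: "length ys = m" if "ys \<in> set ?rows" for ys using that by auto
  have len: "length (concat ?rows) = n * m" using length_concat_uniform[of ?rows m, OF 2] by simp
  have "i * m + j < Suc i * m" using assms by simp
  also have "\<dots> \<le> n * m" using assms by (intro mult_right_mono) auto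
  finally have lt: "i * m + j < length (concat ?rows)" using len by simp
  have "concat (concat ?rows) ! ((i * m + j) * 4 + k) = concat ?rows ! (i * m + j) ! k"
    by (rule nth_concat_uniform[OF 1 lt assms(3)])
  also have "concat ?rows ! (i * m + j) = ?rows ! i ! j"
    by (rule nth_concat_uniform[OF 2 _ assms(2)]) (use assms in auto)
  also have "\<dots> = quad (n, \<alpha>, d) (Suc i) (Suc j)" using assms by (simp add: Suc_eq_plus1_left)
  finally show ?thesis unfolding enc by (simp add: mult.commute)
qed

lemma length_encode_instance: "length (encode_instance m (n, \<alpha>, d)) = 1 + 4 * (n * m)"
proof -
  let ?row = "\<lambda>i. map (quad (n, \<alpha>, d) i) [1..<m+1]"
  let ?rows = "map ?row [1..<n+1]"
  have enc: "encode_instance m (n, \<alpha>, d) = int n # concat (concat ?rows)"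
    by (simp add: encode_instance_def quad_def)
  have 1: "length ys = 4" if "ys \<in> set (concat ?rows)" for ys using that by auto
  have 2: "length ys = m" if "ys \<in> set ?rows" for ys using that by auto
  have "length (concat ?rows) = n * m" using length_concat_uniform[of ?rows m, OF 2] by simp
  then have "length (concat (concat ?rows)) = n * m * 4" using length_concat_uniform[of "concat ?rows" 4, OF 1] by simp
  then show ?thesis unfolding enc by simp
qed

lemma length_le_encoding_length: "length xs \<le> encoding_length xs"
  by (induction xs) (auto simp: encoding_length_def int_size_def)

lemma abs_le_encoding_length: "x \<in> set xs \<Longrightarrow> \<bar>x\<bar> \<le> 2 ^ encoding_length xs"
proof -
  assume x: "x \<in> set xs"
  have "\<bar>x\<bar> \<le> 2 ^ int_size x"
  proof -
    have b: "0 \<le> bitlen \<bar>x\<bar>" by (rule bitlen_nonneg)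
    have "bitlen \<bar>x\<bar> \<le> bitlen \<bar>x\<bar>" by simp
    then have "\<bar>x\<bar> < 2 ^ nat (bitlen \<bar>x\<bar>)" using b by (subst (asm) bitlen_le_iff_power) auto
    also have "\<dots> \<le> (2::int) ^ int_size x" by (intro power_increasing) (auto simp: int_size_def)
    finally show ?thesis by simp
  qed
  also have "int_size x \<le> encoding_length xs"
    unfolding encoding_length_def using x by (intro member_le_sum_list) auto
  then have "(2::int) ^ int_size x \<le> 2 ^ encoding_length xs" by (intro power_increasing) auto
  finally show ?thesis .
qed

section \<open>Polynomially bounded quantities\<close>

definition polynomial_fun :: "(nat \<Rightarrow> nat) \<Rightarrow> bool" where
  "polynomial_fun f \<longleftrightarrow> (\<exists>p :: nat poly. \<forall>x. poly p x = f x)"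

lemma polynomial_fun_const: "polynomial_fun (\<lambda>_. c)"
  unfolding polynomial_fun_def by (rule exI[of _ "[:c:]"]) simp

lemma polynomial_fun_id: "polynomial_fun (\<lambda>x. x)"
  unfolding polynomial_fun_def by (rule exI[of _ "[:0, 1:]"]) simp

lemma polynomial_fun_add: "polynomial_fun f \<Longrightarrow> polynomial_fun g \<Longrightarrow> polynomial_fun (\<lambda>x. f x + g x)"
  unfolding polynomial_fun_def by (metis poly_add)

lemma polynomial_fun_mult: "polynomial_fun f \<Longrightarrow> polynomial_fun g \<Longrightarrow> polynomial_fun (\<lambda>x. f x * g x)"
  unfolding polynomial_fun_def by (metis poly_mult)

lemma polynomial_fun_power: "polynomial_fun f \<Longrightarrow> polynomial_fun (\<lambda>x. f x ^ k)"
  unfolding polynomial_fun_def by (metis poly_power)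

lemma polynomial_fun_compose: "polynomial_fun f \<Longrightarrow> polynomial_fun g \<Longrightarrow> polynomial_fun (\<lambda>x. f (g x))"
  unfolding polynomial_fun_def by (metis poly_pcompose)

lemmas polynomial_fun_intros = polynomial_fun_const polynomial_fun_id polynomial_fun_add polynomial_fun_mult polynomial_fun_power

section \<open>The complete program\<close>

definition solve_game :: "nat \<Rightarrow> com" where
  "solve_game m = powers m ;; fill_rows m ;; total m ;; constants ;; cutting_loop ;; write_output"

lemma mods_cutting_loop: "mods cutting_loop \<inter> {''n'', ''Rr'', ''D''} = {}"
  by (simp add: cutting_loop_def cutting_round_def)

context pd_run
begin

lemma wp_solve_game:
  fixes s :: state and D :: int
  assumes n: "s ''n'' 0 = int n" and D: "s ''D'' 0 = D" "1 \<le> D"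
    and A: "\<And>i j. i < n \<Longrightarrow> j < m \<Longrightarrow> s ''A'' (int i * int m + int j) = ai i j"
    and B: "\<And>i j. i < n \<Longrightarrow> j < m \<Longrightarrow> s ''B'' (int i * int m + int j) = bi i j"
    and zero: "\<And>i. s ''V'' i = 0" "\<And>i. s ''Fb'' i = 0" "\<And>i. s ''Xb'' i = 0"
    and PL: "P = E + D + int KK + 64" "\<And>k. k < L \<Longrightarrow> 2 ^ k < P"
    and N: "KK \<le> N" "T \<le> N" "m \<le> N" "4 * n + 6 \<le> N" "L \<le> N" "2 * l + 2 \<le> N"
    and l: "2 \<le> l" "int T \<le> 2 ^ l" "int m \<le> 2 ^ l" "P ^ (5 * T + 10) * M ^ KK \<le> 2 ^ l"
    and sz: "\<And>i j. i < n \<Longrightarrow> j < m \<Longrightarrow> ai i j \<le> 2 ^ l" "\<And>i j. i < n \<Longrightarrow> j < m \<Longrightarrow> int n * bi i j \<le> 2 ^ l"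
  shows "wp N l (solve_game m) (\<lambda>s'. s' ''output'' 0 = 2 * int n \<and> (\<forall>i<n. written s' i D (nuc (Suc i)))) s"
proof -
  define Q where "Q = (\<lambda>s' :: state. s' ''output'' 0 = 2 * int n \<and> (\<forall>i<n. written s' i D (nuc (Suc i))))"
  have MK: "1 \<le> M ^ KK" using M_ge by (intro one_le_power) simp
  have M2: "2 * M \<le> 2 ^ l"
  proof -
    have "P ^ 1 \<le> P ^ (5 * T + 10)" using P_bounds by (intro power_increasing) auto
    then have "2 \<le> P ^ (5 * T + 10)" using P_bounds by simp
    then have "2 * M \<le> P ^ (5 * T + 10) * M ^ KK" using M_props M_ge by (intro mult_mono) auto
    then show ?thesis using l(4) by linarith
  qed
  have Pl: "P \<le> 2 ^ l" using M2 M_props P_bounds by linarith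
  have nl: "int n \<le> 2 ^ l" "int KK \<le> 2 ^ l" "E \<le> 2 ^ l" using Pl P_bounds n_le_P by linarith+
  have RK: "Rn \<le> KK" using n1 by (simp add: KK_def)
  have R: "Rn \<le> N" "int Rn \<le> 2 ^ l" using RK N(1) nl(2) by linarith+
  have nN: "n \<le> N" using N(4) by simp
  have DP: "D \<le> P" "0 \<le> D" using PL(1) E_nonneg D(2) by simp_all
  have l1: "1 \<le> l" using l(1) by simp
  have np: "int (n ^ m) \<le> 2 ^ l" using R(2) by (simp only: Rn_def)
  have Cl: "Cc t i \<le> 2 ^ l" if "i < n" for t i using Cc_le_E[OF that, of t] nl(3) by linarith
  have "wp N l (powers m) (wp N l (fill_rows m ;; total m ;; constants ;; cutting_loop ;; write_output) Q) s"
  proof (rule wp_use[OF wp_powers[where s = s and n = n and m = m, OF n n1 N(3) l(3) np]])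
    fix s1 assume h1: "s1 ''R'' 0 = int (n ^ m) \<and> (\<forall>h<m. s1 ''np'' (int h) = int (n ^ h))"
      and f1: "\<And>y. y \<notin> mods (powers m) \<Longrightarrow> s1 y = s y"
    have c1: "s1 ''n'' 0 = int n" "s1 ''R'' 0 = int Rn" "\<And>h. h < m \<Longrightarrow> s1 ''np'' (int h) = int (n ^ h)"
      "\<And>i j. i < n \<Longrightarrow> j < m \<Longrightarrow> s1 ''A'' (int i * int m + int j) = ai i j"
      "\<And>i j. i < n \<Longrightarrow> j < m \<Longrightarrow> s1 ''B'' (int i * int m + int j) = bi i j"
      using n A B h1 by (simp_all add: f1 Rn_def)
    have "wp N l (fill_rows m) (wp N l (total m ;; constants ;; cutting_loop ;; write_output) Q) s1"
    proof (rule wp_use[OF wp_fill_rows[where s = s1, OF c1 R N(3) l(3) nN nl(1) l1 sz(1) Cl]])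
      fix s2 assume h2: "rows_filled Rn s2"
        and f2: "\<And>y. y \<notin> mods (fill_rows m) \<Longrightarrow> s2 y = s1 y"
      have c2: "s2 ''n'' 0 = int n" "\<And>i j. i < n \<Longrightarrow> j < m \<Longrightarrow> s2 ''A'' (int i * int m + int j) = ai i j"
        "\<And>i j. i < n \<Longrightarrow> j < m \<Longrightarrow> s2 ''B'' (int i * int m + int j) = bi i j"
        using c1 by (simp_all add: f2)
      have "wp N l (total m) (wp N l (constants ;; cutting_loop ;; write_output) Q) s2"
      proof (rule wp_use[OF wp_total[where s = s2, OF c2(1) E c2(2,3) N(3) l(3) nN nl(1) sz nl(3)]])
        fix s3 assume h3: "s3 ''E'' 0 = E" and f3: "\<And>y. y \<notin> mods (total m) \<Longrightarrow> s3 y = s2 y"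
        have c3: "s3 ''n'' 0 = int n" "s3 ''R'' 0 = int Rn" "s3 ''E'' 0 = E" "s3 ''D'' 0 = D" "\<And>i. s3 ''V'' i = 0"
          using n D h3 c1(2) zero by (simp_all add: f1 f2 f3)
        have "wp N l constants (wp N l (cutting_loop ;; write_output) Q) s3"
        proof (rule wp_use[OF wp_constants[where s = s3, OF c3 PL(1) DP(2) PL(2) nN N(4,5) M2 l(2)]])
          fix s4 assume h4: "s4 ''K'' 0 = int KK \<and> s4 ''Rr'' 0 = Rr \<and> s4 ''M'' 0 = M \<and> s4 ''q'' 0 = q \<and>
            s4 ''T'' 0 = int T \<and> s4 ''W'' 0 = 1 \<and> (\<forall>j<n. \<forall>i<n. s4 ''V'' (int j * int n + int i) = (if j = i then E else 0))"
            and f4: "\<And>y. y \<notin> mods constants \<Longrightarrow> s4 y = s3 y"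
          have W4: "s4 ''W'' 0 = 1" and V4: "\<And>j i. j < n \<Longrightarrow> i < n \<Longrightarrow> s4 ''V'' (int j * int n + int i) = (if j = i then E else 0)"
            and k4: "s4 ''q'' 0 = q" "s4 ''K'' 0 = int KK" "s4 ''M'' 0 = M" "s4 ''T'' 0 = int T" "s4 ''Rr'' 0 = Rr"
            using h4 by blast+
          have c4: "s4 ''Fb'' 0 = 0" "\<And>i. i < n \<Longrightarrow> s4 ''Xb'' (int i) = 0" "s4 ''n'' 0 = int n" "s4 ''D'' 0 = D"
            "\<And>r i. r < Rn \<Longrightarrow> i < n \<Longrightarrow> s4 ''C'' (int r * int n + int i) = Cc r i"
            "\<And>r i. r < Rn \<Longrightarrow> i < n \<Longrightarrow> s4 ''S'' (int r * int n + int i) = St r i"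
            using n D zero h2 by (simp_all add: rows_filled_def f1 f2 f3 f4)
          have "wp N l cutting_loop (wp N l write_output Q) s4"
          proof (rule wp_use[OF wp_cutting_loop[where s = s4, OF W4 V4 c4(1,2,3) k4(1-4) c4(5,6) N(1) nN N(2) l(2,4,1)]])
            fix s5 assume h5: "s5 ''W'' 0 = q ^ T \<and>
              (\<forall>i<n. \<bar>real_of_int (s5 ''Xb'' (int i)) / (int n * q ^ T) - nuc (Suc i)\<bar> < 1 / Rr) \<and>
              (\<forall>i<n. \<bar>s5 ''Xb'' (int i)\<bar> \<le> P ^ (5 * T + 2))"
              and f5: "\<And>y. y \<notin> mods cutting_loop \<Longrightarrow> s5 y = s4 y"
            have "s5 ''n'' = s4 ''n''" "s5 ''Rr'' = s4 ''Rr''" "s5 ''D'' = s4 ''D''"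
              using mods_cutting_loop by (auto intro!: f5)
            then have c5: "s5 ''n'' 0 = int n" "s5 ''Rr'' 0 = Rr" "s5 ''D'' 0 = D" using c4 k4 by simp_all
            have W5: "s5 ''W'' 0 = q ^ T"
              and X5: "\<And>i. i < n \<Longrightarrow> \<bar>real_of_int (s5 ''Xb'' (int i)) / (int n * q ^ T) - nuc (Suc i)\<bar> < 1 / Rr"
                "\<And>i. i < n \<Longrightarrow> \<bar>s5 ''Xb'' (int i)\<bar> \<le> P ^ (5 * T + 2)" using h5 by blast+
            show "wp N l write_output Q s5"
              unfolding Q_def by (rule wp_write_output[where s = s5, OF c5(1,2) W5 c5(3) X5 D(2) DP(1) nN N(6) l(4)])
          qed
          then show "wp N l (cutting_loop ;; write_output) Q s4" by (rule wp_Seq)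
        qed
        then show "wp N l (constants ;; cutting_loop ;; write_output) Q s3" by (rule wp_Seq)
      qed
      then show "wp N l (total m ;; constants ;; cutting_loop ;; write_output) Q s2" by (rule wp_Seq)
    qed
    then show "wp N l (fill_rows m ;; total m ;; constants ;; cutting_loop ;; write_output) Q s1" by (rule wp_Seq)
  qed
  then show ?thesis unfolding solve_game_def Q_def by (rule wp_Seq)
qed

end

text \<open>As functions of the encoding length, these four bound the bits of \<open>P\<close>, the
  number of blocks, the number of rounds, and finally all bit sizes together with the lengths of the
  loops. \<open>m\<close> enters an exponent only through \<open>block_bound\<close>, so for fixed
  \<open>m\<close> all are polynomials.\<close>

definition log_bound :: "nat \<Rightarrow> nat \<Rightarrow> nat" where
  "log_bound m y = 4 * y\<^sup>2 + 4 * y + (m + 1) * y + 8"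
definition block_bound :: "nat \<Rightarrow> nat \<Rightarrow> nat" where
  "block_bound m y = 2 * y ^ (m + 1)"
definition round_bound :: "nat \<Rightarrow> nat \<Rightarrow> nat" where
  "round_bound m y = 16 * y ^ 3 * (y * log_bound m y * ((4 * y + 6) * block_bound m y + 4 * y + 8))"
definition size_bound :: "nat \<Rightarrow> nat \<Rightarrow> nat" where
  "size_bound m y = log_bound m y * (5 * round_bound m y + 10 + (4 * y + 6) * block_bound m y) +
    round_bound m y + block_bound m y + log_bound m y"

lemma polynomial_fun_size_bound: "polynomial_fun (size_bound m)"
proof -
  have "polynomial_fun (\<lambda>y. size_bound m y)"
    unfolding size_bound_def round_bound_def block_bound_def log_bound_def
    by (intro polynomial_fun_intros)
  then show ?thesis by simp
qed

locale pd_encoded =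
  fixes m n :: nat and \<alpha> d :: "nat \<Rightarrow> nat \<Rightarrow> rat"
  assumes m1: "1 \<le> m" and n1: "1 \<le> n"
    and nonneg: "\<And>i j. i \<in> {1..n} \<Longrightarrow> j \<in> {1..m} \<Longrightarrow> 0 \<le> \<alpha> i j \<and> 0 \<le> d i j"
begin

definition inp :: "int list" where "inp = encode_instance m (n, \<alpha>, d)"
definition len :: nat where "len = encoding_length inp"
text \<open>\<open>e\<close> numbers the pairs of player and market row by row; \<open>k\<close>
  runs from 2 to 5, matching the fields of \<open>entry\<close>.\<close>

definition x :: "nat \<Rightarrow> nat \<Rightarrow> int" where
  "x k e = quad (n, \<alpha>, d) (Suc (e div m)) (Suc (e mod m)) ! (k - 2)"
definition D :: int where "D = (\<Prod>e<n * m. x 3 e * x 5 e)"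
definition ai :: "nat \<Rightarrow> nat \<Rightarrow> int" where "ai i j = x 2 (i * m + j) * (D div x 3 (i * m + j))"
definition bi :: "nat \<Rightarrow> nat \<Rightarrow> int" where "bi i j = x 4 (i * m + j) * (D div x 5 (i * m + j))"

lemma flat: "i < n \<Longrightarrow> j < m \<Longrightarrow> i * m + j < n * m"
proof -
  assume "i < n" "j < m"
  then have "i * m + j < Suc i * m" by simp
  also have "\<dots> \<le> n * m" using \<open>i < n\<close> by (intro mult_right_mono) auto
  finally show ?thesis .
qed

lemma x_flat: "j < m \<Longrightarrow> x k (i * m + j) = quad (n, \<alpha>, d) (Suc i) (Suc j) ! (k - 2)"
  by (simp add: x_def)

lemma input_eq:
  assumes "e < n * m" "2 \<le> k" "k \<le> 5"
  shows "input_state inp ''input'' (int k + 4 * int e) = x k e" "x k e \<in> set inp"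
proof -
  have em: "e div m < n" "e mod m < m" using assms(1) m1 by (auto simp: less_mult_imp_div_less)
  have ee: "e div m * m + e mod m = e" by (rule div_mult_mod_eq)
  have nth: "inp ! Suc (4 * e + (k - 2)) = x k e"
    using encode_instance_nth[OF em, of "k - 2" \<alpha> d] assms(2,3) unfolding ee inp_def x_def by simp
  have len: "Suc (4 * e + (k - 2)) < length inp"
  proof -
    have "4 * (e + 1) \<le> 4 * (n * m)" using assms(1) by (intro mult_left_mono) auto
    then show ?thesis using assms(2,3) by (simp add: inp_def length_encode_instance)
  qed
  show "x k e \<in> set inp" using nth_mem[OF len] nth by simp
  have "nat (int k + 4 * int e - 1) = Suc (4 * e + (k - 2))" using assms(2) by (simp add: nat_eq_iff)
  then show "input_state inp ''input'' (int k + 4 * int e) = x k e"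
    using len assms(2) nth by (simp add: input_state_def)
qed

lemma x_entries:
  assumes "i < n" "j < m"
  shows "0 \<le> x 2 (i * m + j)" "1 \<le> x 3 (i * m + j)" "0 \<le> x 4 (i * m + j)" "1 \<le> x 5 (i * m + j)"
    "real_of_rat (\<alpha> (Suc i) (Suc j)) = x 2 (i * m + j) / x 3 (i * m + j)"
    "real_of_rat (d (Suc i) (Suc j)) = x 4 (i * m + j) / x 5 (i * m + j)"
proof -
  have r: "0 < snd (quotient_of r) \<and> (0 \<le> r \<longrightarrow> 0 \<le> fst (quotient_of r)) \<and>
    real_of_rat r = fst (quotient_of r) / snd (quotient_of r)" for r
  proof -
    obtain p q where pq: "quotient_of r = (p, q)" by (cases "quotient_of r")
    have q: "0 < q" by (rule quotient_of_denom_pos[OF pq])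
    have "r = of_int p / of_int q" by (rule quotient_of_div[OF pq])
    then show ?thesis using q pq by (simp add: of_rat_divide zero_le_divide_iff)
  qed
  have nn: "0 \<le> \<alpha> (Suc i) (Suc j)" "0 \<le> d (Suc i) (Suc j)" using nonneg[of "Suc i" "Suc j"] assms by auto
  have q: "quad (n, \<alpha>, d) (Suc i) (Suc j) = [fst (quotient_of (\<alpha> (Suc i) (Suc j))), snd (quotient_of (\<alpha> (Suc i) (Suc j))),
    fst (quotient_of (d (Suc i) (Suc j))), snd (quotient_of (d (Suc i) (Suc j)))]"
    by (simp add: quad_def encode_rat_def)
  have e: "x 2 (i * m + j) = fst (quotient_of (\<alpha> (Suc i) (Suc j)))" "x 3 (i * m + j) = snd (quotient_of (\<alpha> (Suc i) (Suc j)))"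
    "x 4 (i * m + j) = fst (quotient_of (d (Suc i) (Suc j)))" "x 5 (i * m + j) = snd (quotient_of (d (Suc i) (Suc j)))"
    using assms by (simp_all add: x_flat q numeral_eq_Suc)
  show "0 \<le> x 2 (i * m + j)" "1 \<le> x 3 (i * m + j)" "0 \<le> x 4 (i * m + j)" "1 \<le> x 5 (i * m + j)"
    "real_of_rat (\<alpha> (Suc i) (Suc j)) = x 2 (i * m + j) / x 3 (i * m + j)"
    "real_of_rat (d (Suc i) (Suc j)) = x 4 (i * m + j) / x 5 (i * m + j)"
    unfolding e using r[of "\<alpha> (Suc i) (Suc j)"] r[of "d (Suc i) (Suc j)"] nn by auto
qed

lemma den_pos: "e < n * m \<Longrightarrow> 1 \<le> x 3 e" "e < n * m \<Longrightarrow> 1 \<le> x 5 e"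
proof -
  assume e: "e < n * m"
  have em: "e div m < n" "e mod m < m" using e m1 by (auto simp: less_mult_imp_div_less)
  have ee: "e div m * m + e mod m = e" by (rule div_mult_mod_eq)
  show "1 \<le> x 3 e" "1 \<le> x 5 e" using x_entries(2,4)[OF em] unfolding ee by auto
qed

lemma D_pos: "1 \<le> D"
  unfolding D_def
proof (rule prod_ge_1)
  fix e assume "e \<in> {..<n * m}"
  then show "1 \<le> x 3 e * x 5 e" using mult_mono[of 1 "x 3 e" 1 "x 5 e"] den_pos[of e] by simp
qed

lemma D_dvd: "e < n * m \<Longrightarrow> x 3 e dvd D" "e < n * m \<Longrightarrow> x 5 e dvd D"
proof -
  assume e: "e < n * m"
  have "x 3 e * x 5 e dvd D" unfolding D_def by (rule dvd_prodI) (use e in auto)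
  then show "x 3 e dvd D" "x 5 e dvd D" by (auto intro: dvd_trans[OF dvd_triv_left] dvd_trans[OF dvd_triv_right])
qed

lemma scaled:
  assumes "i < n" "j < m"
  shows "real_of_int D * real_of_rat (\<alpha> (Suc i) (Suc j)) = ai i j" "real_of_int D * real_of_rat (d (Suc i) (Suc j)) = bi i j"
    "0 \<le> ai i j" "0 \<le> bi i j"
proof -
  note X = x_entries[OF assms]
  note dv = D_dvd[OF flat[OF assms]]
  show "real_of_int D * real_of_rat (\<alpha> (Suc i) (Suc j)) = ai i j"
    unfolding X(5) ai_def using real_of_int_div[OF dv(1)] by simp
  show "real_of_int D * real_of_rat (d (Suc i) (Suc j)) = bi i j"
    unfolding X(6) bi_def using real_of_int_div[OF dv(2)] by simp
  show "0 \<le> ai i j" unfolding ai_def using X(1,2) D_pos by (intro mult_nonneg_nonneg) (auto simp: pos_imp_zdiv_nonneg_iff)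
  show "0 \<le> bi i j" unfolding bi_def using X(3,4) D_pos by (intro mult_nonneg_nonneg) (auto simp: pos_imp_zdiv_nonneg_iff)
qed

sublocale pd_data n m ai bi "\<lambda>i j. real_of_int D * real_matrix \<alpha> i j" "\<lambda>i j. real_of_int D * real_matrix d i j"
  by unfold_locales (use n1 m1 scaled in \<open>auto simp: real_matrix_def\<close>)

definition E :: int where "E = (\<Sum>j<m. mx (\<lambda>i. ai i j) n * (\<Sum>i<n. bi i j))"
definition P :: int where "P = E + D + int KK + 64"
definition L :: nat where "L = (LEAST k. P \<le> 2 ^ k)"

section \<open>Sizes in terms of the encoding length\<close>

lemma len_bounds: "n \<le> len" "m \<le> len" "n * m \<le> len" "1 \<le> len"
proof -
  have "1 + 4 * (n * m) \<le> len"
    using length_le_encoding_length[of inp] by (simp add: len_def inp_def length_encode_instance)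
  moreover have "n * 1 \<le> n * m" "1 * m \<le> n * m" using n1 m1 by (intro mult_left_mono mult_right_mono; simp)+
  ultimately show "n \<le> len" "m \<le> len" "n * m \<le> len" "1 \<le> len" by linarith+
qed

lemma x_le: "e < n * m \<Longrightarrow> 2 \<le> k \<Longrightarrow> k \<le> 5 \<Longrightarrow> x k e \<le> 2 ^ len"
  using abs_le_encoding_length[OF input_eq(2)] by (fastforce simp: len_def)

lemma D_le: "D \<le> 2 ^ (2 * len\<^sup>2)"
proof -
  have "D \<le> (\<Prod>e<n * m. 2 ^ (2 * len))"
    unfolding D_def
  proof (rule prod_mono)
    fix e assume e: "e \<in> {..<n * m}"
    have "x 3 e * x 5 e \<le> 2 ^ len * 2 ^ len" using e den_pos[of e] x_le[of e] by (intro mult_mono) auto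
    then show "0 \<le> x 3 e * x 5 e \<and> x 3 e * x 5 e \<le> 2 ^ (2 * len)"
      using e den_pos[of e] by (simp add: mult_2 power_add)
  qed
  also have "\<dots> = 2 ^ (2 * len * (n * m))" by (simp add: power_mult)
  also have "\<dots> \<le> 2 ^ (2 * len * len)" using len_bounds by (intro power_increasing mult_left_mono) auto
  finally show ?thesis by (simp add: power2_eq_square mult.assoc)
qed

lemma ai_le: "i < n \<Longrightarrow> j < m \<Longrightarrow> ai i j \<le> 2 ^ (len + 2 * len\<^sup>2)"
  and bi_le: "i < n \<Longrightarrow> j < m \<Longrightarrow> bi i j \<le> 2 ^ (len + 2 * len\<^sup>2)"
proof -
  assume ij: "i < n" "j < m"
  note X = x_entries[OF ij] and f = flat[OF ij]
  have q: "D div y \<le> D" "0 \<le> D div y" if "1 \<le> y" for y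
    using that D_pos abs_div_le_abs[of D y] by (auto simp: pos_imp_zdiv_nonneg_iff)
  have "x 2 (i * m + j) * (D div x 3 (i * m + j)) \<le> 2 ^ len * 2 ^ (2 * len\<^sup>2)"
    using x_le[OF f, of 2] q[OF X(2)] D_le X(1) by (intro mult_mono) auto
  then show "ai i j \<le> 2 ^ (len + 2 * len\<^sup>2)" by (simp add: ai_def power_add)
  have "x 4 (i * m + j) * (D div x 5 (i * m + j)) \<le> 2 ^ len * 2 ^ (2 * len\<^sup>2)"
    using x_le[OF f, of 4] q[OF X(4)] D_le X(3) by (intro mult_mono) auto
  then show "bi i j \<le> 2 ^ (len + 2 * len\<^sup>2)" by (simp add: bi_def power_add)
qed

lemma le_two_power: "a \<le> b \<Longrightarrow> int a \<le> 2 ^ b"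
  using of_nat_less_two_power[of a, where 'a=int] power_increasing[of a b "2::int"] by linarith

lemma n_bi_le: "i < n \<Longrightarrow> j < m \<Longrightarrow> int n * bi i j \<le> 2 ^ (2 * len + 2 * len\<^sup>2)"
proof -
  assume ij: "i < n" "j < m"
  have "int n * bi i j \<le> 2 ^ len * 2 ^ (len + 2 * len\<^sup>2)"
    using le_two_power[OF len_bounds(1)] bi_le[OF ij] scaled(4)[OF ij] by (intro mult_mono) auto
  also have "\<dots> = 2 ^ (2 * len + 2 * len\<^sup>2)" by (simp only: power_add[symmetric] mult_2 add.assoc)
  finally show ?thesis .
qed

lemma E_le: "E \<le> 2 ^ (4 * len + 4 * len\<^sup>2)"
proof -
  have "mx (\<lambda>i. ai i j) n * (\<Sum>i<n. bi i j) \<le> 2 ^ (3 * len + 4 * len\<^sup>2)" if j: "j < m" for j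
  proof -
    have "mx (\<lambda>i. ai i j) n \<le> 2 ^ (len + 2 * len\<^sup>2)"
      unfolding mx_def using ai_le j by (subst Max_le_iff) auto
    moreover have "(\<Sum>i<n. bi i j) \<le> 2 ^ (2 * len + 2 * len\<^sup>2)"
    proof -
      have "(\<Sum>i<n. bi i j) \<le> (\<Sum>i<n. 2 ^ (len + 2 * len\<^sup>2))" using bi_le j by (intro sum_mono) auto
      also have "\<dots> = int n * 2 ^ (len + 2 * len\<^sup>2)" by simp
      also have "\<dots> \<le> 2 ^ len * 2 ^ (len + 2 * len\<^sup>2)" using le_two_power[OF len_bounds(1)] by (intro mult_right_mono) auto
      also have "\<dots> = 2 ^ (2 * len + 2 * len\<^sup>2)" by (simp only: power_add[symmetric] mult_2 add.assoc)
      finally show ?thesis .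
    qed
    moreover have "0 \<le> (\<Sum>i<n. bi i j)" using scaled(4) j by (intro sum_nonneg) auto
    ultimately have "mx (\<lambda>i. ai i j) n * (\<Sum>i<n. bi i j) \<le> 2 ^ (len + 2 * len\<^sup>2) * 2 ^ (2 * len + 2 * len\<^sup>2)"
      by (intro mult_mono) auto
    also have "\<dots> = 2 ^ ((len + 2 * len\<^sup>2) + (2 * len + 2 * len\<^sup>2))" by (simp only: power_add)
    also have "(len + 2 * len\<^sup>2) + (2 * len + 2 * len\<^sup>2) = 3 * len + 4 * len\<^sup>2" by simp
    finally show ?thesis .
  qed
  then have "E \<le> (\<Sum>j<m. 2 ^ (3 * len + 4 * len\<^sup>2))" unfolding E_def by (intro sum_mono) auto
  also have "\<dots> = int m * 2 ^ (3 * len + 4 * len\<^sup>2)" by simp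
  also have "\<dots> \<le> 2 ^ len * 2 ^ (3 * len + 4 * len\<^sup>2)" using le_two_power[OF len_bounds(2)] by (intro mult_right_mono) auto
  also have "\<dots> = 2 ^ (len + (3 * len + 4 * len\<^sup>2))" by (simp only: power_add)
  also have "len + (3 * len + 4 * len\<^sup>2) = 4 * len + 4 * len\<^sup>2" by simp
  finally show ?thesis .
qed

lemma KK_le: "KK \<le> block_bound m len" "int KK \<le> 2 ^ (len * (m + 1) + 1)"
proof -
  have e: "KK = 2 * n ^ (m + 1)" by (simp add: KK_def Rn_def power_add mult_ac)
  have "n ^ (m + 1) \<le> len ^ (m + 1)" using len_bounds(1) by (intro power_mono) auto
  then show "KK \<le> block_bound m len" by (simp add: e block_bound_def)
  have "int n ^ (m + 1) \<le> (2 ^ len) ^ (m + 1)" using le_two_power[OF len_bounds(1)] by (intro power_mono) auto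
  also have "\<dots> = 2 ^ (len * (m + 1))" by (rule power_mult[symmetric])
  finally have "2 * int n ^ (m + 1) \<le> 2 * 2 ^ (len * (m + 1))" by (rule mult_left_mono) simp
  also have "\<dots> = 2 ^ (len * (m + 1) + 1)" by (simp only: power_add power_one_right mult.commute)
  finally have "2 * int n ^ (m + 1) \<le> 2 ^ (len * (m + 1) + 1)" .
  then show "int KK \<le> 2 ^ (len * (m + 1) + 1)" by (simp add: e)
qed

lemma P_le: "P \<le> 2 ^ log_bound m len"
proof -
  \<comment> \<open>Every one of the four summands of \<open>P\<close> is at most
    \<open>2 ^ b\<close>; two more bits hold their sum.\<close>
  define b where "b = 4 * len\<^sup>2 + 4 * len + (m + 1) * len + 6"
  have mono: "y \<le> 2 ^ b" if "y \<le> 2 ^ k" "k \<le> b" for y :: int and k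
    using that power_increasing[of k b "2::int"] by linarith
  have "D \<le> 2 ^ b" by (rule mono[OF D_le]) (simp add: b_def)
  moreover have "E \<le> 2 ^ b" by (rule mono[OF E_le]) (simp add: b_def)
  moreover have "int KK \<le> 2 ^ b" by (rule mono[OF KK_le(2)]) (simp add: b_def mult.commute)
  moreover have "64 \<le> (2::int) ^ b" by (rule mono[of _ 6]) (simp_all add: b_def)
  moreover have "2 ^ log_bound m len = 4 * (2::int) ^ b"
  proof -
    have "log_bound m len = b + 2" by (simp add: log_bound_def b_def)
    then show ?thesis by (simp add: power_add)
  qed
  ultimately show ?thesis unfolding P_def by linarith
qed

lemma L_props: "P \<le> 2 ^ L" "k < L \<Longrightarrow> 2 ^ k < P" "L \<le> log_bound m len"
proof -
  show "P \<le> 2 ^ L" unfolding L_def by (rule LeastI[of "\<lambda>k. P \<le> 2 ^ k", OF P_le])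
  show "2 ^ k < P" if "k < L" using not_less_Least[of k "\<lambda>k. P \<le> 2 ^ k"] that unfolding L_def by simp
  show "L \<le> log_bound m len" unfolding L_def by (rule Least_le) (rule P_le)
qed

sublocale run: pd_run n m ai bi "\<lambda>i j. real_of_int D * real_matrix \<alpha> i j" "\<lambda>i j. real_of_int D * real_matrix d i j" E P L
proof
  show "real_of_int E = v {1..n}" unfolding v_N_int E_def ..
  show "E + int KK + 64 \<le> P" using D_pos by (simp add: P_def)
qed (rule L_props)

text \<open>A single bit bound for the entire run. The loop bound \<open>2 * l + 2\<close> that
  accompanies it is dictated by the continued fraction loop.\<close>

definition l :: nat where "l = size_bound m len"

lemma T_le: "run.T \<le> round_bound m len"
  unfolding run.T_def run.ex_def round_bound_def using len_bounds(1) KK_le(1) L_props(3)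
  by (intro mult_mono add_mono power_mono) auto

lemma l_bounds: "run.T \<le> l" "KK \<le> l" "L \<le> l" "n \<le> l" "m \<le> l" "8 \<le> l" "len + 2 * len\<^sup>2 \<le> l" "2 * len + 2 * len\<^sup>2 \<le> l"
    "len \<le> l" "4 * n + 6 \<le> l"
  using T_le KK_le(1) L_props(3) len_bounds by (auto simp: l_def size_bound_def log_bound_def)

lemma big: "P ^ (5 * run.T + 10) * run.M ^ KK \<le> 2 ^ l"
proof -
  have P1: "1 \<le> P" using run.P_bounds(1) by simp
  have "P ^ (5 * run.T + 10) * run.M ^ KK = P ^ (5 * run.T + 10 + (4 * n + 6) * KK)"
    by (simp only: run.M_def power_add power_mult)
  also have "\<dots> \<le> P ^ (5 * round_bound m len + 10 + (4 * len + 6) * block_bound m len)"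
    using T_le KK_le(1) len_bounds(1) P1 by (intro power_increasing add_mono mult_mono) auto
  also have "\<dots> \<le> (2 ^ log_bound m len) ^ (5 * round_bound m len + 10 + (4 * len + 6) * block_bound m len)"
    using P_le P1 by (intro power_mono) auto
  also have "\<dots> = 2 ^ (log_bound m len * (5 * round_bound m len + 10 + (4 * len + 6) * block_bound m len))"
    by (rule power_mult[symmetric])
  also have "\<dots> \<le> 2 ^ l" by (intro power_increasing) (auto simp: l_def size_bound_def)
  finally show ?thesis .
qed

lemma two_power_le: "k \<le> l \<Longrightarrow> y \<le> 2 ^ k \<Longrightarrow> y \<le> (2::int) ^ l"
  using power_increasing[of k l "2::int"] by linarith

lemma bnd_input: "bnd l (input_state inp)"
  unfolding bnd_def
proof (intro conjI allI)
  show "1 \<le> l" using l_bounds(6) by simp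
  fix y k
  have "int (length inp) \<le> 2 ^ len" using length_le_encoding_length[of inp] by (intro le_two_power) (simp add: len_def)
  then have 1: "int (length inp) \<le> 2 ^ l" by (rule two_power_le[OF l_bounds(9)])
  have 2: "\<bar>z\<bar> \<le> 2 ^ l" if "z \<in> set inp" for z
    using two_power_le[OF l_bounds(9)] abs_le_encoding_length[OF that] by (simp add: len_def)
  have 3: "\<bar>inp ! nat (k - 1)\<bar> \<le> 2 ^ l" if "1 \<le> k" "k \<le> int (length inp)"
    by (rule 2, rule nth_mem) (use that in simp)
  show "\<bar>input_state inp y k\<bar> \<le> 2 ^ l" using 1 3 by (simp add: input_state_def)
qed

section \<open>Correctness of the complete program\<close>

definition solver :: com where "solver = read_data m ;; solve_game m"

lemma wp_solver: "wp (2 * l + 2) l solver (\<lambda>s'. s' ''output'' 0 = 2 * int n \<and> (\<forall>i<n. written s' i D (nuc (Suc i)))) (input_state inp)"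
  unfolding solver_def
proof (rule wp_Seq, rule wp_use[OF wp_read_data])
  have "inp ! 0 = int n" by (simp add: inp_def encode_instance_def)
  moreover have "1 \<le> int (length inp)" by (simp add: inp_def length_encode_instance)
  ultimately show "input_state inp ''input'' 1 = int n" by (simp add: input_state_def)
  show "input_state inp ''input'' (int k + 4 * int e) = x k e" if "e < n * m" "2 \<le> k" "k \<le> 5" for e k
    by (rule input_eq(1)[OF that])
  show "1 \<le> x 3 e" "1 \<le> x 5 e" if "e < n * m" for e using den_pos that by auto
  show "D = (\<Prod>e<n * m. x 3 e * x 5 e)" by (rule D_def)
  show "n * m \<le> 2 * l + 2" using len_bounds(3) l_bounds(9) by simp
  show "int (n * m) \<le> 2 ^ l" using len_bounds(3) l_bounds(9) by (intro le_two_power) simp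
  show "int n \<le> 2 ^ l" by (rule le_two_power[OF l_bounds(4)])
  show "D \<le> 2 ^ l" by (rule two_power_le[OF _ D_le]) (use l_bounds(7) in simp)
  fix e assume e: "e < n * m"
  have em: "e div m < n" "e mod m < m" using e m1 by (auto simp: less_mult_imp_div_less)
  have ee: "e div m * m + e mod m = e" by (rule div_mult_mod_eq)
  have "x 2 e * (D div x 3 e) = ai (e div m) (e mod m)" "x 4 e * (D div x 5 e) = bi (e div m) (e mod m)"
    unfolding ai_def bi_def ee by simp_all
  then show "\<bar>x 2 e * (D div x 3 e)\<bar> \<le> 2 ^ l" "\<bar>x 4 e * (D div x 5 e)\<bar> \<le> 2 ^ l"
    using two_power_le[OF l_bounds(7) ai_le[OF em]] two_power_le[OF l_bounds(7) bi_le[OF em]] scaled(3,4)[OF em] by simp_all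
next
  fix s assume h: "s ''n'' 0 = int n \<and> s ''D'' 0 = D \<and>
    (\<forall>e<n * m. s ''A'' (int e) = x 2 e * (D div x 3 e) \<and> s ''B'' (int e) = x 4 e * (D div x 5 e))"
    and fr: "\<And>y. y \<notin> mods (read_data m) \<Longrightarrow> s y = input_state inp y"
  show "wp (2 * l + 2) l (solve_game m) (\<lambda>s'. s' ''output'' 0 = 2 * int n \<and> (\<forall>i<n. written s' i D (nuc (Suc i)))) s"
  proof (rule run.wp_solve_game)
    show "s ''n'' 0 = int n" "s ''D'' 0 = D" using h by auto
    show "1 \<le> D" by (rule D_pos)
    show "s ''A'' (int i * int m + int j) = ai i j" "s ''B'' (int i * int m + int j) = bi i j" if "i < n" "j < m" for i j
    proof -
      have "int i * int m + int j = int (i * m + j)" by simp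
      then show "s ''A'' (int i * int m + int j) = ai i j" "s ''B'' (int i * int m + int j) = bi i j"
        using h flat[OF that] by (simp_all only: ai_def bi_def)
    qed
    show "s ''V'' i = 0" "s ''Fb'' i = 0" "s ''Xb'' i = 0" for i by (simp_all add: fr input_state_def)
    show "P = E + D + int KK + 64" by (rule P_def)
    show "2 ^ k < P" if "k < L" for k by (rule L_props(2)[OF that])
    show "KK \<le> 2 * l + 2" "run.T \<le> 2 * l + 2" "m \<le> 2 * l + 2" "4 * n + 6 \<le> 2 * l + 2" "L \<le> 2 * l + 2" "2 * l + 2 \<le> 2 * l + 2" "2 \<le> l"
      using l_bounds by auto
    show "int run.T \<le> 2 ^ l" "int m \<le> 2 ^ l" using le_two_power[OF l_bounds(1)] le_two_power[OF l_bounds(5)] by simp_all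
    show "P ^ (5 * run.T + 10) * run.M ^ KK \<le> 2 ^ l" by (rule big)
    show "ai i j \<le> 2 ^ l" if "i < n" "j < m" for i j by (rule two_power_le[OF l_bounds(7) ai_le[OF that]])
    show "int n * bi i j \<le> 2 ^ l" if "i < n" "j < m" for i j by (rule two_power_le[OF l_bounds(8) n_bi_le[OF that]])
  qed
qed

lemma nucleolus_original: "nucleolus n (pd_game m (real_matrix \<alpha>) (real_matrix d)) = {\<lambda>i\<in>{1..n}. nuc i / (D * D)}"
proof -
  have "0 < real_of_int (D * D)" using D_pos by (simp only: of_int_0_less_iff) simp
  then show ?thesis
  proof (rule nucleolus_scale[OF _ _ nucleolus_eq_nuc])
    fix S assume "S \<subseteq> {1..n}"
    then have "finite S" using finite_subset by blast
    then show "v S = real_of_int (D * D) * pd_game m (real_matrix \<alpha>) (real_matrix d) S"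
      unfolding v_def using D_pos by (subst pd_game_scale) auto
  qed
qed

lemma output_pairs: "map f [1..2 * int k] = concat (map (\<lambda>i. [f (2 * int i + 1), f (2 * int i + 2)]) [0..<k])"
proof (induction k)
  case (Suc k)
  have "[1..2 * int (Suc k)] = [1..2 * int k] @ [2 * int k + 1, 2 * int k + 2]"
  proof -
    have "2 * int (Suc k) = 2 * int k + 1 + 1" by simp
    then show ?thesis by (simp add: upto_rec2)
  qed
  then show ?case using Suc by (simp add: upt_Suc)
qed simp

lemma solver_correct:
  "\<exists>b t s. exec solver (input_state inp) t s \<and> output_list s = encode_vector b \<and>
    length b = n \<and> nucleolus n (pd_game m (real_matrix \<alpha>) (real_matrix d)) = {real_vector b} \<and>
    t \<le> tm (2 * l + 2) solver * (l + 2)"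
proof -
  obtain t s where ex: "exec solver (input_state inp) t s" "t \<le> tm (2 * l + 2) solver * (l + 2)"
    and o: "s ''output'' 0 = 2 * int n" "\<forall>i<n. written s i D (nuc (Suc i))"
    using wp_solver bnd_input unfolding wp_def by blast
  define num den where "num i = s ''output'' (2 * int i + 1)" and "den i = s ''output'' (2 * int i + 2)" for i :: nat
  have nd: "0 < den i" "coprime (num i) (den i)" "real_of_int (num i) * D\<^sup>2 = nuc (Suc i) * den i" if "i < n" for i
    using o(2) that by (auto simp: num_def den_def written_def)
  define b where "b = map (\<lambda>i. Rat.Fract (num i) (den i)) [0..<n]"
  \<comment> \<open>Since the pair is coprime with positive denominator, \<open>quotient_of\<close>
    returns exactly the two numbers that were written.\<close>
  have "encode_rat (Rat.Fract (num i) (den i)) = [num i, den i]" if "i < n" for i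
    using nd[OF that] by (simp add: encode_rat_def quotient_of_Fract normalize_stable)
  then have "map encode_rat b = map (\<lambda>i. [num i, den i]) [0..<n]" by (simp add: b_def)
  then have "output_list s = encode_vector b"
    unfolding output_list_def encode_vector_def o(1) output_pairs num_def den_def by simp
  moreover have lb: "length b = n" by (simp add: b_def)
  moreover have "real_vector b = (\<lambda>i\<in>{1..n}. nuc i / (D * D))"
    unfolding real_vector_def
  proof -
    have "real_of_rat (b ! (i - 1)) = nuc i / (D * D)" if i: "i \<in> {1..n}" for i
    proof -
      obtain k where k: "k < n" "i = Suc k" using i by (intro that[of "i - 1"]) auto
      have "real_of_rat (b ! k) = num k / den k" using k nd(1)[OF k(1)] by (simp add: b_def of_rat_rat)
      also have "\<dots> = nuc i / (D * D)" using nd[OF k(1)] D_pos k(2) by (simp add: divide_eq_eq eq_divide_eq power2_eq_square mult_ac)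
      finally show ?thesis using k by simp
    qed
    then show "(\<lambda>i\<in>{1..length b}. real_of_rat (b ! (i - 1))) = (\<lambda>i\<in>{1..n}. nuc i / (D * D))"
      unfolding lb by (rule restrict_ext)
  qed
  ultimately show ?thesis using ex nucleolus_original by metis
qed

end

theorem corollary2:
  fixes m :: nat
  assumes "m \<ge> 1"
  shows "poly_time_computable (encode_instance m) encode_vector (pd_instances m)
           (\<lambda>(n, \<alpha>, d) x. length x = n \<and>
              nucleolus n (pd_game m (real_matrix \<alpha>) (real_matrix d)) = {real_vector x})"
proof -
  \<comment> \<open>The solver defined inside the locale takes only \<open>m\<close> as a parameter,
    so one program serves all numbers of players and all data.\<close>
  define c where "c = pd_encoded.solver m"
  obtain p where p: "\<And>N. tm N c = poly p N" using tm_poly by blast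
  \<comment> \<open>The program is fixed, so \<open>tm\<close> is a polynomial in the loop bound,
    and composition with the size bound stays polynomial.\<close>
  have "polynomial_fun (\<lambda>y. tm (2 * size_bound m y + 2) c * (size_bound m y + 2))"
    unfolding p by (intro polynomial_fun_intros polynomial_fun_size_bound
      polynomial_fun_compose[of "poly p" "\<lambda>y. 2 * size_bound m y + 2"]) (auto simp: polynomial_fun_def)
  then obtain r where r: "\<And>y. poly r y = tm (2 * size_bound m y + 2) c * (size_bound m y + 2)"
    unfolding polynomial_fun_def by blast
  show ?thesis
    unfolding poly_time_computable_def
  proof (rule exI[of _ c], rule exI[of _ r], rule ballI)
    fix a assume "a \<in> pd_instances m"
    then obtain n \<alpha> d where a: "a = (n, \<alpha>, d)" "1 \<le> n"
      "\<And>i j. i \<in> {1..n} \<Longrightarrow> j \<in> {1..m} \<Longrightarrow> 0 \<le> \<alpha> i j \<and> 0 \<le> d i j" by (auto simp: pd_instances_def)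
    interpret pd_encoded m n \<alpha> d
      by unfold_locales (use assms a in auto)
    show "\<exists>b t s. exec c (input_state (encode_instance m a)) t s \<and> output_list s = encode_vector b \<and>
      (case a of (n, \<alpha>, d) \<Rightarrow> \<lambda>x. length x = n \<and>
        nucleolus n (pd_game m (real_matrix \<alpha>) (real_matrix d)) = {real_vector x}) b \<and>
      t \<le> poly r (encoding_length (encode_instance m a))"
      using solver_correct unfolding r c_def a(1) inp_def l_def len_def by auto
  qed
qed

end
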